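(* Let $\sigma^*$, $r$, $\Phi^*$ and the assignment $\mathcal{A}\mapsto\mathcal{A}^*$ be as in the context, and let $n$ and $d$ denote the size and the degree of $\mathcal{A}$. All algorithms have oracles so that operations $+_S,\cdot_S$ for $S\in\mathcal{S}$ and membership tests in $[\![P]\!]$ for $P\in\mathbb{P}$ take time $O(1)$. (1) There is an algorithm that solves Exact Learning with Precomputation for $\Phi$ and $\Phi^*$ with local access to the structure $\mathcal{A}^*$ associated with a structure $\mathcal{A}$ in time $(\log n+d+t)^{O(1)}$, where $t$ is the number of training examples. (2) There is an $s\in\mathbb{N}$ such that, given local access to the structure $\mathcal{A}^*$ associated with $\mathcal{A}$, the hypothesis class $\mathcal{H}:=\mathcal{C}(\Phi^*,\mathcal{A}^*,k,\ell)$ is agnostically PAC-learnable with $t_{\mathcal{H}}(\epsilon,\delta)=s\cdot\lceil\log(n/\delta)/\epsilon^2\rceil$ via an algorithm that, given $t_{\mathcal{H}}(\epsilon,\delta)$ examples, returns a hypothesis of the form $(\varphi^*,\bar{v}^* )$ with $\varphi^*\in\Phi^*$ and $\bar{v}^*\in A^\ell$ in time $(\log n+d+1/\epsilon+\log(1/\delta))^{O(1)}$ with only local access to $\mathcal{A}^*$. Additionally, the algorithms can be chosen such that the returned hypotheses can be evaluated in time $(\log n+d)^{O(1)}$.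
   Context: Weighted structures. A signature $\sigma$ is a finite set of relation symbols with arities in $\mathbb{N}$ (arity $0$ allowed). Let $\mathcal{S}$ be a finite collection of rings and/or abelian groups (which may be infinite), and $\mathbf{W}$ a finite set of weight symbols $\mathtt{w}$ with arity $\ge1$ and type in $\mathcal{S}$. A $(\sigma,\mathbf{W})$-structure $\mathcal{A}$: finite non-empty universe $A$ ($=U(\mathcal{A})$), relations $R^{\mathcal{A}}$, functions $\mathtt{w}^{\mathcal{A}}:A^{\mathrm{ar}(\mathtt{w})}\to\mathrm{type}(\mathtt{w})$ such that $\mathtt{w}^{\mathcal{A}}(a_1,\ldots,a_k)\ne0$ implies $k=1$, or $a_1=\cdots=a_k$, or some tuple of some $R^{\mathcal{A}}$ contains all $a_i$. Size $=|A|$; Gaifman graph: vertices $A$, edges between distinct elements co-occurring in some relation tuple; degree = maximal vertex degree; $\mathcal{N}_r^{\mathcal{A}}(\bar{a})$ = induced substructure on elements at Gaifman distance $\le r$ from an entry of $\bar{a}$. A formula $\varphi(\bar{z})$ is $r$-local if $\mathcal{A}\models\varphi[\bar{a}]$ iff $\mathcal{N}_r^{\mathcal{A}}(\bar{a})\models\varphi[\bar{a}]$ always. Let $(\mathbb{P},\mathrm{ar},\mathrm{type},[\![\cdot]\!])$ be a finite $\mathcal{S}$-predicate collection: predicate names $P$ with arity $m\ge1$, type $(S_1,\ldots,S_m)\in\mathcal{S}^m$, semantics $[\![P]\!]\subseteq S_1\times\cdots\times S_m$. The logic $\mathrm{WA}[\mathbb{P}](\sigma,\mathcal{S},\mathbf{W})$: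 formulas and $\mathcal{S}$-terms built by (1) $x_1=x_2$, $R(\bar{x})$; (2) $(s=\mathtt{w}(\bar{x}))$ (pairwise distinct variables), true iff $s=\mathtt{w}^{\mathcal{A}}$ of the assigned elements; (3) $\neg,\vee$; (4) $\exists y$; (5) $(s=\sum\mathtt{w}(y_1,\ldots,y_k).\varphi)$, true iff $s$ is the $\mathrm{type}(\mathtt{w})$-sum of $\mathtt{w}^{\mathcal{A}}(\bar{a})$ over all $\bar{a}$ satisfying $\varphi$ as values of $\bar{y}$ (empty sum $0$); (6) $P(t_1,\ldots,t_m)$ with terms of the types of $P$, true iff their values lie in $[\![P]\!]$; (7) elements $s\in S\in\mathcal{S}$ are terms of type $S$; (8) $\mathtt{w}(\bar{x})$ is a term; (9) $(t_1+t_2)$, $(t_1-t_2)$, and $(t_1\cdot t_2)$ for ring type; (10) $\sum p.\varphi$ for a $\mathbf{W}$-product $p$ of type $S$ (for a group $S$ that is not a ring: an element of $S$ or $\mathtt{w}(y_1,\ldots,y_k)$ of type $S$ with pairwise distinct variables; for a ring $S$: a product $t_1\cdots t_\ell$ of such factors), denoting the $S$-sum over all assignments to the variables of $p$ satisfying $\varphi$ of the value of $p$. Free variables as usual ((5) binds $\bar{y}$, (10) binds the variables of $p$). $\mathrm{WA}_1[\mathbb{P}](\sigma,\mathcal{S},\mathbf{W})$ restricts rule (5) to finite $\mathrm{type}(\mathtt{w})$ and rule (6) to terms with at most one free variable in total; $\mathrm{FOW}_1$ is $\mathrm{WA}_1$ without rule (10). Quantifier rank: nesting depth of rules (4),(5);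 aggregation depth: nesting depth of rule (10). The class $\Phi$. Fix $k,\ell,q\in\mathbb{N}$ and a finite set $\mathscr{S}$ of elements of members of $\mathcal{S}$. $\Phi=\Phi_{q,k+\ell,\mathscr{S}}$ is the set of all $\mathrm{WA}_1[\mathbb{P}](\sigma,\mathcal{S},\mathbf{W})$-formulas $\varphi(\bar{x},\bar{y})$ with free variables among $x_1,\ldots,x_k,y_1,\ldots,y_\ell$, of quantifier rank and aggregation depth at most $q$, all of whose constants $s$ lie in $\mathscr{S}$, all of whose $\mathbf{W}$-products have length at most $q$, and in which the nesting depth of rule (9) is at most $q$. The objects $\sigma^*$, $r$, $\Phi^*$, $\mathcal{A}^*$ (constructed in the paper from $\Phi$ using its localisation theorem and Feferman-Vaught decompositions): $\sigma^*\supseteq\sigma$ is a signature whose additional symbols have arity $\le1$; for every $(\sigma,\mathbf{W})$-structure $\mathcal{A}$, $\mathcal{A}^*$ is a $\sigma^*$-expansion of $\mathcal{A}$ computable from $\mathcal{A}$ in time $|A|\cdot d^{O(1)}$; $r\in\mathbb{N}$; and $\Phi^*$ is a finite set of $r$-local $\mathrm{FOW}_1[\mathbb{P}](\sigma^*,\mathcal{S},\mathbf{W})$-formulas such that (1) for every $\varphi(\bar{x},\bar{y})\in\Phi$ there is $\varphi^*(\bar{x},\bar{y})\in\Phi^*$ with $\mathcal{A}\models\varphi[\bar{a},\bar{b}]\iff\mathcal{A}^*\models\varphi^*[\bar{a},\bar{b}]$ for all $\mathcal{A}$, $\bar{a}\in A^k$, $\bar{b}\in A^\ell$; (2) every $\varphi^*\in\Phi^*$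 has, for every partition $(\bar{z};\bar{z}')$ of its free variables, a Feferman-Vaught decomposition in $\Phi^*$ (a finite non-empty set $\Delta$ of pairs $(\alpha,\beta)$ of $\Phi^*$-formulas, $\mathrm{free}(\alpha)\subseteq\bar{z}$, $\mathrm{free}(\beta)\subseteq\bar{z}'$, such that for all structures $\mathcal{B},\mathcal{B}'$ with disjoint universes and tuples $\bar{a}$ from $\mathcal{B}$, $\bar{b}$ from $\mathcal{B}'$: $\mathcal{B}\oplus\mathcal{B}'\models\varphi^*[\bar{a},\bar{b}]$ iff some $(\alpha,\beta)\in\Delta$ has $\mathcal{B}\models\alpha[\bar{a}]$ and $\mathcal{B}'\models\beta[\bar{b}]$, where $\mathcal{B}\oplus\mathcal{B}'$ is the union structure with new unary relations $X,Y$ marking the two parts and weights $0$ on mixed tuples); (3) $\Phi^*$ contains, for all $\varphi_1^*,\varphi_2^*\in\Phi^*$, formulas equivalent to $\neg\varphi_1^*$ and $(\varphi_1^*\vee\varphi_2^* )$. Learning notions. $\mathcal{C}(\Psi,\mathcal{B},k,\ell):=\{\bar{a}\mapsto[\![\psi(\bar{a},\bar{v})]\!]^{\mathcal{B}}:\psi\in\Psi,\bar{v}\in B^\ell\}$ with $[\![\psi(\bar{a},\bar{v})]\!]^{\mathcal{B}}=1$ iff $\mathcal{B}\models\psi[\bar{a},\bar{v}]$, else $0$. Local access: interaction only via queries "Is $\bar{a}\in R$?", "Return $\mathtt{w}(\bar{a})$", "Return all Gaifman neighbours of $a$". Exact Learning with Precomputation for $\Phi,\Phi^*$: given a training sequence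 $T=((\bar{a}_1,b_1),\ldots,(\bar{a}_t,b_t))\in(A^k\times\{0,1\})^t$ and local access to $\mathcal{A}^*$, return $\varphi^*\in\Phi^*$ and $\bar{v}\in A^\ell$ such that $\bar{a}\mapsto[\![\varphi^*(\bar{a},\bar{v})]\!]^{\mathcal{A}^*}$ maps each $\bar{a}_i$ to $b_i$; rejecting is allowed if no classifier in $\mathcal{C}(\Phi,\mathcal{A},k,\ell)$ is consistent with $T$. Agnostic PAC learnability of $\mathcal{H}\subseteq\{0,1\}^{A^k}$ with $t_{\mathcal{H}}$: for all rational $\epsilon,\delta\in(0,1)$ and every distribution $\mathcal{D}$ on $A^k\times\{0,1\}$, on $t_{\mathcal{H}}(\epsilon,\delta)$ i.i.d. examples from $\mathcal{D}$ the algorithm's output $h$ satisfies $\Pr\big(\mathrm{err}_{\mathcal{D}}(h)\le\inf_{h'\in\mathcal{H}}\mathrm{err}_{\mathcal{D}}(h')+\epsilon\big)\ge1-\delta$, where $\mathrm{err}_{\mathcal{D}}(h)=\Pr_{(\bar{a},b)\sim\mathcal{D}}(h(\bar{a})\ne b)$. *)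

theory Defs
  imports "HOL-Algebra.Ring" "HOL-Probability.Probability" "HOL-Library.Log_Nat"
begin

section \<open>Weighted structures\<close>

text \<open>
  Relation symbols, weight symbols, predicate names, variables and the indices of the members of
  the collection of rings and abelian groups are natural numbers. All members of the collection
  have their carriers inside one type \<open>'v\<close>; a finite collection over different types
  embeds into a sum type.
\<close>

type_synonym signature = "nat \<rightharpoonup> nat"  \<comment> \<open>relation symbol to arity\<close>

text \<open>
  The members are \<open>alg C i\<close> for \<open>i \<in> idx C\<close>. Those with \<open>i \<in> ring_idx C\<close> are rings; of the others
  only the additive structure of the record is used. \<open>wsig\<close> maps a weight symbol to its arity and
  type, \<open>psig\<close> a predicate name to its list of types.
\<close>

record 'v vocab =
  alg :: "nat \<Rightarrow> 'v ring"
  idx :: "nat set"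
  ring_idx :: "nat set"
  wsig :: "nat \<rightharpoonup> nat \<times> nat"
  psig :: "nat \<rightharpoonup> nat list"
  psem :: "nat \<Rightarrow> 'v list set"

abbreviation war :: "'v vocab \<Rightarrow> nat \<Rightarrow> nat" where
  "war C w \<equiv> fst (the (wsig C w))"

abbreviation wtype :: "'v vocab \<Rightarrow> nat \<Rightarrow> nat" where
  "wtype C w \<equiv> snd (the (wsig C w))"

definition valid_vocab :: "'v vocab \<Rightarrow> bool" where
  "valid_vocab C \<longleftrightarrow>
     finite (idx C) \<and> ring_idx C \<subseteq> idx C \<and>
     (\<forall>i\<in>idx C. abelian_group (alg C i)) \<and> (\<forall>i\<in>ring_idx C. ring (alg C i)) \<and>
     finite (dom (wsig C)) \<and>
     (\<forall>w m i. wsig C w = Some (m, i) \<longrightarrow> 1 \<le> m \<and> i \<in> idx C) \<and>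
     finite (dom (psig C)) \<and>
     (\<forall>P ts. psig C P = Some ts \<longrightarrow> ts \<noteq> [] \<and> set ts \<subseteq> idx C \<and>
        (\<forall>xs\<in>psem C P. list_all2 (\<lambda>x i. x \<in> carrier (alg C i)) xs ts))"

record 'v wstruct =
  univ :: "nat set"
  rel :: "nat \<Rightarrow> nat list set"
  wgt :: "nat \<Rightarrow> nat list \<Rightarrow> 'v"

definition tuples :: "'a set \<Rightarrow> nat \<Rightarrow> 'a list set" where
  "tuples A m = {as. length as = m \<and> set as \<subseteq> A}"

definition is_structure :: "'v vocab \<Rightarrow> signature \<Rightarrow> 'v wstruct \<Rightarrow> bool" where
  "is_structure C \<sigma> A \<longleftrightarrow>
     finite (univ A) \<and> univ A \<noteq> {} \<and>
     (\<forall>R. rel A R \<subseteq> (case \<sigma> R of None \<Rightarrow> {} | Some m \<Rightarrow> tuples (univ A) m)) \<and>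
     (\<forall>w\<in>dom (wsig C). \<forall>as\<in>tuples (univ A) (war C w).
        wgt A w as \<in> carrier (alg C (wtype C w)) \<and>
        (wgt A w as \<noteq> \<zero>\<^bsub>alg C (wtype C w)\<^esub> \<longrightarrow>
           war C w = 1 \<or> (\<exists>a. set as = {a}) \<or> (\<exists>R. \<exists>t\<in>rel A R. set as \<subseteq> set t)))"

definition gaifman :: "'v wstruct \<Rightarrow> (nat \<times> nat) set" where
  "gaifman A = {(a, b). a \<noteq> b \<and> (\<exists>R. \<exists>t\<in>rel A R. a \<in> set t \<and> b \<in> set t)}"

definition struct_degree :: "'v wstruct \<Rightarrow> nat" where
  "struct_degree A = Max ((\<lambda>a. card (gaifman A `` {a})) ` univ A)"

definition nbhd_set :: "'v wstruct \<Rightarrow> nat \<Rightarrow> nat set \<Rightarrow> nat set" where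
  "nbhd_set A r X = (\<Union>m\<le>r. (gaifman A ^^ m) `` X)"

text \<open>
  Weights need no restriction here: only their values on tuples over the universe matter.
  The induced substructure on the empty set (neighbourhood of the empty tuple) keeps the
  relations of arity 0.
\<close>

definition induced :: "'v wstruct \<Rightarrow> nat set \<Rightarrow> 'v wstruct" where
  "induced A X = \<lparr>univ = X, rel = (\<lambda>R. {t \<in> rel A R. set t \<subseteq> X}), wgt = wgt A\<rparr>"

definition nbhd :: "'v wstruct \<Rightarrow> nat \<Rightarrow> nat set \<Rightarrow> 'v wstruct" where
  "nbhd A r X = induced A (nbhd_set A r X)"

text \<open>The structure \<open>B \<oplus> B'\<close>, where \<open>X\<close> and \<open>Y\<close> are the two new unary relation symbols.\<close>

definition oplus ::
  "'v vocab \<Rightarrow> nat \<Rightarrow> nat \<Rightarrow> 'v wstruct \<Rightarrow> 'v wstruct \<Rightarrow> 'v wstruct" where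
  "oplus C X Y B B' = \<lparr>
     univ = univ B \<union> univ B',
     rel = (\<lambda>R. if R = X then {[b] |b. b \<in> univ B}
                else if R = Y then {[b] |b. b \<in> univ B'}
                else rel B R \<union> rel B' R),
     wgt = (\<lambda>w as. if set as \<subseteq> univ B then wgt B w as
                   else if set as \<subseteq> univ B' then wgt B' w as
                   else \<zero>\<^bsub>alg C (wtype C w)\<^esub>)\<rparr>"

definition is_expansion :: "'v vocab \<Rightarrow> signature \<Rightarrow> 'v wstruct \<Rightarrow> 'v wstruct \<Rightarrow> bool" where
  "is_expansion C \<sigma> A A' \<longleftrightarrow>
     univ A' = univ A \<and> (\<forall>R\<in>dom \<sigma>. rel A' R = rel A R) \<and>
     (\<forall>w\<in>dom (wsig C). \<forall>as\<in>tuples (univ A) (war C w). wgt A' w as = wgt A w as)"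


section \<open>Weight aggregation logic\<close>

datatype 'v factor = FElem 'v | FWgt nat "nat list"

text \<open>
  \<open>WSum s w ys \<phi>\<close> is the formula that compares \<open>s\<close> with the sum of \<open>w(ys)\<close> over \<open>\<phi>\<close>. The index in
  \<open>Elem\<close> and \<open>Agg\<close> is the type of the term.
\<close>

datatype 'v fml =
    Eq nat nat
  | Rel nat "nat list"
  | WEq 'v nat "nat list"
  | Neg "'v fml"
  | Or "'v fml" "'v fml"
  | Ex nat "'v fml"
  | WSum 'v nat "nat list" "'v fml"
  | Pred nat "'v trm list"
and 'v trm =
    Elem nat 'v
  | Wgt nat "nat list"
  | Plus "'v trm" "'v trm"
  | Minus "'v trm" "'v trm"
  | Times "'v trm" "'v trm"
  | Agg nat "'v factor list" "'v fml"

fun factor_vars :: "'v factor \<Rightarrow> nat list" where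
  "factor_vars (FElem s) = []"
| "factor_vars (FWgt w ys) = ys"

definition wprod_vars :: "'v factor list \<Rightarrow> nat list" where
  "wprod_vars p = remdups (concat (map factor_vars p))"

fun factor_consts :: "'v factor \<Rightarrow> 'v set" where
  "factor_consts (FElem s) = {s}"
| "factor_consts (FWgt w ys) = {}"

fun free :: "'v fml \<Rightarrow> nat set" and free_trm :: "'v trm \<Rightarrow> nat set" where
  "free (Eq x y) = {x, y}"
| "free (Rel R xs) = set xs"
| "free (WEq s w xs) = set xs"
| "free (Neg \<phi>) = free \<phi>"
| "free (Or \<phi> \<psi>) = free \<phi> \<union> free \<psi>"
| "free (Ex y \<phi>) = free \<phi> - {y}"
| "free (WSum s w ys \<phi>) = free \<phi> - set ys"
| "free (Pred P ts) = (\<Union>t\<in>set ts. free_trm t)"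
| "free_trm (Elem i s) = {}"
| "free_trm (Wgt w xs) = set xs"
| "free_trm (Plus t u) = free_trm t \<union> free_trm u"
| "free_trm (Minus t u) = free_trm t \<union> free_trm u"
| "free_trm (Times t u) = free_trm t \<union> free_trm u"
| "free_trm (Agg i p \<phi>) = free \<phi> - set (wprod_vars p)"

fun ttype :: "'v vocab \<Rightarrow> 'v trm \<Rightarrow> nat" where
  "ttype C (Elem i s) = i"
| "ttype C (Wgt w xs) = wtype C w"
| "ttype C (Plus t u) = ttype C t"
| "ttype C (Minus t u) = ttype C t"
| "ttype C (Times t u) = ttype C t"
| "ttype C (Agg i p \<phi>) = i"

definition wgt_atom :: "'v vocab \<Rightarrow> nat \<Rightarrow> nat list \<Rightarrow> bool" where
  "wgt_atom C w xs \<longleftrightarrow> w \<in> dom (wsig C) \<and> length xs = war C w"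

fun is_factor :: "'v vocab \<Rightarrow> nat \<Rightarrow> 'v factor \<Rightarrow> bool" where
  "is_factor C i (FElem s) \<longleftrightarrow> s \<in> carrier (alg C i)"
| "is_factor C i (FWgt w ys) \<longleftrightarrow> wgt_atom C w ys \<and> distinct ys \<and> wtype C w = i"

definition is_wprod :: "'v vocab \<Rightarrow> nat \<Rightarrow> 'v factor list \<Rightarrow> bool" where
  "is_wprod C i p \<longleftrightarrow> i \<in> idx C \<and> p \<noteq> [] \<and> (\<forall>f\<in>set p. is_factor C i f) \<and>
     (i \<notin> ring_idx C \<longrightarrow> length p = 1)"

text \<open>Membership in \<open>WA\<^sub>1\<close>, for formulas and for terms.\<close>

fun wa1 :: "'v vocab \<Rightarrow> signature \<Rightarrow> 'v fml \<Rightarrow> bool"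
and wa1_trm :: "'v vocab \<Rightarrow> signature \<Rightarrow> 'v trm \<Rightarrow> bool" where
  "wa1 C \<sigma> (Eq x y) \<longleftrightarrow> True"
| "wa1 C \<sigma> (Rel R xs) \<longleftrightarrow> \<sigma> R = Some (length xs)"
| "wa1 C \<sigma> (WEq s w xs) \<longleftrightarrow>
     wgt_atom C w xs \<and> distinct xs \<and> s \<in> carrier (alg C (wtype C w))"
| "wa1 C \<sigma> (Neg \<phi>) \<longleftrightarrow> wa1 C \<sigma> \<phi>"
| "wa1 C \<sigma> (Or \<phi> \<psi>) \<longleftrightarrow> wa1 C \<sigma> \<phi> \<and> wa1 C \<sigma> \<psi>"
| "wa1 C \<sigma> (Ex y \<phi>) \<longleftrightarrow> wa1 C \<sigma> \<phi>"
| "wa1 C \<sigma> (WSum s w ys \<phi>) \<longleftrightarrow>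
     wgt_atom C w ys \<and> distinct ys \<and> s \<in> carrier (alg C (wtype C w)) \<and>
     finite (carrier (alg C (wtype C w))) \<and> wa1 C \<sigma> \<phi>"
| "wa1 C \<sigma> (Pred P ts) \<longleftrightarrow>
     psig C P = Some (map (ttype C) ts) \<and> (\<forall>t\<in>set ts. wa1_trm C \<sigma> t) \<and>
     card (\<Union>t\<in>set ts. free_trm t) \<le> 1"
| "wa1_trm C \<sigma> (Elem i s) \<longleftrightarrow> i \<in> idx C \<and> s \<in> carrier (alg C i)"
| "wa1_trm C \<sigma> (Wgt w xs) \<longleftrightarrow> wgt_atom C w xs"
| "wa1_trm C \<sigma> (Plus t u) \<longleftrightarrow> wa1_trm C \<sigma> t \<and> wa1_trm C \<sigma> u \<and> ttype C t = ttype C u"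
| "wa1_trm C \<sigma> (Minus t u) \<longleftrightarrow> wa1_trm C \<sigma> t \<and> wa1_trm C \<sigma> u \<and> ttype C t = ttype C u"
| "wa1_trm C \<sigma> (Times t u) \<longleftrightarrow> wa1_trm C \<sigma> t \<and> wa1_trm C \<sigma> u \<and> ttype C t = ttype C u \<and>
     ttype C t \<in> ring_idx C"
| "wa1_trm C \<sigma> (Agg i p \<phi>) \<longleftrightarrow> is_wprod C i p \<and> wa1 C \<sigma> \<phi>"

definition upd :: "(nat \<Rightarrow> nat) \<Rightarrow> nat list \<Rightarrow> nat list \<Rightarrow> nat \<Rightarrow> nat" where
  "upd \<beta> ys bs = (\<lambda>x. case map_of (zip ys bs) x of None \<Rightarrow> \<beta> x | Some b \<Rightarrow> b)"

fun factor_val :: "'v wstruct \<Rightarrow> (nat \<Rightarrow> nat) \<Rightarrow> 'v factor \<Rightarrow> 'v" where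
  "factor_val A \<beta> (FElem s) = s"
| "factor_val A \<beta> (FWgt w ys) = wgt A w (map \<beta> ys)"

text \<open>The empty list does not occur (\<open>is_wprod\<close>).\<close>

fun list_mult :: "'v ring \<Rightarrow> 'v list \<Rightarrow> 'v" where
  "list_mult S [] = \<one>\<^bsub>S\<^esub>"
| "list_mult S [x] = x"
| "list_mult S (x # y # xs) = x \<otimes>\<^bsub>S\<^esub> list_mult S (y # xs)"

definition wprod_val ::
  "'v vocab \<Rightarrow> 'v wstruct \<Rightarrow> (nat \<Rightarrow> nat) \<Rightarrow> nat \<Rightarrow> 'v factor list \<Rightarrow> 'v" where
  "wprod_val C A \<beta> i p = list_mult (alg C i) (map (factor_val A \<beta>) p)"

fun sat :: "'v vocab \<Rightarrow> 'v wstruct \<Rightarrow> (nat \<Rightarrow> nat) \<Rightarrow> 'v fml \<Rightarrow> bool"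
and tval :: "'v vocab \<Rightarrow> 'v wstruct \<Rightarrow> (nat \<Rightarrow> nat) \<Rightarrow> 'v trm \<Rightarrow> 'v" where
  "sat C A \<beta> (Eq x y) \<longleftrightarrow> \<beta> x = \<beta> y"
| "sat C A \<beta> (Rel R xs) \<longleftrightarrow> map \<beta> xs \<in> rel A R"
| "sat C A \<beta> (WEq s w xs) \<longleftrightarrow> s = wgt A w (map \<beta> xs)"
| "sat C A \<beta> (Neg \<phi>) \<longleftrightarrow> \<not> sat C A \<beta> \<phi>"
| "sat C A \<beta> (Or \<phi> \<psi>) \<longleftrightarrow> sat C A \<beta> \<phi> \<or> sat C A \<beta> \<psi>"
| "sat C A \<beta> (Ex y \<phi>) \<longleftrightarrow> (\<exists>a\<in>univ A. sat C A (\<beta>(y := a)) \<phi>)"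
| "sat C A \<beta> (WSum s w ys \<phi>) \<longleftrightarrow>
     s = finsum (alg C (wtype C w)) (wgt A w)
           {bs \<in> tuples (univ A) (length ys). sat C A (upd \<beta> ys bs) \<phi>}"
| "sat C A \<beta> (Pred P ts) \<longleftrightarrow> map (tval C A \<beta>) ts \<in> psem C P"
| "tval C A \<beta> (Elem i s) = s"
| "tval C A \<beta> (Wgt w xs) = wgt A w (map \<beta> xs)"
| "tval C A \<beta> (Plus t u) = tval C A \<beta> t \<oplus>\<^bsub>alg C (ttype C t)\<^esub> tval C A \<beta> u"
| "tval C A \<beta> (Minus t u) = tval C A \<beta> t \<ominus>\<^bsub>alg C (ttype C t)\<^esub> tval C A \<beta> u"
| "tval C A \<beta> (Times t u) = tval C A \<beta> t \<otimes>\<^bsub>alg C (ttype C t)\<^esub> tval C A \<beta> u"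
| "tval C A \<beta> (Agg i p \<phi>) =
     finsum (alg C i) (\<lambda>bs. wprod_val C A (upd \<beta> (wprod_vars p) bs) i p)
       {bs \<in> tuples (univ A) (length (wprod_vars p)). sat C A (upd \<beta> (wprod_vars p) bs) \<phi>}"

fun qrank :: "'v fml \<Rightarrow> nat" and qrank_trm :: "'v trm \<Rightarrow> nat" where
  "qrank (Eq x y) = 0"
| "qrank (Rel R xs) = 0"
| "qrank (WEq s w xs) = 0"
| "qrank (Neg \<phi>) = qrank \<phi>"
| "qrank (Or \<phi> \<psi>) = max (qrank \<phi>) (qrank \<psi>)"
| "qrank (Ex y \<phi>) = Suc (qrank \<phi>)"
| "qrank (WSum s w ys \<phi>) = Suc (qrank \<phi>)"
| "qrank (Pred P ts) = fold max (map qrank_trm ts) 0"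
| "qrank_trm (Elem i s) = 0"
| "qrank_trm (Wgt w xs) = 0"
| "qrank_trm (Plus t u) = max (qrank_trm t) (qrank_trm u)"
| "qrank_trm (Minus t u) = max (qrank_trm t) (qrank_trm u)"
| "qrank_trm (Times t u) = max (qrank_trm t) (qrank_trm u)"
| "qrank_trm (Agg i p \<phi>) = qrank \<phi>"

fun agg_depth :: "'v fml \<Rightarrow> nat" and agg_depth_trm :: "'v trm \<Rightarrow> nat" where
  "agg_depth (Eq x y) = 0"
| "agg_depth (Rel R xs) = 0"
| "agg_depth (WEq s w xs) = 0"
| "agg_depth (Neg \<phi>) = agg_depth \<phi>"
| "agg_depth (Or \<phi> \<psi>) = max (agg_depth \<phi>) (agg_depth \<psi>)"
| "agg_depth (Ex y \<phi>) = agg_depth \<phi>"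
| "agg_depth (WSum s w ys \<phi>) = agg_depth \<phi>"
| "agg_depth (Pred P ts) = fold max (map agg_depth_trm ts) 0"
| "agg_depth_trm (Elem i s) = 0"
| "agg_depth_trm (Wgt w xs) = 0"
| "agg_depth_trm (Plus t u) = max (agg_depth_trm t) (agg_depth_trm u)"
| "agg_depth_trm (Minus t u) = max (agg_depth_trm t) (agg_depth_trm u)"
| "agg_depth_trm (Times t u) = max (agg_depth_trm t) (agg_depth_trm u)"
| "agg_depth_trm (Agg i p \<phi>) = Suc (agg_depth \<phi>)"

text \<open>Nesting depth of the term rules for sum, difference and product.\<close>

fun arith_depth :: "'v fml \<Rightarrow> nat" and arith_depth_trm :: "'v trm \<Rightarrow> nat" where
  "arith_depth (Eq x y) = 0"
| "arith_depth (Rel R xs) = 0"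
| "arith_depth (WEq s w xs) = 0"
| "arith_depth (Neg \<phi>) = arith_depth \<phi>"
| "arith_depth (Or \<phi> \<psi>) = max (arith_depth \<phi>) (arith_depth \<psi>)"
| "arith_depth (Ex y \<phi>) = arith_depth \<phi>"
| "arith_depth (WSum s w ys \<phi>) = arith_depth \<phi>"
| "arith_depth (Pred P ts) = fold max (map arith_depth_trm ts) 0"
| "arith_depth_trm (Elem i s) = 0"
| "arith_depth_trm (Wgt w xs) = 0"
| "arith_depth_trm (Plus t u) = Suc (max (arith_depth_trm t) (arith_depth_trm u))"
| "arith_depth_trm (Minus t u) = Suc (max (arith_depth_trm t) (arith_depth_trm u))"
| "arith_depth_trm (Times t u) = Suc (max (arith_depth_trm t) (arith_depth_trm u))"
| "arith_depth_trm (Agg i p \<phi>) = arith_depth \<phi>"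

fun consts_in :: "'v fml \<Rightarrow> 'v set" and consts_in_trm :: "'v trm \<Rightarrow> 'v set" where
  "consts_in (Eq x y) = {}"
| "consts_in (Rel R xs) = {}"
| "consts_in (WEq s w xs) = {s}"
| "consts_in (Neg \<phi>) = consts_in \<phi>"
| "consts_in (Or \<phi> \<psi>) = consts_in \<phi> \<union> consts_in \<psi>"
| "consts_in (Ex y \<phi>) = consts_in \<phi>"
| "consts_in (WSum s w ys \<phi>) = insert s (consts_in \<phi>)"
| "consts_in (Pred P ts) = (\<Union>t\<in>set ts. consts_in_trm t)"
| "consts_in_trm (Elem i s) = {s}"
| "consts_in_trm (Wgt w xs) = {}"
| "consts_in_trm (Plus t u) = consts_in_trm t \<union> consts_in_trm u"
| "consts_in_trm (Minus t u) = consts_in_trm t \<union> consts_in_trm u"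
| "consts_in_trm (Times t u) = consts_in_trm t \<union> consts_in_trm u"
| "consts_in_trm (Agg i p \<phi>) = (\<Union>f\<in>set p. factor_consts f) \<union> consts_in \<phi>"

fun wprods_in :: "'v fml \<Rightarrow> 'v factor list set"
and wprods_in_trm :: "'v trm \<Rightarrow> 'v factor list set" where
  "wprods_in (Eq x y) = {}"
| "wprods_in (Rel R xs) = {}"
| "wprods_in (WEq s w xs) = {}"
| "wprods_in (Neg \<phi>) = wprods_in \<phi>"
| "wprods_in (Or \<phi> \<psi>) = wprods_in \<phi> \<union> wprods_in \<psi>"
| "wprods_in (Ex y \<phi>) = wprods_in \<phi>"
| "wprods_in (WSum s w ys \<phi>) = wprods_in \<phi>"
| "wprods_in (Pred P ts) = (\<Union>t\<in>set ts. wprods_in_trm t)"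
| "wprods_in_trm (Elem i s) = {}"
| "wprods_in_trm (Wgt w xs) = {}"
| "wprods_in_trm (Plus t u) = wprods_in_trm t \<union> wprods_in_trm u"
| "wprods_in_trm (Minus t u) = wprods_in_trm t \<union> wprods_in_trm u"
| "wprods_in_trm (Times t u) = wprods_in_trm t \<union> wprods_in_trm u"
| "wprods_in_trm (Agg i p \<phi>) = insert p (wprods_in \<phi>)"

definition fow1 :: "'v vocab \<Rightarrow> signature \<Rightarrow> 'v fml \<Rightarrow> bool" where
  "fow1 C \<sigma> \<phi> \<longleftrightarrow> wa1 C \<sigma> \<phi> \<and> agg_depth \<phi> = 0"

text \<open>
  The class \<open>\<Phi>\<close>, with \<open>m = k + \<ell>\<close> free variables. The variables \<open>x\<^sub>1,\<dots>,x\<^sub>k,y\<^sub>1,\<dots>,y\<^sub>\<ell>\<close> are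
  \<open>0,\<dots>,k+\<ell>-1\<close>, so that a tuple \<open>as @ bs\<close> is turned into an assignment by \<open>(!) (as @ bs)\<close>.
\<close>

definition Phi_class ::
  "'v vocab \<Rightarrow> signature \<Rightarrow> nat \<Rightarrow> nat \<Rightarrow> 'v set \<Rightarrow> 'v fml set" where
  "Phi_class C \<sigma> q m SS =
     {\<phi>. wa1 C \<sigma> \<phi> \<and> free \<phi> \<subseteq> {..<m} \<and> qrank \<phi> \<le> q \<and> agg_depth \<phi> \<le> q \<and>
         consts_in \<phi> \<subseteq> SS \<and> (\<forall>p\<in>wprods_in \<phi>. length p \<le> q) \<and> arith_depth \<phi> \<le> q}"

definition r_local :: "'v vocab \<Rightarrow> signature \<Rightarrow> nat \<Rightarrow> 'v fml \<Rightarrow> bool" where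
  "r_local C \<sigma> r \<phi> \<longleftrightarrow>
     (\<forall>A \<beta>. is_structure C \<sigma> A \<longrightarrow> \<beta> ` free \<phi> \<subseteq> univ A \<longrightarrow>
        (sat C A \<beta> \<phi> \<longleftrightarrow> sat C (nbhd A r (\<beta> ` free \<phi>)) \<beta> \<phi>))"

definition fml_equiv :: "'v vocab \<Rightarrow> signature \<Rightarrow> 'v fml \<Rightarrow> 'v fml \<Rightarrow> bool" where
  "fml_equiv C \<sigma> \<phi> \<psi> \<longleftrightarrow>
     (\<forall>A \<beta>. is_structure C \<sigma> A \<longrightarrow> range \<beta> \<subseteq> univ A \<longrightarrow> (sat C A \<beta> \<phi> \<longleftrightarrow> sat C A \<beta> \<psi>))"

definition fv_decomposition ::
  "'v vocab \<Rightarrow> signature \<Rightarrow> 'v fml \<Rightarrow> nat set \<Rightarrow> nat set \<Rightarrow> ('v fml \<times> 'v fml) set \<Rightarrow> bool" where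
  "fv_decomposition C \<sigma> \<phi> Z Z' \<Delta> \<longleftrightarrow>
     finite \<Delta> \<and> \<Delta> \<noteq> {} \<and> (\<forall>(\<alpha>, \<gamma>)\<in>\<Delta>. free \<alpha> \<subseteq> Z \<and> free \<gamma> \<subseteq> Z') \<and>
     (\<forall>B B' X Y \<beta>.
        is_structure C \<sigma> B \<longrightarrow> is_structure C \<sigma> B' \<longrightarrow> univ B \<inter> univ B' = {} \<longrightarrow>
        X \<notin> dom \<sigma> \<longrightarrow> Y \<notin> dom \<sigma> \<longrightarrow> X \<noteq> Y \<longrightarrow> \<beta> ` Z \<subseteq> univ B \<longrightarrow> \<beta> ` Z' \<subseteq> univ B' \<longrightarrow>
        (sat C (oplus C X Y B B') \<beta> \<phi> \<longleftrightarrow>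
           (\<exists>(\<alpha>, \<gamma>)\<in>\<Delta>. sat C B \<beta> \<alpha> \<and> sat C B' \<beta> \<gamma>)))"

definition fv_closed :: "'v vocab \<Rightarrow> signature \<Rightarrow> 'v fml set \<Rightarrow> bool" where
  "fv_closed C \<sigma> \<Psi> \<longleftrightarrow>
     (\<forall>\<phi>\<in>\<Psi>. \<forall>Z Z'. Z \<union> Z' = free \<phi> \<longrightarrow> Z \<inter> Z' = {} \<longrightarrow>
        (\<exists>\<Delta>\<subseteq>\<Psi> \<times> \<Psi>. fv_decomposition C \<sigma> \<phi> Z Z' \<Delta>))"

definition boolean_closed :: "'v vocab \<Rightarrow> signature \<Rightarrow> 'v fml set \<Rightarrow> bool" where
  "boolean_closed C \<sigma> \<Psi> \<longleftrightarrow>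
     (\<forall>\<phi>\<in>\<Psi>. \<exists>\<psi>\<in>\<Psi>. fml_equiv C \<sigma> \<psi> (Neg \<phi>)) \<and>
     (\<forall>\<phi>\<^sub>1\<in>\<Psi>. \<forall>\<phi>\<^sub>2\<in>\<Psi>. \<exists>\<psi>\<in>\<Psi>. fml_equiv C \<sigma> \<psi> (Or \<phi>\<^sub>1 \<phi>\<^sub>2))"


section \<open>Random access machines with local access to a structure\<close>

text \<open>
  A machine has a memory of natural numbers and a memory of elements of the rings and groups.
  The elements of a structure are handled through a numbering \<open>code\<close> of the universe by
  \<open>0,\<dots>,n-1\<close>. A program is a finite list of instructions, indexed from 0; it halts when the
  program counter leaves the list. In \<open>VTest\<close>, \<open>QRel\<close> and \<open>QWgt\<close> the last argument is the first of
  the consecutive cells that hold the argument tuple. The last three instructions are the only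
  access to the structure.
\<close>

datatype 'v instr =
    SetC nat nat              \<comment> \<open>\<open>M[i] := c\<close>\<close>
  | Add nat nat nat           \<comment> \<open>\<open>M[i] := M[a] + M[b]\<close>\<close>
  | Sub nat nat nat           \<comment> \<open>\<open>M[i] := max 0 (M[a] - M[b])\<close>\<close>
  | Load nat nat              \<comment> \<open>\<open>M[i] := M[M[a]]\<close>\<close>
  | Store nat nat             \<comment> \<open>\<open>M[M[i]] := M[a]\<close>\<close>
  | Jz nat nat                \<comment> \<open>if \<open>M[a] = 0\<close> go to instruction \<open>l\<close>\<close>
  | VSetC nat 'v              \<comment> \<open>\<open>V[i] := v\<close>\<close>
  | VAdd nat nat nat nat      \<comment> \<open>\<open>V[i] := V[a] + V[b]\<close> in the member with the given index\<close>
  | VSub nat nat nat nat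
  | VMul nat nat nat nat
  | VLoad nat nat             \<comment> \<open>\<open>V[i] := V[M[a]]\<close>\<close>
  | VStore nat nat            \<comment> \<open>\<open>V[M[i]] := V[a]\<close>\<close>
  | VEq nat nat nat           \<comment> \<open>\<open>M[i] :=\<close> truth value of \<open>V[a] = V[b]\<close>\<close>
  | VTest nat nat nat         \<comment> \<open>\<open>M[i] :=\<close> truth value of \<open>P(V[a],\<dots>)\<close>\<close>
  | QRel nat nat nat          \<comment> \<open>\<open>M[i] :=\<close> truth value of \<open>R(M[a],\<dots>)\<close>\<close>
  | QWgt nat nat nat          \<comment> \<open>\<open>V[i] := w(M[a],\<dots>)\<close>\<close>
  | QNbr nat nat              \<comment> \<open>\<open>M[M[b]] :=\<close> number of neighbours of \<open>M[a]\<close>, which follow it\<close>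

fun wf_instr :: "'v vocab \<Rightarrow> signature \<Rightarrow> 'v instr \<Rightarrow> bool" where
  "wf_instr C \<sigma> (VAdd S i a b) \<longleftrightarrow> S \<in> idx C"
| "wf_instr C \<sigma> (VSub S i a b) \<longleftrightarrow> S \<in> idx C"
| "wf_instr C \<sigma> (VMul S i a b) \<longleftrightarrow> S \<in> ring_idx C"
| "wf_instr C \<sigma> (VTest P i a) \<longleftrightarrow> P \<in> dom (psig C)"
| "wf_instr C \<sigma> (QRel R i a) \<longleftrightarrow> R \<in> dom \<sigma>"
| "wf_instr C \<sigma> (QWgt w i a) \<longleftrightarrow> w \<in> dom (wsig C)"
| "wf_instr C \<sigma> _ \<longleftrightarrow> True"

definition wf_prog :: "'v vocab \<Rightarrow> signature \<Rightarrow> 'v instr list \<Rightarrow> bool" where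
  "wf_prog C \<sigma> p \<longleftrightarrow> (\<forall>ins\<in>set p. wf_instr C \<sigma> ins)"

record 'v answers =
  ask_rel :: "nat \<Rightarrow> nat list \<Rightarrow> bool"
  ask_wgt :: "nat \<Rightarrow> nat list \<Rightarrow> 'v"
  ask_nbr :: "nat \<Rightarrow> nat list"

text \<open>
  The order in which neighbours are returned is arbitrary, and so are the answers to queries about
  numbers that are not codes of elements.
\<close>

definition local_access ::
  "'v vocab \<Rightarrow> signature \<Rightarrow> 'v wstruct \<Rightarrow> (nat \<Rightarrow> nat) \<Rightarrow> 'v answers \<Rightarrow> bool" where
  "local_access C \<sigma> A code orc \<longleftrightarrow>
     bij_betw code (univ A) {..<card (univ A)} \<and>
     (\<forall>R m. \<sigma> R = Some m \<longrightarrow>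
        (\<forall>as\<in>tuples (univ A) m. ask_rel orc R (map code as) \<longleftrightarrow> as \<in> rel A R)) \<and>
     (\<forall>w\<in>dom (wsig C). \<forall>as\<in>tuples (univ A) (war C w).
        ask_wgt orc w (map code as) = wgt A w as) \<and>
     (\<forall>a\<in>univ A. distinct (ask_nbr orc (code a)) \<and>
        set (ask_nbr orc (code a)) = code ` (gaifman A `` {a}))"

type_synonym 'v config = "nat \<times> (nat \<Rightarrow> nat) \<times> (nat \<Rightarrow> 'v)"

definition write_list :: "nat \<Rightarrow> nat list \<Rightarrow> (nat \<Rightarrow> nat) \<Rightarrow> nat \<Rightarrow> nat" where
  "write_list b xs M = (\<lambda>j. if b \<le> j \<and> j < b + length xs then xs ! (j - b) else M j)"

fun step :: "'v vocab \<Rightarrow> signature \<Rightarrow> 'v answers \<Rightarrow> 'v instr \<Rightarrow> 'v config \<Rightarrow> 'v config" where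
  "step C \<sigma> orc (SetC i c) (pc, M, V) = (Suc pc, M(i := c), V)"
| "step C \<sigma> orc (Add i a b) (pc, M, V) = (Suc pc, M(i := M a + M b), V)"
| "step C \<sigma> orc (Sub i a b) (pc, M, V) = (Suc pc, M(i := M a - M b), V)"
| "step C \<sigma> orc (Load i a) (pc, M, V) = (Suc pc, M(i := M (M a)), V)"
| "step C \<sigma> orc (Store i a) (pc, M, V) = (Suc pc, M(M i := M a), V)"
| "step C \<sigma> orc (Jz a l) (pc, M, V) = (if M a = 0 then l else Suc pc, M, V)"
| "step C \<sigma> orc (VSetC i v) (pc, M, V) = (Suc pc, M, V(i := v))"
| "step C \<sigma> orc (VAdd S i a b) (pc, M, V) = (Suc pc, M, V(i := V a \<oplus>\<^bsub>alg C S\<^esub> V b))"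
| "step C \<sigma> orc (VSub S i a b) (pc, M, V) = (Suc pc, M, V(i := V a \<ominus>\<^bsub>alg C S\<^esub> V b))"
| "step C \<sigma> orc (VMul S i a b) (pc, M, V) = (Suc pc, M, V(i := V a \<otimes>\<^bsub>alg C S\<^esub> V b))"
| "step C \<sigma> orc (VLoad i a) (pc, M, V) = (Suc pc, M, V(i := V (M a)))"
| "step C \<sigma> orc (VStore i a) (pc, M, V) = (Suc pc, M, V(M i := V a))"
| "step C \<sigma> orc (VEq i a b) (pc, M, V) = (Suc pc, M(i := of_bool (V a = V b)), V)"
| "step C \<sigma> orc (VTest P i a) (pc, M, V) =
     (Suc pc, M(i := of_bool (map V [a..<a + length (the (psig C P))] \<in> psem C P)), V)"
| "step C \<sigma> orc (QRel R i a) (pc, M, V) =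
     (Suc pc, M(i := of_bool (ask_rel orc R (map M [a..<a + the (\<sigma> R)]))), V)"
| "step C \<sigma> orc (QWgt w i a) (pc, M, V) =
     (Suc pc, M, V(i := ask_wgt orc w (map M [a..<a + war C w])))"
| "step C \<sigma> orc (QNbr a b) (pc, M, V) =
     (let xs = ask_nbr orc (M a) in (Suc pc, write_list (M b) (length xs # xs) M, V))"

text \<open>
  The addresses and numbers read or written by an instruction. The cost of an instruction is 1 plus
  the sum of their weights. With weight \<open>floorlog 2\<close> (binary length) this is the logarithmic cost
  measure, with constant weight 1 it is, up to a constant factor, the uniform cost measure in which
  a query for neighbours is charged the length of the answer. Ring and group elements
  cost \<open>O(1)\<close>.
\<close>

definition cell :: "(nat \<Rightarrow> nat) \<Rightarrow> nat \<Rightarrow> nat list" where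
  "cell M i = [i, M i]"

fun touched ::
  "'v vocab \<Rightarrow> signature \<Rightarrow> 'v answers \<Rightarrow> 'v instr \<Rightarrow> (nat \<Rightarrow> nat) \<Rightarrow> nat list" where
  "touched C \<sigma> orc (SetC i c) M = [i, c]"
| "touched C \<sigma> orc (Add i a b) M = cell M a @ cell M b @ [i, M a + M b]"
| "touched C \<sigma> orc (Sub i a b) M = cell M a @ cell M b @ [i, M a - M b]"
| "touched C \<sigma> orc (Load i a) M = cell M a @ cell M (M a) @ [i]"
| "touched C \<sigma> orc (Store i a) M = cell M i @ cell M a"
| "touched C \<sigma> orc (Jz a l) M = cell M a @ [l]"
| "touched C \<sigma> orc (VSetC i v) M = [i]"
| "touched C \<sigma> orc (VAdd S i a b) M = [i, a, b]"
| "touched C \<sigma> orc (VSub S i a b) M = [i, a, b]"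
| "touched C \<sigma> orc (VMul S i a b) M = [i, a, b]"
| "touched C \<sigma> orc (VLoad i a) M = i # cell M a"
| "touched C \<sigma> orc (VStore i a) M = a # cell M i"
| "touched C \<sigma> orc (VEq i a b) M = [i, a, b]"
| "touched C \<sigma> orc (VTest P i a) M = i # [a..<a + length (the (psig C P))]"
| "touched C \<sigma> orc (QRel R i a) M = i # concat (map (cell M) [a..<a + the (\<sigma> R)])"
| "touched C \<sigma> orc (QWgt w i a) M = i # concat (map (cell M) [a..<a + war C w])"
| "touched C \<sigma> orc (QNbr a b) M =
     (let xs = ask_nbr orc (M a) in
        cell M a @ cell M b @ (length xs # xs) @ [M b..<M b + Suc (length xs)])"

definition instr_cost ::
  "'v vocab \<Rightarrow> signature \<Rightarrow> (nat \<Rightarrow> nat) \<Rightarrow> 'v answers \<Rightarrow> 'v instr \<Rightarrow> (nat \<Rightarrow> nat) \<Rightarrow> nat" where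
  "instr_cost C \<sigma> wt orc ins M = 1 + sum_list (map wt (touched C \<sigma> orc ins M))"

inductive exec ::
  "'v vocab \<Rightarrow> signature \<Rightarrow> (nat \<Rightarrow> nat) \<Rightarrow> 'v answers \<Rightarrow> 'v instr list \<Rightarrow>
   'v config \<Rightarrow> nat \<Rightarrow> 'v config \<Rightarrow> bool"
  for C \<sigma> wt orc p where
  halt: "length p \<le> pc \<Longrightarrow> exec C \<sigma> wt orc p (pc, M, V) 0 (pc, M, V)"
| next_step: "pc < length p \<Longrightarrow> exec C \<sigma> wt orc p (step C \<sigma> orc (p ! pc) (pc, M, V)) T c' \<Longrightarrow>
     exec C \<sigma> wt orc p (pc, M, V) (instr_cost C \<sigma> wt orc (p ! pc) M + T) c'"

text \<open>On input \<open>xs\<close> the program \<open>p\<close> halts with memory \<open>M\<close> at cost \<open>T\<close>.\<close>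

definition runs ::
  "'v vocab \<Rightarrow> signature \<Rightarrow> (nat \<Rightarrow> nat) \<Rightarrow> 'v answers \<Rightarrow> 'v instr list \<Rightarrow>
   nat list \<Rightarrow> (nat \<Rightarrow> nat) \<Rightarrow> nat \<Rightarrow> bool" where
  "runs C \<sigma> wt orc p xs M T \<longleftrightarrow>
     (\<exists>pc V. exec C \<sigma> wt orc p (0, write_list 0 xs (\<lambda>_. 0), \<lambda>_. undefined) T (pc, M, V))"

abbreviation log_runs ::
  "'v vocab \<Rightarrow> signature \<Rightarrow> 'v answers \<Rightarrow> 'v instr list \<Rightarrow> nat list \<Rightarrow> (nat \<Rightarrow> nat) \<Rightarrow> nat \<Rightarrow> bool"
  where "log_runs C \<sigma> \<equiv> runs C \<sigma> (floorlog 2)"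

text \<open>
  \<open>A \<mapsto> A\<^sup>*\<close> is computable in time \<open>|A| \<cdot> d\<^bsup>O(1)\<^esup>\<close>, in the uniform cost measure. The input is \<open>n = |A|\<close>,
  with access to \<open>A\<close> by queries (enough to list all tuples of \<open>A\<close> in the given time, as each lies
  in a clique of the Gaifman graph); the output is a table with one row for each element and one column
  for each new symbol (row 0 for the symbols of arity 0).
\<close>

definition computable_expansion ::
  "'v vocab \<Rightarrow> signature \<Rightarrow> signature \<Rightarrow> ('v wstruct \<Rightarrow> 'v wstruct) \<Rightarrow> bool" where
  "computable_expansion C \<sigma> \<sigma>s star \<longleftrightarrow>
     (\<exists>ns p c. distinct ns \<and> set ns = dom \<sigma>s - dom \<sigma> \<and> wf_prog C \<sigma> p \<and>
        (\<forall>A code orc. is_structure C \<sigma> A \<longrightarrow> local_access C \<sigma> A code orc \<longrightarrow>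
           (\<exists>M T. runs C \<sigma> (\<lambda>_. 1) orc p [card (univ A)] M T \<and>
              T \<le> card (univ A) * (struct_degree A + 2) ^ c \<and>
              (\<forall>j<length ns.
                 (\<sigma>s (ns ! j) = Some 0 \<longrightarrow> (M j \<noteq> 0 \<longleftrightarrow> [] \<in> rel (star A) (ns ! j))) \<and>
                 (\<sigma>s (ns ! j) = Some 1 \<longrightarrow>
                    (\<forall>a\<in>univ A. M (code a * length ns + j) \<noteq> 0 \<longleftrightarrow>
                       [a] \<in> rel (star A) (ns ! j)))))))"


section \<open>Learning\<close>

definition hyp :: "'v vocab \<Rightarrow> 'v wstruct \<Rightarrow> nat \<Rightarrow> 'v fml \<Rightarrow> nat list \<Rightarrow> nat list \<Rightarrow> bool" where
  "hyp C B k \<psi> vs = (\<lambda>as\<in>tuples (univ B) k. sat C B ((!) (as @ vs)) \<psi>)"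

definition concept_class ::
  "'v vocab \<Rightarrow> 'v fml set \<Rightarrow> 'v wstruct \<Rightarrow> nat \<Rightarrow> nat \<Rightarrow> (nat list \<Rightarrow> bool) set" where
  "concept_class C \<Psi> B k l = {hyp C B k \<psi> vs |\<psi> vs. \<psi> \<in> \<Psi> \<and> vs \<in> tuples (univ B) l}"

definition samples :: "'v wstruct \<Rightarrow> nat \<Rightarrow> (nat list \<times> bool) list set" where
  "samples A k = lists (tuples (univ A) k \<times> UNIV)"

definition consistent :: "('x \<Rightarrow> bool) \<Rightarrow> ('x \<times> bool) list \<Rightarrow> bool" where
  "consistent h T \<longleftrightarrow> (\<forall>(x, b)\<in>set T. h x = b)"

definition err :: "('x \<times> bool) pmf \<Rightarrow> ('x \<Rightarrow> bool) \<Rightarrow> real" where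
  "err D h = measure_pmf.prob D {(x, b). h x \<noteq> b}"

text \<open>
  \<open>out T h\<close>: on sample \<open>T\<close> the (deterministic) learner outputs the hypothesis \<open>h\<close>. As \<open>X\<close> will be
  finite, every distribution on \<open>X \<times> {0,1}\<close> is a pmf.
\<close>

definition agnostic_pac ::
  "'x set \<Rightarrow> ('x \<Rightarrow> bool) set \<Rightarrow> (real \<Rightarrow> real \<Rightarrow> nat) \<Rightarrow>
   (('x \<times> bool) list \<Rightarrow> ('x \<Rightarrow> bool) \<Rightarrow> bool) \<Rightarrow> bool" where
  "agnostic_pac X H tH out \<longleftrightarrow>
     (\<forall>\<epsilon>\<in>\<rat>. \<forall>\<delta>\<in>\<rat>. \<epsilon> \<in> {0<..<1} \<longrightarrow> \<delta> \<in> {0<..<1} \<longrightarrow>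
       (\<forall>D. set_pmf D \<subseteq> X \<times> UNIV \<longrightarrow>
          measure_pmf.prob (replicate_pmf (tH \<epsilon> \<delta>) D)
            {T. \<exists>h. out T h \<and> err D h \<le> (INF h'\<in>H. err D h') + \<epsilon>} \<ge> 1 - \<delta>))"

definition sample_size :: "nat \<Rightarrow> nat \<Rightarrow> real \<Rightarrow> real \<Rightarrow> nat" where
  "sample_size s n \<epsilon> \<delta> = s * nat \<lceil>log 2 (real n / \<delta>) / \<epsilon>\<^sup>2\<rceil>"

text \<open>
  A learner gets the number of examples followed by the codes of the examples. The finite set
  \<open>\<Phi>\<^sup>*\<close> is listed as \<open>fs\<close>: output \<open>M[0] = 0\<close> means reject, output \<open>M[0] = i + 1\<close> means the
  formula \<open>fs ! i\<close>, with the codes of the parameters in \<open>M[1],\<dots>,M[\<ell>]\<close>.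
\<close>

definition encode_sample :: "(nat \<Rightarrow> nat) \<Rightarrow> (nat list \<times> bool) list \<Rightarrow> nat list" where
  "encode_sample code T =
     length T # concat (map (\<lambda>(as, b). map code as @ [of_bool b]) T)"

definition returns_hyp ::
  "'v vocab \<Rightarrow> signature \<Rightarrow> 'v wstruct \<Rightarrow> (nat \<Rightarrow> nat) \<Rightarrow> 'v answers \<Rightarrow> 'v fml list \<Rightarrow> nat \<Rightarrow>
   'v instr list \<Rightarrow> (nat list \<times> bool) list \<Rightarrow> 'v fml \<Rightarrow> nat list \<Rightarrow> nat \<Rightarrow> bool" where
  "returns_hyp C \<sigma> B code orc fs l p T \<phi> vs c \<longleftrightarrow>
     (\<exists>M i. log_runs C \<sigma> orc p (encode_sample code T) M c \<and>
        i < length fs \<and> M 0 = Suc i \<and> \<phi> = fs ! i \<and>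
        vs \<in> tuples (univ B) l \<and> map M [1..<l + 1] = map code vs)"

definition rejects ::
  "'v vocab \<Rightarrow> signature \<Rightarrow> (nat \<Rightarrow> nat) \<Rightarrow> 'v answers \<Rightarrow>
   'v instr list \<Rightarrow> (nat list \<times> bool) list \<Rightarrow> nat \<Rightarrow> bool" where
  "rejects C \<sigma> code orc p T c \<longleftrightarrow>
     (\<exists>M. log_runs C \<sigma> orc p (encode_sample code T) M c \<and> M 0 = 0)"

text \<open>
  \<open>p\<close> is a learner for Exact Learning with Precomputation, in time \<open>(log n + d + t)\<^bsup>O(1)\<^esup>\<close>. The
  summand 2 in this and the following bounds keeps the base away from 0 and 1 (for instance for
  \<open>n = 1\<close>, \<open>d = t = 0\<close>), so that the exponent also absorbs constant factors.
\<close>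

definition solves_exact_learning ::
  "'v vocab \<Rightarrow> signature \<Rightarrow> signature \<Rightarrow> ('v wstruct \<Rightarrow> 'v wstruct) \<Rightarrow> 'v fml set \<Rightarrow> 'v fml list \<Rightarrow>
   nat \<Rightarrow> nat \<Rightarrow> 'v instr list \<Rightarrow> bool" where
  "solves_exact_learning C \<sigma> \<sigma>s star \<Phi> fs k l p \<longleftrightarrow>
     (\<exists>c. \<forall>A code orc. is_structure C \<sigma> A \<longrightarrow> local_access C \<sigma>s (star A) code orc \<longrightarrow>
        (\<forall>T\<in>samples A k. \<exists>time.
           real time \<le>
             (log 2 (card (univ A)) + struct_degree A + length T + 2) ^ c \<and>
           ((\<exists>\<phi> vs. returns_hyp C \<sigma>s (star A) code orc fs l p T \<phi> vs time \<and>
                consistent (hyp C (star A) k \<phi> vs) T) \<or>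
            rejects C \<sigma>s code orc p T time \<and>
              \<not> (\<exists>h\<in>concept_class C \<Phi> A k l. consistent h T))))"

definition pac_learns ::
  "'v vocab \<Rightarrow> signature \<Rightarrow> signature \<Rightarrow> ('v wstruct \<Rightarrow> 'v wstruct) \<Rightarrow> 'v fml list \<Rightarrow>
   nat \<Rightarrow> nat \<Rightarrow> 'v instr list \<Rightarrow> bool" where
  "pac_learns C \<sigma> \<sigma>s star fs k l p \<longleftrightarrow>
     (\<exists>s c. \<forall>A code orc. is_structure C \<sigma> A \<longrightarrow> local_access C \<sigma>s (star A) code orc \<longrightarrow>
        agnostic_pac (tuples (univ A) k) (concept_class C (set fs) (star A) k l)
          (sample_size s (card (univ A)))
          (\<lambda>T h. \<exists>\<phi> vs time. returns_hyp C \<sigma>s (star A) code orc fs l p T \<phi> vs time \<and>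
             h = hyp C (star A) k \<phi> vs) \<and>
        (\<forall>\<epsilon>\<in>\<rat>. \<forall>\<delta>\<in>\<rat>. \<epsilon> \<in> {0<..<1} \<longrightarrow> \<delta> \<in> {0<..<1} \<longrightarrow>
           (\<forall>T\<in>samples A k. length T = sample_size s (card (univ A)) \<epsilon> \<delta> \<longrightarrow>
              (\<exists>\<phi> vs time. returns_hyp C \<sigma>s (star A) code orc fs l p T \<phi> vs time \<and>
                 real time \<le>
                   (log 2 (card (univ A)) + struct_degree A + 1 / \<epsilon> + log 2 (1 / \<delta>) + 2) ^ c))))"

text \<open>
  \<open>pV\<close> evaluates all hypotheses returned by \<open>p\<close>. The input of \<open>pV\<close> is the index of the formula, the
  parameters, and the tuple at which the hypothesis is to be evaluated.
\<close>

definition evaluates_output ::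
  "'v vocab \<Rightarrow> signature \<Rightarrow> signature \<Rightarrow> ('v wstruct \<Rightarrow> 'v wstruct) \<Rightarrow> 'v fml list \<Rightarrow>
   nat \<Rightarrow> nat \<Rightarrow> 'v instr list \<Rightarrow> 'v instr list \<Rightarrow> bool" where
  "evaluates_output C \<sigma> \<sigma>s star fs k l p pV \<longleftrightarrow>
     (\<exists>c. \<forall>A code orc. is_structure C \<sigma> A \<longrightarrow> local_access C \<sigma>s (star A) code orc \<longrightarrow>
        (\<forall>T\<in>samples A k. \<forall>i<length fs. \<forall>vs time.
           returns_hyp C \<sigma>s (star A) code orc fs l p T (fs ! i) vs time \<longrightarrow>
           (\<forall>as\<in>tuples (univ A) k. \<exists>M time'.
              log_runs C \<sigma>s orc pV (i # map code vs @ map code as) M time' \<and>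
              real time' \<le> (log 2 (card (univ A)) + struct_degree A + 2) ^ c \<and>
              M 0 = of_bool (hyp C (star A) k (fs ! i) vs as))))"

end

theory Submission
  imports Defs
begin

text \<open>
  Feferman-Vaught decompositions and locality show that a hypothesis with arbitrary parameters agrees on the
  sample with one whose parameters lie within distance \<open>l * (2 * r + 2)\<close> of the sample: around the entries of the
  sample there is an annulus free of parameters, and what lies outside of it can be hard-wired into the formula.
  This leaves polynomially many (in the degree and the sample size) candidates, and each is tested by evaluating
  a formula of constant size in a neighbourhood of constant radius. A search by brute force thus
  minimises the number of errors. It solves exact learning, since \<open>\<Phi>\<^sup>*\<close> represents \<open>\<Phi>\<close>, and agnostic
  learning by Hoeffding's inequality, since there are at most \<open>|\<Phi>\<^sup>*| * n ^ l\<close> hypotheses.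
\<close>

section \<open>A structured language for the random access machine\<close>

text \<open>A Feferman-Vaught decomposition speaks of disjoint unions of structures, while a
  hypothesis is evaluated in a single structure. The bridge is locality with one extra step: a
  relation tuple that meets an \<open>r\<close>-neighbourhood lies in the
  \<open>r + 1\<close>-neighbourhood, so two groups of variables can be separated as soon as their
  \<open>r + 1\<close>-neighbourhoods are disjoint. This asks for a distance of more than
  \<open>2 * r + 2\<close>, which is the width of an annulus. The machine is never told
  \<open>n\<close> and learns of elements only through its input and neighbour queries. Hence the
  list of candidates is seeded with the code 0, which exists in every structure and stands in for
  the far parameters. The number \<open>n\<close> enters the running time only through the length of
  codes; all step counts depend on the degree and the sample size alone. The form of the programs is
  dictated by two features of the machine: the input starts at address 0 and has variable length, so
  no working cell is free at first; and logarithmic costs can be bounded only after the number of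
  steps, since the number of steps limits the bit lengths.\<close>

text \<open>
  \<open>When a c\<close> executes \<open>c\<close> if \<open>M[a] \<noteq> 0\<close>; \<open>Until a c\<close> repeats \<open>c\<close> until \<open>M[a] \<noteq> 0\<close>. Both compile to a
  single conditional jump, so that no cell has to be reserved for unconditional jumps.
\<close>

datatype 'v com =
    Blk "'v instr list"
  | Seq "'v com" "'v com"  (infixr ";;" 60)
  | When nat "'v com"
  | Until nat "'v com"

fun is_jump :: "'v instr \<Rightarrow> bool" where
  "is_jump (Jz a l) = True"
| "is_jump _ = False"

text \<open>Jump targets are absolute, so \<open>pos\<close> carries the address of the first
  compiled instruction.\<close>

fun compile :: "nat \<Rightarrow> 'v com \<Rightarrow> 'v instr list" where
  "compile pos (Blk is) = is"
| "compile pos (c1 ;; c2) = (let p = compile pos c1 in p @ compile (pos + length p) c2)"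
| "compile pos (When a c) = (let p = compile (Suc pos) c in Jz a (Suc pos + length p) # p)"
| "compile pos (Until a c) = compile pos c @ [Jz a pos]"

fun instrs :: "'v com \<Rightarrow> 'v instr set" where
  "instrs (Blk is) = set is"
| "instrs (c1 ;; c2) = instrs c1 \<union> instrs c2"
| "instrs (When a c) = instrs c"
| "instrs (Until a c) = instrs c"

lemma set_compile: "set (compile pos c) \<subseteq> instrs c \<union> {i. is_jump i}"
proof (induction c arbitrary: pos)
  case (Seq c1 c2)
  show ?case using Seq[of pos] Seq(2)[of "pos + length (compile pos c1)"] by (auto simp: Let_def)
next
  case (When a c)
  show ?case using When[of "Suc pos"] by (auto simp: Let_def)
next
  case (Until a c)
  show ?case using Until[of pos] by auto
qed auto

lemma wf_prog_compile:
  assumes "\<forall>i\<in>instrs c. wf_instr C \<sigma> i"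
  shows "wf_prog C \<sigma> (compile pos c)"
proof -
  have "wf_instr C \<sigma> i" if "is_jump i" for i
    using that by (cases i) auto
  then show ?thesis
    using assms set_compile[of pos c] unfolding wf_prog_def by blast
qed

text \<open>All that the cost analysis needs to know of a structure: a neighbour query at a code
  below \<open>n\<close> returns at most \<open>d\<close> codes, again below
  \<open>n\<close>.\<close>

locale machine =
  fixes C :: "'v vocab" and \<sigma> :: signature and orc :: "'v answers" and n d :: nat
  assumes nbr_set: "a < n \<Longrightarrow> set (ask_nbr orc a) \<subseteq> {..<n}"
    and nbr_length: "a < n \<Longrightarrow> length (ask_nbr orc a) \<le> d"
begin

definition eff :: "'v instr \<Rightarrow> (nat \<Rightarrow> nat) \<Rightarrow> (nat \<Rightarrow> 'v) \<Rightarrow> (nat \<Rightarrow> nat) \<times> (nat \<Rightarrow> 'v)" where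
  "eff i M V = snd (step C \<sigma> orc i (0, M, V))"

fun safe :: "'v instr \<Rightarrow> (nat \<Rightarrow> nat) \<Rightarrow> bool" where
  "safe (Jz a l) M = False"
| "safe (QNbr a b) M = (M a < n)"
| "safe _ M = True"

text \<open>The number \<open>m\<close> counts executed instructions, including the conditional
  jumps of \<open>When\<close> and \<open>Until\<close>. Bit lengths are ignored here and come back
  in \<open>run_compile\<close>.\<close>

inductive run :: "'v com \<Rightarrow> (nat \<Rightarrow> nat) \<Rightarrow> (nat \<Rightarrow> 'v) \<Rightarrow> nat \<Rightarrow> (nat \<Rightarrow> nat) \<Rightarrow> (nat \<Rightarrow> 'v) \<Rightarrow> bool"
where
  run_Nil: "run (Blk []) M V 0 M V"
| run_Cons: "safe i M \<Longrightarrow> eff i M V = (M', V') \<Longrightarrow> run (Blk is) M' V' m M'' V'' \<Longrightarrow>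
    run (Blk (i # is)) M V (Suc m) M'' V''"
| run_Seq: "run c1 M V m M' V' \<Longrightarrow> run c2 M' V' m' M'' V'' \<Longrightarrow> run (c1 ;; c2) M V (m + m') M'' V''"
| run_When0: "M a = 0 \<Longrightarrow> run (When a c) M V 1 M V"
| run_When: "M a \<noteq> 0 \<Longrightarrow> run c M V m M' V' \<Longrightarrow> run (When a c) M V (Suc m) M' V'"
| run_Until: "run c M V m M' V' \<Longrightarrow> M' a \<noteq> 0 \<Longrightarrow> run (Until a c) M V (Suc m) M' V'"
| run_Until0: "run c M V m M' V' \<Longrightarrow> M' a = 0 \<Longrightarrow> run (Until a c) M' V' m' M'' V'' \<Longrightarrow>
    run (Until a c) M V (Suc (m + m')) M'' V''"

lemma step_eq: "safe i M \<Longrightarrow> step C \<sigma> orc i (pc, M, V) = (Suc pc, eff i M V)"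
  by (cases i) (auto simp: eff_def Let_def)

section \<open>Bit lengths and logarithmic cost of a run\<close>

definition small :: "nat \<Rightarrow> (nat \<Rightarrow> nat) \<Rightarrow> bool" where
  "small b M \<longleftrightarrow> (\<forall>j. M j < 2 ^ b)"

text \<open>\<open>ibound W q i\<close> bounds the addresses and constants in the instruction \<open>i\<close> by \<open>q\<close> and its number of arguments by \<open>W\<close>.\<close>

fun ibound :: "nat \<Rightarrow> nat \<Rightarrow> 'v instr \<Rightarrow> bool" where
  "ibound W q (SetC i c) \<longleftrightarrow> i < q \<and> c < q"
| "ibound W q (Add i a c) \<longleftrightarrow> i < q \<and> a < q \<and> c < q"
| "ibound W q (Sub i a c) \<longleftrightarrow> i < q \<and> a < q \<and> c < q"
| "ibound W q (Load i a) \<longleftrightarrow> i < q \<and> a < q"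
| "ibound W q (Store i a) \<longleftrightarrow> i < q \<and> a < q"
| "ibound W q (Jz a l) \<longleftrightarrow> a < q \<and> l < q"
| "ibound W q (VSetC i v) \<longleftrightarrow> i < q"
| "ibound W q (VAdd S i a c) \<longleftrightarrow> i < q \<and> a < q \<and> c < q"
| "ibound W q (VSub S i a c) \<longleftrightarrow> i < q \<and> a < q \<and> c < q"
| "ibound W q (VMul S i a c) \<longleftrightarrow> i < q \<and> a < q \<and> c < q"
| "ibound W q (VLoad i a) \<longleftrightarrow> i < q \<and> a < q"
| "ibound W q (VStore i a) \<longleftrightarrow> i < q \<and> a < q"
| "ibound W q (VEq i a c) \<longleftrightarrow> i < q \<and> a < q \<and> c < q"
| "ibound W q (VTest P i a) \<longleftrightarrow> i < q \<and> a + length (the (psig C P)) < q \<and>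
     length (the (psig C P)) \<le> W"
| "ibound W q (QRel R i a) \<longleftrightarrow> i < q \<and> a + the (\<sigma> R) < q \<and> the (\<sigma> R) \<le> W"
| "ibound W q (QWgt w i a) \<longleftrightarrow> i < q \<and> a + war C w < q \<and> war C w \<le> W"
| "ibound W q (QNbr a c) \<longleftrightarrow> a < q \<and> c < q"

lemma ibound_mono: "ibound W q i \<Longrightarrow> W \<le> W' \<Longrightarrow> q \<le> q' \<Longrightarrow> ibound W' q' i"
  by (cases i) auto

lemma ex_ibound: "\<exists>b. ibound b b i"
proof -
  show ?thesis
  proof (cases i)
    case (VTest P i a)
    then show ?thesis by (intro exI[of _ "Suc (i + a + length (the (psig C P)))"]) auto
  next
    case (QRel R i a)
    then show ?thesis by (intro exI[of _ "Suc (i + a + the (\<sigma> R))"]) auto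
  next
    case (QWgt w i a)
    then show ?thesis by (intro exI[of _ "Suc (i + a + war C w)"]) auto
  next
    case (SetC i c) then show ?thesis by (intro exI[of _ "Suc (i + c)"]) auto
  next
    case (Add i a c) then show ?thesis by (intro exI[of _ "Suc (i + a + c)"]) auto
  next
    case (Sub i a c) then show ?thesis by (intro exI[of _ "Suc (i + a + c)"]) auto
  next
    case (Load i a) then show ?thesis by (intro exI[of _ "Suc (i + a)"]) auto
  next
    case (Store i a) then show ?thesis by (intro exI[of _ "Suc (i + a)"]) auto
  next
    case (Jz i a) then show ?thesis by (intro exI[of _ "Suc (i + a)"]) auto
  next
    case (VSetC i v) then show ?thesis by (intro exI[of _ "Suc (i)"]) auto
  next
    case (VAdd S i a c) then show ?thesis by (intro exI[of _ "Suc (i + a + c)"]) auto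
  next
    case (VSub S i a c) then show ?thesis by (intro exI[of _ "Suc (i + a + c)"]) auto
  next
    case (VMul S i a c) then show ?thesis by (intro exI[of _ "Suc (i + a + c)"]) auto
  next
    case (VLoad i a) then show ?thesis by (intro exI[of _ "Suc (i + a)"]) auto
  next
    case (VStore i a) then show ?thesis by (intro exI[of _ "Suc (i + a)"]) auto
  next
    case (VEq i a c) then show ?thesis by (intro exI[of _ "Suc (i + a + c)"]) auto
  next
    case (QNbr i a) then show ?thesis by (intro exI[of _ "Suc (i + a)"]) auto
  qed
qed

lemma ex_ibound_set:
  assumes "finite I"
  shows "\<exists>b. \<forall>i\<in>I. ibound b b i"
  using assms
proof (induction I)
  case (insert i I)
  then obtain b b' where "\<forall>i\<in>I. ibound b b i" "ibound b' b' i" using ex_ibound by blast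
  then have "\<forall>j\<in>insert i I. ibound (max b b') (max b b') j"
    by (auto intro: ibound_mono)
  then show ?case by blast
qed simp

lemma le_power_add: "x \<le> 2 ^ b \<Longrightarrow> x \<le> 2 ^ (b + m)"
  and less_power_add: "x < 2 ^ b \<Longrightarrow> x < 2 ^ (b + m)" for x :: nat
  using power_increasing[of b "b + m" "2::nat"] by linarith+

lemma sum_list_le_length: "(\<And>x. x \<in> set xs \<Longrightarrow> f x \<le> (c::nat)) \<Longrightarrow> sum_list (map f xs) \<le> length xs * c"
  by (induction xs) (auto simp: add_mono)

lemma small_mono: "small b M \<Longrightarrow> b \<le> b' \<Longrightarrow> small b' M"
  unfolding small_def by (meson less_le_trans one_le_numeral power_increasing)

text \<open>The factor 2 covers the result of an addition and the addresses behind
  \<open>M b\<close> filled by a neighbour query. Such a query touches each of up to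
  \<open>d + 1\<close> cells by address and by value, whence \<open>2 * d\<close>; relation and
  weight queries touch address and value of each argument, whence \<open>2 * W\<close>.\<close>

lemma touched_bound:
  assumes "small b M" "ibound W (2 ^ b) i" "safe i M \<or> is_jump i" "n \<le> 2 ^ b" "d \<le> 2 ^ b"
  shows "x \<in> set (touched C \<sigma> orc i M) \<Longrightarrow> x < 2 * 2 ^ b"
    and "length (touched C \<sigma> orc i M) \<le> 2 * W + 2 * d + 7"
proof -
  have M: "M j < 2 ^ b" for j using assms(1) by (simp add: small_def)
  have M': "M j < 2 * 2 ^ b" for j using M[of j] by linarith
  have one_less: "Suc 0 < 2 * 2 ^ b" using one_le_power[of "2::nat" b] by linarith
  have 2: "y < 2 * 2 ^ b" if "y < 2 ^ b" for y :: nat using that by linarith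
  have add: "M j + M j' < 2 * 2 ^ b" for j j' using M[of j] M[of j'] by linarith
  have sub: "M j - M j' < 2 * 2 ^ b" for j j' using M[of j] by linarith
  have nbr: "y < 2 ^ b" if "M a < n" "y \<in> set (ask_nbr orc (M a))" for y a
    using nbr_set[OF that(1)] that(2) assms(4) by auto
  show "x < 2 * 2 ^ b" if "x \<in> set (touched C \<sigma> orc i M)"
  proof (cases i)
    case (QNbr a c)
    then show ?thesis
      using that assms M[of a] M[of c] nbr[of a x] nbr_length[of "M a"]
      by (auto simp: cell_def Let_def)
  qed (use that assms add in \<open>auto simp: cell_def intro: add M' sub 2 one_less\<close>)
  have cells: "length (concat (map (cell M) xs)) = 2 * length xs" for xs
    by (induction xs) (auto simp: cell_def)
  show "length (touched C \<sigma> orc i M) \<le> 2 * W + 2 * d + 7"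
  proof (cases i)
    case (QNbr a c)
    then show ?thesis
      using assms nbr_length[of "M a"] by (auto simp: cell_def Let_def)
  qed (use assms in \<open>auto simp: cell_def cells simp del: length_concat\<close>)
qed

lemma floorlog2_le: "x < 2 ^ b \<Longrightarrow> floorlog 2 x \<le> b"
  by (cases "x = 0") (auto simp: floorlog_le_iff)

lemma instr_cost_bound:
  assumes "small b M" "ibound W (2 ^ b) i" "safe i M \<or> is_jump i" "n \<le> 2 ^ b" "d \<le> 2 ^ b"
  shows "instr_cost C \<sigma> (floorlog 2) orc i M \<le> (2 * W + 2 * d + 8) * Suc b"
proof -
  have "sum_list (map (floorlog 2) (touched C \<sigma> orc i M)) \<le> length (touched C \<sigma> orc i M) * Suc b"
    by (rule sum_list_le_length, rule floorlog2_le) (use touched_bound(1)[OF assms] in simp)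
  also have "\<dots> \<le> (2 * W + 2 * d + 7) * Suc b"
    using touched_bound(2)[OF assms] mult_le_mono1 by blast
  finally have "instr_cost C \<sigma> (floorlog 2) orc i M \<le> 1 + (2 * W + 2 * d + 7) * Suc b"
    by (simp add: instr_cost_def)
  also have "\<dots> \<le> (2 * W + 2 * d + 8) * Suc b" by (simp add: algebra_simps)
  finally show ?thesis .
qed

text \<open>An addition at most doubles the largest number. Whatever else is written is bounded by
  the old contents, a constant of the instruction, a truth value, a code or the length of a
  neighbour list; the strict \<open>d < 2 ^ b\<close> takes care of that length.\<close>

lemma eff_small:
  assumes "small b M" "ibound W (2 ^ b) i" "safe i M" "n \<le> 2 ^ b" "d < 2 ^ b" "eff i M V = (M', V')"
  shows "small (Suc b) M'"
proof -
  have M: "M j < 2 ^ b" for j using assms(1) by (simp add: small_def)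
  have M': "M j < 2 * 2 ^ b" for j using M[of j] by linarith
  have one_less: "Suc 0 < 2 * 2 ^ b" using one_le_power[of "2::nat" b] by linarith
  have 2: "y < 2 * 2 ^ b" if "y < 2 ^ b" for y :: nat using that by linarith
  have add: "M j + M j' < 2 * 2 ^ b" for j j' using M[of j] M[of j'] by linarith
  have sub: "M j - M j' < 2 * 2 ^ b" for j j' using M[of j] by linarith
  have "M' j < 2 * 2 ^ b" for j
  proof (cases i)
    case (QNbr a c)
    have nbr: "y < 2 ^ b" if "y \<in> set (ask_nbr orc (M a))" for y
      using nbr_set[of "M a"] that assms(3,4) QNbr by fastforce
    have len: "length (ask_nbr orc (M a)) < 2 ^ b"
      using nbr_length[of "M a"] assms QNbr by auto
    have "(length (ask_nbr orc (M a)) # ask_nbr orc (M a)) ! (j - M c) < 2 ^ b"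
      if "j - M c < Suc (length (ask_nbr orc (M a)))"
      using that nbr len by (cases "j - M c") auto
    moreover have "M' = write_list (M c) (length (ask_nbr orc (M a)) # ask_nbr orc (M a)) M"
      using assms QNbr by (auto simp: eff_def Let_def)
    ultimately show ?thesis
      using M'[of j] by (fastforce simp: write_list_def)
  qed (use assms add M' in \<open>auto simp: eff_def intro: add M' sub 2 one_less\<close>)
  then show ?thesis by (simp add: small_def)
qed

lemma run_small:
  assumes "run c M V m M' V'" "\<forall>i\<in>instrs c. ibound W (2 ^ b) i" "small b M" "n \<le> 2 ^ b" "d < 2 ^ b"
  shows "small (b + m) M'"
  using assms
proof (induction arbitrary: b rule: run.induct)
  case (run_Cons i M V M' V' "is" m M'' V'')
  have "small (Suc b) M'"
    by (rule eff_small[where i = i and W = W and V = V and V' = V'])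
      (use run_Cons in auto)
  then have "small (Suc b + m) M''"
    using run_Cons.prems by (intro run_Cons.IH) (auto intro: ibound_mono[OF _ order_refl] le_power_add less_power_add)
  then show ?case by simp
next
  case (run_Seq c1 M V m M' V' c2 m' M'' V'')
  have "small (b + m) M'" using run_Seq by simp
  moreover have "(2::nat) ^ b \<le> 2 ^ (b + m)" by simp
  ultimately have "small (b + m + m') M''"
    using run_Seq.prems by (intro run_Seq.IH) (auto intro: ibound_mono[OF _ order_refl] le_power_add less_power_add)
  then show ?case by (simp add: add_ac)
next
  case (run_Until0 c M V m M' V' a m' M'' V'')
  have "small (b + m) M'" using run_Until0 by simp
  moreover have "(2::nat) ^ b \<le> 2 ^ (b + m)" by simp
  ultimately have "small (b + m + m') M''"
    using run_Until0.prems by (intro run_Until0.IH(2)) (auto intro: ibound_mono[OF _ order_refl] le_power_add less_power_add)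
  then show ?case by (auto intro: small_mono)
next
  case (run_When M a c V m M' V')
  then have "small (b + m) M'" by simp
  then show ?case by (rule small_mono) simp
next
  case (run_Until c M V m M' V' a)
  then have "small (b + m) M'" by simp
  then show ?case by (rule small_mono) simp
qed (auto intro: small_mono)

abbreviation logexec where "logexec \<equiv> exec C \<sigma> (floorlog 2) orc"

text \<open>
  An instruction at most doubles the largest number in memory, so the numbers have
  at most \<open>b + m\<close> bits during the first \<open>m\<close> steps. This bounds the logarithmic cost by a polynomial in the
  number of steps.
\<close>

lemma run_compile:
  assumes "run c M V m M' V'"
    and "p = ps @ compile (length ps) c @ qs"
    and "small b M" "\<forall>i\<in>set p. ibound W (2 ^ b) i" "\<forall>i\<in>instrs c. ibound W (2 ^ b) i" "n \<le> 2 ^ b" "d < 2 ^ b"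
    and "logexec p (length ps + length (compile (length ps) c), M', V') T' cf"
    and "b + m \<le> bb"
  shows "\<exists>T. T \<le> m * ((2 * W + 2 * d + 8) * Suc bb) \<and> logexec p (length ps, M, V) (T + T') cf"
  using assms
proof (induction arbitrary: ps qs b T' rule: run.induct)
  case (run_Nil M V)
  then show ?case by auto
next
  case (run_Cons i M V M1 V1 "is" m M'' V'')
  let ?c = "instr_cost C \<sigma> (floorlog 2) orc i M"
  \<comment> \<open>The executed instruction moves into the prefix, so that the induction hypothesis
    meets the rest of the block at its true address. One bit is added and one step removed, which
    leaves the sum \<open>b + m\<close> unchanged.\<close>
  have p: "p = (ps @ [i]) @ compile (length (ps @ [i])) (Blk is) @ qs"
    using run_Cons.prems(1) by simp
  have bnd: "ibound W (2 ^ b) i" using run_Cons.prems(1,3) by simp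
  have sm: "small (Suc b) M1"
    using eff_small[OF run_Cons.prems(2) bnd run_Cons.hyps(1) _ _ run_Cons.hyps(2)] run_Cons.prems by simp
  have ib: "\<forall>i\<in>set p. ibound W (2 ^ Suc b) i" "\<forall>i\<in>instrs (Blk is). ibound W (2 ^ Suc b) i"
    using run_Cons.prems(3,4) ibound_mono[OF _ order_refl, of W "2 ^ b" _ "2 ^ Suc b"] by auto
  have n2: "n \<le> 2 ^ Suc b" "d < 2 ^ Suc b" using run_Cons.prems(5,6) by auto
  have ex: "logexec p (length (ps @ [i]) + length (compile (length (ps @ [i])) (Blk is)), M'', V'') T' cf"
    using run_Cons.prems(7) by simp
  obtain T where T: "T \<le> m * ((2 * W + 2 * d + 8) * Suc bb)"
    "logexec p (length (ps @ [i]), M1, V1) (T + T') cf"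
    using run_Cons.IH[OF p sm ib n2 ex] run_Cons.prems(8) by auto
  have c: "?c \<le> (2 * W + 2 * d + 8) * Suc b"
    by (rule instr_cost_bound) (use run_Cons.prems run_Cons.hyps bnd in auto)
  also have "\<dots> \<le> (2 * W + 2 * d + 8) * Suc bb" using run_Cons.prems(8) by (intro mult_le_mono2) simp
  finally have c: "?c \<le> (2 * W + 2 * d + 8) * Suc bb" .
  have pi: "p ! length ps = i" "length ps < length p" using p by (auto simp: nth_append)
  have "logexec p (length ps, M, V) (?c + (T + T')) cf"
    using exec.next_step[OF pi(2), of C \<sigma> "floorlog 2" orc M V "T + T'" cf] T(2)
    by (simp add: pi step_eq[OF run_Cons.hyps(1)] run_Cons.hyps(2))
  then show ?case using c T(1)
    by (intro exI[of _ "?c + T"]) (simp add: add_ac)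
next
  case (run_Seq c1 M V m M' V' c2 m' M'' V'')
  let ?p1 = "compile (length ps) c1"
  have p1: "p = ps @ compile (length ps) c1 @ (compile (length ps + length ?p1) c2 @ qs)"
    and p2: "p = (ps @ ?p1) @ compile (length (ps @ ?p1)) c2 @ qs"
    using run_Seq.prems(1) by (auto simp: Let_def)
  have sm1: "small (b + m) M'"
    using run_small[OF run_Seq.hyps(1), of W b] run_Seq.prems(2,4,5,6) by simp
  have ib: "\<forall>i\<in>set p. ibound W (2 ^ (b + m)) i" "\<forall>i\<in>instrs c2. ibound W (2 ^ (b + m)) i"
    "\<forall>i\<in>instrs c1. ibound W (2 ^ b) i"
    using run_Seq.prems(3,4) ibound_mono[OF _ order_refl, of W "2 ^ b" _ "2 ^ (b + m)"] by auto
  have n2: "n \<le> 2 ^ (b + m)" "d < 2 ^ (b + m)"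
    using run_Seq.prems(5,6) le_power_add less_power_add by auto
  have "logexec p (length (ps @ ?p1) + length (compile (length (ps @ ?p1)) c2), M'', V'') T' cf"
    using run_Seq.prems(7) by (simp add: Let_def add_ac)
  then obtain T2 where T2: "T2 \<le> m' * ((2 * W + 2 * d + 8) * Suc bb)"
    "logexec p (length ps + length ?p1, M', V') (T2 + T') cf"
    using run_Seq.IH(2)[OF p2 sm1 ib(1,2) n2] run_Seq.prems(8) by auto
  obtain T1 where T1: "T1 \<le> m * ((2 * W + 2 * d + 8) * Suc bb)"
    "logexec p (length ps, M, V) (T1 + (T2 + T')) cf"
    using run_Seq.IH(1)[OF p1 run_Seq.prems(2,3) ib(3) run_Seq.prems(5,6) T2(2)] run_Seq.prems(8) by auto
  then show ?case using T1 T2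
    by (intro exI[of _ "T1 + T2"]) (simp add: add_mult_distrib add_ac)
next
  case (run_When0 M a c V)
  let ?j = "Jz a (Suc (length ps) + length (compile (Suc (length ps)) c))"
  let ?c = "instr_cost C \<sigma> (floorlog 2) orc ?j M"
  have pi: "p ! length ps = ?j" "length ps < length p" and mem: "?j \<in> set p"
    using run_When0.prems(1) by (auto simp: nth_append Let_def)
  have "ibound W (2 ^ b) ?j" using run_When0.prems(3) mem by blast
  then have "?c \<le> (2 * W + 2 * d + 8) * Suc b"
    by (intro instr_cost_bound) (use run_When0.prems in auto)
  also have "\<dots> \<le> 1 * ((2 * W + 2 * d + 8) * Suc bb)" using run_When0.prems(8) by simp
  finally show ?case
    using exec.next_step[OF pi(2), of C \<sigma> "floorlog 2" orc M V T' cf] run_When0.prems(7) run_When0.hyps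
    by (intro exI[of _ ?c]) (simp add: pi Let_def)
next
  case (run_When M a c V m M' V')
  let ?j = "Jz a (Suc (length ps) + length (compile (Suc (length ps)) c))"
  let ?c = "instr_cost C \<sigma> (floorlog 2) orc ?j M"
  have p: "p = (ps @ [?j]) @ compile (length (ps @ [?j])) c @ qs"
    using run_When.prems(1) by (simp add: Let_def)
  have pi: "p ! length ps = ?j" "length ps < length p" and mem: "?j \<in> set p"
    using run_When.prems(1) by (auto simp: nth_append Let_def)
  have "ibound W (2 ^ b) ?j" using run_When.prems(3) mem by blast
  then have c: "?c \<le> (2 * W + 2 * d + 8) * Suc b"
    by (intro instr_cost_bound) (use run_When.prems in auto)
  also have "\<dots> \<le> (2 * W + 2 * d + 8) * Suc bb" using run_When.prems(8) by (intro mult_le_mono2) simp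
  finally have c: "?c \<le> (2 * W + 2 * d + 8) * Suc bb" .
  have ib: "\<forall>i\<in>instrs c. ibound W (2 ^ b) i" using run_When.prems(4) by simp
  obtain T where T: "T \<le> m * ((2 * W + 2 * d + 8) * Suc bb)"
    "logexec p (length (ps @ [?j]), M, V) (T + T') cf"
    using run_When.IH[OF p run_When.prems(2,3) ib run_When.prems(5,6), of T'] run_When.prems(7,8)
    by (auto simp: Let_def)
  have "logexec p (length ps, M, V) (?c + (T + T')) cf"
    using exec.next_step[OF pi(2), of C \<sigma> "floorlog 2" orc M V "T + T'" cf] T(2) run_When.hyps(1)
    by (simp add: pi)
  then show ?case using c T(1)
    by (intro exI[of _ "?c + T"]) (simp add: add_ac)
next
  case (run_Until c M V m M' V' a)
  let ?p = "compile (length ps) c"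
  let ?j = "Jz a (length ps)"
  let ?c = "instr_cost C \<sigma> (floorlog 2) orc ?j M'"
  have p: "p = ps @ ?p @ (?j # qs)" using run_Until.prems(1) by simp
  have pi: "p ! (length ps + length ?p) = ?j" "length ps + length ?p < length p" and mem: "?j \<in> set p"
    using p by (auto simp: nth_append)
  have sm: "small (b + m) M'" using run_small[OF run_Until.hyps(1), of W b] run_Until.prems(2,4,5,6) by simp
  have n2: "n \<le> 2 ^ (b + m)" "d < 2 ^ (b + m)"
    using run_Until.prems(5,6) le_power_add less_power_add by auto
  have c: "?c \<le> (2 * W + 2 * d + 8) * Suc (b + m)"
    by (rule instr_cost_bound[OF sm]) (use run_Until.prems(3) mem n2 in \<open>auto intro!: less_power_add\<close>)
  also have "\<dots> \<le> (2 * W + 2 * d + 8) * Suc bb" using run_Until.prems(8) by (intro mult_le_mono2) simp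
  finally have c: "?c \<le> (2 * W + 2 * d + 8) * Suc bb" .
  have ex: "logexec p (length ps + length ?p, M', V') (?c + T') cf"
    using exec.next_step[OF pi(2), of C \<sigma> "floorlog 2" orc M' V' T' cf] run_Until.prems(7) run_Until.hyps(2)
    by (simp add: pi)
  have ib: "\<forall>i\<in>instrs c. ibound W (2 ^ b) i" using run_Until.prems(4) by simp
  obtain T where T: "T \<le> m * ((2 * W + 2 * d + 8) * Suc bb)"
    "logexec p (length ps, M, V) (T + (?c + T')) cf"
    using run_Until.IH[OF p run_Until.prems(2,3) ib run_Until.prems(5,6) ex] run_Until.prems(8) by auto
  then show ?case using c
    by (intro exI[of _ "T + ?c"]) (simp add: add_ac)
next
  case (run_Until0 c M V m M' V' a m' M'' V'')
  let ?p = "compile (length ps) c"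
  let ?j = "Jz a (length ps)"
  let ?c = "instr_cost C \<sigma> (floorlog 2) orc ?j M'"
  have p: "p = ps @ ?p @ (?j # qs)" using run_Until0.prems(1) by simp
  have pi: "p ! (length ps + length ?p) = ?j" "length ps + length ?p < length p" and mem: "?j \<in> set p"
    using p by (auto simp: nth_append)
  have sm: "small (b + m) M'" using run_small[OF run_Until0.hyps(1), of W b] run_Until0.prems(2,4,5,6) by simp
  have ib': "\<forall>i\<in>set p. ibound W (2 ^ (b + m)) i" "\<forall>i\<in>instrs (Until a c). ibound W (2 ^ (b + m)) i"
    using run_Until0.prems(3,4) ibound_mono[OF _ order_refl, of W "2 ^ b" _ "2 ^ (b + m)"] by auto
  have n2: "n \<le> 2 ^ (b + m)" "d < 2 ^ (b + m)"
    using run_Until0.prems(5,6) le_power_add less_power_add by auto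
  have c: "?c \<le> (2 * W + 2 * d + 8) * Suc (b + m)"
    by (rule instr_cost_bound[OF sm]) (use ib' mem n2 in auto)
  also have "\<dots> \<le> (2 * W + 2 * d + 8) * Suc bb" using run_Until0.prems(8) by (intro mult_le_mono2) simp
  finally have c: "?c \<le> (2 * W + 2 * d + 8) * Suc bb" .
  \<comment> \<open>The remaining iterations execute the same code at the same address, but start
    from a memory whose numbers may have \<open>m\<close> more bits.\<close>
  obtain T2 where T2: "T2 \<le> m' * ((2 * W + 2 * d + 8) * Suc bb)"
    "logexec p (length ps, M', V') (T2 + T') cf"
    using run_Until0.IH(2)[OF run_Until0.prems(1) sm ib' n2] run_Until0.prems(7,8) by auto
  have ex: "logexec p (length ps + length ?p, M', V') (?c + (T2 + T')) cf"
    using exec.next_step[OF pi(2), of C \<sigma> "floorlog 2" orc M' V' "T2 + T'" cf] T2(2) run_Until0.hyps(2)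
    by (simp add: pi)
  have ib: "\<forall>i\<in>instrs c. ibound W (2 ^ b) i" using run_Until0.prems(4) by simp
  obtain T1 where T1: "T1 \<le> m * ((2 * W + 2 * d + 8) * Suc bb)"
    "logexec p (length ps, M, V) (T1 + (?c + (T2 + T'))) cf"
    using run_Until0.IH(1)[OF p run_Until0.prems(2,3) ib run_Until0.prems(5,6) ex] run_Until0.prems(8) by auto
  then show ?case using c T2
    by (intro exI[of _ "T1 + ?c + T2"]) (simp add: add_ac add_mult_distrib)
qed

text \<open>There are \<open>m\<close> instructions, and each of them touches a number of cells
  linear in \<open>W + d\<close>, with numbers of at most \<open>Suc (b + m)\<close> bits. So a
  polynomial number of steps gives polynomial logarithmic cost.\<close>

lemma run_log_runs:
  assumes "run c (write_list 0 xs (\<lambda>_. 0)) (\<lambda>_. undefined) m M' V'"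
    and "\<forall>x\<in>set xs. x < 2 ^ b" "\<forall>i\<in>set (compile 0 c) \<union> instrs c. ibound W (2 ^ b) i" "n \<le> 2 ^ b" "d < 2 ^ b"
  shows "\<exists>T. T \<le> m * ((2 * W + 2 * d + 8) * Suc (b + m)) \<and> log_runs C \<sigma> orc (compile 0 c) xs M' T"
proof -
  have sm: "small b (write_list 0 xs (\<lambda>_. 0))"
    using assms(2) by (auto simp: small_def write_list_def)
  have "logexec (compile 0 c) (length (compile 0 c), M', V') 0 (length (compile 0 c), M', V')"
    by (rule exec.halt) simp
  then show ?thesis
    using run_compile[OF assms(1), of "compile 0 c" "[]" "[]" b W 0] assms sm
    unfolding runs_def by fastforce
qed

end

section \<open>Total correctness with step counts\<close>

context machine
begin

text \<open>Total correctness as the existence of a terminating run within \<open>N\<close> steps.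
  The postcondition may itself be an \<open>ensures\<close> statement, so sequences are verified by
  nesting, in the style of weakest preconditions.\<close>

definition ensures ::
  "'v com \<Rightarrow> (nat \<Rightarrow> nat) \<Rightarrow> (nat \<Rightarrow> 'v) \<Rightarrow> nat \<Rightarrow> ((nat \<Rightarrow> nat) \<Rightarrow> (nat \<Rightarrow> 'v) \<Rightarrow> bool) \<Rightarrow> bool" where
  "ensures c M V N Q \<longleftrightarrow> (\<exists>m M' V'. run c M V m M' V' \<and> m \<le> N \<and> Q M' V')"

lemma ensures_mono:
  "ensures c M V N Q \<Longrightarrow> N \<le> N' \<Longrightarrow> (\<And>M' V'. Q M' V' \<Longrightarrow> Q' M' V') \<Longrightarrow> ensures c M V N' Q'"
  unfolding ensures_def by (meson le_trans)

lemma ensures_Nil [simp]: "ensures (Blk []) M V N Q \<longleftrightarrow> Q M V"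
  unfolding ensures_def by (auto elim: run.cases intro: run_Nil)

text \<open>As a simplification rule this executes straight-line code symbolically: with
  \<open>eff_simps\<close>, the simplifier turns a block into a chain of updates of the
  memory.\<close>

lemma ensures_Cons [simp]:
  "ensures (Blk (i # is)) M V N Q \<longleftrightarrow>
     safe i M \<and> 1 \<le> N \<and> (case eff i M V of (M', V') \<Rightarrow> ensures (Blk is) M' V' (N - 1) Q)"
proof (cases "eff i M V")
  case (Pair M' V')
  show ?thesis
  proof
    assume "ensures (Blk (i # is)) M V N Q"
    then obtain m M'' V'' where "run (Blk (i # is)) M V m M'' V''" "m \<le> N" "Q M'' V''"
      unfolding ensures_def by blast
    then show "safe i M \<and> 1 \<le> N \<and> (case eff i M V of (M', V') \<Rightarrow> ensures (Blk is) M' V' (N - 1) Q)"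
      using Pair by (cases rule: run.cases) (auto simp: ensures_def, metis diff_Suc_1 diff_le_mono One_nat_def)
  next
    assume "safe i M \<and> 1 \<le> N \<and> (case eff i M V of (M', V') \<Rightarrow> ensures (Blk is) M' V' (N - 1) Q)"
    then obtain m M'' V'' where "safe i M" "1 \<le> N" "run (Blk is) M' V' m M'' V''" "m \<le> N - 1" "Q M'' V''"
      using Pair unfolding ensures_def by auto
    then show "ensures (Blk (i # is)) M V N Q"
      using run_Cons[OF _ Pair, of "is" m M'' V''] unfolding ensures_def
      by (intro exI[of _ "Suc m"] exI[of _ M''] exI[of _ V'']) auto
  qed
qed

lemma eff_simps [simp]:
  "eff (SetC i c) M V = (M(i := c), V)"
  "eff (Add i a b) M V = (M(i := M a + M b), V)"
  "eff (Sub i a b) M V = (M(i := M a - M b), V)"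
  "eff (Load i a) M V = (M(i := M (M a)), V)"
  "eff (Store i a) M V = (M(M i := M a), V)"
  "eff (VSetC i v) M V = (M, V(i := v))"
  "eff (VAdd S i a b) M V = (M, V(i := V a \<oplus>\<^bsub>alg C S\<^esub> V b))"
  "eff (VSub S i a b) M V = (M, V(i := V a \<ominus>\<^bsub>alg C S\<^esub> V b))"
  "eff (VMul S i a b) M V = (M, V(i := V a \<otimes>\<^bsub>alg C S\<^esub> V b))"
  "eff (VEq i a b) M V = (M(i := of_bool (V a = V b)), V)"
  "eff (VTest P i a) M V =
     (M(i := of_bool (map V [a..<a + length (the (psig C P))] \<in> psem C P)), V)"
  "eff (QRel R i a) M V = (M(i := of_bool (ask_rel orc R (map M [a..<a + the (\<sigma> R)]))), V)"
  "eff (QWgt w i a) M V = (M, V(i := ask_wgt orc w (map M [a..<a + war C w])))"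
  "eff (QNbr a b) M V =
     (write_list (M b) (length (ask_nbr orc (M a)) # ask_nbr orc (M a)) M, V)"
  by (auto simp: eff_def Let_def)

lemma ensures_seq:
  assumes "ensures c1 M V N1 (\<lambda>M' V'. ensures c2 M' V' N2 Q)" "N1 + N2 \<le> N"
  shows "ensures (c1 ;; c2) M V N Q"
proof -
  obtain m M' V' m' M'' V'' where "run c1 M V m M' V'" "m \<le> N1" "run c2 M' V' m' M'' V''" "m' \<le> N2" "Q M'' V''"
    using assms(1) unfolding ensures_def by blast
  then show ?thesis using assms(2) run_Seq unfolding ensures_def
    by (intro exI[of _ "m + m'"] exI[of _ M''] exI[of _ V'']) auto
qed

lemma ensures_When:
  assumes "M a \<noteq> 0 \<Longrightarrow> ensures c M V N Q" "M a = 0 \<Longrightarrow> Q M V" "Suc N \<le> N'"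
  shows "ensures (When a c) M V N' Q"
proof (cases "M a = 0")
  case True
  then show ?thesis using assms(2,3) run_When0[of M a c V] unfolding ensures_def
    by (intro exI[of _ 1] exI[of _ M] exI[of _ V]) auto
next
  case False
  then obtain m M' V' where "run c M V m M' V'" "m \<le> N" "Q M' V'"
    using assms(1) unfolding ensures_def by blast
  then show ?thesis using assms(3) run_When[of M a c V m M' V'] False unfolding ensures_def
    by (intro exI[of _ "Suc m"] exI[of _ M'] exI[of _ V']) auto
qed

text \<open>One unfolding of the loop; \<open>N'\<close> is the budget for all later iterations, and
  the extra step is the jump.\<close>

lemma ensures_Until:
  assumes "ensures c M V N (\<lambda>M' V'. if M' a = 0 then ensures (Until a c) M' V' N' Q else Q M' V')"
  shows "ensures (Until a c) M V (Suc (N + N')) Q"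
proof -
  obtain m M' V' where 1: "run c M V m M' V'" "m \<le> N"
    "if M' a = 0 then ensures (Until a c) M' V' N' Q else Q M' V'"
    using assms unfolding ensures_def by blast
  show ?thesis
  proof (cases "M' a = 0")
    case True
    then obtain m' M'' V'' where "run (Until a c) M' V' m' M'' V''" "m' \<le> N'" "Q M'' V''"
      using 1(3) unfolding ensures_def by auto
    then show ?thesis using 1 True run_Until0[OF 1(1) True] unfolding ensures_def
      by (intro exI[of _ "Suc (m + m')"] exI[of _ M''] exI[of _ V'']) auto
  next
    case False
    then show ?thesis using 1 run_Until[OF 1(1) False] unfolding ensures_def
      by (intro exI[of _ "Suc m"] exI[of _ M'] exI[of _ V']) auto
  qed
qed

end

text \<open>Counts \<open>cnt\<close> down to 0. The cell \<open>flag\<close> serves twice: as the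
  constant 1 to be subtracted, and as the exit condition \<open>1 - cnt\<close>, which is non-zero
  exactly when the counter is exhausted. The outer \<open>When\<close> is there because
  \<open>Until\<close> always runs its body once.\<close>

definition For :: "nat \<Rightarrow> nat \<Rightarrow> 'v com \<Rightarrow> 'v com" where
  "For cnt flag c = When cnt (Until flag
     (c ;; Blk [SetC flag 1, Sub cnt cnt flag, SetC flag 1, Sub flag flag cnt]))"

text \<open>The list occupies the cells from \<open>M[lb]\<close> up to \<open>M[e]\<close>, exclusively.\<close>

definition ForEach :: "nat \<Rightarrow> nat \<Rightarrow> nat \<Rightarrow> 'v com \<Rightarrow> 'v com" where
  "ForEach lb e f c =
     Blk [SetC (f + 1) 0, Add (f + 1) (f + 1) e, Sub (f + 1) (f + 1) lb,
          SetC (f + 2) 0, Add (f + 2) (f + 2) lb] ;;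
     For (f + 1) (f + 3)
       (Blk [Load f (f + 2)] ;; c ;; Blk [SetC (f + 3) 1, Add (f + 2) (f + 2) (f + 3)])"

text \<open>\<open>ForEach\<close> occupies four registers: current entry, countdown, read pointer
  and flag. So component \<open>i\<close> of the current tuple is found in the cell
  \<open>f + 4 * i\<close>.\<close>

fun ForTup :: "nat \<Rightarrow> nat \<Rightarrow> nat \<Rightarrow> nat \<Rightarrow> 'v com \<Rightarrow> 'v com" where
  "ForTup lb e f 0 c = c"
| "ForTup lb e f (Suc m) c = ForEach lb e f (ForTup lb e (f + 4) m c)"

text \<open>Each iteration costs 8 steps besides its body: 1 to load the entry, 2 to advance the
  pointer and 5 for the counting loop. The 6 is made up of 5 initial instructions and the guarding
  jump of \<open>For\<close>.\<close>

fun tup_steps :: "nat \<Rightarrow> nat \<Rightarrow> nat \<Rightarrow> nat" where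
  "tup_steps L N 0 = N"
| "tup_steps L N (Suc m) = L * (tup_steps L N m + 8) + 6"

definition hlist :: "(nat \<Rightarrow> nat) \<Rightarrow> nat \<Rightarrow> nat list \<Rightarrow> bool" where
  "hlist M b xs \<longleftrightarrow> (\<forall>i<length xs. M (b + i) = xs ! i)"

lemma hlist_cong: "hlist M b xs \<Longrightarrow> (\<And>j. b \<le> j \<Longrightarrow> j < b + length xs \<Longrightarrow> M' j = M j) \<Longrightarrow> hlist M' b xs"
  unfolding hlist_def by simp

lemma hlist_append: "hlist M b (xs @ ys) \<longleftrightarrow> hlist M b xs \<and> hlist M (b + length xs) ys"
proof
  assume *: "hlist M b (xs @ ys)"
  have "M (b + length xs + i) = ys ! i" if "i < length ys" for i
    using *[unfolded hlist_def, rule_format, of "length xs + i"] that by (simp add: nth_append_length_plus add.assoc)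
  then show "hlist M b xs \<and> hlist M (b + length xs) ys"
    using * unfolding hlist_def by (auto simp: nth_append)
next
  assume *: "hlist M b xs \<and> hlist M (b + length xs) ys"
  have "M (b + i) = (xs @ ys) ! i" if "i < length (xs @ ys)" for i
  proof (cases "i < length xs")
    case False
    then show ?thesis using *[THEN conjunct2, unfolded hlist_def, rule_format, of "i - length xs"] that
      by (auto simp: nth_append)
  qed (use * in \<open>auto simp: hlist_def nth_append\<close>)
  then show "hlist M b (xs @ ys)" by (auto simp: hlist_def)
qed

context machine
begin

text \<open>Induction on the number of iterations left. The invariant has to survive arbitrary
  changes of the two control cells, because the loop alters them behind the back of the
  body.\<close>

lemma ensures_Loop:
  assumes "cnt \<noteq> flag"
    and stable: "\<And>i M V M'. Inv i M V \<Longrightarrow> (\<forall>j. j \<noteq> cnt \<longrightarrow> j \<noteq> flag \<longrightarrow> M' j = M j) \<Longrightarrow> Inv i M' V"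
    and body: "\<And>i M V. i < k \<Longrightarrow> Inv i M V \<Longrightarrow> M cnt = k - i \<Longrightarrow>
       ensures c M V N (\<lambda>M' V'. M' cnt = k - i \<and> Inv (Suc i) M' V')"
    and "Inv i M V" "M cnt = k - i" "i < k"
  shows "ensures (Until flag (c ;; Blk [SetC flag 1, Sub cnt cnt flag, SetC flag 1, Sub flag flag cnt]))
    M V ((k - i) * (N + 5)) (Inv k)"
  using assms(4-6)
proof (induction "k - i" arbitrary: i M V)
  case 0
  then show ?case by simp
next
  case (Suc kk)
  let ?c = "c ;; Blk [SetC flag 1, Sub cnt cnt flag, SetC flag 1, Sub flag flag cnt]"
  have *: "ensures ?c M V (N + 4)
    (\<lambda>M' V'. if M' flag = 0 then ensures (Until flag ?c) M' V' ((k - Suc i) * (N + 5)) (Inv k) else Inv k M' V')"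
  proof (rule ensures_seq)
    show "ensures c M V N (\<lambda>M' V'. ensures (Blk [SetC flag 1, Sub cnt cnt flag, SetC flag 1, Sub flag flag cnt]) M' V' 4
      (\<lambda>M' V'. if M' flag = 0 then ensures (Until flag ?c) M' V' ((k - Suc i) * (N + 5)) (Inv k) else Inv k M' V'))"
    proof (rule ensures_mono[OF body[OF Suc.prems(3,1,2)] order_refl])
      fix M1 :: "nat \<Rightarrow> nat" and V1 :: "nat \<Rightarrow> 'v" assume M1: "M1 cnt = k - i \<and> Inv (Suc i) M1 V1"
      let ?M = "M1(flag := Suc 0 - (k - i - Suc 0), cnt := k - i - Suc 0)"
      have inv: "Inv (Suc i) ?M V1" by (rule stable[of _ M1]) (use M1 in auto)
      have eq: "M1(flag := 1, cnt := k - i - Suc 0, flag := Suc 0, flag := Suc 0 - (k - i - Suc 0)) = ?M"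
        using assms(1) by auto
      show "ensures (Blk [SetC flag 1, Sub cnt cnt flag, SetC flag 1, Sub flag flag cnt]) M1 V1 4
        (\<lambda>M' V'. if M' flag = 0 then ensures (Until flag ?c) M' V' ((k - Suc i) * (N + 5)) (Inv k) else Inv k M' V')"
      proof (cases "Suc i = k")
        case True
        then show ?thesis using assms(1) M1 inv by (auto simp: fun_upd_twist)
      next
        case False
        then have "ensures (Until flag ?c) ?M V1 ((k - Suc i) * (N + 5)) (Inv k)"
          using Suc assms(1) inv by (intro Suc.hyps(1)) auto
        then show ?thesis using assms(1) M1 False Suc.prems(3) by (auto simp: fun_upd_twist)
      qed
    qed
  qed simp
  have eq: "k - i = Suc (k - Suc i)" using Suc.prems(3) by simp
  have "Suc (N + 4 + (k - Suc i) * (N + 5)) \<le> (k - i) * (N + 5)" unfolding eq by simp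
  then show ?case by (rule ensures_mono[OF ensures_Until[OF *]])
qed

lemma ensures_For:
  assumes "cnt \<noteq> flag" "M cnt = k" "Inv 0 M V"
    and stable: "\<And>i M V M'. Inv i M V \<Longrightarrow> (\<forall>j. j \<noteq> cnt \<longrightarrow> j \<noteq> flag \<longrightarrow> M' j = M j) \<Longrightarrow> Inv i M' V"
    and body: "\<And>i M V. i < k \<Longrightarrow> Inv i M V \<Longrightarrow> M cnt = k - i \<Longrightarrow>
       ensures c M V N (\<lambda>M' V'. M' cnt = k - i \<and> Inv (Suc i) M' V')"
  shows "ensures (For cnt flag c) M V (k * (N + 5) + 1) (Inv k)"
  unfolding For_def
proof (rule ensures_When[where N = "k * (N + 5)"])
  assume "M cnt \<noteq> 0"
  then have "M cnt = k - 0" and "0 < k" using assms(2) by auto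
  have "ensures (Until flag (c ;; Blk [SetC flag 1, Sub cnt cnt flag, SetC flag 1, Sub flag flag cnt])) M V
    ((k - 0) * (N + 5)) (Inv k)"
    by (rule ensures_Loop[where Inv = Inv and i = 0 and k = k and N = N and cnt = cnt])
      (fact assms(1), rule stable, assumption+, rule body, assumption+, fact assms(3), fact+)
  then show "ensures (Until flag (c ;; Blk [SetC flag 1, Sub cnt cnt flag, SetC flag 1, Sub flag flag cnt])) M V
    (k * (N + 5)) (Inv k)" by simp
qed (use assms(2,3) in auto)

text \<open>The number of iterations is computed from \<open>M e\<close> once, before the loop.
  Hence the body may append to the list and move \<open>M e\<close>; only the entries present at the
  start are visited. The growth of neighbourhoods relies on this.\<close>

lemma ensures_ForEach:
  assumes regs: "lb \<notin> {f..f+3}" "e \<notin> {f..f+3}" and init: "M lb = b" "M e = b + length xs" "Inv 0 M V"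
    and stable: "\<And>i M V M'. Inv i M V \<Longrightarrow> (\<forall>j. j \<notin> {f..f+3} \<longrightarrow> M' j = M j) \<Longrightarrow> Inv i M' V"
    and list: "\<And>i M V. Inv i M V \<Longrightarrow> hlist M b xs"
    and body: "\<And>i M V. i < length xs \<Longrightarrow> Inv i M V \<Longrightarrow> M f = xs ! i \<Longrightarrow>
       ensures c M V N (\<lambda>M' V'. M' (f+1) = M (f+1) \<and> M' (f+2) = M (f+2) \<and> Inv (Suc i) M' V')"
  shows "ensures (ForEach lb e f c) M V (length xs * (N + 8) + 6) (Inv (length xs))"
  unfolding ForEach_def
proof (rule ensures_seq[where ?N1.0 = 5 and ?N2.0 = "length xs * (N + 3 + 5) + 1"])
  let ?Inv = "\<lambda>i M V. Inv i M V \<and> M (f + 2) = b + i"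
  let ?M = "M(f + 1 := length xs, f + 2 := b)"
  have inv: "Inv 0 ?M V" by (rule stable[OF init(3)]) auto
  have "ensures (For (f + 1) (f + 3) (Blk [Load f (f + 2)] ;; c ;; Blk [SetC (f + 3) 1, Add (f + 2) (f + 2) (f + 3)]))
    ?M V (length xs * (N + 3 + 5) + 1) (?Inv (length xs))"
  proof (rule ensures_For[where Inv = ?Inv])
    show "?Inv i M' V" if "?Inv i M V" "\<forall>j. j \<noteq> f + 1 \<longrightarrow> j \<noteq> f + 3 \<longrightarrow> M' j = M j" for i M V M'
    proof -
      have "M' j = M j" if "j \<notin> {f..f+3}" for j
        using that \<open>\<forall>j. j \<noteq> f + 1 \<longrightarrow> j \<noteq> f + 3 \<longrightarrow> M' j = M j\<close> by force
      then show ?thesis using that stable[of i M V M'] by auto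
    qed
    fix i M1 V1 assume i: "i < length xs" and I: "?Inv i M1 V1" and cnt: "M1 (f + 1) = length xs - i"
    have xi: "M1 (b + i) = xs ! i" using list[of i M1 V1] I i by (auto simp: hlist_def)
    let ?M1 = "M1(f := xs ! i)"
    have inv1: "Inv i ?M1 V1" by (rule stable[of i M1]) (use I in auto)
    show "ensures (Blk [Load f (f + 2)] ;; c ;; Blk [SetC (f + 3) 1, Add (f + 2) (f + 2) (f + 3)]) M1 V1 (N + 3)
      (\<lambda>M' V'. M' (f + 1) = length xs - i \<and> ?Inv (Suc i) M' V')"
    proof (rule ensures_seq[where ?N1.0 = 1 and ?N2.0 = "N + 2"])
      have "ensures (c ;; Blk [SetC (f + 3) 1, Add (f + 2) (f + 2) (f + 3)]) ?M1 V1 (N + 2)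
        (\<lambda>M' V'. M' (f + 1) = length xs - i \<and> ?Inv (Suc i) M' V')"
      proof (rule ensures_seq[where ?N1.0 = N and ?N2.0 = 2])
        show "ensures c ?M1 V1 N (\<lambda>M' V'. ensures (Blk [SetC (f + 3) 1, Add (f + 2) (f + 2) (f + 3)]) M' V' 2
          (\<lambda>M' V'. M' (f + 1) = length xs - i \<and> ?Inv (Suc i) M' V'))"
        proof (rule ensures_mono[OF body[OF i inv1] order_refl])
          fix M2 :: "nat \<Rightarrow> nat" and V2 :: "nat \<Rightarrow> 'v"
          assume M2: "M2 (f + 1) = ?M1 (f + 1) \<and> M2 (f + 2) = ?M1 (f + 2) \<and> Inv (Suc i) M2 V2"
          have "Inv (Suc i) (M2(f + 3 := Suc 0, f + 2 := Suc (b + i))) V2"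
            by (rule stable[of _ M2]) (use M2 in auto)
          then show "ensures (Blk [SetC (f + 3) 1, Add (f + 2) (f + 2) (f + 3)]) M2 V2 2
          (\<lambda>M' V'. M' (f + 1) = length xs - i \<and> ?Inv (Suc i) M' V')"
            using M2 I cnt by simp
        qed simp
      qed simp
      then show "ensures (Blk [Load f (f + 2)]) M1 V1 1 (\<lambda>M' V'. ensures (c ;; Blk [SetC (f + 3) 1, Add (f + 2) (f + 2) (f + 3)]) M' V' (N + 2)
        (\<lambda>M' V'. M' (f + 1) = length xs - i \<and> ?Inv (Suc i) M' V'))"
        using I xi by simp
    qed simp
  qed (use inv in auto)
  then have *: "ensures (For (f + 1) (f + 3) (Blk [Load f (f + 2)] ;; c ;; Blk [SetC (f + 3) 1, Add (f + 2) (f + 2) (f + 3)]))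
    ?M V (length xs * (N + 3 + 5) + 1) (Inv (length xs))"
    by (rule ensures_mono) auto
  have **: "M(Suc f := 0, Suc f := b + length xs, Suc f := length xs, f + 2 := 0, f + 2 := b) = ?M"
    by auto
  show "ensures (Blk [SetC (f + 1) 0, Add (f + 1) (f + 1) e, Sub (f + 1) (f + 1) lb,
          SetC (f + 2) 0, Add (f + 2) (f + 2) lb]) M V 5 (\<lambda>M' V'. ensures (For (f + 1) (f + 3) (Blk [Load f (f + 2)] ;; c ;; Blk [SetC (f + 3) 1, Add (f + 2) (f + 2) (f + 3)]))
    M' V' (length xs * (N + 3 + 5) + 1) (Inv (length xs)))"
  proof -
    have "lb \<noteq> f + 1" "e \<noteq> f + 1" "lb \<noteq> f + 2" using regs by force+
    then show ?thesis using init(1,2)  * ** by (simp add: fun_upd_twist)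
  qed
qed (simp add: algebra_simps)

text \<open>The invariant is indexed by the list of tuples already treated, which arise in the order
  of \<open>product_lists\<close>. The body must leave the loop registers of all levels
  intact.\<close>

lemma ensures_ForTup:
  assumes "lb < f" "e < f"
    and "Inv [] M V"
    and "\<And>P M V M'. Inv P M V \<Longrightarrow> (\<forall>j. j < f \<or> f + 4 * m \<le> j \<longrightarrow> M' j = M j) \<Longrightarrow> Inv P M' V"
    and "\<And>P M V. Inv P M V \<Longrightarrow> M lb = b \<and> M e = b + length xs \<and> hlist M b xs"
    and "\<And>P cs M V. cs \<in> tuples (set xs) m \<Longrightarrow> Inv P M V \<Longrightarrow> (\<forall>i<m. M (f + 4 * i) = cs ! i) \<Longrightarrow>
       ensures c M V N (\<lambda>M' V'. Inv (P @ [cs]) M' V' \<and> (\<forall>j. f \<le> j \<and> j < f + 4 * m \<longrightarrow> M' j = M j))"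
  shows "ensures (ForTup lb e f m c) M V (tup_steps (length xs) N m)
    (\<lambda>M' V'. Inv (product_lists (replicate m xs)) M' V')"
  using assms
proof (induction m arbitrary: f Inv M V)
  case 0
  have "ensures c M V N (\<lambda>M' V'. Inv ([] @ [[]]) M' V' \<and> (\<forall>j. f \<le> j \<and> j < f + 4 * 0 \<longrightarrow> M' j = M j))"
    by (rule 0(6)[of "[]"]) (use 0(3) in \<open>auto simp: tuples_def\<close>)
  then show ?case by (auto intro: ensures_mono)
next
  case (Suc m)
  let ?pl = "product_lists (replicate m xs)"
  \<comment> \<open>The tuples treated once the outermost loop has passed its first \<open>i\<close>
    entries.\<close>
  define Q where "Q i = concat (map (\<lambda>x. map ((#) x) ?pl) (take i xs))" for i
  have Q: "Q 0 = []" "Q (length xs) = product_lists (replicate (Suc m) xs)"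
    "\<And>i. i < length xs \<Longrightarrow> Q (Suc i) = Q i @ map ((#) (xs ! i)) ?pl"
    by (auto simp: Q_def take_Suc_conv_app_nth)
  have "ensures (ForEach lb e f (ForTup lb e (f + 4) m c)) M V (length xs * (tup_steps (length xs) N m + 8) + 6)
    ((\<lambda>i. Inv (Q i)) (length xs))"
  proof (rule ensures_ForEach)
    show "lb \<notin> {f..f + 3}" "e \<notin> {f..f + 3}" "M lb = b" "M e = b + length xs" "Inv (Q 0) M V"
      using Suc.prems(1-3) Suc.prems(5)[of "[]" M V] Q by auto
    show "Inv (Q i) M' V" if "Inv (Q i) M V" "\<forall>j. j \<notin> {f..f + 3} \<longrightarrow> M' j = M j" for i M V M'
      by (rule Suc.prems(4)[OF that(1)]) (use that(2) in auto)
    show "hlist M b xs" if "Inv (Q i) M V" for i M V using Suc.prems(5)[OF that] by simp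
    fix i M1 V1 assume i: "i < length xs" and I: "Inv (Q i) M1 V1" and x: "M1 f = xs ! i"
    \<comment> \<open>The invariant for the inner levels puts the fixed first component in front of
      every inner tuple and freezes the registers of the outer level.\<close>
    let ?Inv = "\<lambda>P M V. Inv (Q i @ map ((#) (xs ! i)) P) M V \<and> M f = xs ! i \<and>
      M (f+1) = M1 (f+1) \<and> M (f+2) = M1 (f+2)"
    have "ensures (ForTup lb e (f + 4) m c) M1 V1 (tup_steps (length xs) N m) (?Inv ?pl)"
    proof (rule Suc.IH[where Inv = ?Inv])
      show "?Inv P M' V" if "?Inv P M V" "\<forall>j. j < f + 4 \<or> f + 4 + 4 * m \<le> j \<longrightarrow> M' j = M j" for P M V M'
        using Suc.prems(4)[of "Q i @ map ((#) (xs ! i)) P" M V M'] that by auto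
      show "M lb = b \<and> M e = b + length xs \<and> hlist M b xs" if "?Inv P M V" for P M V
        using Suc.prems(5) that by blast
      fix P cs M V assume cs: "cs \<in> tuples (set xs) m" and I2: "?Inv P M V" "\<forall>j<m. M (f + 4 + 4 * j) = cs ! j"
      have t: "(xs ! i) # cs \<in> tuples (set xs) (Suc m)" using cs i by (auto simp: tuples_def)
      have r: "\<forall>j<Suc m. M (f + 4 * j) = (xs ! i # cs) ! j"
        using I2 by (auto simp: less_Suc_eq_0_disj add_ac)
      show "ensures c M V N (\<lambda>M' V'. ?Inv (P @ [cs]) M' V' \<and>
          (\<forall>j. f + 4 \<le> j \<and> j < f + 4 + 4 * m \<longrightarrow> M' j = M j))"
        by (rule ensures_mono[OF Suc.prems(6)[OF t I2(1)[THEN conjunct1] r] order_refl]) (use I2 in auto)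
    qed (use Suc.prems(1,2) I x in simp_all)
    then show "ensures (ForTup lb e (f + 4) m c) M1 V1 (tup_steps (length xs) N m)
      (\<lambda>M' V'. M' (f + 1) = M1 (f + 1) \<and> M' (f + 2) = M1 (f + 2) \<and> Inv (Q (Suc i)) M' V')"
      by (rule ensures_mono) (auto simp: Q(3)[OF i])
  qed
  then show ?case using Q by simp
qed

lemma set_product_lists_replicate: "set (product_lists (replicate m xs)) = tuples (set xs) m"
  by (auto simp: product_lists_set list_all2_conv_all_nth tuples_def subset_eq all_set_conv_all_nth)

end

section \<open>Evaluation of formulas in a listed structure\<close>

fun copies :: "nat \<Rightarrow> nat list \<Rightarrow> 'v instr list" where
  "copies f [] = []"
| "copies f (a # as) = SetC f 0 # Add f f a # copies (Suc f) as"

text \<open>The empty program for \<open>Agg\<close> is a dummy: only terms of aggregation depth 0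
  are evaluated. Intermediate values form a stack in the registers from \<open>g\<close> on, the
  result ending in \<open>g\<close>.\<close>

fun eval_trm :: "'v vocab \<Rightarrow> (nat \<Rightarrow> nat) \<Rightarrow> nat \<Rightarrow> nat \<Rightarrow> 'v trm \<Rightarrow> 'v com" where
  "eval_trm C \<rho> f g (Elem i s) = Blk [VSetC g s]"
| "eval_trm C \<rho> f g (Wgt w xs) = Blk (copies f (map \<rho> xs)) ;; Blk [QWgt w g f]"
| "eval_trm C \<rho> f g (Plus t u) =
     eval_trm C \<rho> f g t ;; eval_trm C \<rho> f (Suc g) u ;; Blk [VAdd (ttype C t) g g (Suc g)]"
| "eval_trm C \<rho> f g (Minus t u) =
     eval_trm C \<rho> f g t ;; eval_trm C \<rho> f (Suc g) u ;; Blk [VSub (ttype C t) g g (Suc g)]"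
| "eval_trm C \<rho> f g (Times t u) =
     eval_trm C \<rho> f g t ;; eval_trm C \<rho> f (Suc g) u ;; Blk [VMul (ttype C t) g g (Suc g)]"
| "eval_trm C \<rho> f g (Agg i p \<phi>) = Blk []"

fun eval_trms :: "'v vocab \<Rightarrow> (nat \<Rightarrow> nat) \<Rightarrow> nat \<Rightarrow> nat \<Rightarrow> 'v trm list \<Rightarrow> 'v com" where
  "eval_trms C \<rho> f g [] = Blk []"
| "eval_trms C \<rho> f g (t # ts) = eval_trm C \<rho> f g t ;; eval_trms C \<rho> f (Suc g) ts"

text \<open>
  The variable \<open>x\<close> is kept in the cell \<open>\<rho> x\<close>. The cells from \<open>f\<close> on and the ring and group registers
  from \<open>g\<close> on are free, and the universe is listed between \<open>M[lb]\<close> and \<open>M[e]\<close>.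
  The formula holds iff finally \<open>M[f] \<noteq> 0\<close>.
\<close>

fun eval_fml ::
  "'v vocab \<Rightarrow> nat \<Rightarrow> nat \<Rightarrow> (nat \<Rightarrow> nat) \<Rightarrow> nat \<Rightarrow> nat \<Rightarrow> 'v fml \<Rightarrow> 'v com" where
  "eval_fml C lb e \<rho> f g (Eq x y) =
     Blk [Sub f (\<rho> x) (\<rho> y), Sub (Suc f) (\<rho> y) (\<rho> x), Add f f (Suc f),
          SetC (Suc f) 1, Sub f (Suc f) f]"
| "eval_fml C lb e \<rho> f g (Rel R xs) = Blk (copies f (map \<rho> xs)) ;; Blk [QRel R f f]"
| "eval_fml C lb e \<rho> f g (WEq s w xs) =
     Blk (copies f (map \<rho> xs)) ;; Blk [QWgt w g f, VSetC (Suc g) s, VEq f (Suc g) g]"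
| "eval_fml C lb e \<rho> f g (Neg \<phi>) =
     eval_fml C lb e \<rho> f g \<phi> ;; Blk [SetC (Suc f) 1, Sub f (Suc f) f]"
| "eval_fml C lb e \<rho> f g (Or \<phi> \<psi>) =
     eval_fml C lb e \<rho> f g \<phi> ;; eval_fml C lb e \<rho> (Suc f) g \<psi> ;; Blk [Add f f (Suc f)]"
| "eval_fml C lb e \<rho> f g (Ex y \<phi>) =
     Blk [SetC f 0] ;;
     ForEach lb e (Suc f) (eval_fml C lb e (\<rho>(y := Suc f)) (f + 5) g \<phi> ;; Blk [Add f f (f + 5)])"
| "eval_fml C lb e \<rho> f g (WSum s w ys \<phi>) =
     (let m = length ys; vs = map (\<lambda>i. Suc f + 4 * i) [0..<m]; f' = Suc f + 4 * m in
      Blk [VSetC g \<zero>\<^bsub>alg C (wtype C w)\<^esub>] ;;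
      ForTup lb e (Suc f) m
        (eval_fml C lb e (upd \<rho> ys vs) f' (g + 2) \<phi> ;;
         When f' (Blk (copies f' vs) ;;
                  Blk [QWgt w (Suc g) f', VAdd (wtype C w) g g (Suc g)])) ;;
      Blk [VSetC (Suc g) s, VEq f (Suc g) g])"
| "eval_fml C lb e \<rho> f g (Pred P ts) = eval_trms C \<rho> f g ts ;; Blk [VTest P f g]"

fun width_trm :: "'v trm \<Rightarrow> nat" where
  "width_trm (Elem i s) = 0"
| "width_trm (Wgt w xs) = length xs"
| "width_trm (Plus t u) = width_trm t + width_trm u"
| "width_trm (Minus t u) = width_trm t + width_trm u"
| "width_trm (Times t u) = width_trm t + width_trm u"
| "width_trm (Agg i p \<phi>) = 0"

text \<open>Bounds the number of cells from \<open>f\<close> on that the evaluation overwrites. The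
  list of the universe has to lie behind them.\<close>

fun width :: "'v fml \<Rightarrow> nat" where
  "width (Eq x y) = 2"
| "width (Rel R xs) = Suc (length xs)"
| "width (WEq s w xs) = Suc (length xs)"
| "width (Neg \<phi>) = width \<phi> + 2"
| "width (Or \<phi> \<psi>) = width \<phi> + width \<psi> + 2"
| "width (Ex y \<phi>) = width \<phi> + 5"
| "width (WSum s w ys \<phi>) = width \<phi> + 5 * length ys + 2"
| "width (Pred P ts) = sum_list (map width_trm ts) + 1"

fun eval_steps_trm :: "'v trm \<Rightarrow> nat" where
  "eval_steps_trm (Elem i s) = 1"
| "eval_steps_trm (Wgt w xs) = 2 * length xs + 1"
| "eval_steps_trm (Plus t u) = eval_steps_trm t + eval_steps_trm u + 1"
| "eval_steps_trm (Minus t u) = eval_steps_trm t + eval_steps_trm u + 1"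
| "eval_steps_trm (Times t u) = eval_steps_trm t + eval_steps_trm u + 1"
| "eval_steps_trm (Agg i p \<phi>) = 0"

fun eval_steps :: "nat \<Rightarrow> 'v fml \<Rightarrow> nat" where
  "eval_steps L (Eq x y) = 5"
| "eval_steps L (Rel R xs) = 2 * length xs + 1"
| "eval_steps L (WEq s w xs) = 2 * length xs + 3"
| "eval_steps L (Neg \<phi>) = eval_steps L \<phi> + 2"
| "eval_steps L (Or \<phi> \<psi>) = eval_steps L \<phi> + eval_steps L \<psi> + 1"
| "eval_steps L (Ex y \<phi>) = L * (eval_steps L \<phi> + 9) + 7"
| "eval_steps L (WSum s w ys \<phi>) =
     tup_steps L (eval_steps L \<phi> + 2 * length ys + 3) (length ys) + 3"
| "eval_steps L (Pred P ts) = sum_list (map eval_steps_trm ts) + 1"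

definition answers_for ::
  "'v vocab \<Rightarrow> signature \<Rightarrow> 'v answers \<Rightarrow> (nat \<Rightarrow> nat) \<Rightarrow> 'v wstruct \<Rightarrow> bool" where
  "answers_for C \<sigma> orc code D \<longleftrightarrow>
     finite (univ D) \<and> inj_on code (univ D) \<and>
     (\<forall>R m. \<sigma> R = Some m \<longrightarrow>
        (\<forall>as\<in>tuples (univ D) m. ask_rel orc R (map code as) \<longleftrightarrow> as \<in> rel D R)) \<and>
     (\<forall>w\<in>dom (wsig C). \<forall>as\<in>tuples (univ D) (war C w).
        ask_wgt orc w (map code as) = wgt D w as \<and> wgt D w as \<in> carrier (alg C (wtype C w)))"

text \<open>Links the sum accumulated by a loop to \<open>finsum\<close>. Distinctness matters,
  because a repeated entry would be added twice.\<close>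

lemma (in abelian_monoid) foldl_eq_finsum:
  assumes "distinct xs" "\<And>x. x \<in> set xs \<Longrightarrow> h x \<in> carrier G"
  shows "foldl (\<lambda>a x. if P x then a \<oplus> h x else a) \<zero> xs = finsum G h {x \<in> set xs. P x}"
  using assms
proof (induction xs rule: rev_induct)
  case (snoc x xs)
  have *: "{y \<in> set (xs @ [x]). P y} =
    (if P x then insert x {y \<in> set xs. P y} else {y \<in> set xs. P y})" by auto
  have "finsum G h {y \<in> set xs. P y} \<in> carrier G" using snoc.prems by (intro finsum_closed) auto
  then show ?case using snoc unfolding * by (auto simp: Pi_def a_comm)
qed simp

lemma upd_comp: "length ys = length bs \<Longrightarrow> (\<lambda>x. h (upd \<beta> ys bs x)) = upd (\<lambda>x. h (\<beta> x)) ys (map h bs)"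
  by (rule ext) (auto simp: upd_def zip_map2 map_of_map split: option.splits dest!: map_of_SomeD dest: set_zip_leftD)

lemma upd_in: "x \<in> set ys \<Longrightarrow> length ys = length bs \<Longrightarrow> upd \<beta> ys bs x \<in> set bs"
proof -
  assume "x \<in> set ys" "length ys = length bs"
  then obtain b where b: "map_of (zip ys bs) x = Some b" by (metis map_of_zip_is_Some)
  then have "b \<in> set bs" by (metis map_of_SomeD set_zip_rightD)
  then show ?thesis using b by (simp add: upd_def)
qed

lemma upd_out: "x \<notin> set ys \<Longrightarrow> upd \<beta> ys bs x = \<beta> x"
  by (auto simp: upd_def split: option.splits dest: map_of_SomeD set_zip_leftD)

lemma fold_max_0_iff: "fold max (map h ts) 0 = (0::nat) \<longleftrightarrow> (\<forall>t\<in>set ts. h t = 0)"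
proof -
  have "fold max (map h ts) a = 0 \<longleftrightarrow> a = 0 \<and> (\<forall>t\<in>set ts. h t = 0)" for a
    by (induction ts arbitrary: a) auto
  then show ?thesis by simp
qed

section \<open>Correctness of the evaluation programs\<close>

context machine
begin

lemma ensures_copies_disjoint:
  assumes "\<forall>a\<in>set as. a < f \<or> f + length as \<le> a"
  shows "ensures (Blk (copies f as)) M V (2 * length as)
    (\<lambda>M' V'. V' = V \<and> (\<forall>i<length as. M' (f + i) = M (as ! i)) \<and>
       (\<forall>j. j < f \<or> f + length as \<le> j \<longrightarrow> M' j = M j))"
  using assms
proof (induction as arbitrary: f M)
  case (Cons a as)
  let ?M = "M(f := M a)"
  have "ensures (Blk (copies (Suc f) as)) ?M V (2 * length as)
    (\<lambda>M' V'. V' = V \<and> (\<forall>i<length (a # as). M' (f + i) = M ((a # as) ! i)) \<and>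
       (\<forall>j. j < f \<or> f + length (a # as) \<le> j \<longrightarrow> M' j = M j))"
  proof (rule ensures_mono[OF Cons.IH order_refl])
    show "\<forall>a\<in>set as. a < Suc f \<or> Suc f + length as \<le> a" using Cons.prems by auto
    fix M' V' assume *: "V' = V \<and> (\<forall>i<length as. M' (Suc f + i) = ?M (as ! i)) \<and>
       (\<forall>j. j < Suc f \<or> Suc f + length as \<le> j \<longrightarrow> M' j = ?M j)"
    have "M' (f + i) = M ((a # as) ! i)" if "i < Suc (length as)" for i
    proof (cases i)
      case (Suc i')
      then have "M' (Suc f + i') = ?M (as ! i')" "as ! i' \<in> set as" using * that by auto
      then show ?thesis using Suc Cons.prems by auto
    qed (use * in auto)
    then show "V' = V \<and> (\<forall>i<length (a # as). M' (f + i) = M ((a # as) ! i)) \<and>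
       (\<forall>j. j < f \<or> f + length (a # as) \<le> j \<longrightarrow> M' j = M j)"
      using * by auto
  qed
  moreover have "M(f := 0, f := M a) = ?M" by simp
  moreover have "a \<noteq> f" using Cons.prems by auto
  ultimately show ?case by simp
qed simp

lemma ensures_copies:
  assumes "\<forall>a\<in>set as. a < f"
  shows "ensures (Blk (copies f as)) M V (2 * length as)
    (\<lambda>M' V'. V' = V \<and> (\<forall>i<length as. M' (f + i) = M (as ! i)) \<and>
       (\<forall>j. j < f \<or> f + length as \<le> j \<longrightarrow> M' j = M j))"
  by (rule ensures_copies_disjoint) (use assms in auto)

lemma map_upt_eq: "(\<forall>i<length as. M (f + i) = h (as ! i)) \<Longrightarrow> k = length as \<Longrightarrow> map M [f..<f + k] = map h as"
  by (auto intro: nth_equalityI)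

text \<open>Frame condition: only the cells in \<open>{f..<f+k}\<close> and the registers from \<open>g\<close> on are changed.\<close>

definition frame :: "nat \<Rightarrow> nat \<Rightarrow> nat \<Rightarrow> (nat \<Rightarrow> nat) \<Rightarrow> (nat \<Rightarrow> 'v) \<Rightarrow> (nat \<Rightarrow> nat) \<Rightarrow> (nat \<Rightarrow> 'v) \<Rightarrow> bool" where
  "frame f k g M V M' V' \<longleftrightarrow>
     (\<forall>j. j < f \<or> f + k \<le> j \<longrightarrow> M' j = M j) \<and> (\<forall>j<g. V' j = V j)"

text \<open>For a binary operation the left value waits in \<open>g\<close> while the right operand
  is evaluated into \<open>Suc g\<close>; the frame condition for the second evaluation guarantees
  that it is still there.\<close>

lemma eval_trm_correct:
  assumes "answers_for C \<sigma> orc code D"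
    and "wa1_trm C \<sigma> t" "agg_depth_trm t = 0"
    and "\<forall>x\<in>free_trm t. \<rho> x < f \<and> \<beta> x \<in> univ D \<and> M (\<rho> x) = code (\<beta> x)"
  shows "ensures (eval_trm C \<rho> f g t) M V (eval_steps_trm t)
    (\<lambda>M' V'. V' g = tval C D \<beta> t \<and> frame f (width_trm t) g M V M' V')"
  using assms(2-)
proof (induction t arbitrary: g M V rule: measure_induct_rule[where f = size])
  case (less t)
  have step: "ensures (eval_trm C \<rho> f g t1 ;; eval_trm C \<rho> f (Suc g) t2 ;; Blk [i]) M V
      (eval_steps_trm t1 + eval_steps_trm t2 + 1)
      (\<lambda>M' V'. V' g = v \<and> frame f (width_trm t1 + width_trm t2) g M V M' V')"
    if t: "size t1 < size t" "size t2 < size t" "wa1_trm C \<sigma> t1" "wa1_trm C \<sigma> t2" "agg_depth_trm t1 = 0" "agg_depth_trm t2 = 0"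
      "free_trm t = free_trm t1 \<union> free_trm t2"
      and safe: "\<And>M. safe i M"
      and i: "\<And>M' V'. V' g = tval C D \<beta> t1 \<Longrightarrow> V' (Suc g) = tval C D \<beta> t2 \<Longrightarrow> eff i M' V' = (M', V'(g := v))"
    for t1 t2 i v
  proof (rule ensures_seq[OF ensures_mono[OF less.IH[OF t(1,3,5)] order_refl]])
    show "\<forall>x\<in>free_trm t1. \<rho> x < f \<and> \<beta> x \<in> univ D \<and> M (\<rho> x) = code (\<beta> x)" using less.prems t by auto
    fix M1 V1 assume 1: "V1 g = tval C D \<beta> t1 \<and> frame f (width_trm t1) g M V M1 V1"
    show "ensures (eval_trm C \<rho> f (Suc g) t2 ;; Blk [i]) M1 V1 (eval_steps_trm t2 + 1)
      (\<lambda>M' V'. V' g = v \<and> frame f (width_trm t1 + width_trm t2) g M V M' V')"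
    proof (rule ensures_seq[OF ensures_mono[OF less.IH[OF t(2,4,6)] order_refl]])
      show "\<forall>x\<in>free_trm t2. \<rho> x < f \<and> \<beta> x \<in> univ D \<and> M1 (\<rho> x) = code (\<beta> x)"
        using less.prems t 1 by (auto simp: frame_def)
      fix M2 V2 assume 2: "V2 (Suc g) = tval C D \<beta> t2 \<and> frame f (width_trm t2) (Suc g) M1 V1 M2 V2"
      have "eff i M2 V2 = (M2, V2(g := v))" by (rule i) (use 1 2 in \<open>auto simp: frame_def\<close>)
      then show "ensures (Blk [i]) M2 V2 1 (\<lambda>M' V'. V' g = v \<and> frame f (width_trm t1 + width_trm t2) g M V M' V')"
        using 1 2 safe by (auto simp: frame_def)
    qed simp
  qed simp
  show ?case
  proof (cases t)
    case (Elem i s)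
    then show ?thesis by (auto simp: frame_def)
  next
    case (Wgt w xs)
    have w: "w \<in> dom (wsig C)" "length xs = war C w" using less.prems(1) Wgt by (auto simp: wgt_atom_def)
    have xs: "map \<beta> xs \<in> tuples (univ D) (war C w)" "\<forall>x\<in>set xs. \<rho> x < f \<and> M (\<rho> x) = code (\<beta> x)"
      using less.prems(3) Wgt w by (auto simp: tuples_def)
    show ?thesis unfolding Wgt eval_trm.simps
    proof (rule ensures_seq[OF ensures_mono[OF ensures_copies order_refl]])
      fix M1 V1 assume 1: "V1 = V \<and> (\<forall>i<length (map \<rho> xs). M1 (f + i) = M (map \<rho> xs ! i)) \<and>
         (\<forall>j. j < f \<or> f + length (map \<rho> xs) \<le> j \<longrightarrow> M1 j = M j)"
      have "map M1 [f..<f + war C w] = map code (map \<beta> xs)"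
        unfolding map_map comp_def by (rule map_upt_eq) (use 1 xs w in auto)
      moreover have "ask_wgt orc w (map code (map \<beta> xs)) = wgt D w (map \<beta> xs)"
        using assms(1) w(1) xs(1) unfolding answers_for_def by blast
      ultimately have "ask_wgt orc w (map M1 [f..<f + war C w]) = wgt D w (map \<beta> xs)" by simp
      then show "ensures (Blk [QWgt w g f]) M1 V1 1
        (\<lambda>M' V'. V' g = tval C D \<beta> (Wgt w xs) \<and> frame f (width_trm (Wgt w xs)) g M V M' V')"
        using 1 by (auto simp: frame_def)
    qed (use xs in auto)
  next
    case (Plus t1 t2)
    show ?thesis unfolding Plus eval_trm.simps eval_steps_trm.simps width_trm.simps
      by (rule step) (use less.prems Plus in auto)
  next
    case (Minus t1 t2)
    show ?thesis unfolding Minus eval_trm.simps eval_steps_trm.simps width_trm.simps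
      by (rule step) (use less.prems Minus in auto)
  next
    case (Times t1 t2)
    show ?thesis unfolding Times eval_trm.simps eval_steps_trm.simps width_trm.simps
      by (rule step) (use less.prems Times in auto)
  next
    case (Agg i p \<phi>)
    then show ?thesis using less.prems by simp
  qed
qed

lemma eval_trms_correct:
  assumes "answers_for C \<sigma> orc code D"
    and "\<forall>t\<in>set ts. wa1_trm C \<sigma> t \<and> agg_depth_trm t = 0"
    and "\<forall>t\<in>set ts. \<forall>x\<in>free_trm t. \<rho> x < f \<and> \<beta> x \<in> univ D \<and> M (\<rho> x) = code (\<beta> x)"
  shows "ensures (eval_trms C \<rho> f g ts) M V (sum_list (map eval_steps_trm ts))
    (\<lambda>M' V'. (\<forall>i<length ts. V' (g + i) = tval C D \<beta> (ts ! i)) \<and>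
       frame f (sum_list (map width_trm ts)) g M V M' V')"
  using assms(2-)
proof (induction ts arbitrary: g M V)
  case Nil
  then show ?case by (simp add: frame_def)
next
  case (Cons t ts)
  show ?case unfolding eval_trms.simps
  proof (rule ensures_seq[OF ensures_mono[OF eval_trm_correct[OF assms(1)] order_refl]])
    fix M1 V1 assume 1: "V1 g = tval C D \<beta> t \<and> frame f (width_trm t) g M V M1 V1"
    show "ensures (eval_trms C \<rho> f (Suc g) ts) M1 V1 (sum_list (map eval_steps_trm ts))
      (\<lambda>M' V'. (\<forall>i<length (t # ts). V' (g + i) = tval C D \<beta> ((t # ts) ! i)) \<and>
       frame f (sum_list (map width_trm (t # ts))) g M V M' V')"
    proof (rule ensures_mono[OF Cons.IH order_refl])
      show "\<forall>t\<in>set ts. \<forall>x\<in>free_trm t. \<rho> x < f \<and> \<beta> x \<in> univ D \<and> M1 (\<rho> x) = code (\<beta> x)"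
        using Cons.prems 1 by (auto simp: frame_def)
      fix M2 V2 assume 2: "(\<forall>i<length ts. V2 (Suc g + i) = tval C D \<beta> (ts ! i)) \<and>
         frame f (sum_list (map width_trm ts)) (Suc g) M1 V1 M2 V2"
      have "V2 (g + i) = tval C D \<beta> ((t # ts) ! i)" if "i < length (t # ts)" for i
        using 1 2 that by (cases i) (auto simp: frame_def)
      then show "(\<forall>i<length (t # ts). V2 (g + i) = tval C D \<beta> ((t # ts) ! i)) \<and>
         frame f (sum_list (map width_trm (t # ts))) g M V M2 V2"
        using 1 2 by (auto simp: frame_def)
    qed (use Cons.prems in auto)
  qed (use Cons.prems in auto)
qed

end

context machine
begin

text \<open>Register assignment, first free cell, valuation and memory are all generalised, as a
  quantifier changes each of them. The list has no duplicates because sums must count every element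
  once, and \<open>f + width \<phi> \<le> b\<close> keeps it out of reach of the working
  cells.\<close>

lemma eval_fml_correct:
  assumes vv: "valid_vocab C" and ans: "answers_for C \<sigma> orc code D"
    and "distinct xs" "set xs = code ` univ D"
    and "wa1 C \<sigma> \<phi>" "agg_depth \<phi> = 0"
    and "\<forall>x\<in>free \<phi>. \<rho> x < f \<and> \<beta> x \<in> univ D \<and> M (\<rho> x) = code (\<beta> x)"
    and "lb < f" "e < f" "M lb = b" "M e = b + length xs" "hlist M b xs" "f + width \<phi> \<le> b"
  shows "ensures (eval_fml C lb e \<rho> f g \<phi>) M V (eval_steps (length xs) \<phi>)
    (\<lambda>M' V'. (M' f \<noteq> 0 \<longleftrightarrow> sat C D \<beta> \<phi>) \<and> frame f (width \<phi>) g M V M' V')"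
  using assms(5-)
proof (induction \<phi> arbitrary: \<rho> f g \<beta> M V rule: measure_induct_rule[where f = size])
  case (less \<phi>)
  note ans' = ans[unfolded answers_for_def]
  have copies_eq: "map M1 [f'..<f' + k] = map code (map \<beta> ys)"
    if "\<forall>i<length (map \<rho> ys). M1 (f' + i) = M (map \<rho> ys ! i)" "\<forall>y\<in>set ys. M (\<rho> y) = code (\<beta> y)" "k = length ys"
    for M1 f' k ys
    unfolding map_map comp_def by (rule map_upt_eq) (use that in auto)
  show ?case
  proof (cases \<phi>)
    case (Eq x y)
    \<comment> \<open>The program adds the two truncated differences, which gives the distance of
      the codes, and then negates.\<close>
    have "code (\<beta> x) = code (\<beta> y) \<longleftrightarrow> \<beta> x = \<beta> y"
      using ans' less.prems(3) Eq by (auto dest: inj_onD)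
    then show ?thesis using less.prems(3) Eq by (auto simp: frame_def)
  next
    case (Rel R ys)
    have ys: "\<forall>y\<in>set ys. \<rho> y < f" "\<forall>y\<in>set ys. M (\<rho> y) = code (\<beta> y)" "map \<beta> ys \<in> tuples (univ D) (length ys)"
      using less.prems(3) Rel by (auto simp: tuples_def)
    have R: "\<sigma> R = Some (length ys)" using less.prems(1) Rel by simp
    show ?thesis unfolding Rel eval_fml.simps
    proof (rule ensures_seq[OF ensures_mono[OF ensures_copies order_refl]])
      fix M1 V1 assume 1: "V1 = V \<and> (\<forall>i<length (map \<rho> ys). M1 (f + i) = M (map \<rho> ys ! i)) \<and>
         (\<forall>j. j < f \<or> f + length (map \<rho> ys) \<le> j \<longrightarrow> M1 j = M j)"
      have "ask_rel orc R (map code (map \<beta> ys)) \<longleftrightarrow> map \<beta> ys \<in> rel D R"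
        using ans' R ys(3) by blast
      then have "ask_rel orc R (map M1 [f..<f + the (\<sigma> R)]) \<longleftrightarrow> map \<beta> ys \<in> rel D R"
        using copies_eq[of ys M1 f "the (\<sigma> R)"] 1 ys(2) R by auto
      then show "ensures (Blk [QRel R f f]) M1 V1 1
        (\<lambda>M' V'. (M' f \<noteq> 0 \<longleftrightarrow> sat C D \<beta> (Rel R ys)) \<and> frame f (width (Rel R ys)) g M V M' V')"
        using 1 by (auto simp: frame_def)
    qed (use ys in auto)
  next
    case (WEq s w ys)
    have ys: "\<forall>y\<in>set ys. \<rho> y < f" "\<forall>y\<in>set ys. M (\<rho> y) = code (\<beta> y)"
      using less.prems(3) WEq by auto
    have w: "w \<in> dom (wsig C)" "length ys = war C w" using less.prems(1) WEq by (auto simp: wgt_atom_def)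
    have t: "map \<beta> ys \<in> tuples (univ D) (war C w)" using less.prems(3) WEq w by (auto simp: tuples_def)
    show ?thesis unfolding WEq eval_fml.simps
    proof (rule ensures_seq[OF ensures_mono[OF ensures_copies order_refl]])
      fix M1 V1 assume 1: "V1 = V \<and> (\<forall>i<length (map \<rho> ys). M1 (f + i) = M (map \<rho> ys ! i)) \<and>
         (\<forall>j. j < f \<or> f + length (map \<rho> ys) \<le> j \<longrightarrow> M1 j = M j)"
      have "ask_wgt orc w (map code (map \<beta> ys)) = wgt D w (map \<beta> ys)"
        using ans' w(1) t by blast
      moreover have "map M1 [f..<f + war C w] = map code (map \<beta> ys)"
        by (rule copies_eq) (use 1 ys(2) w(2) in simp_all)
      ultimately have "ask_wgt orc w (map M1 [f..<f + war C w]) = wgt D w (map \<beta> ys)" by simp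
      then show "ensures (Blk [QWgt w g f, VSetC (Suc g) s, VEq f (Suc g) g]) M1 V1 3
        (\<lambda>M' V'. (M' f \<noteq> 0 \<longleftrightarrow> sat C D \<beta> (WEq s w ys)) \<and> frame f (width (WEq s w ys)) g M V M' V')"
        using 1 by (auto simp: frame_def)
    qed (use ys in auto)
  next
    case (Neg \<psi>)
    have 0: "ensures (eval_fml C lb e \<rho> f g \<psi>) M V (eval_steps (length xs) \<psi>)
      (\<lambda>M' V'. (M' f \<noteq> 0 \<longleftrightarrow> sat C D \<beta> \<psi>) \<and> frame f (width \<psi>) g M V M' V')"
      by (rule less.IH) (use less.prems Neg in simp_all)
    show ?thesis unfolding Neg eval_fml.simps
    proof (rule ensures_seq[OF ensures_mono[OF 0 order_refl]])
      fix M1 V1 assume 1: "(M1 f \<noteq> 0 \<longleftrightarrow> sat C D \<beta> \<psi>) \<and> frame f (width \<psi>) g M V M1 V1"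
      show "ensures (Blk [SetC (Suc f) 1, Sub f (Suc f) f]) M1 V1 2
        (\<lambda>M' V'. (M' f \<noteq> 0 \<longleftrightarrow> sat C D \<beta> (Neg \<psi>)) \<and> frame f (width (Neg \<psi>)) g M V M' V')"
        using 1 by (auto simp: frame_def)
    qed simp
  next
    case (Or \<phi>1 \<phi>2)
    have 0: "ensures (eval_fml C lb e \<rho> f g \<phi>1) M V (eval_steps (length xs) \<phi>1)
      (\<lambda>M' V'. (M' f \<noteq> 0 \<longleftrightarrow> sat C D \<beta> \<phi>1) \<and> frame f (width \<phi>1) g M V M' V')"
      by (rule less.IH) (use less.prems Or in simp_all)
    show ?thesis unfolding Or eval_fml.simps
    proof (rule ensures_seq[OF ensures_mono[OF 0 order_refl]])
      fix M1 V1 assume 1: "(M1 f \<noteq> 0 \<longleftrightarrow> sat C D \<beta> \<phi>1) \<and> frame f (width \<phi>1) g M V M1 V1"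
      have fr: "M1 j = M j" if "j < f \<or> f + width \<phi>1 \<le> j" for j using 1 that by (auto simp: frame_def)
      have vs: "\<forall>x\<in>free \<phi>2. \<rho> x < Suc f \<and> \<beta> x \<in> univ D \<and> M1 (\<rho> x) = code (\<beta> x)"
        using less.prems(3) Or fr by (fastforce simp: less_Suc_eq)
      have hl: "hlist M1 b xs"
        by (rule hlist_cong[OF less.prems(8)]) (use less.prems(9) Or fr in auto)
      have 00: "ensures (eval_fml C lb e \<rho> (Suc f) g \<phi>2) M1 V1 (eval_steps (length xs) \<phi>2)
        (\<lambda>M' V'. (M' (Suc f) \<noteq> 0 \<longleftrightarrow> sat C D \<beta> \<phi>2) \<and> frame (Suc f) (width \<phi>2) g M1 V1 M' V')"
        by (rule less.IH) (use less.prems Or vs hl fr in simp_all)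
      show "ensures (eval_fml C lb e \<rho> (Suc f) g \<phi>2 ;; Blk [Add f f (Suc f)]) M1 V1 (eval_steps (length xs) \<phi>2 + 1)
        (\<lambda>M' V'. (M' f \<noteq> 0 \<longleftrightarrow> sat C D \<beta> (Or \<phi>1 \<phi>2)) \<and> frame f (width (Or \<phi>1 \<phi>2)) g M V M' V')"
      proof (rule ensures_seq[OF ensures_mono[OF 00 order_refl]])
        fix M2 V2 assume 2: "(M2 (Suc f) \<noteq> 0 \<longleftrightarrow> sat C D \<beta> \<phi>2) \<and> frame (Suc f) (width \<phi>2) g M1 V1 M2 V2"
        show "ensures (Blk [Add f f (Suc f)]) M2 V2 1
          (\<lambda>M' V'. (M' f \<noteq> 0 \<longleftrightarrow> sat C D \<beta> (Or \<phi>1 \<phi>2)) \<and> frame f (width (Or \<phi>1 \<phi>2)) g M V M' V')"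
          using 1 2 by (auto simp: frame_def)
      qed simp
    qed simp
  next
    case (Ex y \<psi>)
    let ?w = "width \<psi> + 5"
    let ?body = "eval_fml C lb e (\<rho>(y := Suc f)) (f + 5) g \<psi> ;; Blk [Add f f (f + 5)]"
    \<comment> \<open>The cell \<open>f\<close> sums up the results for the elements seen so far, so
      it is non-zero iff one of them is a witness.\<close>
    let ?Inv = "\<lambda>i M1 V1. (M1 f \<noteq> 0 \<longleftrightarrow> (\<exists>a\<in>univ D. code a \<in> set (take i xs) \<and> sat C D (\<beta>(y := a)) \<psi>)) \<and>
      frame f ?w g M V M1 V1"
    have hl: "hlist M1 b xs" if "frame f ?w g M V M1 V1" for M1 V1
      by (rule hlist_cong[OF less.prems(8)]) (use less.prems(9) Ex that in \<open>auto simp: frame_def\<close>)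
    have "ensures (ForEach lb e (Suc f) ?body) (M(f := 0)) V
      (length xs * (eval_steps (length xs) \<psi> + 1 + 8) + 6) (?Inv (length xs))"
    proof (rule ensures_ForEach[where b = b])
      show "?Inv i M' V1" if "?Inv i M1 V1" "\<forall>j. j \<notin> {Suc f..Suc f + 3} \<longrightarrow> M' j = M1 j" for i M1 V1 M'
      proof -
        have "M' f = M1 f" using that(2) by auto
        moreover have "frame f ?w g M V M' V1" using that by (auto simp: frame_def)
        ultimately show ?thesis using that by simp
      qed
      show "hlist M1 b xs" if "?Inv i M1 V1" for i M1 V1 using hl that by blast
      fix i M1 V1 assume i: "i < length xs" and I: "?Inv i M1 V1" and x: "M1 (Suc f) = xs ! i"
      have fr: "M1 j = M j" if "j < f \<or> f + ?w \<le> j" for j using I that by (auto simp: frame_def)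
      obtain a where a: "a \<in> univ D" "code a = xs ! i" using i assms(4) nth_mem[OF i] by auto
      have vs: "\<forall>x\<in>free \<psi>. (\<rho>(y := Suc f)) x < f + 5 \<and> (\<beta>(y := a)) x \<in> univ D \<and> M1 ((\<rho>(y := Suc f)) x) = code ((\<beta>(y := a)) x)"
        using less.prems(3) Ex fr a x by (auto simp: less_Suc_eq trans_less_add1)
      have 0: "ensures (eval_fml C lb e (\<rho>(y := Suc f)) (f + 5) g \<psi>) M1 V1 (eval_steps (length xs) \<psi>)
        (\<lambda>M' V'. (M' (f + 5) \<noteq> 0 \<longleftrightarrow> sat C D (\<beta>(y := a)) \<psi>) \<and> frame (f + 5) (width \<psi>) g M1 V1 M' V')"
        by (rule less.IH[OF _ _ _ vs]) (use less.prems(1,2,4-7,9) Ex hl[of M1 V1] I fr in simp_all)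
      show "ensures ?body M1 V1 (eval_steps (length xs) \<psi> + 1)
        (\<lambda>M' V'. M' (Suc f + 1) = M1 (Suc f + 1) \<and> M' (Suc f + 2) = M1 (Suc f + 2) \<and> ?Inv (Suc i) M' V')"
      proof (rule ensures_seq[OF ensures_mono[OF 0 order_refl]])
        fix M2 V2 assume 2: "(M2 (f + 5) \<noteq> 0 \<longleftrightarrow> sat C D (\<beta>(y := a)) \<psi>) \<and> frame (f + 5) (width \<psi>) g M1 V1 M2 V2"
        have "(\<exists>a\<in>univ D. code a \<in> set (take (Suc i) xs) \<and> sat C D (\<beta>(y := a)) \<psi>) \<longleftrightarrow>
          (\<exists>a\<in>univ D. code a \<in> set (take i xs) \<and> sat C D (\<beta>(y := a)) \<psi>) \<or> sat C D (\<beta>(y := a)) \<psi>"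
        proof -
          have "a' = a" if "a' \<in> univ D" "code a' = xs ! i" for a'
            using that a ans' by (metis inj_onD)
          moreover have "set (take (Suc i) xs) = insert (xs ! i) (set (take i xs))"
            using i by (simp add: take_Suc_conv_app_nth)
          ultimately show ?thesis using a by (metis insert_iff)
        qed
        then show "ensures (Blk [Add f f (f + 5)]) M2 V2 1
          (\<lambda>M' V'. M' (Suc f + 1) = M1 (Suc f + 1) \<and> M' (Suc f + 2) = M1 (Suc f + 2) \<and> ?Inv (Suc i) M' V')"
          using 2 I by (auto simp: frame_def)
      qed simp
    qed (use less.prems Ex in \<open>auto simp: frame_def\<close>)
    then have "ensures (ForEach lb e (Suc f) ?body) (M(f := 0)) V
      (length xs * (eval_steps (length xs) \<psi> + 9) + 6)
      (\<lambda>M' V'. (M' f \<noteq> 0 \<longleftrightarrow> sat C D \<beta> (Ex y \<psi>)) \<and> frame f (width (Ex y \<psi>)) g M V M' V')"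
      by (rule ensures_mono) (use assms(4) in auto)
    then show ?thesis unfolding Ex eval_fml.simps eval_steps.simps
      by (intro ensures_seq[where ?N1.0 = 1 and ?N2.0 = "length xs * (eval_steps (length xs) \<psi> + 9) + 6"]) auto
  next
    case (WSum s w ys \<psi>)
    define m where "m = length ys"
    define vs where "vs = map (\<lambda>i. Suc f + 4 * i) [0..<m]"
    define f' where "f' = Suc f + 4 * m"
    define dec where "dec = inv_into (univ D) code"
    let ?G = "alg C (wtype C w)"
    let ?w = "width \<psi> + 5 * m + 2"
    let ?N = "eval_steps (length xs) \<psi>"
    define ok where "ok cs = sat C D (upd \<beta> ys (map dec cs)) \<psi>" for cs
    define h where "h cs = wgt D w (map dec cs)" for cs
    \<comment> \<open>The content of the value register \<open>g\<close> after the loop has treated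
      the tuples of codes in \<open>P\<close>.\<close>
    define acc where "acc P = foldl (\<lambda>a cs. if ok cs then a \<oplus>\<^bsub>?G\<^esub> h cs else a) \<zero>\<^bsub>?G\<^esub> P" for P
    let ?Inv = "\<lambda>P M1 V1. V1 g = acc P \<and> frame f ?w g M V M1 V1"
    have w: "w \<in> dom (wsig C)" "war C w = m" using less.prems(1) WSum by (auto simp: wgt_atom_def m_def)
    then have "wtype C w \<in> idx C" using vv unfolding valid_vocab_def by auto
    then interpret G: abelian_group ?G using vv unfolding valid_vocab_def by auto
    have inj: "inj_on code (univ D)" using ans' by blast
    have dec: "dec x \<in> univ D" "code (dec x) = x" if "x \<in> set xs" for x
      using that assms(4) by (auto simp: dec_def inv_into_into f_inv_into_f)
    have dec': "dec (code a) = a" if "a \<in> univ D" for a using that inj by (simp add: dec_def)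
    have code_dec: "map code (map dec cs) = cs" "map dec cs \<in> tuples (univ D) m" "length cs = m"
      if "cs \<in> tuples (set xs) m" for cs
      using that dec by (auto simp: tuples_def subset_iff intro!: map_idI)
    have hc: "h cs \<in> carrier ?G" "ask_wgt orc w cs = h cs" if "cs \<in> tuples (set xs) m" for cs
      using ans' w code_dec[OF that] unfolding h_def by metis+
    have vs: "length vs = m" "\<forall>v\<in>set vs. f < v \<and> v < f'" by (auto simp: vs_def f'_def)
    have hl: "hlist M1 b xs" if "frame f ?w g M V M1 V1" for M1 V1
      by (rule hlist_cong[OF less.prems(8)]) (use less.prems(9) WSum that in \<open>auto simp: frame_def m_def\<close>)
    have fr: "M1 j = M j" if "frame f ?w g M V M1 V1" "j < f" for M1 V1 j using that by (auto simp: frame_def)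
    let ?body = "eval_fml C lb e (upd \<rho> ys vs) f' (g + 2) \<psi> ;;
         When f' (Blk (copies f' vs) ;; Blk [QWgt w (Suc g) f', VAdd (wtype C w) g g (Suc g)])"
    have "ensures (ForTup lb e (Suc f) m ?body) M (V(g := \<zero>\<^bsub>?G\<^esub>)) (tup_steps (length xs) (?N + 2 * m + 3) m)
      (?Inv (product_lists (replicate m xs)))"
    proof (rule ensures_ForTup[where b = b])
      show "?Inv P M' V1" if "?Inv P M1 V1" "\<forall>j. j < Suc f \<or> Suc f + 4 * m \<le> j \<longrightarrow> M' j = M1 j" for P M1 V1 M'
        using that by (auto simp: frame_def)
      show "M1 lb = b \<and> M1 e = b + length xs \<and> hlist M1 b xs" if "?Inv P M1 V1" for P M1 V1
        using that fr hl less.prems(4-7) by metis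
      show "?Inv [] M (V(g := \<zero>\<^bsub>?G\<^esub>))" by (simp add: acc_def frame_def)
      fix P cs M1 V1 assume cs: "cs \<in> tuples (set xs) m" and I: "?Inv P M1 V1"
        and r: "\<forall>i<m. M1 (Suc f + 4 * i) = cs ! i"
      have mv: "map M1 vs = cs" using r code_dec(3)[OF cs] by (auto simp: vs_def intro!: nth_equalityI)
      let ?\<beta> = "upd \<beta> ys (map dec cs)"
      have "upd \<rho> ys vs x < f' \<and> ?\<beta> x \<in> univ D \<and> M1 (upd \<rho> ys vs x) = code (?\<beta> x)"
        if x: "x \<in> free \<psi>" for x
      proof (cases "x \<in> set ys")
        case True
        \<comment> \<open>A bound variable lives in a loop register. Both its cell and its value are
          updates along \<open>ys\<close>, and pushing \<open>M1\<close> and \<open>code\<close>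
          through these updates leaves the same tuple \<open>cs\<close> on both sides.\<close>
        have "M1 (upd \<rho> ys vs x) = upd (\<lambda>x. M1 (\<rho> x)) ys cs x"
          using fun_cong[OF upd_comp[of ys vs M1 \<rho>]] vs(1) mv by (simp add: m_def)
        moreover have "code (?\<beta> x) = upd (\<lambda>x. code (\<beta> x)) ys cs x"
          using fun_cong[OF upd_comp[of ys "map dec cs" code \<beta>]] code_dec[OF cs] by (simp add: m_def)
        moreover have "upd (\<lambda>x. M1 (\<rho> x)) ys cs x = upd (\<lambda>x. code (\<beta> x)) ys cs x"
          using True code_dec(3)[OF cs] by (simp add: upd_def m_def split: option.split)
        moreover have "upd \<rho> ys vs x \<in> set vs"
          by (rule upd_in) (use True vs(1) m_def in simp_all)
        moreover have "?\<beta> x \<in> set (map dec cs)"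
          by (rule upd_in) (use True code_dec(3)[OF cs] m_def in simp_all)
        ultimately show ?thesis using vs(2) code_dec(2)[OF cs] by (auto simp: tuples_def)
      next
        case False
        then have "\<rho> x < f" "\<beta> x \<in> univ D" "M (\<rho> x) = code (\<beta> x)" using less.prems(3) WSum x by auto
        then show ?thesis using upd_out[OF False] fr[OF I[THEN conjunct2]] by (simp add: f'_def)
      qed
      then have vars: "\<forall>x\<in>free \<psi>. upd \<rho> ys vs x < f' \<and> ?\<beta> x \<in> univ D \<and> M1 (upd \<rho> ys vs x) = code (?\<beta> x)"
        by blast
      have 0: "ensures (eval_fml C lb e (upd \<rho> ys vs) f' (g + 2) \<psi>) M1 V1 ?N
        (\<lambda>M' V'. (M' f' \<noteq> 0 \<longleftrightarrow> sat C D ?\<beta> \<psi>) \<and> frame f' (width \<psi>) (g + 2) M1 V1 M' V')"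
        using fr[OF I[THEN conjunct2], of lb] fr[OF I[THEN conjunct2], of e] hl[OF I[THEN conjunct2]]
        by (intro less.IH[OF _ _ _ vars])
          (use less.prems(1,2,4-7,9) WSum in \<open>simp_all add: f'_def m_def\<close>)
      show "ensures ?body M1 V1 (?N + 2 * m + 3)
        (\<lambda>M' V'. ?Inv (P @ [cs]) M' V' \<and> (\<forall>j. Suc f \<le> j \<and> j < Suc f + 4 * m \<longrightarrow> M' j = M1 j))"
      proof (rule ensures_seq[OF ensures_mono[OF 0 order_refl], where ?N2.0 = "2 * m + 3"])
        fix M2 V2 assume 2: "(M2 f' \<noteq> 0 \<longleftrightarrow> sat C D ?\<beta> \<psi>) \<and> frame f' (width \<psi>) (g + 2) M1 V1 M2 V2"
        have g2: "V2 g = acc P" using 2 I by (simp add: frame_def)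
        have fr2: "frame f ?w g M V M2 V2" using 2 I by (auto simp: frame_def f'_def)
        show "ensures (When f' (Blk (copies f' vs) ;; Blk [QWgt w (Suc g) f', VAdd (wtype C w) g g (Suc g)]))
          M2 V2 (2 * m + 3)
          (\<lambda>M' V'. ?Inv (P @ [cs]) M' V' \<and> (\<forall>j. Suc f \<le> j \<and> j < Suc f + 4 * m \<longrightarrow> M' j = M1 j))"
        proof (rule ensures_When[where N = "2 * m + 2"])
          assume "M2 f' = 0"
          then have "\<not> ok cs" using 2 by (simp add: ok_def)
          then show "?Inv (P @ [cs]) M2 V2 \<and> (\<forall>j. Suc f \<le> j \<and> j < Suc f + 4 * m \<longrightarrow> M2 j = M1 j)"
            using 2 g2 fr2 by (simp add: acc_def frame_def f'_def)
        next
          assume "M2 f' \<noteq> 0"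
          then have ok: "ok cs" using 2 by (simp add: ok_def)
          show "ensures (Blk (copies f' vs) ;; Blk [QWgt w (Suc g) f', VAdd (wtype C w) g g (Suc g)])
            M2 V2 (2 * m + 2)
            (\<lambda>M' V'. ?Inv (P @ [cs]) M' V' \<and> (\<forall>j. Suc f \<le> j \<and> j < Suc f + 4 * m \<longrightarrow> M' j = M1 j))"
          proof (rule ensures_seq[OF ensures_mono[OF ensures_copies order_refl], where ?N2.0 = 2])
            fix M3 V3 assume 3: "V3 = V2 \<and> (\<forall>i<length vs. M3 (f' + i) = M2 (vs ! i)) \<and>
              (\<forall>j. j < f' \<or> f' + length vs \<le> j \<longrightarrow> M3 j = M2 j)"
            have "M2 v = M1 v" if "v \<in> set vs" for v using 2 vs(2) that by (auto simp: frame_def)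
            then have "map M2 vs = cs" using mv by (metis map_eq_conv)
            moreover have "map M3 [f'..<f' + m] = map M2 vs"
              by (rule map_upt_eq) (use 3 vs(1) in auto)
            ultimately have "ask_wgt orc w (map M3 [f'..<f' + war C w]) = h cs" using hc(2)[OF cs] w(2) by simp
            moreover have "acc (P @ [cs]) = acc P \<oplus>\<^bsub>?G\<^esub> h cs" using ok by (simp add: acc_def)
            ultimately have "ask_wgt orc w (map M3 [f'..<f' + war C w]) = h cs"
              and "acc (P @ [cs]) = V3 g \<oplus>\<^bsub>?G\<^esub> h cs" using g2 3 by auto
            then show "ensures (Blk [QWgt w (Suc g) f', VAdd (wtype C w) g g (Suc g)]) M3 V3 2
              (\<lambda>M' V'. ?Inv (P @ [cs]) M' V' \<and> (\<forall>j. Suc f \<le> j \<and> j < Suc f + 4 * m \<longrightarrow> M' j = M1 j))"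
              using 3 2 fr2 vs(1) by (auto simp: frame_def f'_def)
          qed (use vs in auto)
        qed simp
      qed simp
    qed (use less.prems(4,5) in auto)
    note loop = this
    have "acc (product_lists (replicate m xs)) =
      finsum ?G h {cs \<in> set (product_lists (replicate m xs)). ok cs}"
      unfolding acc_def
    proof (rule G.foldl_eq_finsum)
      show "distinct (product_lists (replicate m xs))"
        using assms(3) by (intro distinct_product_lists) auto
    qed (auto simp: set_product_lists_replicate intro: hc)
    also have "{cs \<in> set (product_lists (replicate m xs)). ok cs} =
      map code ` {bs \<in> tuples (univ D) m. sat C D (upd \<beta> ys bs) \<psi>}" (is "?A = map code ` ?B")
    proof -
      have 1: "map dec (map code bs) = bs" if "bs \<in> tuples (univ D) m" for bs
        using that dec' by (auto simp: tuples_def subset_iff intro!: map_idI)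
      have 2: "map code bs \<in> tuples (set xs) m" if "bs \<in> tuples (univ D) m" for bs
        using that assms(4) by (auto simp: tuples_def)
      show ?thesis unfolding set_product_lists_replicate
      proof (intro equalityI subsetI)
        fix cs assume "cs \<in> {cs \<in> tuples (set xs) m. ok cs}"
        then show "cs \<in> map code ` ?B"
          using code_dec[of cs] by (intro image_eqI[of _ _ "map dec cs"]) (simp_all add: ok_def del: map_map)
      next
        fix cs assume "cs \<in> map code ` ?B"
        then obtain bs where "bs \<in> ?B" "cs = map code bs" by blast
        then show "cs \<in> {cs \<in> tuples (set xs) m. ok cs}"
          using 1[of bs] 2[of bs] by (simp add: ok_def del: map_map)
      qed
    qed
    \<comment> \<open>The machine sums over tuples of codes, the semantics over tuples of elements;
      injectivity of \<open>code\<close> allows the change of index.\<close>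
    also have "finsum ?G h \<dots> = finsum ?G (\<lambda>bs. h (map code bs)) ?B"
    proof (rule G.finsum_reindex)
      show "inj_on (map code) ?B"
        using inj by (auto simp: tuples_def intro!: inj_onI dest: map_inj_on[OF _ inj_on_subset])
      show "h \<in> map code ` ?B \<rightarrow> carrier ?G"
      proof (clarify, rule hc(1))
        show "map code bs \<in> tuples (set xs) m" if "bs \<in> tuples (univ D) m" for bs
          using that assms(4) by (auto simp: tuples_def)
      qed
    qed
    also have "\<dots> = finsum ?G (wgt D w) ?B"
    proof (rule G.finsum_cong')
      have "map dec (map code bs) = bs" if "bs \<in> tuples (univ D) m" for bs
        using that dec' by (auto simp: tuples_def subset_iff intro!: map_idI)
      then show "h (map code bs) = wgt D w bs" if "bs \<in> ?B" for bs
        using that unfolding h_def by (simp del: map_map)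
      show "wgt D w \<in> ?B \<rightarrow> carrier ?G" using ans' w by auto
    qed simp
    finally have sum: "sat C D \<beta> \<phi> \<longleftrightarrow> s = acc (product_lists (replicate m xs))"
      by (simp add: WSum m_def)
    have "ensures (Blk [VSetC g \<zero>\<^bsub>?G\<^esub>] ;; ForTup lb e (Suc f) m ?body ;; Blk [VSetC (Suc g) s, VEq f (Suc g) g])
      M V (1 + (tup_steps (length xs) (?N + 2 * m + 3) m + 2))
      (\<lambda>M' V'. (M' f \<noteq> 0 \<longleftrightarrow> sat C D \<beta> \<phi>) \<and> frame f ?w g M V M' V')"
    proof (rule ensures_seq[where ?N1.0 = 1, OF _ order_refl])
      have "ensures (ForTup lb e (Suc f) m ?body ;; Blk [VSetC (Suc g) s, VEq f (Suc g) g])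
        M (V(g := \<zero>\<^bsub>?G\<^esub>)) (tup_steps (length xs) (?N + 2 * m + 3) m + 2)
        (\<lambda>M' V'. (M' f \<noteq> 0 \<longleftrightarrow> sat C D \<beta> \<phi>) \<and> frame f ?w g M V M' V')"
        by (rule ensures_seq[OF ensures_mono[OF loop order_refl], where ?N2.0 = 2])
          (auto simp: sum frame_def)
      then show "ensures (Blk [VSetC g \<zero>\<^bsub>?G\<^esub>]) M V 1 (\<lambda>M' V'. ensures (ForTup lb e (Suc f) m ?body ;; Blk [VSetC (Suc g) s, VEq f (Suc g) g])
        M' V' (tup_steps (length xs) (?N + 2 * m + 3) m + 2) (\<lambda>M' V'. (M' f \<noteq> 0 \<longleftrightarrow> sat C D \<beta> \<phi>) \<and> frame f ?w g M V M' V'))"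
        by simp
    qed
    then show ?thesis
      unfolding WSum eval_fml.simps eval_steps.simps width.simps Let_def
        m_def[symmetric] vs_def[symmetric] f'_def[symmetric]
      by (rule ensures_mono) auto
  next
    case (Pred P ts)
    have ts: "\<forall>t\<in>set ts. wa1_trm C \<sigma> t \<and> agg_depth_trm t = 0" "length (the (psig C P)) = length ts"
      using less.prems(1,2) Pred by (auto simp: fold_max_0_iff)
    show ?thesis unfolding Pred eval_fml.simps
    proof (rule ensures_seq[OF ensures_mono[OF eval_trms_correct[OF ans ts(1)] order_refl]])
      fix M1 V1 assume 1: "(\<forall>i<length ts. V1 (g + i) = tval C D \<beta> (ts ! i)) \<and>
       frame f (sum_list (map width_trm ts)) g M V M1 V1"
      have "map V1 [g..<g + length (the (psig C P))] = map (tval C D \<beta>) ts"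
        using 1 ts(2) by (auto intro!: nth_equalityI)
      then show "ensures (Blk [VTest P f g]) M1 V1 1
        (\<lambda>M' V'. (M' f \<noteq> 0 \<longleftrightarrow> sat C D \<beta> (Pred P ts)) \<and> frame f (width (Pred P ts)) g M V M' V')"
        using 1 by (auto simp: frame_def)
    qed (use less.prems Pred in auto)
  qed
qed

end

section \<open>Neighbourhoods\<close>

fun pushes :: "nat \<Rightarrow> nat \<Rightarrow> nat list \<Rightarrow> 'v instr list" where
  "pushes e t [] = []"
| "pushes e t (a # as) = Store e a # SetC t 1 # Add e e t # pushes e t as"

text \<open>
  A neighbour query writes the number of neighbours in front of them. Directing it to the last cell of the list
  and then restoring this cell appends just the neighbours.
\<close>

definition grow :: "nat \<Rightarrow> nat \<Rightarrow> nat \<Rightarrow> 'v com" where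
  "grow lb e f = ForEach lb e f (Blk
     [SetC (f + 4) 1, SetC (f + 5) 0, Add (f + 5) (f + 5) e, Sub (f + 5) (f + 5) (f + 4),
      Load (f + 6) (f + 5), QNbr f (f + 5), Load (f + 7) (f + 5), Store (f + 5) (f + 6),
      Add e e (f + 7)])"

fun grows :: "nat \<Rightarrow> nat \<Rightarrow> nat \<Rightarrow> nat \<Rightarrow> 'v com" where
  "grows lb e f 0 = Blk []"
| "grows lb e f (Suc r) = grows lb e f r ;; grow lb e f"

text \<open>Sums must not count an element twice, whereas repeated neighbour queries list it many
  times. The clean list starts where the old one ends. \<open>M[f + 4]\<close> counts the
  occurrences of the current entry in the clean list and is then negated, so that an entry is
  appended only if it is new.\<close>

definition dedup :: "nat \<Rightarrow> nat \<Rightarrow> nat \<Rightarrow> nat \<Rightarrow> nat \<Rightarrow> 'v com" where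
  "dedup lb e lb' e' f =
     Blk [SetC lb' 0, Add lb' lb' e, SetC e' 0, Add e' e' e] ;;
     ForEach lb e f
       (Blk [SetC (f + 4) 0] ;;
        ForEach lb' e' (f + 5)
          (Blk [Sub (f + 9) f (f + 5), Sub (f + 10) (f + 5) f, Add (f + 9) (f + 9) (f + 10),
                SetC (f + 10) 1, Sub (f + 9) (f + 10) (f + 9), Add (f + 4) (f + 4) (f + 9)]) ;;
        Blk [SetC (f + 9) 1, Sub (f + 4) (f + 9) (f + 4)] ;;
        When (f + 4) (Blk [Store e' f, SetC (f + 9) 1, Add e' e' (f + 9)]))"

lemma nbhd_set_0: "nbhd_set A 0 X = X"
  by (auto simp: nbhd_set_def)

lemma nbhd_set_Suc: "nbhd_set A (Suc r) X = nbhd_set A r X \<union> gaifman A `` nbhd_set A r X"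
proof -
  have "(\<Union>m\<le>Suc r. (gaifman A ^^ m) `` X) = X \<union> (\<Union>m\<le>r. (gaifman A ^^ Suc m) `` X)"
    by (subst atMost_Suc_eq_insert_0) auto
  also have "\<dots> = X \<union> gaifman A `` nbhd_set A r X" by (auto simp: nbhd_set_def relcomp_Image)
  also have "\<dots> \<union> nbhd_set A r X = nbhd_set A r X \<union> gaifman A `` nbhd_set A r X"
    by (auto simp: nbhd_set_def intro: bexI[of _ 0])
  finally have "(\<Union>m\<le>Suc r. (gaifman A ^^ m) `` X) \<union> nbhd_set A r X =
    nbhd_set A r X \<union> gaifman A `` nbhd_set A r X" by (auto simp: Un_ac)
  moreover have "nbhd_set A r X \<subseteq> (\<Union>m\<le>Suc r. (gaifman A ^^ m) `` X)"
    by (force simp: nbhd_set_def)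
  ultimately show ?thesis unfolding nbhd_set_def[of A "Suc r"] by blast
qed

section \<open>Correctness of the list operations\<close>

context machine
begin

text \<open>One round of growth at the level of lists. Duplicates are kept, so each round multiplies
  the length by at most \<open>d + 1\<close>.\<close>

definition with_nbrs :: "nat list \<Rightarrow> nat list" where
  "with_nbrs xs = xs @ concat (map (ask_nbr orc) xs)"

lemma ensures_pushes:
  assumes "\<forall>a\<in>set as. a \<noteq> e \<and> a \<noteq> t \<and> a < M e" "e \<noteq> t" "e < M e" "t < M e"
  shows "ensures (Blk (pushes e t as)) M V (3 * length as)
    (\<lambda>M' V'. V' = V \<and> M' e = M e + length as \<and> hlist M' (M e) (map M as) \<and>
       (\<forall>j. j \<noteq> e \<and> j \<noteq> t \<and> (j < M e \<or> M e + length as \<le> j) \<longrightarrow> M' j = M j))"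
  using assms
proof (induction as arbitrary: M)
  case Nil
  then show ?case by (simp add: hlist_def)
next
  case (Cons a as)
  let ?M = "M(M e := M a, t := 1, e := Suc (M e))"
  have "ensures (Blk (pushes e t as)) ?M V (3 * length as)
    (\<lambda>M' V'. V' = V \<and> M' e = M e + length (a # as) \<and> hlist M' (M e) (map M (a # as)) \<and>
       (\<forall>j. j \<noteq> e \<and> j \<noteq> t \<and> (j < M e \<or> M e + length (a # as) \<le> j) \<longrightarrow> M' j = M j))"
  proof (rule ensures_mono[OF Cons.IH order_refl])
    fix M' V' assume *: "V' = V \<and> M' e = ?M e + length as \<and> hlist M' (?M e) (map ?M as) \<and>
      (\<forall>j. j \<noteq> e \<and> j \<noteq> t \<and> (j < ?M e \<or> ?M e + length as \<le> j) \<longrightarrow> M' j = ?M j)"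
    have eq: "map ?M as = map M as" using Cons.prems by auto
    have "hlist M' (M e) [M a]" using * Cons.prems by (auto simp: hlist_def)
    then have "hlist M' (M e) (map M (a # as))"
      using * hlist_append[of M' "M e" "[M a]" "map M as"] unfolding eq by simp
    then show "V' = V \<and> M' e = M e + length (a # as) \<and> hlist M' (M e) (map M (a # as)) \<and>
       (\<forall>j. j \<noteq> e \<and> j \<noteq> t \<and> (j < M e \<or> M e + length (a # as) \<le> j) \<longrightarrow> M' j = M j)"
      using * by auto
  qed (use Cons.prems in auto)
  then show ?case using Cons.prems by (simp add: fun_upd_twist)
qed

lemma ensures_grow:
  assumes "lb < f" "e < f" "lb \<noteq> e" "f + 8 \<le> b" "M lb = b" "M e = b + length xs" "hlist M b xs"
    and "set xs \<subseteq> {..<n}"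
  shows "ensures (grow lb e f) M V (17 * length xs + 6)
    (\<lambda>M' V'. V' = V \<and> M' e = b + length (with_nbrs xs) \<and> hlist M' b (with_nbrs xs) \<and>
       (\<forall>j<b. j \<noteq> e \<and> j \<notin> {f..<f + 8} \<longrightarrow> M' j = M j))"
proof -
  let ?ys = "\<lambda>i. xs @ concat (map (ask_nbr orc) (take i xs))"
  let ?Inv = "\<lambda>i M' V'. V' = V \<and> M' e = b + length (?ys i) \<and> hlist M' b (?ys i) \<and>
       (\<forall>j<b. j \<noteq> e \<and> j \<notin> {f..<f + 8} \<longrightarrow> M' j = M j)"
  have "ensures (grow lb e f) M V (length xs * (9 + 8) + 6) (?Inv (length xs))"
    unfolding grow_def
  proof (rule ensures_ForEach)
    show "?Inv i M' V1" if I: "?Inv i M1 V1" and eq: "\<forall>j. j \<notin> {f..f+3} \<longrightarrow> M' j = M1 j" for i M1 V1 M'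
    proof -
      have "M' e = M1 e" using eq assms(2) by auto
      moreover have "hlist M' b (?ys i)"
        by (rule hlist_cong[of M1]) (use I eq assms(4) in auto)
      moreover have "M' j = M j" if "j < b" "j \<noteq> e" "j \<notin> {f..<f + 8}" for j
        using that I eq by auto
      ultimately show ?thesis using I by auto
    qed
    show "hlist M1 b xs" if "?Inv i M1 V1" for i M1 V1 using that by (simp add: hlist_append)
    fix i M1 V1 assume i: "i < length xs" and I: "?Inv i M1 V1" and x: "M1 f = xs ! i"
    define ns where "ns = ask_nbr orc (xs ! i)"
    define E where "E = b + length (?ys i)"
    \<comment> \<open>Inside the loop the list is non-empty, so the cell \<open>E - 1\<close> to
      which the query is directed belongs to the list and lies behind all registers.\<close>
    have E: "M1 e = E" "b < E" using I i by (auto simp: E_def)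
    have xn: "xs ! i < n" using assms(8) i nth_mem by blast
    define M2 where "M2 = M1(f + 4 := 1, f + 5 := E - 1, f + 6 := M1 (E - 1))"
    define M3 where "M3 = write_list (E - 1) (length ns # ns) M2"
    define M4 where "M4 = M3(f + 7 := length ns, E - 1 := M1 (E - 1), e := E + length ns)"
    have M3: "M3 j = M2 j" if "j < b" for j using that E by (auto simp: M3_def write_list_def)
    have M3': "M3 (E - 1) = length ns" by (simp add: M3_def write_list_def)
    have M3'': "M3 (E + j) = ns ! j" if "j < length ns" for j
      using that E by (auto simp: M3_def write_list_def)
    have b': "E - 1 \<noteq> f + 4" "E - 1 \<noteq> f + 5" "E - 1 \<noteq> f + 6" "E - 1 \<noteq> f + 7" "E - 1 \<noteq> e" "E - 1 \<noteq> f"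
      using E assms by auto
    have run: "ensures (Blk [SetC (f + 4) 1, SetC (f + 5) 0, Add (f + 5) (f + 5) e, Sub (f + 5) (f + 5) (f + 4),
      Load (f + 6) (f + 5), QNbr f (f + 5), Load (f + 7) (f + 5), Store (f + 5) (f + 6),
      Add e e (f + 7)]) M1 V1 9 (\<lambda>M' V'. M' = M4 \<and> V' = V1)"
    proof -
      have ef: "e \<noteq> f + 4" "e \<noteq> f + 5" "e \<noteq> f + 6" "e \<noteq> f + 7" "e \<noteq> f" using assms by auto
      have fb: "f < b" "f + 4 < b" "f + 5 < b" "f + 6 < b" "f + 7 < b" "e < b" using assms by auto
      let ?M5 = "M1(f + 4 := 1, f + 5 := E)"
      let ?M6 = "M1(f + 4 := 1, f + 5 := E - 1)"
      have M2: "M2 f = xs ! i" "M2 (f + 5) = E - 1" "M2 e = E" "M2 (f + 6) = M1 (E - 1)"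
        using x ef E by (auto simp: M2_def)
      then have M3f: "M3 (f + 5) = E - 1" "M3 e = E" "M3 (f + 6) = M1 (E - 1)"
        using M3 fb by auto
      have 1: "eff (SetC (f + 4) 1) M1 V1 = (M1(f + 4 := 1), V1)"
        and 2: "eff (SetC (f + 5) 0) (M1(f + 4 := 1)) V1 = (M1(f + 4 := 1, f + 5 := 0), V1)"
        and 3: "eff (Add (f + 5) (f + 5) e) (M1(f + 4 := 1, f + 5 := 0)) V1 = (?M5, V1)"
        and 4: "eff (Sub (f + 5) (f + 5) (f + 4)) ?M5 V1 = (?M6, V1)"
        and 5: "eff (Load (f + 6) (f + 5)) ?M6 V1 = (M2, V1)"
        using ef E b' by (simp_all add: M2_def)
      have 6: "eff (QNbr f (f + 5)) M2 V1 = (M3, V1)"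
        unfolding eff_simps M2 M3_def ns_def ..
      have 7: "eff (Load (f + 7) (f + 5)) M3 V1 = (M3(f + 7 := length ns), V1)"
        unfolding eff_simps M3f M3' ..
      have 8: "eff (Store (f + 5) (f + 6)) (M3(f + 7 := length ns)) V1 = (M3(f + 7 := length ns, E - 1 := M1 (E - 1)), V1)"
        using M3f by simp
      have 9: "eff (Add e e (f + 7)) (M3(f + 7 := length ns, E - 1 := M1 (E - 1))) V1 = (M4, V1)"
        using M3f ef b' by (simp add: M4_def)
      have sf: "safe (QNbr f (f + 5)) M2" using M2(1) xn by simp
      show ?thesis
        unfolding ensures_Cons 1 2 3 4 5 6 7 8 9 prod.case ensures_Nil using sf by simp
    qed
    show "ensures (Blk [SetC (f + 4) 1, SetC (f + 5) 0, Add (f + 5) (f + 5) e, Sub (f + 5) (f + 5) (f + 4),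
      Load (f + 6) (f + 5), QNbr f (f + 5), Load (f + 7) (f + 5), Store (f + 5) (f + 6),
      Add e e (f + 7)]) M1 V1 9
      (\<lambda>M' V'. M' (f + 1) = M1 (f + 1) \<and> M' (f + 2) = M1 (f + 2) \<and> ?Inv (Suc i) M' V')"
    proof (rule ensures_mono[OF run order_refl])
      fix M' V' assume "M' = M4 \<and> V' = V1"
      have low: "M4 j = M1 j" if "j < b" "j \<notin> {f + 4..<f + 8}" "j \<noteq> e" for j
        using that E M3[of j] by (auto simp: M4_def M2_def)
      have M4E: "M4 j = M1 j" if "b \<le> j" "j < E" for j
        using that E assms(1-4) by (auto simp: M4_def M3_def M2_def write_list_def)
      have "hlist M4 b (?ys i)" by (rule hlist_cong[of M1]) (use I M4E in \<open>auto simp: E_def\<close>)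
      moreover have "hlist M4 E ns"
        unfolding hlist_def using M3'' E assms(1-4) by (auto simp: M4_def)
      moreover have "?ys (Suc i) = ?ys i @ ns" using i by (simp add: take_Suc_conv_app_nth ns_def)
      ultimately have "hlist M4 b (?ys (Suc i))" "M4 e = b + length (?ys (Suc i))"
        by (simp_all only: hlist_append E_def) (simp_all add: M4_def E_def)
      moreover have "M4 j = M j" if "j < b" "j \<noteq> e" "j \<notin> {f..<f + 8}" for j
        using that I low[of j] by auto
      moreover have "M4 (f + 1) = M1 (f + 1)" "M4 (f + 2) = M1 (f + 2)"
        using low[of "f + 1"] low[of "f + 2"] assms by auto
      ultimately show "M' (f + 1) = M1 (f + 1) \<and> M' (f + 2) = M1 (f + 2) \<and> ?Inv (Suc i) M' V'"
        using \<open>M' = M4 \<and> V' = V1\<close> I by auto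
    qed
  qed (use assms in \<open>auto\<close>)
  then show ?thesis by (rule ensures_mono) (auto simp: with_nbrs_def)
qed

lemma with_nbrs_length: "set xs \<subseteq> {..<n} \<Longrightarrow> length (with_nbrs xs) \<le> length xs * (d + 1)"
proof -
  assume "set xs \<subseteq> {..<n}"
  then have "sum_list (map (length \<circ> ask_nbr orc) xs) \<le> length xs * d"
    using nbr_length by (intro sum_list_le_length) auto
  then show ?thesis by (simp add: with_nbrs_def length_concat)
qed

lemma with_nbrs_valid: "set xs \<subseteq> {..<n} \<Longrightarrow> set (with_nbrs xs) \<subseteq> {..<n}"
  using nbr_set by (fastforce simp: with_nbrs_def)

lemma funpow_with_nbrs:
  assumes "set xs \<subseteq> {..<n}"
  shows "set ((with_nbrs ^^ r) xs) \<subseteq> {..<n}" "length ((with_nbrs ^^ r) xs) \<le> length xs * (d + 1) ^ r"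
proof (induction r)
  case (Suc r)
  {
    case 1
    show ?case using with_nbrs_valid[OF Suc(1)] by simp
  next
    case 2
    have "length ((with_nbrs ^^ Suc r) xs) \<le> length ((with_nbrs ^^ r) xs) * (d + 1)"
      using with_nbrs_length[OF Suc(1)] by simp
    also have "\<dots> \<le> length xs * (d + 1) ^ r * (d + 1)" using Suc(2) by (rule mult_le_mono1)
    finally show ?case by (simp add: algebra_simps)
  }
qed (use assms in auto)

lemma ensures_grows:
  assumes "lb < f" "e < f" "lb \<noteq> e" "f + 8 \<le> b" "M lb = b" "M e = b + length xs" "hlist M b xs"
    and "set xs \<subseteq> {..<n}" "length xs * (d + 1) ^ r \<le> L"
  shows "ensures (grows lb e f r) M V (r * (17 * L + 6))
    (\<lambda>M' V'. V' = V \<and> M' e = b + length ((with_nbrs ^^ r) xs) \<and> hlist M' b ((with_nbrs ^^ r) xs) \<and>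
       (\<forall>j<b. j \<noteq> e \<and> j \<notin> {f..<f + 8} \<longrightarrow> M' j = M j))"
  using assms(9)
proof (induction r)
  case (Suc r)
  have L: "length xs * (d + 1) ^ r \<le> L"
  proof -
    have "length xs * (d + 1) ^ r \<le> length xs * (d + 1) ^ Suc r" by simp
    then show ?thesis using Suc.prems by linarith
  qed
  show ?case unfolding grows.simps
  proof (rule ensures_seq[OF ensures_mono[OF Suc.IH[OF L] order_refl]])
    fix M1 V1 assume 1: "V1 = V \<and> M1 e = b + length ((with_nbrs ^^ r) xs) \<and> hlist M1 b ((with_nbrs ^^ r) xs) \<and>
       (\<forall>j<b. j \<noteq> e \<and> j \<notin> {f..<f + 8} \<longrightarrow> M1 j = M j)"
    have lb: "M1 lb = b" using 1 assms(1-5) by simp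
    have len: "17 * length ((with_nbrs ^^ r) xs) + 6 \<le> 17 * L + 6"
      using funpow_with_nbrs(2)[OF assms(8), of r] L by linarith
    show "ensures (grow lb e f) M1 V1 (17 * L + 6)
      (\<lambda>M' V'. V' = V \<and> M' e = b + length ((with_nbrs ^^ Suc r) xs) \<and> hlist M' b ((with_nbrs ^^ Suc r) xs) \<and>
       (\<forall>j<b. j \<noteq> e \<and> j \<notin> {f..<f + 8} \<longrightarrow> M' j = M j))"
      by (rule ensures_mono[OF ensures_grow[where b = b and xs = "(with_nbrs ^^ r) xs"] len])
        (use assms(1-4) 1 lb funpow_with_nbrs(1)[OF assms(8), of r] in auto)
  qed simp
qed (use assms in simp)

lemma ensures_dedup:
  assumes "lb < f" "e < f" "lb' < f" "e' < f" "distinct [lb, e, lb', e']" "f + 11 \<le> b"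
    and "M lb = b" "M e = b + length xs" "hlist M b xs"
  shows "ensures (dedup lb e lb' e' f) M V (length xs * (14 * length xs + 22) + 10)
    (\<lambda>M' V'. V' = V \<and> (\<exists>ys. distinct ys \<and> set ys = set xs \<and> length ys \<le> length xs \<and>
       M' lb' = b + length xs \<and> M' e' = b + length xs + length ys \<and> hlist M' (b + length xs) ys) \<and>
       (\<forall>j<b + length xs. j \<noteq> lb' \<and> j \<noteq> e' \<and> j \<notin> {f..<f + 11} \<longrightarrow> M' j = M j))"
proof -
  define B where "B = b + length xs"
  define K where "K = {lb', e'} \<union> {f..<f + 11}"
  let ?Inv = "\<lambda>i M1 V1. V1 = V \<and> (\<exists>ys. distinct ys \<and> set ys = set (take i xs) \<and> length ys \<le> i \<and>
       M1 lb' = B \<and> M1 e' = B + length ys \<and> hlist M1 B ys) \<and> (\<forall>j<B. j \<notin> K \<longrightarrow> M1 j = M j)"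
  define test :: "'v com" where "test = Blk [Sub (f + 9) f (f + 5), Sub (f + 10) (f + 5) f, Add (f + 9) (f + 9) (f + 10),
                SetC (f + 10) 1, Sub (f + 9) (f + 10) (f + 9), Add (f + 4) (f + 4) (f + 9)]"
  define body where "body = Blk [SetC (f + 4) 0] ;; ForEach lb' e' (f + 5) test ;;
        Blk [SetC (f + 9) 1, Sub (f + 4) (f + 9) (f + 4)] ;;
        When (f + 4) (Blk [Store e' f, SetC (f + 9) 1, Add e' e' (f + 9)])"
  have "ensures (ForEach lb e f body) (M(lb' := B, e' := B)) V (length xs * (14 * length xs + 14 + 8) + 6) (?Inv (length xs))"
  proof (rule ensures_ForEach[where b = b])
    show "?Inv i M' V1" if I: "?Inv i M1 V1" and eq: "\<forall>j. j \<notin> {f..f+3} \<longrightarrow> M' j = M1 j" for i M1 V1 M'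
    proof -
      have "hlist M' B ys" if "hlist M1 B ys" for ys
        by (rule hlist_cong[OF that]) (use eq assms(6) in \<open>auto simp: B_def\<close>)
      moreover have "M' lb' = M1 lb'" "M' e' = M1 e'" using eq assms(3,4) by auto
      moreover have "M' j = M j" if "j < B" "j \<notin> K" for j using that I eq by (auto simp: K_def)
      ultimately show ?thesis using I by metis
    qed
    show "hlist M1 b xs" if "?Inv i M1 V1" for i M1 V1
      by (rule hlist_cong[OF assms(9)]) (use that assms(3,4,6) in \<open>auto simp: B_def K_def\<close>)
    fix i M1 V1 assume i: "i < length xs" and I: "?Inv i M1 V1" and x: "M1 f = xs ! i"
    obtain ys where ys: "distinct ys" "set ys = set (take i xs)" "length ys \<le> i"
       "M1 lb' = B" "M1 e' = B + length ys" "hlist M1 B ys" using I by blast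
    have fB: "f + 10 < B" using assms(6) by (simp add: B_def)
    \<comment> \<open>The inner loop counts the positions before \<open>k\<close> of the clean list
      that hold the current entry; the entry is new iff the final count is 0.\<close>
    let ?J = "\<lambda>k M2 V2. V2 = V \<and> M2 (f + 4) = card {p. p < k \<and> ys ! p = xs ! i} \<and>
      (\<forall>j. j \<noteq> f + 4 \<and> j \<notin> {f + 5..f + 10} \<longrightarrow> M2 j = M1 j)"
    have loop: "ensures (ForEach lb' e' (f + 5) test) (M1(f + 4 := 0)) V (length ys * (6 + 8) + 6) (?J (length ys))"
    proof (rule ensures_ForEach[where b = B])
      show "?J k M' V2" if "?J k M2 V2" "\<forall>j. j \<notin> {f + 5..f + 5 + 3} \<longrightarrow> M' j = M2 j" for k M2 V2 M'
        using that by auto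
      show "hlist M2 B ys" if "?J k M2 V2" for k M2 V2
        by (rule hlist_cong[OF ys(6)]) (use that fB in auto)
      fix k M2 V2 assume k: "k < length ys" and J: "?J k M2 V2" and y: "M2 (f + 5) = ys ! k"
      have f: "M2 f = xs ! i" using J x by auto
      have "{p. p < Suc k \<and> ys ! p = xs ! i} =
        (if ys ! k = xs ! i then insert k {p. p < k \<and> ys ! p = xs ! i} else {p. p < k \<and> ys ! p = xs ! i})"
        by (auto simp: less_Suc_eq)
      then have "card {p. p < Suc k \<and> ys ! p = xs ! i} = card {p. p < k \<and> ys ! p = xs ! i} + of_bool (ys ! k = xs ! i)"
        by auto
      moreover have "Suc 0 - ((xs ! i - ys ! k) + (ys ! k - xs ! i)) = of_bool (ys ! k = xs ! i)"
        by auto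
      ultimately show "ensures test M2 V2 6 (\<lambda>M' V'. M' (f + 5 + 1) = M2 (f + 5 + 1) \<and> M' (f + 5 + 2) = M2 (f + 5 + 2) \<and> ?J (Suc k) M' V')"
        using J f y by (simp add: test_def)
    qed (use assms ys in auto)
    show "ensures body M1 V1 (14 * length xs + 14)
      (\<lambda>M' V'. M' (f + 1) = M1 (f + 1) \<and> M' (f + 2) = M1 (f + 2) \<and> ?Inv (Suc i) M' V')"
    proof -
      let ?Q = "\<lambda>M' V'. M' (f + 1) = M1 (f + 1) \<and> M' (f + 2) = M1 (f + 2) \<and> ?Inv (Suc i) M' V'"
      have fin: "ensures (Blk [SetC (f + 9) 1, Sub (f + 4) (f + 9) (f + 4)] ;;
        When (f + 4) (Blk [Store e' f, SetC (f + 9) 1, Add e' e' (f + 9)])) M2 V2 6 ?Q"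
        if J: "?J (length ys) M2 V2" for M2 V2
      proof -
        let ?c = "card {p. p < length ys \<and> ys ! p = xs ! i}"
        define Mz where "Mz = M2(f + 9 := 1, f + 4 := 1 - ?c)"
        have "{p. p < length ys \<and> ys ! p = xs ! i} = {} \<longleftrightarrow> xs ! i \<notin> set ys"
          by (auto simp: in_set_conv_nth)
        moreover have "finite {p. p < length ys \<and> ys ! p = xs ! i}" by simp
        ultimately have c: "?c = 0 \<longleftrightarrow> xs ! i \<notin> set ys" by (metis card_eq_0_iff)
        have M: "Mz lb' = B" "Mz e' = B + length ys" "Mz f = xs ! i" "Mz (f+1) = M1 (f+1)" "Mz (f+2) = M1 (f+2)"
          using J ys x assms(3,4) by (auto simp: Mz_def)
        have hl: "hlist Mz B ys" by (rule hlist_cong[OF ys(6)]) (use J fB in \<open>auto simp: Mz_def\<close>)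
        have fr: "Mz j = M j" if "j < B" "j \<notin> K" for j
        proof -
          have "j \<noteq> f + 9" "j \<noteq> f + 4" "j \<notin> {f + 5..f + 10}" using that(2) by (auto simp: K_def)
          then show ?thesis using J I that by (simp add: Mz_def)
        qed
        have "ensures (When (f + 4) (Blk [Store e' f, SetC (f + 9) 1, Add e' e' (f + 9)])) Mz V2 4 ?Q"
        proof (rule ensures_When[where N = 3])
          assume "Mz (f + 4) = 0"
          then have "1 - ?c = 0" by (simp add: Mz_def)
          then have "?c \<noteq> 0" by linarith
          then have "xs ! i \<in> set ys" using c by metis
          then have "set ys = set (take (Suc i) xs)" using ys(2) i by (auto simp: take_Suc_conv_app_nth)
          then have "\<exists>ys. distinct ys \<and> set ys = set (take (Suc i) xs) \<and> length ys \<le> Suc i \<and>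
            Mz lb' = B \<and> Mz e' = B + length ys \<and> hlist Mz B ys"
            using M hl ys by (intro exI[of _ ys]) simp
          then show "?Q Mz V2" using M fr J by blast
        next
          assume "Mz (f + 4) \<noteq> 0"
          then have "1 - ?c \<noteq> 0" by (simp add: Mz_def)
          then have "?c = 0" by linarith
          then have nin: "xs ! i \<notin> set ys" using c by metis
          let ?M' = "Mz(B + length ys := xs ! i, f + 9 := 1, e' := Suc (B + length ys))"
          have ne: "B + length ys \<noteq> e'" "B + length ys \<noteq> lb'" "B + length ys \<noteq> f + 9" "B + length ys \<noteq> f + 4"
             "B + length ys \<noteq> f + 1" "B + length ys \<noteq> f + 2" "lb' \<noteq> e'" "lb' \<noteq> f + 9" "e' \<noteq> f + 9" "e' \<noteq> f" "e' \<noteq> f + 1" "e' \<noteq> f + 2"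
            using assms(1-6) by (auto simp: B_def)
          have "hlist ?M' B ys" by (rule hlist_cong[OF hl]) (use fB ne assms(3,4) in auto)
          moreover have "hlist ?M' (B + length ys) [xs ! i]" using ne by (simp add: hlist_def)
          ultimately have "hlist ?M' B (ys @ [xs ! i])" by (simp add: hlist_append)
          moreover have "?M' lb' = B" using M ne by simp
          ultimately have "\<exists>ys. distinct ys \<and> set ys = set (take (Suc i) xs) \<and> length ys \<le> Suc i \<and>
            ?M' lb' = B \<and> ?M' e' = B + length ys \<and> hlist ?M' B ys"
            using ys nin i by (intro exI[of _ "ys @ [xs ! i]"]) (auto simp: take_Suc_conv_app_nth)
          moreover have "?M' j = M j" if "j < B" "j \<notin> K" for j
            using fr[OF that] that by (auto simp: K_def)
          moreover have "?M' (f + 1) = M1 (f + 1)" "?M' (f + 2) = M1 (f + 2)"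
            using M(4,5) ne by auto
          ultimately have q: "?Q ?M' V2" using J by blast
          have "eff (Store e' f) Mz V2 = (Mz(B + length ys := xs ! i), V2)" using M by simp
          moreover have "eff (Add e' e' (f + 9)) (Mz(B + length ys := xs ! i, f + 9 := 1)) V2 = (?M', V2)"
            using M ne by simp
          moreover have "eff (SetC (f + 9) 1) (Mz(B + length ys := xs ! i)) V2 = (Mz(B + length ys := xs ! i, f + 9 := 1), V2)"
            by simp
          ultimately show "ensures (Blk [Store e' f, SetC (f + 9) 1, Add e' e' (f + 9)]) Mz V2 3 ?Q"
            unfolding ensures_Cons using q by (simp only: safe.simps ensures_Nil prod.case) simp
        qed simp
        then show ?thesis
          by (intro ensures_seq[where ?N1.0 = 2 and ?N2.0 = 4]) (use J in \<open>simp_all add: Mz_def\<close>)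
      qed
      have V1: "V1 = V" using I by simp
      have "ensures body M1 V (1 + ((length ys * (6 + 8) + 6) + 6)) ?Q"
        unfolding body_def
      proof (rule ensures_seq[where ?N1.0 = 1, OF _ order_refl])
        have "ensures (ForEach lb' e' (f + 5) test ;; Blk [SetC (f + 9) 1, Sub (f + 4) (f + 9) (f + 4)] ;;
          When (f + 4) (Blk [Store e' f, SetC (f + 9) 1, Add e' e' (f + 9)])) (M1(f + 4 := 0)) V ((length ys * (6 + 8) + 6) + 6) ?Q"
          by (rule ensures_seq[OF ensures_mono[OF loop order_refl fin] order_refl])
        then show "ensures (Blk [SetC (f + 4) 0]) M1 V 1 (\<lambda>M' V'. ensures (ForEach lb' e' (f + 5) test ;; Blk [SetC (f + 9) 1, Sub (f + 4) (f + 9) (f + 4)] ;;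
          When (f + 4) (Blk [Store e' f, SetC (f + 9) 1, Add e' e' (f + 9)])) M' V' ((length ys * (6 + 8) + 6) + 6) ?Q)"
          by simp
      qed
      then show ?thesis unfolding V1 by (rule ensures_mono) (use ys(3) i in auto)
    qed
  qed (use assms in \<open>auto simp: B_def hlist_def K_def\<close>)
  note loop = this
  have eq: "M(lb' := 0, lb' := B, e' := 0, e' := B) = M(lb' := B, e' := B)" by simp
  show ?thesis unfolding dedup_def test_def[symmetric] body_def[symmetric]
  proof (rule ensures_seq[where ?N1.0 = 4])
    show "ensures (Blk [SetC lb' 0, Add lb' lb' e, SetC e' 0, Add e' e' e]) M V 4
      (\<lambda>M' V'. ensures (ForEach lb e f body) M' V' (length xs * (14 * length xs + 14 + 8) + 6)
      (\<lambda>M' V'. V' = V \<and> (\<exists>ys. distinct ys \<and> set ys = set xs \<and> length ys \<le> length xs \<and>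
       M' lb' = b + length xs \<and> M' e' = b + length xs + length ys \<and> hlist M' (b + length xs) ys) \<and>
       (\<forall>j<b + length xs. j \<noteq> lb' \<and> j \<noteq> e' \<and> j \<notin> {f..<f + 11} \<longrightarrow> M' j = M j)))"
      using ensures_mono[OF loop order_refl] assms(5,8) eq
      by (simp add: B_def K_def) 
  qed simp
qed

end

text \<open>The register \<open>hp\<close> points to free memory. Listing starts there with the
  values of the free variables, grows by \<open>r\<close> rounds of queries and is cleaned. The
  cells \<open>f\<close> and \<open>f + 1\<close> delimit the raw list, \<open>f + 2\<close> and
  \<open>f + 3\<close> the clean one.\<close>

definition eval_at ::
  "'v vocab \<Rightarrow> nat \<Rightarrow> (nat \<Rightarrow> nat) \<Rightarrow> nat \<Rightarrow> nat \<Rightarrow> 'v fml \<Rightarrow> 'v com" where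
  "eval_at C r \<rho> hp f \<phi> =
     Blk [SetC f 0, Add f f hp, SetC (f + 1) 0, Add (f + 1) (f + 1) hp] ;;
     Blk (pushes (f + 1) (f + 4) (map \<rho> (sorted_list_of_set (free \<phi>)))) ;;
     grows f (f + 1) (f + 4) r ;;
     dedup f (f + 1) (f + 2) (f + 3) (f + 4) ;;
     eval_fml C (f + 2) (f + 3) \<rho> (f + 4) 0 \<phi>"

text \<open>\<open>L\<close> bounds the length of the list after \<open>r\<close> rounds of growth.
  The size of the universe does not occur, which is what makes sublinear learning possible.\<close>

definition at_steps :: "nat \<Rightarrow> nat \<Rightarrow> 'v fml \<Rightarrow> nat" where
  "at_steps d r \<phi> =
     (let L = card (free \<phi>) * (d + 1) ^ r in
      4 + 3 * card (free \<phi>) + r * (17 * L + 6) + (L * (14 * L + 22) + 10) + eval_steps L \<phi>)"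

lemma tup_steps_mono: "L \<le> L' \<Longrightarrow> N \<le> N' \<Longrightarrow> tup_steps L N m \<le> tup_steps L' N' m"
  by (induction m) (auto intro!: mult_le_mono)

lemma eval_steps_mono: "L \<le> L' \<Longrightarrow> eval_steps L \<phi> \<le> eval_steps L' \<phi>"
proof (induction \<phi> rule: measure_induct_rule[where f = size])
  case (less \<phi>)
  show ?case
  proof (cases \<phi>)
    case (Neg \<psi>) then show ?thesis using less by simp
  next
    case (Or \<phi>1 \<phi>2)
    have "eval_steps L \<phi>1 \<le> eval_steps L' \<phi>1" "eval_steps L \<phi>2 \<le> eval_steps L' \<phi>2"
      using less Or by auto
    then show ?thesis using Or by simp
  next
    case (Ex y \<psi>)
    have "eval_steps L \<psi> \<le> eval_steps L' \<psi>" using less Ex by simp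
    then show ?thesis using Ex less.prems by (simp add: mult_le_mono)
  next
    case (WSum s w ys \<psi>)
    have "eval_steps L \<psi> \<le> eval_steps L' \<psi>" using less WSum by simp
    then show ?thesis using WSum less.prems by (simp add: tup_steps_mono)
  qed simp_all
qed

lemma
  fixes \<phi> :: "'v fml" and t :: "'v trm"
  shows free_finite: "finite (free \<phi>)" and free_trm_finite: "finite (free_trm t)"
  by (induction \<phi> and t) auto

section \<open>Well-formedness of the programs\<close>

definition wf_com :: "'v vocab \<Rightarrow> signature \<Rightarrow> 'v com \<Rightarrow> bool" where
  "wf_com C \<sigma> c \<longleftrightarrow> (\<forall>i\<in>instrs c. wf_instr C \<sigma> i)"

lemma wf_com_simps [simp]:
  "wf_com C \<sigma> (Blk is) \<longleftrightarrow> (\<forall>i\<in>set is. wf_instr C \<sigma> i)"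
  "wf_com C \<sigma> (c1 ;; c2) \<longleftrightarrow> wf_com C \<sigma> c1 \<and> wf_com C \<sigma> c2"
  "wf_com C \<sigma> (When a c) \<longleftrightarrow> wf_com C \<sigma> c"
  "wf_com C \<sigma> (Until a c) \<longleftrightarrow> wf_com C \<sigma> c"
  by (auto simp: wf_com_def)

lemma wf_com_loops [simp]:
  "wf_com C \<sigma> (For a b c) \<longleftrightarrow> wf_com C \<sigma> c"
  "wf_com C \<sigma> (ForEach lb e f c) \<longleftrightarrow> wf_com C \<sigma> c"
  "wf_com C \<sigma> (ForTup lb e f m c) \<longleftrightarrow> wf_com C \<sigma> c"
proof -
  show F: "wf_com C \<sigma> (For a b c) \<longleftrightarrow> wf_com C \<sigma> c" for a b c by (auto simp: For_def)
  show E: "wf_com C \<sigma> (ForEach lb e f c) \<longleftrightarrow> wf_com C \<sigma> c" for f c by (auto simp: ForEach_def F)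
  show "wf_com C \<sigma> (ForTup lb e f m c) \<longleftrightarrow> wf_com C \<sigma> c"
    by (induction m arbitrary: f) (auto simp: E)
qed

lemma wf_copies: "i \<in> set (copies f as) \<Longrightarrow> wf_instr C \<sigma> i"
  by (induction as arbitrary: f) auto

lemma wf_pushes: "i \<in> set (pushes e t as) \<Longrightarrow> wf_instr C \<sigma> i"
  by (induction as) auto

lemma wf_grows [simp]: "wf_com C \<sigma> (grows lb e f r)"
  by (induction r) (auto simp: grow_def)

lemma wf_dedup [simp]: "wf_com C \<sigma> (dedup lb e lb' e' f)"
  by (simp add: dedup_def)

lemma ttype_idx:
  assumes "valid_vocab C" "wa1_trm C \<sigma> t"
  shows "ttype C t \<in> idx C"
  using assms(2)
proof (induction t rule: measure_induct_rule[where f = size])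
  case (less t)
  show ?case
  proof (cases t)
    case (Wgt w xs)
    then show ?thesis using less.prems assms(1) by (auto simp: wgt_atom_def valid_vocab_def)
  qed (use less in \<open>auto simp: is_wprod_def\<close>)
qed

lemma wf_eval_trm:
  assumes "valid_vocab C" "wa1_trm C \<sigma> t"
  shows "wf_com C \<sigma> (eval_trm C \<rho> f g t)"
  using assms(2)
proof (induction t arbitrary: g rule: measure_induct_rule[where f = size])
  case (less t)
  show ?case
  proof (cases t)
    case (Wgt w xs)
    then show ?thesis using less.prems by (auto simp: wgt_atom_def wf_copies)
  qed (use less ttype_idx[OF assms(1)] in auto)
qed

lemma wf_eval_trms:
  assumes "valid_vocab C" "\<forall>t\<in>set ts. wa1_trm C \<sigma> t"
  shows "wf_com C \<sigma> (eval_trms C \<rho> f g ts)"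
  using assms(2) by (induction ts arbitrary: g) (auto simp: wf_eval_trm[OF assms(1)])

lemma wf_eval_fml:
  assumes "valid_vocab C" "wa1 C \<sigma> \<phi>"
  shows "wf_com C \<sigma> (eval_fml C lb e \<rho> f g \<phi>)"
  using assms(2)
proof (induction \<phi> arbitrary: \<rho> f g rule: measure_induct_rule[where f = size])
  case (less \<phi>)
  show ?case
  proof (cases \<phi>)
    case (Pred P ts)
    then show ?thesis using less.prems wf_eval_trms[OF assms(1)] by auto
  next
    case (WSum s w ys \<psi>)
    then have "w \<in> dom (wsig C)" using less.prems by (auto simp: wgt_atom_def)
    then have "wtype C w \<in> idx C" "w \<in> dom (wsig C)" using assms(1) by (auto simp: valid_vocab_def)
    then show ?thesis using less WSum by (auto simp: Let_def wf_copies)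
  qed (use less in \<open>auto simp: wgt_atom_def wf_copies\<close>)
qed

lemma wf_eval_at:
  "valid_vocab C \<Longrightarrow> wa1 C \<sigma> \<phi> \<Longrightarrow> wf_com C \<sigma> (eval_at C r \<rho> hp f \<phi>)"
  by (auto simp: eval_at_def wf_eval_fml wf_pushes)

section \<open>Evaluation of local formulas\<close>

lemma structure_rel:
  assumes "is_structure C \<sigma> A" "t \<in> rel A R"
  obtains m where "\<sigma> R = Some m" "t \<in> tuples (univ A) m"
proof -
  have "rel A R \<subseteq> (case \<sigma> R of None \<Rightarrow> {} | Some m \<Rightarrow> tuples (univ A) m)"
    using assms(1) unfolding is_structure_def by blast
  then show thesis using assms(2) that by (cases "\<sigma> R") auto
qed

lemma gaifman_univ:
  assumes "is_structure C \<sigma> A" "(a, b) \<in> gaifman A"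
  shows "a \<in> univ A \<and> b \<in> univ A"
proof -
  obtain R t where "t \<in> rel A R" "a \<in> set t" "b \<in> set t" using assms(2) by (auto simp: gaifman_def)
  moreover obtain m where "t \<in> tuples (univ A) m"
    by (rule structure_rel[OF assms(1) \<open>t \<in> rel A R\<close>])
  ultimately show ?thesis by (auto simp: tuples_def)
qed

lemma nbhd_set_univ: "is_structure C \<sigma> A \<Longrightarrow> X \<subseteq> univ A \<Longrightarrow> nbhd_set A r X \<subseteq> univ A"
  by (induction r) (auto simp: nbhd_set_0 nbhd_set_Suc dest: gaifman_univ)

locale structure_access =
  fixes C :: "'v vocab" and \<sigma> :: signature and orc :: "'v answers" and A :: "'v wstruct"
    and code :: "nat \<Rightarrow> nat" and d :: nat
  assumes vocab: "valid_vocab C" and struct: "is_structure C \<sigma> A"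
    and access: "local_access C \<sigma> A code orc"
    and degree: "a \<in> univ A \<Longrightarrow> card (gaifman A `` {a}) \<le> d"
begin

lemma code_inj: "inj_on code (univ A)" and code_image: "code ` univ A = {..<card (univ A)}"
  using access by (auto simp: local_access_def bij_betw_def)

lemma nbr:
  "a \<in> univ A \<Longrightarrow> distinct (ask_nbr orc (code a)) \<and> set (ask_nbr orc (code a)) = code ` (gaifman A `` {a})"
  using access by (auto simp: local_access_def)

end

text \<open>Numbers below the size of the universe are exactly the codes, and a duplicate-free
  answer is as long as the number of neighbours since \<open>code\<close> is injective.\<close>

sublocale structure_access \<subseteq> machine C \<sigma> orc "card (univ A)" d
proof
  fix c assume "c < card (univ A)"
  then obtain a where a: "a \<in> univ A" "c = code a" using code_image by (metis imageE lessThan_iff)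
  have sub: "gaifman A `` {a} \<subseteq> univ A" using gaifman_univ[OF struct] by auto
  then show "set (ask_nbr orc c) \<subseteq> {..<card (univ A)}" using nbr[OF a(1)] a(2) code_image by auto
  have "length (ask_nbr orc c) = card (code ` (gaifman A `` {a}))"
    using nbr[OF a(1)] a(2) distinct_card by metis
  also have "\<dots> = card (gaifman A `` {a})" using card_image code_inj inj_on_subset sub by metis
  finally show "length (ask_nbr orc c) \<le> d" using degree[OF a(1)] by simp
qed

section \<open>Evaluating a local formula by neighbour queries\<close>

context structure_access
begin

lemma set_with_nbrs:
  assumes "X \<subseteq> univ A" "set xs = code ` X"
  shows "set ((with_nbrs ^^ r) xs) = code ` nbhd_set A r X"
proof (induction r)
  case (Suc r)
  have "(\<Union>c\<in>code ` nbhd_set A r X. set (ask_nbr orc c)) = code ` (gaifman A `` nbhd_set A r X)"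
    using nbr nbhd_set_univ[OF struct assms(1), of r] by (fastforce simp: Image_def)
  then show ?case using Suc by (simp add: with_nbrs_def nbhd_set_Suc image_Un)
qed (simp add: assms nbhd_set_0)

text \<open>An induced substructure inherits relations and weights on the tuples over its universe,
  so the oracle for \<open>A\<close> also answers for the neighbourhood.\<close>

lemma answers_for_nbhd:
  assumes "X \<subseteq> univ A"
  shows "answers_for C \<sigma> orc code (nbhd A r X)"
proof -
  have sub: "nbhd_set A r X \<subseteq> univ A" by (rule nbhd_set_univ[OF struct assms])
  have fin: "finite (univ A)" using struct by (simp add: is_structure_def)
  have t: "as \<in> tuples (nbhd_set A r X) m \<Longrightarrow> as \<in> tuples (univ A) m" for as m
    using sub by (auto simp: tuples_def)
  show ?thesis
    unfolding answers_for_def nbhd_def induced_def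
    using access struct t sub fin inj_on_subset[OF code_inj sub] finite_subset[OF sub fin]
    by (auto simp: local_access_def is_structure_def) (auto simp: tuples_def)
qed

text \<open>By locality the truth value in \<open>A\<close> is that in the neighbourhood of the free
  variables, which can be listed by queries and then searched exhaustively.\<close>

lemma eval_at_correct:
  assumes "wa1 C \<sigma> \<phi>" "agg_depth \<phi> = 0" "r_local C \<sigma> r \<phi>"
    and vars: "\<forall>x\<in>free \<phi>. \<rho> x < f \<and> \<beta> x \<in> univ A \<and> M (\<rho> x) = code (\<beta> x)"
    and "hp < f" "f + 15 + width \<phi> \<le> M hp"
  shows "ensures (eval_at C r \<rho> hp f \<phi>) M V (at_steps d r \<phi>)
    (\<lambda>M' V'. (M' (f + 4) \<noteq> 0 \<longleftrightarrow> sat C A \<beta> \<phi>) \<and>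
       (\<forall>j. j < f \<or> f + 15 + width \<phi> \<le> j \<and> j < M hp \<longrightarrow> M' j = M j))"
proof -
  define b where "b = M hp"
  define vs where "vs = sorted_list_of_set (free \<phi>)"
  define X where "X = \<beta> ` free \<phi>"
  define xs where "xs = map (\<lambda>x. code (\<beta> x)) vs"
  define L where "L = card (free \<phi>) * (d + 1) ^ r"
  define M1 where "M1 = M(f := b, f + 1 := b)"
  let ?w = "f + 15 + width \<phi>"
  have vs: "set vs = free \<phi>" "length vs = card (free \<phi>)"
    by (simp_all add: vs_def free_finite)
  have X: "X \<subseteq> univ A" using vars by (auto simp: X_def)
  have xs: "set xs = code ` X" "length xs = card (free \<phi>)" by (auto simp: xs_def X_def vs)
  have xn: "set xs \<subseteq> {..<card (univ A)}" using xs X code_image by auto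
  have bf: "?w \<le> b" using assms(6) by (simp add: b_def)
  let ?Q = "\<lambda>M' V'. (M' (f + 4) \<noteq> 0 \<longleftrightarrow> sat C A \<beta> \<phi>) \<and>
       (\<forall>j. j < f \<or> ?w \<le> j \<and> j < M hp \<longrightarrow> M' j = M j)"
  have *: "ensures (Blk (pushes (f + 1) (f + 4) (map \<rho> vs)) ;; grows f (f + 1) (f + 4) r ;;
     dedup f (f + 1) (f + 2) (f + 3) (f + 4) ;; eval_fml C (f + 2) (f + 3) \<rho> (f + 4) 0 \<phi>) M1 V
     (3 * card (free \<phi>) + (r * (17 * L + 6) + ((L * (14 * L + 22) + 10) + eval_steps L \<phi>))) ?Q"
  proof (rule ensures_seq[OF ensures_mono[OF ensures_pushes order_refl]])
    show "\<forall>a\<in>set (map \<rho> vs). a \<noteq> f + 1 \<and> a \<noteq> f + 4 \<and> a < M1 (f + 1)"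
      "f + 1 \<noteq> f + 4" "f + 1 < M1 (f + 1)" "f + 4 < M1 (f + 1)"
      using vars bf by (auto simp: vs M1_def)
    show "3 * length (map \<rho> vs) + (r * (17 * L + 6) + ((L * (14 * L + 22) + 10) + eval_steps L \<phi>)) \<le>
      3 * card (free \<phi>) + (r * (17 * L + 6) + ((L * (14 * L + 22) + 10) + eval_steps L \<phi>))"
      by (simp add: vs)
    fix M2 V2 assume 2: "V2 = V \<and> M2 (f + 1) = M1 (f + 1) + length (map \<rho> vs) \<and>
      hlist M2 (M1 (f + 1)) (map M1 (map \<rho> vs)) \<and>
      (\<forall>j. j \<noteq> f + 1 \<and> j \<noteq> f + 4 \<and> (j < M1 (f + 1) \<or> M1 (f + 1) + length (map \<rho> vs) \<le> j) \<longrightarrow> M2 j = M1 j)"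
    have "map M1 (map \<rho> vs) = xs" using vars vs by (auto simp: xs_def M1_def)
    then have 2: "M2 (f + 1) = b + length xs" "hlist M2 b xs" "M2 f = b"
      "\<forall>j. j \<noteq> f + 1 \<and> j \<noteq> f + 4 \<and> j < b \<longrightarrow> M2 j = M1 j"
      using 2 bf vs xs by (auto simp: M1_def)
    show "ensures (grows f (f + 1) (f + 4) r ;; dedup f (f + 1) (f + 2) (f + 3) (f + 4) ;;
       eval_fml C (f + 2) (f + 3) \<rho> (f + 4) 0 \<phi>) M2 V2
       (r * (17 * L + 6) + ((L * (14 * L + 22) + 10) + eval_steps L \<phi>)) ?Q"
    proof (rule ensures_seq[OF ensures_mono[OF ensures_grows[where b = b and xs = xs] order_refl] order_refl])
      show "length xs * (d + 1) ^ r \<le> L" by (simp add: xs L_def)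
      fix M3 V3 assume 3: "V3 = V2 \<and> M3 (f + 1) = b + length ((with_nbrs ^^ r) xs) \<and>
        hlist M3 b ((with_nbrs ^^ r) xs) \<and> (\<forall>j<b. j \<noteq> f + 1 \<and> j \<notin> {f + 4..<f + 4 + 8} \<longrightarrow> M3 j = M2 j)"
      let ?ns = "(with_nbrs ^^ r) xs"
      have len: "length ?ns \<le> L" using funpow_with_nbrs(2)[OF xn, of r] by (simp add: xs L_def)
      show "ensures (dedup f (f + 1) (f + 2) (f + 3) (f + 4) ;; eval_fml C (f + 2) (f + 3) \<rho> (f + 4) 0 \<phi>) M3 V3
         ((L * (14 * L + 22) + 10) + eval_steps L \<phi>) ?Q"
      proof (rule ensures_seq[OF ensures_mono[OF ensures_dedup[where b = b and xs = ?ns]] order_refl])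
        show "length ?ns * (14 * length ?ns + 22) + 10 \<le> L * (14 * L + 22) + 10"
          using len by (intro add_le_mono1 mult_le_mono) auto
        fix M4 V4 assume 4: "V4 = V3 \<and> (\<exists>ys. distinct ys \<and> set ys = set ?ns \<and> length ys \<le> length ?ns \<and>
           M4 (f + 2) = b + length ?ns \<and> M4 (f + 3) = b + length ?ns + length ys \<and> hlist M4 (b + length ?ns) ys) \<and>
           (\<forall>j<b + length ?ns. j \<noteq> f + 2 \<and> j \<noteq> f + 3 \<and> j \<notin> {f + 4..<f + 4 + 11} \<longrightarrow> M4 j = M3 j)"
        then obtain ys where ys: "distinct ys" "set ys = set ?ns" "length ys \<le> length ?ns"
           "M4 (f + 2) = b + length ?ns" "M4 (f + 3) = b + length ?ns + length ys" "hlist M4 (b + length ?ns) ys"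
          by blast
        have low: "M4 j = M j" if "j < f \<or> ?w \<le> j \<and> j < b" for j
        proof -
          have "j < b" "j \<noteq> f" "j \<notin> {f + 1, f + 2, f + 3}" "j \<notin> {f + 4..<f + 4 + 11}"
            "j \<notin> {f + 4..<f + 4 + 8}" "j \<noteq> f + 4"
            using that bf by auto
          then show ?thesis using 4 3 2(4) by (auto simp: M1_def)
        qed
        have univ: "set ys = code ` univ (nbhd A r X)"
          using ys(2) set_with_nbrs[OF X xs(1)] by (simp add: nbhd_def induced_def)
        have vars': "\<forall>x\<in>free \<phi>. \<rho> x < f + 4 \<and> \<beta> x \<in> univ (nbhd A r X) \<and> M4 (\<rho> x) = code (\<beta> x)"
        proof
          fix x assume x: "x \<in> free \<phi>"
          have "\<beta> x \<in> nbhd_set A r X"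
            using x by (auto simp: X_def nbhd_set_def intro!: bexI[of _ 0])
          then show "\<rho> x < f + 4 \<and> \<beta> x \<in> univ (nbhd A r X) \<and> M4 (\<rho> x) = code (\<beta> x)"
            using vars x low by (auto simp: nbhd_def induced_def)
        qed
        have loc: "sat C A \<beta> \<phi> \<longleftrightarrow> sat C (nbhd A r X) \<beta> \<phi>"
          using assms(3) struct X unfolding r_local_def X_def by blast
        have "ensures (eval_fml C (f + 2) (f + 3) \<rho> (f + 4) 0 \<phi>) M4 V4 (eval_steps (length ys) \<phi>)
          (\<lambda>M' V'. (M' (f + 4) \<noteq> 0 \<longleftrightarrow> sat C (nbhd A r X) \<beta> \<phi>) \<and> frame (f + 4) (width \<phi>) 0 M4 V4 M' V')"
          by (rule eval_fml_correct[OF vocab answers_for_nbhd[OF X] ys(1) univ assms(1,2) vars' _ _ ys(4,5,6)])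
            (use bf in auto)
        then show "ensures (eval_fml C (f + 2) (f + 3) \<rho> (f + 4) 0 \<phi>) M4 V4 (eval_steps L \<phi>) ?Q"
        proof (rule ensures_mono)
          show "eval_steps (length ys) \<phi> \<le> eval_steps L \<phi>"
            using ys(3) len by (intro eval_steps_mono) simp
        qed (use low loc in \<open>auto simp: frame_def b_def\<close>)
      next
        show "M3 f = b" "M3 (f + 1) = b + length ?ns" "hlist M3 b ?ns"
          using 3 2(3) bf by auto
      qed (use bf in auto)
    qed (use 2 bf xn in auto)
  qed
  show ?thesis unfolding eval_at_def vs_def[symmetric]
  proof (rule ensures_seq[where ?N1.0 = 4 and ?N2.0 =
     "3 * card (free \<phi>) + (r * (17 * L + 6) + ((L * (14 * L + 22) + 10) + eval_steps L \<phi>))"])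
    have "M(f := 0, f := b, f + 1 := 0, f + 1 := b) = M1" by (simp add: M1_def)
    then show "ensures (Blk [SetC f 0, Add f f hp, SetC (f + 1) 0, Add (f + 1) (f + 1) hp]) M V 4
      (\<lambda>M' V'. ensures (Blk (pushes (f + 1) (f + 4) (map \<rho> vs)) ;; grows f (f + 1) (f + 4) r ;;
       dedup f (f + 1) (f + 2) (f + 3) (f + 4) ;; eval_fml C (f + 2) (f + 3) \<rho> (f + 4) 0 \<phi>) M' V'
       (3 * card (free \<phi>) + (r * (17 * L + 6) + ((L * (14 * L + 22) + 10) + eval_steps L \<phi>))) ?Q)"
      using * assms(5) by (simp add: b_def M1_def)
  qed (simp add: at_steps_def L_def Let_def)
qed

end

section \<open>Locality and Feferman-Vaught decompositions\<close>

lemma upd_cong: "(x \<notin> set ys \<Longrightarrow> \<beta> x = \<beta>' x) \<Longrightarrow> length ys = length bs \<Longrightarrow> upd \<beta> ys bs x = upd \<beta>' ys bs x"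
proof (cases "x \<in> set ys")
  case True
  moreover assume "length ys = length bs"
  ultimately show ?thesis by (auto simp: upd_def split: option.split)
qed (simp add: upd_out)

lemma vocab_group: "valid_vocab C \<Longrightarrow> w \<in> dom (wsig C) \<Longrightarrow> abelian_group (alg C (wtype C w))"
  by (auto simp: valid_vocab_def)

lemma vocab_arity: "valid_vocab C \<Longrightarrow> w \<in> dom (wsig C) \<Longrightarrow> 1 \<le> war C w"
  by (auto simp: valid_vocab_def)

lemma structure_wgt:
  assumes "is_structure C \<sigma> A" "w \<in> dom (wsig C)" "as \<in> tuples (univ A) (war C w)"
  shows "wgt A w as \<in> carrier (alg C (wtype C w))"
    and "wgt A w as \<noteq> \<zero>\<^bsub>alg C (wtype C w)\<^esub> \<Longrightarrow>
       war C w = 1 \<or> (\<exists>a. set as = {a}) \<or> (\<exists>R. \<exists>t\<in>rel A R. set as \<subseteq> set t)"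
  using assms unfolding is_structure_def by blast+

lemma tval_cong:
  assumes "wa1_trm C \<sigma> t" "agg_depth_trm t = 0"
    and wgt: "\<And>w as. w \<in> dom (wsig C) \<Longrightarrow> as \<in> tuples U (war C w) \<Longrightarrow> wgt A w as = wgt B w as"
    and "\<forall>x\<in>free_trm t. \<beta> x = \<beta>' x \<and> \<beta>' x \<in> U"
  shows "tval C A \<beta> t = tval C B \<beta>' t"
  using assms(1,2,4)
proof (induction t rule: measure_induct_rule[where f = size])
  case (less t)
  show ?case
  proof (cases t)
    case (Wgt w xs)
    then have "w \<in> dom (wsig C)" "map \<beta>' xs \<in> tuples U (war C w)" "map \<beta> xs = map \<beta>' xs"
      using less.prems by (auto simp: wgt_atom_def tuples_def)
    then show ?thesis using wgt[of w "map \<beta>' xs"] Wgt by (simp del: map_eq_conv)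
  qed (use less in auto)
qed

text \<open>Relations are compared only for symbols in \<open>dom \<sigma>\<close>, so marker
  relations with new names are invisible to the formula. Membership in the carrier is demanded
  because \<open>finsum\<close> respects pointwise equality only for functions into the
  carrier.\<close>

lemma sat_cong:
  assumes vv: "valid_vocab C" and "wa1 C \<sigma> \<phi>" "agg_depth \<phi> = 0"
    and univ: "univ A = U" "univ B = U"
    and rel: "\<And>R t. R \<in> dom \<sigma> \<Longrightarrow> set t \<subseteq> U \<Longrightarrow> t \<in> rel A R \<longleftrightarrow> t \<in> rel B R"
    and wgt: "\<And>w as. w \<in> dom (wsig C) \<Longrightarrow> as \<in> tuples U (war C w) \<Longrightarrow> wgt A w as = wgt B w as"
    and car: "\<And>w as. w \<in> dom (wsig C) \<Longrightarrow> as \<in> tuples U (war C w) \<Longrightarrow> wgt B w as \<in> carrier (alg C (wtype C w))"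
    and "\<forall>x\<in>free \<phi>. \<beta> x = \<beta>' x \<and> \<beta>' x \<in> U"
  shows "sat C A \<beta> \<phi> \<longleftrightarrow> sat C B \<beta>' \<phi>"
  using assms(2,3,9)
proof (induction \<phi> arbitrary: \<beta> \<beta>' rule: measure_induct_rule[where f = size])
  case (less \<phi>)
  show ?case
  proof (cases \<phi>)
    case (Rel R xs)
    then have "R \<in> dom \<sigma>" "set (map \<beta>' xs) \<subseteq> U" "map \<beta> xs = map \<beta>' xs" using less.prems by auto
    then show ?thesis using rel[of R "map \<beta>' xs"] Rel by (simp del: map_eq_conv set_map)
  next
    case (WEq s w xs)
    then have "w \<in> dom (wsig C)" "map \<beta>' xs \<in> tuples U (war C w)" "map \<beta> xs = map \<beta>' xs"
      using less.prems by (auto simp: wgt_atom_def tuples_def)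
    then show ?thesis using wgt[of w "map \<beta>' xs"] WEq by (simp del: map_eq_conv)
  next
    case (Neg \<psi>) then show ?thesis using less by simp
  next
    case (Or \<phi>1 \<phi>2)
    have "sat C A \<beta> \<phi>1 \<longleftrightarrow> sat C B \<beta>' \<phi>1" "sat C A \<beta> \<phi>2 \<longleftrightarrow> sat C B \<beta>' \<phi>2"
      using less Or by auto
    then show ?thesis using Or by simp
  next
    case (Ex y \<psi>)
    have "sat C A (\<beta>(y := a)) \<psi> \<longleftrightarrow> sat C B (\<beta>'(y := a)) \<psi>" if "a \<in> U" for a
      using less.prems Ex that by (intro less.IH) auto
    then show ?thesis using Ex univ by auto
  next
    case (WSum s w ys \<psi>)
    have w: "w \<in> dom (wsig C)" "length ys = war C w" using less.prems WSum by (auto simp: wgt_atom_def)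
    interpret G: abelian_group "alg C (wtype C w)" by (rule vocab_group[OF vv w(1)])
    have "sat C A (upd \<beta> ys bs) \<psi> \<longleftrightarrow> sat C B (upd \<beta>' ys bs) \<psi>" if bs: "bs \<in> tuples U (length ys)" for bs
    proof (rule less.IH)
      have len: "length ys = length bs" "set bs \<subseteq> U" using bs by (auto simp: tuples_def)
      show "\<forall>x\<in>free \<psi>. upd \<beta> ys bs x = upd \<beta>' ys bs x \<and> upd \<beta>' ys bs x \<in> U"
      proof
        fix x assume x: "x \<in> free \<psi>"
        show "upd \<beta> ys bs x = upd \<beta>' ys bs x \<and> upd \<beta>' ys bs x \<in> U"
        proof (cases "x \<in> set ys")
          case True
          then show ?thesis using len upd_in[OF True len(1)] upd_cong[of x ys \<beta> \<beta>' bs] by auto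
        next
          case False
          then show ?thesis using less.prems WSum x by (simp add: upd_out)
        qed
      qed
    qed (use less.prems WSum in auto)
    then have "{bs \<in> tuples U (length ys). sat C A (upd \<beta> ys bs) \<psi>} =
      {bs \<in> tuples U (length ys). sat C B (upd \<beta>' ys bs) \<psi>}" by blast
    moreover have "finsum (alg C (wtype C w)) (wgt A w) S = finsum (alg C (wtype C w)) (wgt B w) S"
      if "S \<subseteq> tuples U (length ys)" for S
    proof (rule G.finsum_cong')
      have S: "bs \<in> tuples U (war C w)" if "bs \<in> S" for bs
        using that \<open>S \<subseteq> tuples U (length ys)\<close> w(2) by auto
      show "wgt B w \<in> S \<rightarrow> carrier (alg C (wtype C w))" using car[OF w(1) S] by blast
      show "wgt A w bs = wgt B w bs" if "bs \<in> S" for bs using wgt[OF w(1) S[OF that]] .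
    qed simp
    ultimately show ?thesis using WSum univ by simp
  next
    case (Pred P ts)
    have "map (tval C A \<beta>) ts = map (tval C B \<beta>') ts"
    proof (rule map_cong)
      fix t assume t: "t \<in> set ts"
      show "tval C A \<beta> t = tval C B \<beta>' t"
        by (rule tval_cong[OF _ _ wgt]) (use less.prems Pred t in \<open>auto simp: fold_max_0_iff\<close>)
    qed simp
    then show ?thesis using Pred by (simp del: map_eq_conv)
  qed (use less.prems in auto)
qed

section \<open>Distances in the Gaifman graph and transfer of local formulas\<close>

lemma nbhd_set_mono: "m \<le> r \<Longrightarrow> X \<subseteq> Y \<Longrightarrow> nbhd_set A m X \<subseteq> nbhd_set A r Y"
  by (force simp: nbhd_set_def)

lemma nbhd_set_self: "X \<subseteq> nbhd_set A r X"
  using nbhd_set_mono[of 0 r X X A] by (simp add: nbhd_set_0)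

lemma nbhd_set_add: "nbhd_set A a (nbhd_set A b X) = nbhd_set A (a + b) X"
  by (induction a) (auto simp: nbhd_set_0 nbhd_set_Suc)

lemma nbhd_set_Un: "nbhd_set A r (X \<union> Y) = nbhd_set A r X \<union> nbhd_set A r Y"
  by (induction r) (auto simp: nbhd_set_0 nbhd_set_Suc)

text \<open>Gaifman edges are symmetric, so a path can be walked backwards.\<close>

lemma nbhd_set_sym: "y \<in> nbhd_set A r X \<Longrightarrow> \<exists>x\<in>X. x \<in> nbhd_set A r {y}"
proof (induction r arbitrary: y)
  case (Suc r)
  show ?case
  proof (cases "y \<in> nbhd_set A r X")
    case True
    then obtain x where "x \<in> X" "x \<in> nbhd_set A r {y}" using Suc.IH by blast
    then show ?thesis by (auto simp: nbhd_set_Suc)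
  next
    case False
    then obtain z where z: "z \<in> nbhd_set A r X" "(z, y) \<in> gaifman A"
      using Suc.prems by (auto simp: nbhd_set_Suc)
    then obtain x where x: "x \<in> X" "x \<in> nbhd_set A r {z}" using Suc.IH by blast
    have "(y, z) \<in> gaifman A" using z(2) by (auto simp: gaifman_def)
    then have "{z} \<subseteq> nbhd_set A 1 {y}" by (auto simp: nbhd_set_Suc nbhd_set_0)
    then have "nbhd_set A r {z} \<subseteq> nbhd_set A (r + 1) {y}"
      using nbhd_set_mono[OF order_refl] nbhd_set_add by metis
    then show ?thesis using x by auto
  qed
qed (simp add: nbhd_set_0)

lemma nbhd_sets_meet:
  assumes "nbhd_set A r X \<inter> nbhd_set A s Y \<noteq> {}"
  shows "\<exists>y\<in>Y. y \<in> nbhd_set A (s + r) X"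
proof -
  obtain z where z: "z \<in> nbhd_set A r X" "z \<in> nbhd_set A s Y" using assms by blast
  obtain y where y: "y \<in> Y" "y \<in> nbhd_set A s {z}" using nbhd_set_sym[OF z(2)] by blast
  have "nbhd_set A s {z} \<subseteq> nbhd_set A s (nbhd_set A r X)" using z(1) by (intro nbhd_set_mono) auto
  then show ?thesis using y by (auto simp: nbhd_set_add)
qed

text \<open>The entries of a relation tuple are pairwise equal or adjacent. This is the reason for
  the radius \<open>Suc r\<close> in all restrictions below.\<close>

lemma rel_nbhd_Suc:
  assumes "t \<in> rel A R" "set t \<inter> nbhd_set A r X \<noteq> {}"
  shows "set t \<subseteq> nbhd_set A (Suc r) X"
proof
  fix b assume "b \<in> set t"
  obtain a where a: "a \<in> set t" "a \<in> nbhd_set A r X" using assms(2) by blast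
  then have "a = b \<or> (a, b) \<in> gaifman A" using assms(1) \<open>b \<in> set t\<close> by (auto simp: gaifman_def)
  then show "b \<in> nbhd_set A (Suc r) X" using a by (auto simp: nbhd_set_Suc)
qed

text \<open>If two structures have the same relation tuples meeting the
  \<open>r\<close>-neighbourhood, then a neighbourhood search takes the same course in both, and the
  two induced substructures agree. The empty tuple is added by hand, because relations of arity 0
  survive in every neighbourhood.\<close>

lemma local_transfer:
  assumes vv: "valid_vocab C" and "wa1 C \<sigma> \<phi>" "agg_depth \<phi> = 0" and loc: "r_local C \<sigma> r \<phi>"
    and A: "is_structure C \<sigma> A" "\<beta> ` free \<phi> \<subseteq> univ A"
    and D: "is_structure C \<sigma> D" "\<beta> ` free \<phi> \<subseteq> univ D"
    and rel: "\<And>R t. t = [] \<or> set t \<inter> nbhd_set A r (\<beta> ` free \<phi>) \<noteq> {} \<Longrightarrow> t \<in> rel A R \<longleftrightarrow> t \<in> rel D R"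
    and wgt: "\<And>w as. w \<in> dom (wsig C) \<Longrightarrow> as \<in> tuples (nbhd_set A r (\<beta> ` free \<phi>)) (war C w) \<Longrightarrow>
       wgt A w as = wgt D w as"
  shows "sat C A \<beta> \<phi> \<longleftrightarrow> sat C D \<beta> \<phi>"
proof -
  let ?F = "\<beta> ` free \<phi>"
  have gaif: "gaifman D `` S = gaifman A `` S" if "S \<subseteq> nbhd_set A r ?F" for S
  proof -
    have "(a, b) \<in> gaifman D \<longleftrightarrow> (a, b) \<in> gaifman A" if "a \<in> S" for a b
    proof -
      have "t \<in> rel A R \<longleftrightarrow> t \<in> rel D R" if "a \<in> set t" for t R
        using rel[of t R] that \<open>a \<in> S\<close> \<open>S \<subseteq> nbhd_set A r ?F\<close> by blast
      then show ?thesis unfolding gaifman_def by blast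
    qed
    then show ?thesis by (auto simp: Image_def)
  qed
  \<comment> \<open>Equality of the neighbourhoods by induction on the radius; edges leaving the
    ball of radius \<open>m\<close> agree as long as this ball lies within the known region.\<close>
  have "m \<le> r \<Longrightarrow> nbhd_set D m ?F = nbhd_set A m ?F" for m
  proof (induction m)
    case (Suc m)
    then show ?case using gaif[of "nbhd_set A m ?F"] nbhd_set_mono[of m r ?F ?F A]
      by (simp add: nbhd_set_Suc)
  qed (simp add: nbhd_set_0)
  then have eq: "nbhd_set D r ?F = nbhd_set A r ?F" by simp
  have "sat C (nbhd A r ?F) \<beta> \<phi> \<longleftrightarrow> sat C (nbhd D r ?F) \<beta> \<phi>"
  proof (rule sat_cong[OF vv assms(2,3)])
    show "univ (nbhd A r ?F) = nbhd_set A r ?F" "univ (nbhd D r ?F) = nbhd_set A r ?F"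
      by (simp_all add: nbhd_def induced_def eq)
    show "t \<in> rel (nbhd A r ?F) R \<longleftrightarrow> t \<in> rel (nbhd D r ?F) R" if "set t \<subseteq> nbhd_set A r ?F" for R t
    proof -
      have "t = [] \<or> set t \<inter> nbhd_set A r ?F \<noteq> {}" using that by (cases t) auto
      then show ?thesis using rel[of t R] that by (simp add: nbhd_def induced_def eq)
    qed
    show "wgt (nbhd A r ?F) w as = wgt (nbhd D r ?F) w as"
      if "w \<in> dom (wsig C)" "as \<in> tuples (nbhd_set A r ?F) (war C w)" for w as
      using wgt[OF that] by (simp add: nbhd_def induced_def)
    show "wgt (nbhd D r ?F) w as \<in> carrier (alg C (wtype C w))"
      if "w \<in> dom (wsig C)" "as \<in> tuples (nbhd_set A r ?F) (war C w)" for w as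
    proof -
      have "as \<in> tuples (univ D) (war C w)"
        using that(2) nbhd_set_univ[OF D, of r] eq by (auto simp: tuples_def)
      then show ?thesis using structure_wgt(1)[OF D(1) that(1)] by (simp add: nbhd_def induced_def)
    qed
    show "\<forall>x\<in>free \<phi>. \<beta> x = \<beta> x \<and> \<beta> x \<in> nbhd_set A r ?F" using nbhd_set_self by blast
  qed
  then show ?thesis using loc A D unfolding r_local_def by blast
qed

text \<open>
  Weights whose tuple is no longer covered are set to 0; this makes the restriction a structure again
  (the induced substructure need not be one).
\<close>

definition covered :: "'v vocab \<Rightarrow> 'v wstruct \<Rightarrow> nat set \<Rightarrow> nat \<Rightarrow> nat list \<Rightarrow> bool" where
  "covered C A S w as \<longleftrightarrow>
     war C w = 1 \<or> (\<exists>a. set as = {a}) \<or> (\<exists>R. \<exists>t\<in>rel A R. set t \<subseteq> S \<and> set as \<subseteq> set t)"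

definition restr :: "'v vocab \<Rightarrow> 'v wstruct \<Rightarrow> nat set \<Rightarrow> 'v wstruct" where
  "restr C A S = \<lparr>univ = S, rel = (\<lambda>R. {t \<in> rel A R. set t \<subseteq> S}),
     wgt = (\<lambda>w as. if covered C A S w as then wgt A w as else \<zero>\<^bsub>alg C (wtype C w)\<^esub>)\<rparr>"

lemma restr_structure:
  assumes "valid_vocab C" "is_structure C \<sigma> A" "S \<subseteq> univ A" "S \<noteq> {}"
  shows "is_structure C \<sigma> (restr C A S)"
  unfolding is_structure_def
proof (intro conjI allI ballI)
  show "finite (univ (restr C A S))" "univ (restr C A S) \<noteq> {}"
    using assms finite_subset by (auto simp: restr_def is_structure_def)
  show "rel (restr C A S) R \<subseteq> (case \<sigma> R of None \<Rightarrow> {} | Some m \<Rightarrow> tuples (univ (restr C A S)) m)" for R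
  proof
    fix t assume "t \<in> rel (restr C A S) R"
    then have t: "t \<in> rel A R" "set t \<subseteq> S" by (auto simp: restr_def)
    obtain m where "\<sigma> R = Some m" "t \<in> tuples (univ A) m" by (rule structure_rel[OF assms(2) t(1)])
    then show "t \<in> (case \<sigma> R of None \<Rightarrow> {} | Some m \<Rightarrow> tuples (univ (restr C A S)) m)"
      using t by (auto simp: tuples_def restr_def)
  qed
  fix w as assume w: "w \<in> dom (wsig C)" and as: "as \<in> tuples (univ (restr C A S)) (war C w)"
  interpret G: abelian_group "alg C (wtype C w)" by (rule vocab_group[OF assms(1) w])
  have "as \<in> tuples (univ A) (war C w)" using as assms(3) by (auto simp: restr_def tuples_def)
  then show "wgt (restr C A S) w as \<in> carrier (alg C (wtype C w))"
    using structure_wgt(1)[OF assms(2) w] by (simp add: restr_def)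
  show "wgt (restr C A S) w as \<noteq> \<zero>\<^bsub>alg C (wtype C w)\<^esub> \<longrightarrow>
    war C w = 1 \<or> (\<exists>a. set as = {a}) \<or> (\<exists>R. \<exists>t\<in>rel (restr C A S) R. set as \<subseteq> set t)"
    by (auto simp: restr_def covered_def)
qed

text \<open>The relation tuple that justifies a non-zero weight meets the
  \<open>r\<close>-neighbourhood, hence lies in the \<open>Suc r\<close>-neighbourhood. So the
  restriction to \<open>S\<close> does not erase weights that an \<open>r\<close>-local formula can
  see.\<close>

lemma covered_nbhd:
  assumes "valid_vocab C" "is_structure C \<sigma> A" "w \<in> dom (wsig C)" "as \<in> tuples (univ A) (war C w)"
    and "set as \<inter> nbhd_set A r X \<noteq> {}" "nbhd_set A (Suc r) X \<subseteq> S"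
    and "wgt A w as \<noteq> \<zero>\<^bsub>alg C (wtype C w)\<^esub>"
  shows "covered C A S w as"
proof -
  consider "war C w = 1" | a where "set as = {a}" | R t where "t \<in> rel A R" "set as \<subseteq> set t"
    using structure_wgt(2)[OF assms(2,3,4,7)] by blast
  then show ?thesis
  proof cases
    case 3
    then have "set t \<subseteq> S" using rel_nbhd_Suc[OF 3(1), of r X] assms(5,6) by blast
    then show ?thesis using 3 by (auto simp: covered_def)
  qed (auto simp: covered_def)
qed

lemma restr_sat:
  assumes vv: "valid_vocab C" and "wa1 C \<sigma> \<phi>" "agg_depth \<phi> = 0" "r_local C \<sigma> r \<phi>"
    and A: "is_structure C \<sigma> A" and S: "S \<subseteq> univ A" "S \<noteq> {}"
    and nb: "nbhd_set A (Suc r) (\<beta> ` free \<phi>) \<subseteq> S"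
  shows "sat C A \<beta> \<phi> \<longleftrightarrow> sat C (restr C A S) \<beta> \<phi>"
proof (rule local_transfer[OF vv assms(2-4) A _ restr_structure[OF vv A S]])
  let ?N = "nbhd_set A r (\<beta> ` free \<phi>)"
  have F: "\<beta> ` free \<phi> \<subseteq> S" using nb nbhd_set_self by blast
  then show "\<beta> ` free \<phi> \<subseteq> univ A" "\<beta> ` free \<phi> \<subseteq> univ (restr C A S)"
    using S by (auto simp: restr_def)
  show "t \<in> rel A R \<longleftrightarrow> t \<in> rel (restr C A S) R" if "t = [] \<or> set t \<inter> ?N \<noteq> {}" for R t
    using that rel_nbhd_Suc[of t A R r "\<beta> ` free \<phi>"] nb by (auto simp: restr_def)
  fix w as assume w: "w \<in> dom (wsig C)" and as: "as \<in> tuples ?N (war C w)"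
  have N: "?N \<subseteq> univ A" using nbhd_set_mono[of r "Suc r" "\<beta> ` free \<phi>" "\<beta> ` free \<phi>" A] nb S by auto
  have "as \<in> tuples (univ A) (war C w)" "set as \<inter> ?N \<noteq> {}"
    using as N vocab_arity[OF vv w] by (cases as; auto simp: tuples_def)+
  then show "wgt A w as = wgt (restr C A S) w as"
    using covered_nbhd[OF vv A w _ _ nb] by (auto simp: restr_def)
qed

text \<open>The structure is cut down to the disjoint sets \<open>S\<close> and \<open>S'\<close>
  around the two groups of variables. Near the variables the union of the two pieces looks like
  \<open>A\<close>, so locality gives the same truth value; in the union the decomposition applies;
  and each component formula, being local as well, is carried back to \<open>A\<close>.\<close>

lemma sat_split:
  assumes vv: "valid_vocab C" and fin: "finite (dom \<sigma>)"
    and phi: "wa1 C \<sigma> \<phi>" "agg_depth \<phi> = 0" "r_local C \<sigma> r \<phi>"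
    and A: "is_structure C \<sigma> A" "\<beta> ` free \<phi> \<subseteq> univ A"
    and Z: "Z \<union> Z' = free \<phi>" "Z \<noteq> {}" "Z' \<noteq> {}"
    and fv: "fv_decomposition C \<sigma> \<phi> Z Z' \<Delta>"
    and parts: "\<And>\<alpha> \<gamma>. (\<alpha>, \<gamma>) \<in> \<Delta> \<Longrightarrow> wa1 C \<sigma> \<alpha> \<and> agg_depth \<alpha> = 0 \<and> r_local C \<sigma> r \<alpha> \<and>
       wa1 C \<sigma> \<gamma> \<and> agg_depth \<gamma> = 0 \<and> r_local C \<sigma> r \<gamma>"
    and disj: "nbhd_set A (Suc r) (\<beta> ` Z) \<inter> nbhd_set A (Suc r) (\<beta> ` Z') = {}"
  shows "sat C A \<beta> \<phi> \<longleftrightarrow> (\<exists>(\<alpha>, \<gamma>)\<in>\<Delta>. sat C A \<beta> \<alpha> \<and> sat C A \<beta> \<gamma>)"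
proof -
  define S where "S = nbhd_set A (Suc r) (\<beta> ` Z)"
  define S' where "S' = nbhd_set A (Suc r) (\<beta> ` Z')"
  have ZU: "\<beta> ` Z \<subseteq> univ A" "\<beta> ` Z' \<subseteq> univ A" using A(2) Z(1) by auto
  have sub: "S \<subseteq> univ A" "S' \<subseteq> univ A"
    unfolding S_def S'_def by (rule nbhd_set_univ[OF A(1)], rule ZU)+
  have self: "\<beta> ` Z \<subseteq> S" "\<beta> ` Z' \<subseteq> S'"
    unfolding S_def S'_def by (rule nbhd_set_self)+
  have "S \<inter> S' = {}" using disj by (simp add: S_def S'_def)
  moreover have "S \<noteq> {}" "S' \<noteq> {}" using self Z(2,3) by auto
  ultimately have S: "S \<subseteq> univ A" "S' \<subseteq> univ A" "S \<inter> S' = {}" "\<beta> ` Z \<subseteq> S" "\<beta> ` Z' \<subseteq> S'" "S \<noteq> {}" "S' \<noteq> {}"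
    using sub self by simp_all
  let ?B = "restr C A S" and ?B' = "restr C A S'"
  have B: "is_structure C \<sigma> ?B" "is_structure C \<sigma> ?B'"
    using restr_structure[OF vv A(1)] S by auto
  obtain X where X: "X \<notin> dom \<sigma>" using ex_new_if_finite[OF infinite_UNIV_nat fin] by blast
  obtain Y where Y: "Y \<notin> dom \<sigma>" "X \<noteq> Y"
    using ex_new_if_finite[OF infinite_UNIV_nat, of "insert X (dom \<sigma>)"] fin by blast
  let ?P = "oplus C X Y ?B ?B'"
  \<comment> \<open>The sum \<open>?P\<close> without its markers. Locality is a statement about
    structures over \<open>\<sigma>\<close>, but \<open>?P\<close> interprets two further symbols,
    so \<open>D\<close> mediates between \<open>A\<close> and \<open>?P\<close>.\<close>
  define D where "D = \<lparr>univ = S \<union> S', rel = (\<lambda>R. rel ?B R \<union> rel ?B' R), wgt = wgt ?P\<rparr>"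
  have wD: "wgt D w as = (if set as \<subseteq> S then wgt ?B w as else if set as \<subseteq> S' then wgt ?B' w as
     else \<zero>\<^bsub>alg C (wtype C w)\<^esub>)" for w as
    by (simp add: D_def oplus_def restr_def)
  have carD: "wgt D w as \<in> carrier (alg C (wtype C w))"
    if w: "w \<in> dom (wsig C)" and as: "as \<in> tuples (S \<union> S') (war C w)" for w as
  proof -
    interpret G: abelian_group "alg C (wtype C w)" by (rule vocab_group[OF vv w])
    show ?thesis using structure_wgt(1)[OF B(1) w, of as] structure_wgt(1)[OF B(2) w, of as] as
      unfolding wD by (auto simp: restr_def tuples_def)
  qed
  have D: "is_structure C \<sigma> D"
    unfolding is_structure_def
  proof (intro conjI allI ballI)
    show "finite (univ D)" "univ D \<noteq> {}"
      using A(1) S finite_subset[of "S \<union> S'" "univ A"] by (auto simp: D_def is_structure_def)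
    show "rel D R \<subseteq> (case \<sigma> R of None \<Rightarrow> {} | Some m \<Rightarrow> tuples (univ D) m)" for R
    proof
      fix t assume "t \<in> rel D R"
      then have t: "t \<in> rel A R" "set t \<subseteq> S \<union> S'" by (auto simp: D_def restr_def)
      obtain m where "\<sigma> R = Some m" "t \<in> tuples (univ A) m" by (rule structure_rel[OF A(1) t(1)])
      then show "t \<in> (case \<sigma> R of None \<Rightarrow> {} | Some m \<Rightarrow> tuples (univ D) m)"
        using t by (auto simp: tuples_def D_def)
    qed
    fix w as assume w: "w \<in> dom (wsig C)" and as: "as \<in> tuples (univ D) (war C w)"
    show "wgt D w as \<in> carrier (alg C (wtype C w))" using carD[OF w] as by (simp add: D_def)
    show "wgt D w as \<noteq> \<zero>\<^bsub>alg C (wtype C w)\<^esub> \<longrightarrow>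
      war C w = 1 \<or> (\<exists>a. set as = {a}) \<or> (\<exists>R. \<exists>t\<in>rel D R. set as \<subseteq> set t)"
    proof
      assume "wgt D w as \<noteq> \<zero>\<^bsub>alg C (wtype C w)\<^esub>"
      then consider "covered C A S w as" | "covered C A S' w as"
        unfolding wD by (auto simp: restr_def split: if_splits)
      moreover have "t \<in> rel D R" if "t \<in> rel A R" "set t \<subseteq> S \<or> set t \<subseteq> S'" for t R
        using that by (auto simp: D_def restr_def)
      ultimately show "war C w = 1 \<or> (\<exists>a. set as = {a}) \<or> (\<exists>R. \<exists>t\<in>rel D R. set as \<subseteq> set t)"
        by cases (unfold covered_def, blast+)
    qed
  qed
  have "sat C A \<beta> \<phi> \<longleftrightarrow> sat C D \<beta> \<phi>"
  proof (rule local_transfer[OF vv phi A D])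
    let ?N = "nbhd_set A r (\<beta> ` free \<phi>)"
    have "\<beta> ` free \<phi> = \<beta> ` Z \<union> \<beta> ` Z'" using Z(1) by blast
    then have N: "?N = nbhd_set A r (\<beta> ` Z) \<union> nbhd_set A r (\<beta> ` Z')"
      by (simp add: nbhd_set_Un)
    have NS: "nbhd_set A r (\<beta> ` Z) \<subseteq> S" "nbhd_set A r (\<beta> ` Z') \<subseteq> S'"
      unfolding S_def S'_def by (simp_all add: nbhd_set_Suc)
    show "\<beta> ` free \<phi> \<subseteq> univ D"
      unfolding Z(1)[symmetric] image_Un D_def using S(4,5) by auto
    \<comment> \<open>No relation tuple of \<open>A\<close> near the variables stretches over both
      parts, because meeting one of the inner neighbourhoods forces it into the corresponding outer
      one.\<close>
    have relS: "set t \<subseteq> S \<or> set t \<subseteq> S'" if "t \<in> rel A R" "set t \<inter> ?N \<noteq> {}" for t R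
      using rel_nbhd_Suc[OF that(1), of r "\<beta> ` Z"] rel_nbhd_Suc[OF that(1), of r "\<beta> ` Z'"] that(2) N
      unfolding S_def S'_def by blast
    show "t \<in> rel A R \<longleftrightarrow> t \<in> rel D R" if "t = [] \<or> set t \<inter> ?N \<noteq> {}" for R t
      using that relS[of t R] by (auto simp: D_def restr_def)
    fix w as assume w: "w \<in> dom (wsig C)" and as: "as \<in> tuples ?N (war C w)"
    have ne: "set as \<noteq> {}" using as vocab_arity[OF vv w] by (auto simp: tuples_def)
    have asN: "set as \<subseteq> ?N" using as by (simp add: tuples_def)
    have "?N \<subseteq> univ A" unfolding N using NS S(1,2) by blast
    then have asA: "as \<in> tuples (univ A) (war C w)" using as asN by (auto simp: tuples_def)
    consider (in1) "set as \<subseteq> S" | (in2) "set as \<subseteq> S'" "\<not> set as \<subseteq> S" | (mixed) "\<not> set as \<subseteq> S" "\<not> set as \<subseteq> S'"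
      by blast
    moreover obtain a where a: "a \<in> set as" using ne by (meson ex_in_conv)
    moreover have aN: "a \<in> nbhd_set A r (\<beta> ` Z) \<or> a \<in> nbhd_set A r (\<beta> ` Z')"
      using asN a unfolding N by blast
    ultimately show "wgt A w as = wgt D w as"
    proof cases
      case in1
      have "set as \<inter> nbhd_set A r (\<beta> ` Z) \<noteq> {}" using in1 a aN NS(2) S(3) by (meson IntI disjoint_iff subsetD empty_iff)
      then show ?thesis using in1 covered_nbhd[OF vv A(1) w asA, of r "\<beta> ` Z" S]
        unfolding wD by (auto simp: restr_def S_def)
    next
      case in2
      have "set as \<inter> nbhd_set A r (\<beta> ` Z') \<noteq> {}" using in2 a aN NS(1) S(3) by (meson IntI disjoint_iff subsetD empty_iff)
      then show ?thesis using in2 covered_nbhd[OF vv A(1) w asA, of r "\<beta> ` Z'" S']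
        unfolding wD by (auto simp: restr_def S'_def)
    next
      case mixed
      \<comment> \<open>The sum has weight 0 on mixed tuples, so \<open>A\<close> must agree. A
        non-zero weight would require a relation tuple covering both parts; the alternatives of
        arity 1 or a single repeated element cannot be mixed.\<close>
      have "wgt A w as = \<zero>\<^bsub>alg C (wtype C w)\<^esub>"
      proof (rule ccontr)
        assume nz: "wgt A w as \<noteq> \<zero>\<^bsub>alg C (wtype C w)\<^esub>"
        have sub: "set as \<subseteq> S \<union> S'" using asN NS unfolding N by (meson Un_mono subset_trans)
        consider "war C w = 1" | a where "set as = {a}" | R t where "t \<in> rel A R" "set as \<subseteq> set t"
          using structure_wgt(2)[OF A(1) w asA nz] by blast
        then show False
        proof cases
          case 1
          then obtain a where "as = [a]" using asA by (auto simp: tuples_def length_Suc_conv)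
          then show False using mixed sub by auto
        next
          case 2
          then show False using mixed sub by auto
        next
          case 3
          then have "set t \<inter> ?N \<noteq> {}" using asN a by (meson disjoint_iff subsetD)
          then show False using relS[OF 3(1)] 3(2) mixed by blast
        qed
      qed
      then show ?thesis using mixed unfolding wD by simp
    qed
  qed
  also have "\<dots> \<longleftrightarrow> sat C ?P \<beta> \<phi>"
  proof (rule sat_cong[OF vv phi(1,2)])
    show "univ D = S \<union> S'" "univ ?P = S \<union> S'" by (auto simp: D_def oplus_def restr_def)
    show "t \<in> rel D R \<longleftrightarrow> t \<in> rel ?P R" if "R \<in> dom \<sigma>" for R t
      using that X Y by (auto simp: D_def oplus_def)
    show "wgt D w as = wgt ?P w as" for w as by (simp add: D_def)
    show "wgt ?P w as \<in> carrier (alg C (wtype C w))"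
      if "w \<in> dom (wsig C)" "as \<in> tuples (S \<union> S') (war C w)" for w as
      using carD[OF that] by (simp add: D_def)
    show "\<forall>x\<in>free \<phi>. \<beta> x = \<beta> x \<and> \<beta> x \<in> S \<union> S'"
      unfolding Z(1)[symmetric] using S(4,5) by blast
  qed
  also have "\<dots> \<longleftrightarrow> (\<exists>(\<alpha>, \<gamma>)\<in>\<Delta>. sat C ?B \<beta> \<alpha> \<and> sat C ?B' \<beta> \<gamma>)"
  proof -
    have "univ ?B \<inter> univ ?B' = {}" "\<beta> ` Z \<subseteq> univ ?B" "\<beta> ` Z' \<subseteq> univ ?B'"
      using S by (auto simp: restr_def)
    then show ?thesis using fv B X Y unfolding fv_decomposition_def by blast
  qed
  also have "\<dots> \<longleftrightarrow> (\<exists>(\<alpha>, \<gamma>)\<in>\<Delta>. sat C A \<beta> \<alpha> \<and> sat C A \<beta> \<gamma>)"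
  proof -
    have "sat C ?B \<beta> \<alpha> = sat C A \<beta> \<alpha>" "sat C ?B' \<beta> \<gamma> = sat C A \<beta> \<gamma>" if "(\<alpha>, \<gamma>) \<in> \<Delta>" for \<alpha> \<gamma>
    proof -
      have fr: "free \<alpha> \<subseteq> Z" "free \<gamma> \<subseteq> Z'" using fv that unfolding fv_decomposition_def by blast+
      have nb: "nbhd_set A (Suc r) (\<beta> ` free \<alpha>) \<subseteq> S" "nbhd_set A (Suc r) (\<beta> ` free \<gamma>) \<subseteq> S'"
        unfolding S_def S'_def by (intro nbhd_set_mono order_refl image_mono fr)+
      note p = parts[OF that]
      show "sat C ?B \<beta> \<alpha> = sat C A \<beta> \<alpha>"
        by (rule restr_sat[OF vv _ _ _ A(1) S(1,6) nb(1), symmetric]) (simp_all add: p)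
      show "sat C ?B' \<beta> \<gamma> = sat C A \<beta> \<gamma>"
        by (rule restr_sat[OF vv _ _ _ A(1) S(2,7) nb(2), symmetric]) (simp_all add: p)
    qed
    then show ?thesis by blast
  qed
  finally show ?thesis .
qed

section \<open>Moving the parameters close to the sample\<close>

locale formula_class =
  fixes C :: "'v vocab" and \<sigma> :: signature and r k l :: nat and \<Psi> :: "'v fml set"
  assumes vocab: "valid_vocab C" and fin_sig: "finite (dom \<sigma>)"
    and ne: "\<Psi> \<noteq> {}"
    and fow1: "\<phi> \<in> \<Psi> \<Longrightarrow> fow1 C \<sigma> \<phi>" and vars: "\<phi> \<in> \<Psi> \<Longrightarrow> free \<phi> \<subseteq> {..<k + l}"
    and local: "\<phi> \<in> \<Psi> \<Longrightarrow> r_local C \<sigma> r \<phi>"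
    and fv: "fv_closed C \<sigma> \<Psi>" and bool: "boolean_closed C \<sigma> \<Psi>"
begin

lemma wa1: "\<phi> \<in> \<Psi> \<Longrightarrow> wa1 C \<sigma> \<phi>" and agg: "\<phi> \<in> \<Psi> \<Longrightarrow> agg_depth \<phi> = 0"
  using fow1 by (auto simp: fow1_def)

lemma sat_agree:
  assumes "\<phi> \<in> \<Psi>" "is_structure C \<sigma> A" "\<forall>x\<in>free \<phi>. \<beta> x = \<beta>' x \<and> \<beta>' x \<in> univ A"
  shows "sat C A \<beta> \<phi> \<longleftrightarrow> sat C A \<beta>' \<phi>"
  by (rule sat_cong[OF vocab wa1[OF assms(1)] agg[OF assms(1)] refl refl refl refl
        structure_wgt(1)[OF assms(2)] assms(3)])

lemma neg:
  assumes "\<phi> \<in> \<Psi>" "is_structure C \<sigma> A"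
  shows "\<exists>\<psi>\<in>\<Psi>. \<forall>\<beta>. range \<beta> \<subseteq> univ A \<longrightarrow> (sat C A \<beta> \<psi> \<longleftrightarrow> \<not> sat C A \<beta> \<phi>)"
proof -
  obtain \<psi> where "\<psi> \<in> \<Psi>" "fml_equiv C \<sigma> \<psi> (Neg \<phi>)"
    using bool assms(1) unfolding boolean_closed_def by blast
  then show ?thesis using assms(2) unfolding fml_equiv_def by (intro bexI[of _ \<psi>]) auto
qed

lemma disj:
  assumes "\<phi> \<in> \<Psi>" "\<psi> \<in> \<Psi>" "is_structure C \<sigma> A"
  shows "\<exists>\<eta>\<in>\<Psi>. \<forall>\<beta>. range \<beta> \<subseteq> univ A \<longrightarrow> (sat C A \<beta> \<eta> \<longleftrightarrow> sat C A \<beta> \<phi> \<or> sat C A \<beta> \<psi>)"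
proof -
  obtain \<eta> where "\<eta> \<in> \<Psi>" "fml_equiv C \<sigma> \<eta> (Or \<phi> \<psi>)"
    using bool assms(1,2) unfolding boolean_closed_def by blast
  then show ?thesis using assms(3) unfolding fml_equiv_def by (intro bexI[of _ \<eta>]) auto
qed

text \<open>A tautology is obtained as the disjunction of any member with its negation; this is
  where non-emptiness of the class is used.\<close>

lemma const:
  assumes "is_structure C \<sigma> A"
  shows "\<exists>\<psi>\<in>\<Psi>. \<forall>\<beta>. range \<beta> \<subseteq> univ A \<longrightarrow> (sat C A \<beta> \<psi> \<longleftrightarrow> b)"
proof -
  obtain \<phi> where \<phi>: "\<phi> \<in> \<Psi>" using ne by blast
  obtain \<psi> where \<psi>: "\<psi> \<in> \<Psi>" "\<forall>\<beta>. range \<beta> \<subseteq> univ A \<longrightarrow> (sat C A \<beta> \<psi> \<longleftrightarrow> \<not> sat C A \<beta> \<phi>)"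
    using neg[OF \<phi> assms] by blast
  obtain t where t: "t \<in> \<Psi>" "\<forall>\<beta>. range \<beta> \<subseteq> univ A \<longrightarrow> sat C A \<beta> t"
    using disj[OF \<phi> \<psi>(1) assms] \<psi>(2) by blast
  obtain f where f: "f \<in> \<Psi>" "\<forall>\<beta>. range \<beta> \<subseteq> univ A \<longrightarrow> \<not> sat C A \<beta> f"
    using neg[OF t(1) assms] t(2) by blast
  show ?thesis using t f by (cases b) auto
qed

text \<open>Only closure under binary disjunction is given; the empty disjunction needs the false
  formula from \<open>const\<close>.\<close>

lemma Disj:
  assumes "is_structure C \<sigma> A" "finite I" "I \<subseteq> \<Psi>"
  shows "\<exists>\<psi>\<in>\<Psi>. \<forall>\<beta>. range \<beta> \<subseteq> univ A \<longrightarrow> (sat C A \<beta> \<psi> \<longleftrightarrow> (\<exists>\<alpha>\<in>I. sat C A \<beta> \<alpha>))"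
  using assms(2,3)
proof (induction I)
  case empty
  then show ?case using const[OF assms(1), of False] by auto
next
  case (insert \<phi> I)
  then obtain \<psi> where \<psi>: "\<psi> \<in> \<Psi>" "\<forall>\<beta>. range \<beta> \<subseteq> univ A \<longrightarrow> (sat C A \<beta> \<psi> \<longleftrightarrow> (\<exists>\<alpha>\<in>I. sat C A \<beta> \<alpha>))"
    by auto
  obtain \<eta> where \<eta>: "\<eta> \<in> \<Psi>" "\<forall>\<beta>. range \<beta> \<subseteq> univ A \<longrightarrow> (sat C A \<beta> \<eta> \<longleftrightarrow> sat C A \<beta> \<phi> \<or> sat C A \<beta> \<psi>)"
    using disj[of \<phi> \<psi> A] insert.prems \<psi>(1) assms(1) by blast
  show ?case
    by (rule bexI[OF _ \<eta>(1)]) (use \<psi>(2) \<eta>(2) in auto)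
qed

text \<open>
  Among \<open>l + 1\<close> disjoint annuli of width \<open>2 * r + 2\<close> around \<open>X\<close> one contains no parameter. The parameters
  outside of it influence the sample only through the truth values of the second components of a
  Feferman-Vaught decomposition, and these can be hard-wired into the formula.
\<close>

lemma near_parameters:
  assumes A: "is_structure C \<sigma> A" and X: "X \<subseteq> univ A" and e: "e \<in> univ A"
    and phi: "\<phi> \<in> \<Psi>" and vs: "vs \<in> tuples (univ A) l"
  shows "\<exists>\<phi>'\<in>\<Psi>. \<exists>vs'\<in>tuples (insert e (nbhd_set A (l * (2 * r + 2)) X)) l. \<forall>as\<in>tuples X k.
    sat C A ((!) (as @ vs)) \<phi> \<longleftrightarrow> sat C A ((!) (as @ vs')) \<phi>'"
proof -
  let ?w = "2 * r + 2"
  let ?N = "\<lambda>j. nbhd_set A (j * ?w) X"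
  have len: "length vs = l" "\<And>i. i < l \<Longrightarrow> vs ! i \<in> univ A" using vs by (auto simp: tuples_def)
  have mono: "?N i \<subseteq> ?N j" if "i \<le> j" for i j
    by (rule nbhd_set_mono[OF mult_le_mono1[OF that] order_refl])
  have "\<exists>j\<le>l. \<forall>i<l. vs ! i \<in> ?N (Suc j) \<longrightarrow> vs ! i \<in> ?N j"
  proof (rule ccontr)
    \<comment> \<open>Pigeonhole: if each of the \<open>l + 1\<close> annuli contained a parameter,
      choosing one per annulus would inject \<open>l + 1\<close> annuli into \<open>l\<close>
      positions, as nested balls make the annuli disjoint.\<close>
    assume "\<not> ?thesis"
    then obtain g where g: "\<And>j. j \<le> l \<Longrightarrow> g j < l \<and> vs ! g j \<in> ?N (Suc j) \<and> vs ! g j \<notin> ?N j"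
      by metis
    have "inj_on g {..l}"
    proof (rule linorder_inj_onI)
      fix i j assume "i < j" "i \<in> {..l}" "j \<in> {..l}"
      then show "g i \<noteq> g j" using g[of i] g[of j] mono[of "Suc i" j] by auto
    qed auto
    moreover have "g ` {..l} \<subseteq> {..<l}" using g by auto
    ultimately have "card {..l} \<le> card {..<l}" by (rule card_inj_on_le) simp
    then show False by simp
  qed
  then obtain j where j: "j \<le> l" "\<And>i. i < l \<Longrightarrow> vs ! i \<in> ?N (Suc j) \<Longrightarrow> vs ! i \<in> ?N j" by blast
  \<comment> \<open>Parameters beyond the free annulus are replaced by the dummy element
    \<open>e\<close>, which merely fills their places.\<close>
  define vs' where "vs' = map (\<lambda>v. if v \<in> ?N j then v else e) vs"
  have vs': "vs' \<in> tuples (insert e (?N l)) l" "length vs' = l" "set vs' \<subseteq> univ A"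
    "\<And>i. i < l \<Longrightarrow> vs ! i \<in> ?N j \<Longrightarrow> vs' ! i = vs ! i"
    using mono[OF j(1)] len vs e by (auto simp: vs'_def tuples_def)
  define Z where "Z = {x \<in> free \<phi>. x < k \<or> vs ! (x - k) \<in> ?N j}"
  define Z' where "Z' = free \<phi> - Z"
  \<comment> \<open>Equivalence of formulas is available only for assignments with all values in the
    universe, whereas \<open>(!)\<close> is unspecified behind the end of the list. Hence a total
    variant is used, with default \<open>e\<close>.\<close>
  define asg where "asg ws as = (\<lambda>i. if i < k + l then (as @ ws) ! i else e)" for ws as :: "nat list"
  have asg: "sat C A ((!) (as @ ws)) \<psi> \<longleftrightarrow> sat C A (asg ws as) \<psi>" "range (asg ws as) \<subseteq> univ A"
    if "\<psi> \<in> \<Psi>" "as \<in> tuples X k" "length ws = l" "set ws \<subseteq> univ A" for \<psi> as ws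
  proof -
    have "(as @ ws) ! i \<in> univ A" if "i < k + l" for i
    proof -
      have "(as @ ws) ! i \<in> set (as @ ws)"
        by (rule nth_mem) (use that \<open>as \<in> tuples X k\<close> \<open>length ws = l\<close> in \<open>auto simp: tuples_def\<close>)
      then show ?thesis using \<open>as \<in> tuples X k\<close> \<open>set ws \<subseteq> univ A\<close> X by (auto simp: tuples_def)
    qed
    then show "range (asg ws as) \<subseteq> univ A" using e by (auto simp: asg_def)
    then show "sat C A ((!) (as @ ws)) \<psi> \<longleftrightarrow> sat C A (asg ws as) \<psi>"
      by (intro sat_agree[OF that(1) A]) (use vars[OF that(1)] in \<open>auto simp: asg_def\<close>)
  qed
  have vsU: "set vs \<subseteq> univ A" using vs by (simp add: tuples_def)
  have asgZ: "asg vs as x = asg vs' as x" if "x \<in> Z" "as \<in> tuples X k" for as x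
  proof -
    have "x < k + l" using that vars[OF phi] by (auto simp: Z_def)
    then show ?thesis using that vs'(4)[of "x - k"] by (auto simp: asg_def nth_append tuples_def Z_def)
  qed
  have asgZ': "asg vs as x = vs ! (x - k)" "x - k < l" "vs ! (x - k) \<notin> ?N j" if "x \<in> Z'" "as \<in> tuples X k" for as x
    using that vars[OF phi] by (auto simp: asg_def nth_append tuples_def Z_def Z'_def)
  have phi': "wa1 C \<sigma> \<phi>" "agg_depth \<phi> = 0" "r_local C \<sigma> r \<phi>" using phi wa1 agg local by auto
  have "\<exists>\<phi>'\<in>\<Psi>. \<forall>as\<in>tuples X k. sat C A (asg vs as) \<phi> \<longleftrightarrow> sat C A (asg vs' as) \<phi>'"
  proof -
    \<comment> \<open>The decomposition is used only when both sides are non-empty. With all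
      variables near, the formula stays as it is; with all of them far, its truth value does not
      depend on the example and a constant formula does.\<close>
    consider "Z' = {}" | "Z = {}" | "Z \<noteq> {}" "Z' \<noteq> {}" by blast
    then show ?thesis
    proof cases
      case 1
      have "sat C A (asg vs as) \<phi> \<longleftrightarrow> sat C A (asg vs' as) \<phi>" if as: "as \<in> tuples X k" for as
      proof (rule sat_agree[OF phi A])
        show "\<forall>x\<in>free \<phi>. asg vs as x = asg vs' as x \<and> asg vs' as x \<in> univ A"
          using 1 asgZ[OF _ as] asg(2)[OF phi as vs'(2,3)] by (auto simp: Z'_def)
      qed
      then show ?thesis using phi by blast
    next
      case 2
      have const: "sat C A (asg vs as) \<phi> \<longleftrightarrow> sat C A (asg vs as') \<phi>"
        if as: "as \<in> tuples X k" "as' \<in> tuples X k" for as as'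
      proof (rule sat_agree[OF phi A])
        show "\<forall>x\<in>free \<phi>. asg vs as x = asg vs as' x \<and> asg vs as' x \<in> univ A"
        proof
          fix x assume "x \<in> free \<phi>"
          then have "x \<in> Z'" using 2 by (simp add: Z'_def)
          then show "asg vs as x = asg vs as' x \<and> asg vs as' x \<in> univ A"
            using asgZ'(1)[OF _ as(1)] asgZ'(1)[OF _ as(2)] asg(2)[OF phi as(2) len(1) vsU]
            by (metis rangeI subsetD)
        qed
      qed
      obtain \<psi> where \<psi>: "\<psi> \<in> \<Psi>"
        "\<forall>\<beta>. range \<beta> \<subseteq> univ A \<longrightarrow> (sat C A \<beta> \<psi> \<longleftrightarrow> (\<exists>as\<in>tuples X k. sat C A (asg vs as) \<phi>))"
        using formula_class.const[OF formula_class_axioms A] by blast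
      have "sat C A (asg vs as) \<phi> \<longleftrightarrow> sat C A (asg vs' as) \<psi>" if as: "as \<in> tuples X k" for as
        using \<psi>(2) asg(2)[OF phi as vs'(2,3)] const as by blast
      then show ?thesis using \<psi>(1) by blast
    next
      case 3
      have ZZ': "Z \<union> Z' = free \<phi>" "Z \<inter> Z' = {}" by (auto simp: Z_def Z'_def)
      then obtain \<Delta> where \<Delta>: "\<Delta> \<subseteq> \<Psi> \<times> \<Psi>" "fv_decomposition C \<sigma> \<phi> Z Z' \<Delta>"
        using fv[unfolded fv_closed_def, rule_format, OF phi ZZ'] by blast
      \<comment> \<open>The left components whose right partner is true. The right partner reads
        only far parameters, so its truth value is the same for every example; the new formula is
        the disjunction over \<open>I\<close>.\<close>
      define I where "I = {\<alpha>. \<exists>\<gamma>. (\<alpha>, \<gamma>) \<in> \<Delta> \<and> sat C A (\<lambda>x. vs ! (x - k)) \<gamma>}"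
      have "finite \<Delta>" and fr: "\<And>\<alpha> \<gamma>. (\<alpha>, \<gamma>) \<in> \<Delta> \<Longrightarrow> free \<alpha> \<subseteq> Z \<and> free \<gamma> \<subseteq> Z'"
        using \<Delta>(2) unfolding fv_decomposition_def by auto
      have "I \<subseteq> fst ` \<Delta>" by (force simp: I_def)
      then have "finite I" by (rule finite_subset) (simp add: \<open>finite \<Delta>\<close>)
      have "I \<subseteq> \<Psi>" using \<Delta>(1) by (auto simp: I_def)
      then obtain \<psi> where \<psi>: "\<psi> \<in> \<Psi>"
        "\<forall>\<beta>. range \<beta> \<subseteq> univ A \<longrightarrow> (sat C A \<beta> \<psi> \<longleftrightarrow> (\<exists>\<alpha>\<in>I. sat C A \<beta> \<alpha>))"
        using Disj[OF A \<open>finite I\<close>] by blast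
      have "sat C A (asg vs as) \<phi> \<longleftrightarrow> sat C A (asg vs' as) \<psi>" if as: "as \<in> tuples X k" for as
      proof -
        let ?\<beta> = "asg vs as"
        have rng: "range ?\<beta> \<subseteq> univ A" "range (asg vs' as) \<subseteq> univ A"
          using asg(2)[OF phi as len(1) vsU] asg(2)[OF phi as vs'(2,3)] by auto
        have ZN: "?\<beta> ` Z \<subseteq> ?N j"
        proof
          fix y assume "y \<in> ?\<beta> ` Z"
          then obtain x where x: "x \<in> Z" "y = ?\<beta> x" by blast
          show "y \<in> ?N j"
          proof (cases "x < k")
            case True
            then have "y \<in> X" using as x by (auto simp: asg_def nth_append tuples_def)
            then show ?thesis using nbhd_set_self by blast
          next
            case False
            then have "x < k + l" using x vars[OF phi] by (auto simp: Z_def)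
            then show ?thesis using False x as by (auto simp: asg_def nth_append tuples_def Z_def)
          qed
        qed
        have "nbhd_set A (Suc r) (?\<beta> ` Z) \<inter> nbhd_set A (Suc r) (?\<beta> ` Z') = {}"
        proof (rule ccontr)
          assume "\<not> ?thesis"
          then obtain y where y: "y \<in> ?\<beta> ` Z'" "y \<in> nbhd_set A (Suc r + Suc r) (?\<beta> ` Z)"
            using nbhd_sets_meet by blast
          then obtain x where x: "x \<in> Z'" "y = vs ! (x - k)" using asgZ'(1)[OF _ as] by auto
          have "nbhd_set A (Suc r + Suc r) (?\<beta> ` Z) \<subseteq> nbhd_set A (Suc r + Suc r) (?N j)"
            by (rule nbhd_set_mono[OF order_refl ZN])
          \<comment> \<open>The two radii \<open>Suc r\<close> add up to the width
            \<open>2 * r + 2\<close>, so a common point of the neighbourhoods would put a far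
            parameter into the free annulus.\<close>
          also have "\<dots> = ?N (Suc j)" by (simp add: nbhd_set_add algebra_simps)
          finally have "vs ! (x - k) \<in> ?N (Suc j)" using y x by auto
          then show False using j(2) asgZ'(2,3)[OF x(1) as] by blast
        qed
        then have "sat C A ?\<beta> \<phi> \<longleftrightarrow> (\<exists>(\<alpha>, \<gamma>)\<in>\<Delta>. sat C A ?\<beta> \<alpha> \<and> sat C A ?\<beta> \<gamma>)"
          using rng(1) \<Delta>(1) 3 ZZ'
          by (intro sat_split[OF vocab fin_sig phi' A _ _ _ _ \<Delta>(2)]) (auto intro: wa1 agg local)
        also have "\<dots> \<longleftrightarrow> (\<exists>\<alpha>\<in>I. sat C A (asg vs' as) \<alpha>)"
        proof -
          have "sat C A ?\<beta> \<alpha> \<longleftrightarrow> sat C A (asg vs' as) \<alpha>" if "(\<alpha>, \<gamma>) \<in> \<Delta>" for \<alpha> \<gamma>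
            using that \<Delta>(1) fr[OF that] asgZ[OF _ as] rng by (intro sat_agree[OF _ A]) auto
          moreover have "sat C A ?\<beta> \<gamma> \<longleftrightarrow> sat C A (\<lambda>x. vs ! (x - k)) \<gamma>" if "(\<alpha>, \<gamma>) \<in> \<Delta>" for \<alpha> \<gamma>
            using that \<Delta>(1) fr[OF that] asgZ'(1,2)[OF _ as] len(2) by (intro sat_agree[OF _ A]) auto
          ultimately show ?thesis unfolding I_def by blast
        qed
        also have "\<dots> \<longleftrightarrow> sat C A (asg vs' as) \<psi>" using \<psi>(2) rng(2) by blast
        finally show ?thesis .
      qed
      then show ?thesis using \<psi>(1) by blast
    qed
  qed
  then obtain \<phi>' where "\<phi>' \<in> \<Psi>" "\<forall>as\<in>tuples X k. sat C A (asg vs as) \<phi> \<longleftrightarrow> sat C A (asg vs' as) \<phi>'" by blast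
  then show ?thesis using vs'(1) asg(1)[OF phi _ len(1) vsU] asg(1)[OF _ _ vs'(2,3)] by blast
qed

end

section \<open>The learner\<close>

text \<open>Copies the tuple of the next example into the argument cells. Its counterpart
  \<open>appends\<close> copies it to the end of the list of candidates. Both advance the read
  pointer \<open>ep\<close> and use \<open>t\<close> for the constant 1.\<close>

fun loads :: "nat \<Rightarrow> nat \<Rightarrow> nat \<Rightarrow> nat \<Rightarrow> 'v instr list" where
  "loads dst ep t 0 = []"
| "loads dst ep t (Suc k) = Load dst ep # SetC t 1 # Add ep ep t # loads (Suc dst) ep t k"

fun appends :: "nat \<Rightarrow> nat \<Rightarrow> nat \<Rightarrow> nat \<Rightarrow> 'v instr list" where
  "appends ne ep t 0 = []"
| "appends ne ep t (Suc k) =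
     Load t ep # Store ne t # SetC t 1 # Add ne ne t # Add ep ep t # appends ne ep t k"

lemma hlist_concat:
  assumes "\<And>x. x \<in> set xs \<Longrightarrow> length (h x) = w" "i < length xs" "hlist M b (concat (map h xs))"
  shows "hlist M (b + i * w) (h (xs ! i))"
  using assms
proof (induction xs arbitrary: b i)
  case (Cons x xs)
  have "hlist M b (h x)" "hlist M (b + w) (concat (map h xs))"
    using Cons.prems by (auto simp: hlist_append)
  then show ?case using Cons.IH[of "i - 1" "b + w"] Cons.prems by (cases i) (auto simp: add_ac)
qed simp

context machine
begin

lemma ensures_loads:
  assumes "ep < M ep" "t < M ep" "dst + k \<le> M ep" "ep \<noteq> t"
    and "ep < dst \<or> dst + k \<le> ep" "t < dst \<or> dst + k \<le> t"
  shows "ensures (Blk (loads dst ep t k)) M V (3 * k)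
    (\<lambda>M' V'. V' = V \<and> M' ep = M ep + k \<and> (\<forall>i<k. M' (dst + i) = M (M ep + i)) \<and>
       (\<forall>j. j \<noteq> ep \<and> j \<noteq> t \<and> (j < dst \<or> dst + k \<le> j) \<longrightarrow> M' j = M j))"
  using assms
proof (induction k arbitrary: dst M)
  case (Suc k)
  let ?M = "M(dst := M (M ep), t := 1, ep := Suc (M ep))"
  have "ensures (Blk (loads (Suc dst) ep t k)) ?M V (3 * k)
    (\<lambda>M' V'. V' = V \<and> M' ep = M ep + Suc k \<and> (\<forall>i<Suc k. M' (dst + i) = M (M ep + i)) \<and>
       (\<forall>j. j \<noteq> ep \<and> j \<noteq> t \<and> (j < dst \<or> dst + Suc k \<le> j) \<longrightarrow> M' j = M j))"
  proof (rule ensures_mono[OF Suc.IH order_refl])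
    fix M' V' assume *: "V' = V \<and> M' ep = ?M ep + k \<and> (\<forall>i<k. M' (Suc dst + i) = ?M (?M ep + i)) \<and>
       (\<forall>j. j \<noteq> ep \<and> j \<noteq> t \<and> (j < Suc dst \<or> Suc dst + k \<le> j) \<longrightarrow> M' j = ?M j)"
    have "M' (dst + i) = M (M ep + i)" if "i < Suc k" for i
    proof (cases i)
      case 0
      then show ?thesis using * Suc.prems by auto
    next
      case (Suc i')
      have "M' (Suc dst + i') = ?M (?M ep + i')" using * Suc that by blast
      then show ?thesis using Suc Suc.prems by auto
    qed
    then show "V' = V \<and> M' ep = M ep + Suc k \<and> (\<forall>i<Suc k. M' (dst + i) = M (M ep + i)) \<and>
       (\<forall>j. j \<noteq> ep \<and> j \<noteq> t \<and> (j < dst \<or> dst + Suc k \<le> j) \<longrightarrow> M' j = M j)"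
      using * Suc.prems by auto
  qed (use Suc.prems in auto)
  moreover have "dst \<noteq> ep" "dst \<noteq> t" using Suc.prems by auto
  ultimately show ?case using Suc.prems(4) by (simp add: fun_upd_twist)
qed simp

lemma ensures_appends:
  assumes "ne < M ep" "ep < M ep" "t < M ep" "distinct [ne, ep, t]" "M ep + k \<le> M ne"
  shows "ensures (Blk (appends ne ep t k)) M V (5 * k)
    (\<lambda>M' V'. V' = V \<and> M' ep = M ep + k \<and> M' ne = M ne + k \<and> (\<forall>i<k. M' (M ne + i) = M (M ep + i)) \<and>
       (\<forall>j<M ne. j \<notin> {ne, ep, t} \<longrightarrow> M' j = M j))"
  using assms
proof (induction k arbitrary: M)
  case (Suc k)
  let ?M = "M(M ne := M (M ep), t := 1, ne := Suc (M ne), ep := Suc (M ep))"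
  have "ensures (Blk (appends ne ep t k)) ?M V (5 * k)
    (\<lambda>M' V'. V' = V \<and> M' ep = M ep + Suc k \<and> M' ne = M ne + Suc k \<and> (\<forall>i<Suc k. M' (M ne + i) = M (M ep + i)) \<and>
       (\<forall>j<M ne. j \<notin> {ne, ep, t} \<longrightarrow> M' j = M j))"
  proof (rule ensures_mono[OF Suc.IH order_refl])
    fix M' V' assume *: "V' = V \<and> M' ep = ?M ep + k \<and> M' ne = ?M ne + k \<and>
      (\<forall>i<k. M' (?M ne + i) = ?M (?M ep + i)) \<and> (\<forall>j<?M ne. j \<notin> {ne, ep, t} \<longrightarrow> M' j = ?M j)"
    have "M' (M ne + i) = M (M ep + i)" if "i < Suc k" for i
    proof (cases i)
      case 0
      then show ?thesis using * Suc.prems by auto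
    next
      case (Suc i')
      have "M' (?M ne + i') = ?M (?M ep + i')" using * Suc that by blast
      then show ?thesis using Suc Suc.prems that by auto
    qed
    then show "V' = V \<and> M' ep = M ep + Suc k \<and> M' ne = M ne + Suc k \<and> (\<forall>i<Suc k. M' (M ne + i) = M (M ep + i)) \<and>
       (\<forall>j<M ne. j \<notin> {ne, ep, t} \<longrightarrow> M' j = M j)"
      using * Suc.prems by auto
  qed (use Suc.prems in auto)
  moreover have "M(t := M (M ep), M ne := M (M ep), t := 1, ne := Suc (M ne), ep := Suc (M ep)) = ?M"
    using Suc.prems by auto
  ultimately show ?case using Suc.prems by simp
qed simp

end

text \<open>
  Cell 0 holds the index of a formula (in the output its successor), the cells \<open>1..l\<close> the
  parameters and the cells \<open>l+1..l+k\<close> the tuple at which the hypothesis is evaluated. The further registers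
  start at \<open>q\<close>, which leaves cell 1 as a constant for \<open>saves\<close> even if \<open>k = l = 0\<close>.
\<close>

locale layout =
  fixes C :: "'v vocab" and r k l :: nat and fs :: "'v fml list"
begin

definition "q = Suc (Suc (l + k))"
text \<open>Roles of the registers: \<open>rT\<close> sample size, \<open>rIN\<close> address of the
  sample, \<open>rNB\<close> and \<open>rNE\<close> bounds of the list of candidates,
  \<open>rBEST\<close> least error count, \<open>rBI\<close> successor of the index of the formula
  attaining it, \<open>rBV\<close> its parameters, \<open>rERR\<close> errors of the current
  hypothesis, \<open>rCNT\<close> and \<open>rFLAG\<close> loop control, \<open>rEP\<close> read
  pointer, \<open>rLAB\<close> label, \<open>rX\<close> and \<open>rY\<close> scratch,
  \<open>rF\<close> loops over parameters, \<open>fe\<close> evaluation.\<close>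

definition "rT = q"
definition "rIN = q + 1"
definition "rNB = q + 2"
definition "rNE = q + 3"
definition "rBEST = q + 4"
definition "rBI = q + 5"
definition "rERR = q + 6"
definition "rCNT = q + 7"
definition "rFLAG = q + 8"
definition "rEP = q + 9"
definition "rLAB = q + 10"
definition "rX = q + 11"
definition "rY = q + 12"
definition "rBV = q + 13"
definition "rF = rBV + l"
definition "fe = rF + 4 * l"
text \<open>Bounds all registers and working cells of every evaluation, so that data stored from
  \<open>K\<close> on are safe. The 15 cells are the four list bounds of \<open>eval_at\<close> and
  the eleven cells of \<open>dedup\<close>.\<close>

definition "K = fe + 15 + sum_list (map width fs)"

lemmas reg_defs = rT_def rIN_def rNB_def rNE_def rBEST_def rBI_def rERR_def rCNT_def rFLAG_def
  rEP_def rLAB_def rX_def rY_def rBV_def rF_def fe_def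

text \<open>In the formulas the example comes first, in memory the parameters do: the output format
  wants them in the cells from 1 on.\<close>

definition var_cell :: "nat \<Rightarrow> nat" where
  "var_cell x = (if x < k then Suc (l + x) else Suc (x - k))"

text \<open>The end of the list of candidates serves as the pointer to free memory. The
  neighbourhood lists of one evaluation are overwritten by the next.\<close>

definition eval_hyp :: "'v fml \<Rightarrow> 'v com" where
  "eval_hyp \<phi> = eval_at C r var_cell rNE fe \<phi>"

text \<open>With \<open>a = 1 - M[fe + 4]\<close>, the hypothesis errs on an example with label \<open>b\<close> iff \<open>a = b\<close>.\<close>

definition check_example :: "'v fml \<Rightarrow> 'v com" where
  "check_example \<phi> =
     Blk (loads (Suc l) rEP rX k) ;;
     Blk [Load rLAB rEP, SetC rX 1, Add rEP rEP rX] ;;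
     eval_hyp \<phi> ;;
     Blk [SetC rX 1, Sub rY rX (fe + 4), Sub rX rY rLAB, Sub rY rLAB rY, Add rY rY rX,
          SetC rX 1, Sub rX rX rY, Add rERR rERR rX]"

text \<open>The truncated difference \<open>rBEST - rERR\<close> is non-zero exactly for a strict
  improvement, so earlier hypotheses win ties.\<close>

definition try_formula :: "nat \<Rightarrow> 'v fml \<Rightarrow> 'v com" where
  "try_formula i \<phi> =
     Blk [SetC rERR 0, SetC rEP 0, Add rEP rEP rIN, SetC rCNT 0, Add rCNT rCNT rT] ;;
     For rCNT rFLAG (check_example \<phi>) ;;
     Blk [Sub rX rBEST rERR] ;;
     When rX (Blk [SetC rBEST 0, Add rBEST rBEST rERR, SetC rBI (Suc i)] ;; Blk (copies rBV [1..<Suc l]))"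

fun try_all :: "nat \<Rightarrow> 'v fml list \<Rightarrow> 'v com" where
  "try_all i [] = Blk []"
| "try_all i (\<phi> # \<phi>s) = try_formula i \<phi> ;; try_all (Suc i) \<phi>s"

text \<open>The start value, one more than the sample size, exceeds every error count; so the first
  hypothesis tried is always stored.\<close>

definition search :: "'v com" where
  "search =
     Blk [SetC rBEST 1, Add rBEST rBEST rT, SetC rBI 0] ;;
     ForTup rNB rNE rF l (Blk (copies 1 (map (\<lambda>i. rF + 4 * i) [0..<l])) ;; try_all 0 fs)"

text \<open>The code 0 is stored in front of the entries of the sample. So there is a candidate even
  if no example has an entry. Labels are skipped by the extra increment of
  \<open>rEP\<close>.\<close>

definition candidates :: "'v com" where
  "candidates =
     Blk [SetC rNB 0, Add rNB rNB rNE, SetC rX 0, Store rNE rX, SetC rX 1, Add rNE rNE rX,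
          SetC rEP 0, Add rEP rEP rIN, SetC rCNT 0, Add rCNT rCNT rT] ;;
     For rCNT rFLAG (Blk (appends rNE rEP rX k) ;; Blk [SetC rX 1, Add rEP rEP rX]) ;;
     grows rNB rNE fe (l * (2 * r + 2))"

definition try_steps :: "nat \<Rightarrow> nat \<Rightarrow> nat" where
  "try_steps d t = t * (3 * k + 16 + (\<Sum>\<phi>\<leftarrow>fs. at_steps d r \<phi>)) + 2 * l + 11"

definition search_steps :: "nat \<Rightarrow> nat \<Rightarrow> nat \<Rightarrow> nat" where
  "search_steps d L t = 3 + tup_steps L (2 * l + length fs * try_steps d t) l"

end

section \<open>Correctness of the search for a best hypothesis\<close>

locale learner = structure_access C \<sigma> orc A code d + formula_class C \<sigma> r k l "set fs" + layout C r k l fs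
  for C :: "'v vocab" and \<sigma> orc A code d r k l and fs :: "'v fml list" +
  fixes T :: "(nat list \<times> bool) list"
  assumes sample: "T \<in> samples A k"
begin

definition errs :: "'v fml \<Rightarrow> nat list \<Rightarrow> (nat list \<times> bool) list \<Rightarrow> nat" where
  "errs \<phi> vs S = length (filter (\<lambda>(as, b). sat C A ((!) (as @ vs)) \<phi> \<noteq> b) S)"

abbreviation enc :: "nat list \<times> bool \<Rightarrow> nat list" where
  "enc \<equiv> \<lambda>(as, b). map code as @ [of_bool b]"

definition inp :: "nat list" where "inp = concat (map enc T)"

text \<open>The invariant of the search: the sample is listed from \<open>P\<close> on, the candidate parameters \<open>ns\<close> from \<open>nb\<close> on.\<close>

definition ctx :: "nat \<Rightarrow> nat \<Rightarrow> nat list \<Rightarrow> (nat \<Rightarrow> nat) \<Rightarrow> bool" where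
  "ctx P nb ns M \<longleftrightarrow> M rT = length T \<and> M rIN = P \<and> M rNB = nb \<and> M rNE = nb + length ns \<and>
     hlist M P inp \<and> hlist M nb ns \<and> P + length inp \<le> nb \<and> K \<le> P"

lemma width_le: "\<phi> \<in> set fs \<Longrightarrow> fe + 15 + width \<phi> \<le> K"
  using member_le_sum_list[of "width \<phi>" "map width fs"] by (auto simp: K_def)

lemma sample_entry: "i < length T \<Longrightarrow> T ! i = (as, b) \<Longrightarrow> length as = k \<and> set as \<subseteq> univ A"
  using sample nth_mem[of i T] by (auto simp: samples_def tuples_def lists_eq_set)

lemma enc_length: "x \<in> set T \<Longrightarrow> length (enc x) = Suc k"
  using sample by (auto simp: samples_def tuples_def)

lemma inp_length: "length inp = length T * Suc k"
proof -
  have "sum_list (map (\<lambda>x. length (enc x)) T) = sum_list (map (\<lambda>_. Suc k) T)"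
    by (rule arg_cong[where f = sum_list], rule map_cong) (auto dest: enc_length)
  then show ?thesis by (simp add: inp_def length_concat comp_def sum_list_triv)
qed

lemma inp_example:
  assumes "hlist M P inp" "i < length T" "T ! i = (as, b)"
  shows "\<forall>j<k. M (P + i * Suc k + j) = code (as ! j)" "M (P + i * Suc k + k) = of_bool b"
proof -
  have "hlist M (P + i * Suc k) (enc (T ! i))"
    by (rule hlist_concat) (use assms enc_length in \<open>auto simp: inp_def\<close>)
  then have h: "hlist M (P + i * Suc k) (map code as)" "hlist M (P + i * Suc k + k) [of_bool b]"
    using assms(3) sample_entry[OF assms(2,3)] by (auto simp: hlist_append)
  show "\<forall>j<k. M (P + i * Suc k + j) = code (as ! j)"
    using h(1) sample_entry[OF assms(2,3)] by (auto simp: hlist_def)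
  show "M (P + i * Suc k + k) = of_bool b" using h(2) by (auto simp: hlist_def)
qed

lemma eval_hyp_correct:
  assumes "\<phi> \<in> set fs" "as \<in> tuples (univ A) k" "vs \<in> tuples (univ A) l"
    and "\<forall>i<l. M (Suc i) = code (vs ! i)" "\<forall>i<k. M (Suc (l + i)) = code (as ! i)" "K \<le> M rNE"
  shows "ensures (eval_hyp \<phi>) M V (at_steps d r \<phi>)
    (\<lambda>M' V'. (M' (fe + 4) \<noteq> 0 \<longleftrightarrow> sat C A ((!) (as @ vs)) \<phi>) \<and>
       (\<forall>j. j < fe \<or> K \<le> j \<and> j < M rNE \<longrightarrow> M' j = M j))"
  unfolding eval_hyp_def
proof (rule ensures_mono[OF eval_at_correct[OF wa1 agg local, where \<beta> = "(!) (as @ vs)"] order_refl])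
  show "\<forall>x\<in>free \<phi>. var_cell x < fe \<and> (as @ vs) ! x \<in> univ A \<and> M (var_cell x) = code ((as @ vs) ! x)"
  proof
    fix x assume "x \<in> free \<phi>"
    then have x: "x < k + l" using vars[OF assms(1)] by auto
    have len: "length as = k" "length vs = l" using assms(2,3) by (auto simp: tuples_def)
    have "(as @ vs) ! x \<in> set (as @ vs)" using x len by (intro nth_mem) simp
    then have "(as @ vs) ! x \<in> univ A" using assms(2,3) by (auto simp: tuples_def)
    moreover have "var_cell x < fe" using x by (auto simp: var_cell_def reg_defs q_def)
    moreover have "M (var_cell x) = code ((as @ vs) ! x)"
      using x len assms(4,5)[rule_format, of "x - k"] assms(5)[rule_format, of x] assms(4)[rule_format, of "x - k"]
      by (auto simp: var_cell_def nth_append)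
    ultimately show "var_cell x < fe \<and> (as @ vs) ! x \<in> univ A \<and> M (var_cell x) = code ((as @ vs) ! x)" by simp
  qed
  show "rNE < fe" by (simp add: reg_defs)
  show "fe + 15 + width \<phi> \<le> M rNE" using width_le[OF assms(1)] assms(6) by simp
qed (use assms(1) width_le[OF assms(1)] in auto)

text \<open>What survives the check of one example. The gaps are the example's tuple, the error
  counter and the scratch registers, the working cells of the evaluation, and the memory behind the
  candidates.\<close>

definition keepE :: "nat \<Rightarrow> (nat \<Rightarrow> nat) \<Rightarrow> (nat \<Rightarrow> nat) \<Rightarrow> bool" where
  "keepE ne M M' \<longleftrightarrow>
     (\<forall>j. j \<le> l \<or> q \<le> j \<and> j < q + 6 \<or> q + 13 \<le> j \<and> j < fe \<or> K \<le> j \<and> j < ne \<longrightarrow> M' j = M j)"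

lemma keepE_trans: "keepE ne M M' \<Longrightarrow> keepE ne M' M'' \<Longrightarrow> keepE ne M M''"
  by (simp add: keepE_def)

lemma keepE_ctx: "ctx P nb ns M \<Longrightarrow> keepE (nb + length ns) M M' \<Longrightarrow> ctx P nb ns M'"
  unfolding ctx_def
  by (auto simp: keepE_def reg_defs elim!: hlist_cong)

lemma check_example_correct:
  assumes "\<phi> \<in> set fs" "vs \<in> tuples (univ A) l" "\<forall>i<l. M (Suc i) = code (vs ! i)" "ctx P nb ns M"
    and i: "i < length T" and "M rEP = P + i * Suc k" "M rERR = errs \<phi> vs (take i T)"
  shows "ensures (check_example \<phi>) M V (3 * k + 11 + at_steps d r \<phi>)
    (\<lambda>M' V'. M' rEP = P + Suc i * Suc k \<and> M' rERR = errs \<phi> vs (take (Suc i) T) \<and>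
       M' rCNT = M rCNT \<and> keepE (nb + length ns) M M')"
proof -
  obtain as b where asb: "T ! i = (as, b)" by fastforce
  have as: "as \<in> tuples (univ A) k" using sample_entry[OF i asb] by (simp add: tuples_def)
  have hl: "hlist M P inp" and P: "K \<le> P" using assms(4) by (auto simp: ctx_def)
  have KP: "fe + 15 \<le> P" using P by (simp add: K_def)
  note ex = inp_example[OF hl i asb]
  have feq: "fe = q + 13 + l + 4 * l" by (simp add: reg_defs)
  have ne: "M rNE = nb + length ns" "K \<le> nb + length ns" using assms(4) by (auto simp: ctx_def)
  let ?Q = "\<lambda>M' V'. M' rEP = P + Suc i * Suc k \<and> M' rERR = errs \<phi> vs (take (Suc i) T) \<and>
       M' rCNT = M rCNT \<and> keepE (nb + length ns) M M'"
  have errs: "errs \<phi> vs (take (Suc i) T) = errs \<phi> vs (take i T) + of_bool (sat C A ((!) (as @ vs)) \<phi> \<noteq> b)"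
    using i by (simp add: errs_def take_Suc_conv_app_nth asb)
  have "ensures (check_example \<phi>) M V (3 * k + (3 + (at_steps d r \<phi> + 8))) ?Q"
    unfolding check_example_def
  proof (rule ensures_seq[OF ensures_mono[OF ensures_loads order_refl] order_refl])
    fix M1 V1 assume 1: "V1 = V \<and> M1 rEP = M rEP + k \<and> (\<forall>i<k. M1 (Suc l + i) = M (M rEP + i)) \<and>
       (\<forall>j. j \<noteq> rEP \<and> j \<noteq> rX \<and> (j < Suc l \<or> Suc l + k \<le> j) \<longrightarrow> M1 j = M j)"
    have "P + i * Suc k + k \<noteq> rEP \<and> P + i * Suc k + k \<noteq> rX \<and> Suc l + k \<le> P + i * Suc k + k"
      using KP by (simp add: reg_defs q_def)
    then have lab: "M1 (M1 rEP) = of_bool b" using 1 ex(2) assms(6) by (simp add: add_ac)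
    define M2 where "M2 = M1(rLAB := of_bool b, rX := 1, rEP := P + Suc i * Suc k)"
    have M2: "\<forall>i<l. M2 (Suc i) = code (vs ! i)" "\<forall>i<k. M2 (Suc (l + i)) = code (as ! i)" "M2 rNE = M rNE"
      using 1 assms(3,6) ex(1) by (auto simp: M2_def reg_defs q_def)
    have keep2: "keepE (nb + length ns) M M2" "M2 rERR = M rERR" "M2 rCNT = M rCNT"
      using 1 by (auto simp: keepE_def M2_def reg_defs q_def K_def)
    have "ensures (eval_hyp \<phi> ;; Blk [SetC rX 1, Sub rY rX (fe + 4), Sub rX rY rLAB, Sub rY rLAB rY, Add rY rY rX,
          SetC rX 1, Sub rX rX rY, Add rERR rERR rX]) M2 V1 (at_steps d r \<phi> + 8) ?Q"
    proof (rule ensures_seq[OF ensures_mono[OF eval_hyp_correct[OF assms(1) as assms(2) M2(1,2)] order_refl] order_refl])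
      show "K \<le> M2 rNE" using M2(3) ne by simp
      fix M3 V3 assume 3: "(M3 (fe + 4) \<noteq> 0 \<longleftrightarrow> sat C A ((!) (as @ vs)) \<phi>) \<and>
       (\<forall>j. j < fe \<or> K \<le> j \<and> j < M2 rNE \<longrightarrow> M3 j = M2 j)"
      have low: "M3 j = M2 j" if "j < fe" for j using 3 that by blast
      have r3: "M3 rLAB = of_bool b" "M3 rERR = M rERR" "M3 rEP = P + Suc i * Suc k" "M3 rCNT = M rCNT"
        using low keep2 by (auto simp: reg_defs M2_def)
      let ?D = "M3 rLAB - (Suc 0 - M3 (fe + 4)) + (Suc 0 - M3 (fe + 4) - M3 rLAB)"
      have e: "Suc 0 - ?D = of_bool (sat C A ((!) (as @ vs)) \<phi> \<noteq> b)"
        using 3 r3(1) by (cases "M3 (fe + 4)"; cases b) auto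
      have "rX < fe" "rY < fe" "rLAB < fe" "rERR < fe" "distinct [rX, rY, rLAB, rERR]"
        by (simp_all add: reg_defs)
      then have run: "ensures (Blk [SetC rX 1, Sub rY rX (fe + 4), Sub rX rY rLAB, Sub rY rLAB rY, Add rY rY rX,
          SetC rX 1, Sub rX rX rY, Add rERR rERR rX]) M3 V3 8
          (\<lambda>M' V'. M' rERR = M3 rERR + (Suc 0 - ?D) \<and> (\<forall>j. j \<notin> {rX, rY, rERR} \<longrightarrow> M' j = M3 j))"
        by auto
      show "ensures (Blk [SetC rX 1, Sub rY rX (fe + 4), Sub rX rY rLAB, Sub rY rLAB rY, Add rY rY rX,
          SetC rX 1, Sub rX rX rY, Add rERR rERR rX]) M3 V3 8 ?Q"
      proof (rule ensures_mono[OF run order_refl])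
        fix M4 V4 assume 4: "M4 rERR = M3 rERR + (Suc 0 - ?D) \<and> (\<forall>j. j \<notin> {rX, rY, rERR} \<longrightarrow> M4 j = M3 j)"
        have "keepE (nb + length ns) M2 M4"
          using 3 4 ne(1) M2(3) by (auto simp: keepE_def reg_defs q_def K_def)
        then have "keepE (nb + length ns) M M4" by (rule keepE_trans[OF keep2(1)])
        moreover have "M4 rERR = errs \<phi> vs (take (Suc i) T)" using 4 e r3(2) assms(7) errs by simp
        moreover have "M4 rEP = M3 rEP" "M4 rCNT = M3 rCNT" using 4 by (auto simp: reg_defs)
        ultimately show "?Q M4 V4" using r3 by simp
      qed
    qed
    moreover have "M1(rLAB := of_bool b, rX := Suc 0, rEP := P + Suc i * Suc k) = M2" by (simp add: M2_def)
    moreover have "M1 rEP + 1 = P + Suc i * Suc k" using 1 assms(6) by simp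
    ultimately show "ensures (Blk [Load rLAB rEP, SetC rX 1, Add rEP rEP rX] ;; eval_hyp \<phi> ;;
       Blk [SetC rX 1, Sub rY rX (fe + 4), Sub rX rY rLAB, Sub rY rLAB rY, Add rY rY rX,
          SetC rX 1, Sub rX rX rY, Add rERR rERR rX]) M1 V1 (3 + (at_steps d r \<phi> + 8)) ?Q"
      using lab by (intro ensures_seq[where ?N1.0 = 3 and ?N2.0 = "at_steps d r \<phi> + 8"])
        (simp_all add: reg_defs)
  qed (use assms(6) KP in \<open>auto simp: reg_defs q_def\<close>)
  then show ?thesis by (rule ensures_mono) auto
qed

lemma errs_le: "errs \<phi> vs S \<le> length S"
  by (simp add: errs_def)

text \<open>What survives the trial of one formula: \<open>rBEST\<close>, \<open>rBI\<close> and
  \<open>rBV\<close> are no longer protected, since the trial may replace the record.\<close>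

definition keepT :: "nat \<Rightarrow> (nat \<Rightarrow> nat) \<Rightarrow> (nat \<Rightarrow> nat) \<Rightarrow> bool" where
  "keepT ne M M' \<longleftrightarrow>
     (\<forall>j. 1 \<le> j \<and> j \<le> l \<or> q \<le> j \<and> j < q + 4 \<or> rF \<le> j \<and> j < fe \<or> K \<le> j \<and> j < ne \<longrightarrow> M' j = M j)"

lemma keepT_trans: "keepT ne M M' \<Longrightarrow> keepT ne M' M'' \<Longrightarrow> keepT ne M M''"
  by (simp add: keepT_def)

lemma keepT_ctx: "ctx P nb ns M \<Longrightarrow> keepT (nb + length ns) M M' \<Longrightarrow> ctx P nb ns M'"
  unfolding ctx_def
  by (auto simp: keepT_def reg_defs elim!: hlist_cong)

text \<open>\<open>M[rBEST]\<close> is the least number of errors of the hypotheses tried so far.\<close>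

definition best :: "(nat \<times> nat list) set \<Rightarrow> (nat \<Rightarrow> nat) \<Rightarrow> bool" where
  "best S M \<longleftrightarrow> (\<forall>(i, vs)\<in>S. M rBEST \<le> errs (fs ! i) vs T) \<and>
     (S = {} \<and> M rBEST = Suc (length T) \<or>
      (\<exists>(i, vs)\<in>S. i < length fs \<and> vs \<in> tuples (univ A) l \<and> M rBEST = errs (fs ! i) vs T \<and>
         M rBI = Suc i \<and> (\<forall>j<l. M (rBV + j) = code (vs ! j))))"

lemma best_cong:
  "best S M \<Longrightarrow> (\<And>j. j = rBEST \<or> j = rBI \<or> rBV \<le> j \<and> j < rF \<Longrightarrow> M' j = M j) \<Longrightarrow> best S M'"
  unfolding best_def rF_def by (force split: prod.splits)

lemma try_formula_correct:
  assumes i: "i < length fs" and vs: "vs \<in> tuples (univ A) l" "\<forall>j<l. M (Suc j) = code (vs ! j)"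
    and ctx: "ctx P nb ns M" and best: "best S M"
  shows "ensures (try_formula i (fs ! i)) M V (try_steps d (length T))
    (\<lambda>M' V'. best (insert (i, vs) S) M' \<and> keepT (nb + length ns) M M')"
proof -
  let ?\<phi> = "fs ! i"
  let ?N = "3 * k + 11 + at_steps d r ?\<phi>"
  let ?ne = "nb + length ns"
  have phi: "?\<phi> \<in> set fs" using i by simp
  let ?Inv = "\<lambda>j M' V'. M' rEP = P + j * Suc k \<and> M' rERR = errs ?\<phi> vs (take j T) \<and> keepE ?ne M M'"
  let ?Q = "\<lambda>M' V'. best (insert (i, vs) S) M' \<and> keepT ?ne M M'"
  let ?M = "M(rERR := 0, rEP := P, rCNT := length T)"
  have KE: "fe \<le> K" by (simp add: K_def)
  have feq: "fe = q + 13 + l + 4 * l" by (simp add: reg_defs)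
  have loop: "ensures (For rCNT rFLAG (check_example ?\<phi>)) ?M V (length T * (?N + 5) + 1) (?Inv (length T))"
  proof (rule ensures_For)
    show "?Inv 0 ?M V" using KE feq by (auto simp: errs_def keepE_def reg_defs q_def)
    show "?Inv j M' V1" if "?Inv j M1 V1" "\<forall>p. p \<noteq> rCNT \<longrightarrow> p \<noteq> rFLAG \<longrightarrow> M' p = M1 p" for j M1 V1 M'
      using that KE feq by (auto simp: keepE_def reg_defs q_def)
    fix j M1 V1 assume j: "j < length T" and I: "?Inv j M1 V1" and cnt: "M1 rCNT = length T - j"
    have v: "\<forall>p<l. M1 (Suc p) = code (vs ! p)" using I vs(2) by (simp add: keepE_def)
    have c: "ctx P nb ns M1" using keepE_ctx[OF ctx] I by blast
    show "ensures (check_example ?\<phi>) M1 V1 ?N (\<lambda>M' V'. M' rCNT = length T - j \<and> ?Inv (Suc j) M' V')"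
    proof (rule ensures_mono[OF check_example_correct[OF phi vs(1) v c j] order_refl])
      show "M1 rEP = P + j * Suc k" "M1 rERR = errs ?\<phi> vs (take j T)" using I by auto
      fix M' V' assume "M' rEP = P + Suc j * Suc k \<and> M' rERR = errs ?\<phi> vs (take (Suc j) T) \<and>
         M' rCNT = M1 rCNT \<and> keepE ?ne M1 M'"
      then show "M' rCNT = length T - j \<and> ?Inv (Suc j) M' V'"
        using cnt keepE_trans[of ?ne M M1 M'] I by simp
    qed
  qed (auto simp: reg_defs)
  have fin: "ensures (Blk [Sub rX rBEST rERR] ;;
     When rX (Blk [SetC rBEST 0, Add rBEST rBEST rERR, SetC rBI (Suc i)] ;; Blk (copies rBV [1..<Suc l]))) M1 V1
     (5 + 2 * l) ?Q" if I: "?Inv (length T) M1 V1" for M1 V1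
  proof -
    let ?ev = "errs ?\<phi> vs T"
    let ?M1 = "M1(rX := M rBEST - ?ev)"
    have v: "\<forall>p<l. M1 (Suc p) = code (vs ! p)" using I vs(2) by (simp add: keepE_def)
    have B: "M1 rBEST = M rBEST" "M1 rERR = ?ev" using I by (auto simp: keepE_def reg_defs)
    have bestM1: "best S ?M1"
      by (rule best_cong[OF best]) (use I in \<open>auto simp: keepE_def reg_defs\<close>)
    have keep: "keepT ?ne M ?M1" using I KE feq by (auto simp: keepE_def keepT_def reg_defs q_def)
    have "ensures (When rX (Blk [SetC rBEST 0, Add rBEST rBEST rERR, SetC rBI (Suc i)] ;; Blk (copies rBV [1..<Suc l]))) ?M1 V1
      (4 + 2 * l) ?Q"
    proof (rule ensures_When[where N = "3 + 2 * l"])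
      assume "?M1 rX = 0"
      then have "M rBEST \<le> ?ev" by simp
      \<comment> \<open>If nothing had been tried before, \<open>M rBEST\<close> would be
        \<open>Suc (length T)\<close>, which no error count reaches; so without an improvement there
        is an earlier record to keep.\<close>
      moreover from this have "S \<noteq> {}" using best errs_le[of ?\<phi> vs T] by (auto simp: best_def)
      moreover have "?M1 rBEST = M rBEST" using B by (simp add: reg_defs)
      ultimately have "best (insert (i, vs) S) ?M1" using bestM1 unfolding best_def by auto
      then show "?Q ?M1 V1" using keep by simp
    next
      assume "?M1 rX \<noteq> 0"
      then have lt: "?ev < M rBEST" by simp
      let ?M2 = "?M1(rBEST := ?ev, rBI := Suc i)"
      have "ensures (Blk (copies rBV [1..<Suc l])) ?M2 V1 (2 * l) ?Q"
      proof (rule ensures_mono[OF ensures_copies_disjoint])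
        show "\<forall>a\<in>set [1..<Suc l]. a < rBV \<or> rBV + length [1..<Suc l] \<le> a" by (auto simp: reg_defs q_def)
        fix M3 V3 assume 3: "V3 = V1 \<and> (\<forall>p<length [1..<Suc l]. M3 (rBV + p) = ?M2 ([1..<Suc l] ! p)) \<and>
          (\<forall>j. j < rBV \<or> rBV + length [1..<Suc l] \<le> j \<longrightarrow> M3 j = ?M2 j)"
        have bv: "M3 (rBV + p) = code (vs ! p)" if "p < l" for p
        proof -
          have "M3 (rBV + p) = ?M2 ([1..<Suc l] ! p)" using 3 that by simp
          also have "[1..<Suc l] ! p = Suc p" using that by (subst nth_upt) auto
          also have "?M2 (Suc p) = code (vs ! p)" using v that by (simp add: reg_defs q_def)
          finally show ?thesis .
        qed
        have r: "M3 rBEST = ?ev" "M3 rBI = Suc i" using 3 by (auto simp: reg_defs)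
        have "\<forall>(i, vs)\<in>S. ?ev \<le> errs (fs ! i) vs T" using best lt by (force simp: best_def)
        then have "best (insert (i, vs) S) M3" using r bv i vs(1) by (auto simp: best_def)
        moreover have "keepT ?ne ?M1 M3" using 3 KE feq by (auto simp: keepT_def reg_defs q_def)
        ultimately show "?Q M3 V3" using keepT_trans[OF keep] by blast
      qed simp
      then show "ensures (Blk [SetC rBEST 0, Add rBEST rBEST rERR, SetC rBI (Suc i)] ;; Blk (copies rBV [1..<Suc l])) ?M1 V1 (3 + 2 * l) ?Q"
        using B(2) by (intro ensures_seq[where ?N1.0 = 3 and ?N2.0 = "2 * l"]) (simp_all add: reg_defs)
    qed simp
    then show ?thesis using B by (intro ensures_seq[where ?N1.0 = 1 and ?N2.0 = "4 + 2 * l"]) simp_all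
  qed
  have le: "at_steps d r ?\<phi> \<le> (\<Sum>\<phi>\<leftarrow>fs. at_steps d r \<phi>)"
    using i by (intro member_le_sum_list) auto
  have "ensures (For rCNT rFLAG (check_example ?\<phi>) ;; Blk [Sub rX rBEST rERR] ;;
     When rX (Blk [SetC rBEST 0, Add rBEST rBEST rERR, SetC rBI (Suc i)] ;; Blk (copies rBV [1..<Suc l]))) ?M V
     (length T * (?N + 5) + 1 + (5 + 2 * l)) ?Q"
    by (rule ensures_seq[OF ensures_mono[OF loop order_refl fin] order_refl])
  then have "ensures (try_formula i ?\<phi>) M V (5 + (length T * (?N + 5) + 1 + (5 + 2 * l))) ?Q"
    unfolding try_formula_def using ctx
    by (intro ensures_seq[where ?N1.0 = 5 and ?N2.0 = "length T * (?N + 5) + 1 + (5 + 2 * l)"])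
      (simp_all add: ctx_def reg_defs)
  then show ?thesis
  proof (rule ensures_mono)
    have "length T * (?N + 5) \<le> length T * (3 * k + 16 + (\<Sum>\<phi>\<leftarrow>fs. at_steps d r \<phi>))"
      using le by (intro mult_le_mono2) simp
    then show "5 + (length T * (?N + 5) + 1 + (5 + 2 * l)) \<le> try_steps d (length T)"
      by (simp add: try_steps_def)
  qed
qed

lemma try_all_correct:
  assumes "i + length \<phi>s = length fs" "\<phi>s = drop i fs" "vs \<in> tuples (univ A) l"
    "\<forall>j<l. M (Suc j) = code (vs ! j)" "ctx P nb ns M" "best S M"
  shows "ensures (try_all i \<phi>s) M V (length \<phi>s * try_steps d (length T))
    (\<lambda>M' V'. best (S \<union> {(j, vs) |j. i \<le> j \<and> j < length fs}) M' \<and> keepT (nb + length ns) M M')"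
  using assms
proof (induction \<phi>s arbitrary: i M V S)
  case Nil
  have eq: "S \<union> {(j, vs) |j. i \<le> j \<and> j < length fs} = S" using Nil(1) by auto
  show ?case unfolding eq using Nil by (simp add: keepT_def)
next
  case (Cons \<phi> \<phi>s)
  have i: "i < length fs" using Cons.prems(1) by simp
  have "\<phi> # \<phi>s = fs ! i # drop (Suc i) fs" using Cons.prems(2) Cons_nth_drop_Suc[OF i] by metis
  then have phi: "\<phi> = fs ! i" and rest: "\<phi>s = drop (Suc i) fs" by auto
  show ?case unfolding try_all.simps
  proof (rule ensures_seq[OF ensures_mono[OF _ order_refl]])
    show "ensures (try_formula i \<phi>) M V (try_steps d (length T))
      (\<lambda>M' V'. best (insert (i, vs) S) M' \<and> keepT (nb + length ns) M M')"
      unfolding phi by (rule try_formula_correct[OF i Cons.prems(3-6)])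
    fix M1 V1 assume 1: "best (insert (i, vs) S) M1 \<and> keepT (nb + length ns) M M1"
    have v: "\<forall>j<l. M1 (Suc j) = code (vs ! j)" using 1 Cons.prems(4) by (simp add: keepT_def)
    have c: "ctx P nb ns M1" using keepT_ctx[OF Cons.prems(5)] 1 by blast
    have eq: "insert (i, vs) S \<union> {(j, vs) |j. Suc i \<le> j \<and> j < length fs} = S \<union> {(j, vs) |j. i \<le> j \<and> j < length fs}"
    proof -
      have "{(j, vs) |j. i \<le> j \<and> j < length fs} = insert (i, vs) {(j, vs) |j. Suc i \<le> j \<and> j < length fs}"
        using i by (auto simp: Suc_le_eq order.order_iff_strict)
      then show ?thesis by auto
    qed
    show "ensures (try_all (Suc i) \<phi>s) M1 V1 (length \<phi>s * try_steps d (length T))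
      (\<lambda>M' V'. best (S \<union> {(j, vs) |j. i \<le> j \<and> j < length fs}) M' \<and> keepT (nb + length ns) M M')"
    proof (rule ensures_mono[OF Cons.IH order_refl])
      show "Suc i + length \<phi>s = length fs" using Cons.prems(1) by simp
      show "\<phi>s = drop (Suc i) fs" by (rule rest)
      show "best (insert (i, vs) S) M1" using 1 by blast
      fix M' V' assume "best (insert (i, vs) S \<union> {(j, vs) |j. Suc i \<le> j \<and> j < length fs}) M' \<and> keepT (nb + length ns) M1 M'"
      then show "best (S \<union> {(j, vs) |j. i \<le> j \<and> j < length fs}) M' \<and> keepT (nb + length ns) M M'"
        using 1 keepT_trans unfolding eq by blast
    qed (use Cons.prems(3) v c in auto)
  qed simp
qed

lemma search_correct:
  assumes ctx: "ctx P nb ns M" and ns: "set ns \<subseteq> code ` univ A"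
  shows "ensures search M V (search_steps d (length ns) (length T))
    (\<lambda>M' V'. best {(i, vs). i < length fs \<and> vs \<in> tuples (univ A) l \<and> map code vs \<in> tuples (set ns) l} M')"
proof -
  let ?S = "\<lambda>P. {(i, vs). i < length fs \<and> vs \<in> tuples (univ A) l \<and> map code vs \<in> set P}"
  let ?Inv = "\<lambda>Ps M' V'. ctx P nb ns M' \<and> best (?S Ps) M'"
  let ?M = "M(rBEST := Suc (length T), rBI := 0)"
  let ?regs = "map (\<lambda>i. rF + 4 * i) [0..<l]"
  have "ensures (ForTup rNB rNE rF l (Blk (copies 1 ?regs) ;; try_all 0 fs)) ?M V
    (tup_steps (length ns) (2 * l + length fs * try_steps d (length T)) l) (?Inv (product_lists (replicate l ns)))"
  proof (rule ensures_ForTup[where b = nb])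
    show "rNB < rF" "rNE < rF" by (simp_all add: reg_defs)
    have "ctx P nb ns ?M" by (rule keepT_ctx[OF ctx]) (auto simp: keepT_def reg_defs q_def K_def)
    then show "?Inv [] ?M V" by (simp add: best_def reg_defs)
    show "?Inv Ps M' V1" if "?Inv Ps M1 V1" "\<forall>j. j < rF \<or> rF + 4 * l \<le> j \<longrightarrow> M' j = M1 j" for Ps M1 V1 M'
    proof
      have *: "M' j = M1 j" if j: "j < rF \<or> K \<le> j" for j
      proof -
        have "j < rF \<or> rF + 4 * l \<le> j" using j by (auto simp: K_def fe_def)
        then show ?thesis using \<open>\<forall>j. j < rF \<or> rF + 4 * l \<le> j \<longrightarrow> M' j = M1 j\<close> by blast
      qed
      have c: "ctx P nb ns M1" using that by blast
      show "ctx P nb ns M'"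
        using c * unfolding ctx_def by (auto simp: reg_defs elim!: hlist_cong)
      show "best (?S Ps) M'"
        by (rule best_cong[of _ M1]) (use that * in \<open>auto simp: reg_defs\<close>)
    qed
    show "M1 rNB = nb \<and> M1 rNE = nb + length ns \<and> hlist M1 nb ns" if "?Inv Ps M1 V1" for Ps M1 V1
      using that by (simp add: ctx_def)
    fix Ps cs M1 V1 assume cs: "cs \<in> tuples (set ns) l" and I: "?Inv Ps M1 V1" and r: "\<forall>i<l. M1 (rF + 4 * i) = cs ! i"
    obtain vs where vs: "vs \<in> tuples (univ A) l" "cs = map code vs"
    proof -
      have "set cs \<subseteq> code ` univ A" using cs ns by (auto simp: tuples_def)
      then have "map (inv_into (univ A) code) cs \<in> tuples (univ A) l"
        "cs = map code (map (inv_into (univ A) code) cs)"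
        using cs by (auto simp: tuples_def subset_iff inv_into_into f_inv_into_f intro!: map_idI[symmetric])
      then show thesis by (rule that)
    qed
    show "ensures (Blk (copies 1 ?regs) ;; try_all 0 fs) M1 V1 (2 * l + length fs * try_steps d (length T))
      (\<lambda>M' V'. ?Inv (Ps @ [cs]) M' V' \<and> (\<forall>j. rF \<le> j \<and> j < rF + 4 * l \<longrightarrow> M' j = M1 j))"
    proof (rule ensures_seq[OF ensures_mono[OF ensures_copies_disjoint order_refl]])
      show "\<forall>a\<in>set ?regs. a < 1 \<or> 1 + length ?regs \<le> a" by (auto simp: reg_defs q_def)
      fix M2 V2 assume 2: "V2 = V1 \<and> (\<forall>i<length ?regs. M2 (1 + i) = M1 (?regs ! i)) \<and>
        (\<forall>j. j < 1 \<or> 1 + length ?regs \<le> j \<longrightarrow> M2 j = M1 j)"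
      have v: "\<forall>j<l. M2 (Suc j) = code (vs ! j)" using 2 r vs by (auto simp: tuples_def)
      have high: "M2 j = M1 j" if "l < j" for j using 2 that by auto
      have c: "ctx P nb ns M2"
        using I high unfolding ctx_def by (auto simp: reg_defs q_def K_def elim!: hlist_cong)
      have b: "best (?S Ps) M2" by (rule best_cong[of _ M1]) (use I high in \<open>auto simp: reg_defs q_def\<close>)
      \<comment> \<open>As \<open>code\<close> is injective, a tuple of codes comes from one tuple
        of elements only, and a pass through \<open>try_all\<close> adds precisely the hypotheses
        with these parameters.\<close>
      have eq: "?S Ps \<union> {(j, vs) |j. 0 \<le> j \<and> j < length fs} = ?S (Ps @ [cs])"
      proof -
        have "vs' = vs" if "vs' \<in> tuples (univ A) l" "map code vs' = map code vs" for vs'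
          using that vs(1) code_inj by (intro map_inj_on[OF that(2)]) (auto simp: tuples_def intro: inj_on_subset)
        then show ?thesis using vs by auto
      qed
      show "ensures (try_all 0 fs) M2 V2 (length fs * try_steps d (length T))
        (\<lambda>M' V'. ?Inv (Ps @ [cs]) M' V' \<and> (\<forall>j. rF \<le> j \<and> j < rF + 4 * l \<longrightarrow> M' j = M1 j))"
      proof (rule ensures_mono[OF try_all_correct[OF _ _ vs(1) v c b] order_refl])
        fix M3 V3 assume 3: "best (?S Ps \<union> {(j, vs) |j. 0 \<le> j \<and> j < length fs}) M3 \<and> keepT (nb + length ns) M2 M3"
        have "ctx P nb ns M3" using keepT_ctx[OF c] 3 by blast
        moreover have "\<forall>j. rF \<le> j \<and> j < rF + 4 * l \<longrightarrow> M3 j = M1 j"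
          using 3 high by (auto simp: keepT_def fe_def reg_defs q_def)
        ultimately show "?Inv (Ps @ [cs]) M3 V3 \<and> (\<forall>j. rF \<le> j \<and> j < rF + 4 * l \<longrightarrow> M3 j = M1 j)"
          using 3 unfolding eq by blast
      qed auto
    qed simp
  qed
  then have loop: "ensures (ForTup rNB rNE rF l (Blk (copies 1 ?regs) ;; try_all 0 fs)) ?M V
    (tup_steps (length ns) (2 * l + length fs * try_steps d (length T)) l)
    (\<lambda>M' V'. best {(i, vs). i < length fs \<and> vs \<in> tuples (univ A) l \<and> map code vs \<in> tuples (set ns) l} M')"
    by (rule ensures_mono) (auto simp: set_product_lists_replicate)
  show ?thesis unfolding search_def search_steps_def
  proof (rule ensures_seq[where ?N1.0 = 3])
    show "ensures (Blk [SetC rBEST 1, Add rBEST rBEST rT, SetC rBI 0]) M V 3 (\<lambda>M' V'.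
      ensures (ForTup rNB rNE rF l (Blk (copies 1 ?regs) ;; try_all 0 fs)) M' V'
    (tup_steps (length ns) (2 * l + length fs * try_steps d (length T)) l)
    (\<lambda>M' V'. best {(i, vs). i < length fs \<and> vs \<in> tuples (univ A) l \<and> map code vs \<in> tuples (set ns) l} M'))"
      using loop ctx by (simp add: ctx_def reg_defs)
  qed simp
qed

end

section \<open>Empirical risk minimisation\<close>

lemma nn_integral_replicate_pmf_Suc:
  "(\<integral>\<^sup>+T. h T \<partial>replicate_pmf (Suc m) D) = (\<integral>\<^sup>+x. \<integral>\<^sup>+T. h (x # T) \<partial>replicate_pmf m D \<partial>D)"
  by (simp add: nn_integral_bind_pmf)

text \<open>Hoeffding's bound by the exponential moment method with parameter
  \<open>\<epsilon>\<close> itself. For values in an interval of length 2, Hoeffding's lemma bounds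
  the centred moment by \<open>exp (\<epsilon>\<^sup>2 / 2)\<close>, and the mean contributes at
  most \<open>exp (- \<epsilon>\<^sup>2)\<close>. Independence enters through the recursion of
  \<open>replicate_pmf\<close>.\<close>

lemma prob_sum_nonpos:
  fixes Z :: "'x \<Rightarrow> real" and \<epsilon> :: real
  assumes Z: "\<And>x. Z x \<in> {-1..1}" and mean: "measure_pmf.expectation D Z \<ge> \<epsilon>" and "\<epsilon> > 0"
  shows "measure_pmf.prob (replicate_pmf t D) {T. (\<Sum>x\<leftarrow>T. Z x) \<le> 0} \<le> exp (- (real t * \<epsilon>\<^sup>2 / 2))"
proof -
  interpret interval_bounded_random_variable "measure_pmf D" "\<lambda>x. - Z x" "-1" 1
    using Z by unfold_locales (auto simp: AE_measure_pmf_iff)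
  let ?mu = "measure_pmf.expectation D Z"
  have one: "(\<integral>\<^sup>+x. ennreal (exp (\<epsilon> * - Z x)) \<partial>D) \<le> ennreal (exp (- \<epsilon>\<^sup>2 / 2))"
  proof -
    have "(\<integral>\<^sup>+x. ennreal (exp (\<epsilon> * (- Z x - measure_pmf.expectation D (\<lambda>x. - Z x)))) \<partial>D) \<le>
      ennreal (exp (\<epsilon>\<^sup>2 * (1 - (-1))\<^sup>2 / 8))"
      using Hoeffdings_lemma_nn_integral[OF \<open>\<epsilon> > 0\<close>] by simp
    also have "\<epsilon>\<^sup>2 * (1 - (-1))\<^sup>2 / 8 = \<epsilon>\<^sup>2 / 2" by simp
    finally have H: "(\<integral>\<^sup>+x. ennreal (exp (\<epsilon> * (- Z x + ?mu))) \<partial>D) \<le> ennreal (exp (\<epsilon>\<^sup>2 / 2))" by simp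
    have "(\<integral>\<^sup>+x. ennreal (exp (\<epsilon> * - Z x)) \<partial>D) =
      (\<integral>\<^sup>+x. ennreal (exp (- \<epsilon> * ?mu)) * ennreal (exp (\<epsilon> * (- Z x + ?mu))) \<partial>D)"
      by (intro nn_integral_cong) (simp add: ennreal_mult[symmetric] exp_add[symmetric] algebra_simps)
    also have "\<dots> = ennreal (exp (- \<epsilon> * ?mu)) * (\<integral>\<^sup>+x. ennreal (exp (\<epsilon> * (- Z x + ?mu))) \<partial>D)"
      by (rule nn_integral_cmult) simp
    also have "\<dots> \<le> ennreal (exp (- \<epsilon> * ?mu)) * ennreal (exp (\<epsilon>\<^sup>2 / 2))"
      by (rule mult_left_mono[OF H]) simp
    also have "\<dots> = ennreal (exp (- \<epsilon> * ?mu + \<epsilon>\<^sup>2 / 2))" by (simp add: ennreal_mult[symmetric] exp_add[symmetric])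
    also have "\<dots> \<le> ennreal (exp (- \<epsilon>\<^sup>2 / 2))"
    proof (intro ennreal_leI, unfold exp_le_cancel_iff)
      have "\<epsilon> * \<epsilon> \<le> \<epsilon> * ?mu" using mean \<open>\<epsilon> > 0\<close> by (intro mult_left_mono) auto
      then show "- \<epsilon> * ?mu + \<epsilon>\<^sup>2 / 2 \<le> - \<epsilon>\<^sup>2 / 2" by (simp add: power2_eq_square field_simps)
    qed
    finally show ?thesis .
  qed
  have all: "(\<integral>\<^sup>+T. ennreal (exp (- \<epsilon> * (\<Sum>x\<leftarrow>T. Z x))) \<partial>replicate_pmf t D) \<le> ennreal (exp (- \<epsilon>\<^sup>2 / 2)) ^ t"
  proof (induction t)
    case 0
    then show ?case by simp
  next
    case (Suc t)
    have "(\<integral>\<^sup>+T. ennreal (exp (- \<epsilon> * (\<Sum>x\<leftarrow>T. Z x))) \<partial>replicate_pmf (Suc t) D) =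
      (\<integral>\<^sup>+x. \<integral>\<^sup>+T. ennreal (exp (\<epsilon> * - Z x)) * ennreal (exp (- \<epsilon> * (\<Sum>x\<leftarrow>T. Z x))) \<partial>replicate_pmf t D \<partial>D)"
      unfolding nn_integral_replicate_pmf_Suc
      by (intro nn_integral_cong) (simp add: ennreal_mult[symmetric] exp_add[symmetric] algebra_simps)
    also have "\<dots> = (\<integral>\<^sup>+x. ennreal (exp (\<epsilon> * - Z x)) *
        (\<integral>\<^sup>+T. ennreal (exp (- \<epsilon> * (\<Sum>x\<leftarrow>T. Z x))) \<partial>replicate_pmf t D) \<partial>D)"
      by (intro nn_integral_cong nn_integral_cmult) simp
    also have "\<dots> = (\<integral>\<^sup>+x. ennreal (exp (\<epsilon> * - Z x)) \<partial>D) *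
        (\<integral>\<^sup>+T. ennreal (exp (- \<epsilon> * (\<Sum>x\<leftarrow>T. Z x))) \<partial>replicate_pmf t D)"
      by (rule nn_integral_multc) simp
    also have "\<dots> \<le> ennreal (exp (- \<epsilon>\<^sup>2 / 2)) * ennreal (exp (- \<epsilon>\<^sup>2 / 2)) ^ t"
      by (intro mult_mono one Suc.IH) auto
    finally show ?case by simp
  qed
  have "emeasure (replicate_pmf t D) {T. (\<Sum>x\<leftarrow>T. Z x) \<le> 0} =
    (\<integral>\<^sup>+T. indicator {T. (\<Sum>x\<leftarrow>T. Z x) \<le> 0} T \<partial>replicate_pmf t D)" by simp
  \<comment> \<open>Markov's inequality in pointwise form: where the sum is non-positive, the
    exponential is at least 1.\<close>
  also have "\<dots> \<le> (\<integral>\<^sup>+T. ennreal (exp (- \<epsilon> * (\<Sum>x\<leftarrow>T. Z x))) \<partial>replicate_pmf t D)"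
    using \<open>\<epsilon> > 0\<close> by (intro nn_integral_mono)
      (auto simp: indicator_def mult_nonneg_nonpos intro: one_le_exp_iff[THEN iffD2])
  also have "\<dots> \<le> ennreal (exp (- \<epsilon>\<^sup>2 / 2)) ^ t" by (rule all)
  also have "\<dots> = ennreal (exp (- (real t * \<epsilon>\<^sup>2 / 2)))"
    by (simp add: ennreal_power exp_of_nat_mult[symmetric])
  finally show ?thesis by (simp add: measure_pmf.emeasure_eq_measure)
qed

definition mistakes :: "('x \<Rightarrow> bool) \<Rightarrow> ('x \<times> bool) list \<Rightarrow> nat" where
  "mistakes h T = length (filter (\<lambda>(x, b). h x \<noteq> b) T)"

lemma err_eq_expectation: "err D h = measure_pmf.expectation D (\<lambda>(x, b). of_bool (h x \<noteq> b))"
proof -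
  have "err D h = measure_pmf.expectation D (indicator {(x, b). h x \<noteq> b})"
    by (simp add: err_def)
  also have "indicator {(x, b). h x \<noteq> b} = (\<lambda>(x, b). of_bool (h x \<noteq> b) :: real)"
    by (auto simp: indicator_def fun_eq_iff)
  finally show ?thesis .
qed

text \<open>
  The union bound runs over the bad hypotheses only, each of which has to beat a fixed best hypothesis on the
  sample; so there is no additive term in the exponent if the class has at most two elements.
\<close>

lemma erm_agnostic:
  fixes H :: "('x \<Rightarrow> bool) set" and D :: "('x \<times> bool) pmf"
  assumes "finite H" "H \<noteq> {}" "\<epsilon> > 0"
    and out: "\<And>T. T \<in> set_pmf (replicate_pmf t D) \<Longrightarrow>
       \<exists>h\<in>H. out T h \<and> (\<forall>h'\<in>H. mistakes h T \<le> mistakes h' T)"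
    and bound: "real (card H - 1) * exp (- (real t * \<epsilon>\<^sup>2 / 2)) \<le> \<delta>"
  shows "measure_pmf.prob (replicate_pmf t D) {T. \<exists>h. out T h \<and> err D h \<le> (INF h'\<in>H. err D h') + \<epsilon>} \<ge> 1 - \<delta>"
proof -
  let ?G = "{T. \<exists>h. out T h \<and> err D h \<le> (INF h'\<in>H. err D h') + \<epsilon>}"
  let ?R = "replicate_pmf t D"
  obtain h0 where h0: "h0 \<in> H" "\<And>h. h \<in> H \<Longrightarrow> err D h0 \<le> err D h"
    using finite_has_minimal[of "err D ` H"] assms(1,2) by (metis (no_types, lifting) arg_min_if_finite(1,2) linorder_not_less)
  have inf: "(INF h'\<in>H. err D h') = err D h0"
  proof (rule antisym)
    show "(INF h'\<in>H. err D h') \<le> err D h0" using h0(1) assms(1) by (intro cINF_lower) auto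
    show "err D h0 \<le> (INF h'\<in>H. err D h')" using h0 assms(2) by (intro cINF_greatest) auto
  qed
  define Bad where "Bad = {h \<in> H. err D h > err D h0 + \<epsilon>}"
  let ?E = "\<lambda>h. {T. mistakes h T \<le> mistakes h0 T}"
  have E: "measure_pmf.prob ?R (?E h) \<le> exp (- (real t * \<epsilon>\<^sup>2 / 2))" if "h \<in> Bad" for h
  proof -
    \<comment> \<open>The difference of the losses of \<open>h\<close> and the optimal
      \<open>h0\<close> on one example. It lies in the interval from -1 to 1, and for a bad
      \<open>h\<close> its mean exceeds \<open>\<epsilon>\<close>.\<close>
    let ?Z = "\<lambda>(x, b). of_bool (h x \<noteq> b) - of_bool (h0 x \<noteq> b) :: real"
    have "(\<Sum>x\<leftarrow>T. ?Z x) = real (mistakes h T) - real (mistakes h0 T)" for T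
      by (induction T) (auto simp: mistakes_def)
    then have "?E h = {T. (\<Sum>x\<leftarrow>T. ?Z x) \<le> 0}" by auto
    moreover have "measure_pmf.expectation D ?Z = err D h - err D h0"
    proof -
      have int: "integrable D (\<lambda>(x, b). of_bool (g x \<noteq> b) :: real)" for g
        by (rule measure_pmf.integrable_const_bound[where B = 1]) (auto simp: AE_measure_pmf_iff)
      have "measure_pmf.expectation D ?Z =
        measure_pmf.expectation D (\<lambda>y. (case y of (x, b) \<Rightarrow> of_bool (h x \<noteq> b)) - (case y of (x, b) \<Rightarrow> of_bool (h0 x \<noteq> b)))"
        by (rule Bochner_Integration.integral_cong) auto
      also have "\<dots> = err D h - err D h0"
        unfolding err_eq_expectation by (rule Bochner_Integration.integral_diff[OF int int])
      finally show ?thesis .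
    qed
    ultimately show ?thesis
      using prob_sum_nonpos[of ?Z \<epsilon> D t] that assms(3) by (auto simp: Bad_def split: prod.splits)
  qed
  have "finite Bad" "Bad \<subseteq> H - {h0}" using assms(1,3) by (auto simp: Bad_def)
  then have cardBad: "card Bad \<le> card H - 1" using card_mono[of "H - {h0}" Bad] assms(1) h0(1) by simp
  \<comment> \<open>If no good hypothesis is output, the one provided by \<open>out\<close> is bad,
    yet makes no more mistakes than \<open>h0\<close>. The inclusion holds only almost everywhere,
    since \<open>out\<close> is known only on samples in the support.\<close>
  have "measure_pmf.prob ?R (- ?G) \<le> measure_pmf.prob ?R (\<Union>h\<in>Bad. ?E h)"
  proof (rule measure_pmf.finite_measure_mono_AE)
    show "AE T in ?R. T \<in> - ?G \<longrightarrow> T \<in> (\<Union>h\<in>Bad. ?E h)"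
      unfolding AE_measure_pmf_iff
    proof (intro ballI impI)
      fix T assume T: "T \<in> set_pmf ?R" "T \<in> - ?G"
      obtain h where h: "h \<in> H" "out T h" "\<forall>h'\<in>H. mistakes h T \<le> mistakes h' T" using out[OF T(1)] by blast
      then have "\<not> err D h \<le> err D h0 + \<epsilon>" using T(2) inf by auto
      then show "T \<in> (\<Union>h\<in>Bad. ?E h)" using h h0(1) by (auto simp: Bad_def)
    qed
  qed simp
  also have "\<dots> \<le> (\<Sum>h\<in>Bad. measure_pmf.prob ?R (?E h))"
    by (rule measure_pmf.finite_measure_subadditive_finite) (use \<open>finite Bad\<close> in auto)
  also have "\<dots> \<le> real (card Bad) * exp (- (real t * \<epsilon>\<^sup>2 / 2))"
    using sum_mono[of Bad "\<lambda>h. measure_pmf.prob ?R (?E h)" "\<lambda>_. exp (- (real t * \<epsilon>\<^sup>2 / 2))"] E by simp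
  also have "\<dots> \<le> real (card H - 1) * exp (- (real t * \<epsilon>\<^sup>2 / 2))"
    using cardBad by (intro mult_right_mono) auto
  also have "\<dots> \<le> \<delta>" by (rule bound)
  finally have "measure_pmf.prob ?R (- ?G) \<le> \<delta>" .
  moreover have "measure_pmf.prob ?R (- ?G) = 1 - measure_pmf.prob ?R ?G"
    using measure_pmf.prob_compl[of ?G ?R] by (simp add: Compl_eq_Diff_UNIV)
  ultimately show ?thesis by simp
qed

text \<open>Of the factor \<open>2 * (c + l + 1)\<close>, the 2 cancels the one in the exponent,
  \<open>c\<close> absorbs the logarithm of the constant, \<open>l\<close> that of
  \<open>n ^ l\<close>, and 1 leaves \<open>\<delta>\<close>. Absorbing the constant needs the
  binary logarithm of \<open>n / \<delta>\<close> to be at least 1, which fails for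
  \<open>n = 1\<close> and \<open>\<delta>\<close> close to 1; there the assumption
  \<open>N \<le> 2\<close> steps in.\<close>

lemma hypotheses_bound:
  fixes N :: nat
  assumes n: "1 \<le> n" and d: "0 < \<delta>" "\<delta> < 1" and e: "0 < \<epsilon>"
    and card: "N \<le> c * n ^ l" "n = 1 \<Longrightarrow> N \<le> 2" and c: "1 \<le> c"
    and t: "t = sample_size (2 * (c + l + 1)) n \<epsilon> \<delta>"
  shows "real (N - 1) * exp (- (real t * \<epsilon>\<^sup>2 / 2)) \<le> \<delta>"
proof -
  let ?L = "log 2 (real n / \<delta>)"
  have "real n / \<delta> > 1" using n d by (simp add: field_simps)
  then have Lpos: "?L > 0" by simp
  have "real t \<ge> real (2 * (c + l + 1)) * (?L / \<epsilon>\<^sup>2)"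
  proof -
    have "?L / \<epsilon>\<^sup>2 \<le> real (nat \<lceil>?L / \<epsilon>\<^sup>2\<rceil>)" using Lpos e by (simp add: real_nat_ceiling_ge)
    then show ?thesis unfolding t sample_size_def of_nat_mult by (intro mult_left_mono) auto
  qed
  then have "real t * \<epsilon>\<^sup>2 / 2 \<ge> real (2 * (c + l + 1)) * (?L / \<epsilon>\<^sup>2) * \<epsilon>\<^sup>2 / 2"
    by (intro divide_right_mono mult_right_mono) auto
  moreover have "real (2 * (c + l + 1)) * (?L / \<epsilon>\<^sup>2) * \<epsilon>\<^sup>2 / 2 = real (c + l + 1) * ?L"
    using e by (simp add: field_simps)
  ultimately have A: "real t * \<epsilon>\<^sup>2 / 2 \<ge> real (c + l + 1) * ?L" by linarith
  have ln: "ln (real n / \<delta>) \<le> ?L"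
  proof -
    have "ln 2 \<le> (1::real)" using ln_2_less_1 by simp
    then show ?thesis using Lpos \<open>real n / \<delta> > 1\<close> by (simp add: log_def field_simps mult_le_cancel_left1)
  qed
  have ln0: "ln (real n / \<delta>) > 0" using \<open>real n / \<delta> > 1\<close> by simp
  show ?thesis
  proof (cases "n = 1")
    case True
    have "real (c + l + 1) * ?L \<ge> ?L" using Lpos by (simp add: mult_le_cancel_right1)
    then have "real t * \<epsilon>\<^sup>2 / 2 \<ge> ln (1 / \<delta>)" using A ln True by simp
    then have "exp (- (real t * \<epsilon>\<^sup>2 / 2)) \<le> exp (- ln (1 / \<delta>))" by simp
    also have "\<dots> = \<delta>" using d by (simp add: ln_div)
    finally have "exp (- (real t * \<epsilon>\<^sup>2 / 2)) \<le> \<delta>" .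
    moreover have "real (N - 1) \<le> 1" using card(2)[OF True] by simp
    ultimately show ?thesis
      by (meson exp_ge_zero mult_left_le_one_le of_nat_0_le_iff order_trans)
  next
    case False
    then have n2: "real n \<ge> 2" using n by simp
    have lnn: "ln (real n) \<le> ln (real n / \<delta>)" using n2 d by (intro ln_mono) (auto simp: field_simps)
    have "?L \<ge> log 2 2" using n2 d by (subst log_le_cancel_iff) (auto simp: field_simps)
    then have L1: "?L \<ge> 1" by simp
    have lnc: "ln (real c) \<le> real c * ?L"
    proof -
      have "ln (real c) \<le> real c" using ln_bound[of "real c"] c by simp
      also have "\<dots> \<le> real c * ?L" using L1 by (simp add: mult_le_cancel_left1)
      finally show ?thesis .
    qed
    have "real (N - 1) \<le> real c * real n ^ l"
      using card(1) by (metis diff_le_self le_trans of_nat_le_iff of_nat_mult of_nat_power)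
    also have "\<dots> = exp (ln (real c) + real l * ln (real n))"
      using c n2 by (simp add: exp_add exp_of_nat_mult)
    finally have "real (N - 1) * exp (- (real t * \<epsilon>\<^sup>2 / 2)) \<le>
      exp (ln (real c) + real l * ln (real n)) * exp (- (real t * \<epsilon>\<^sup>2 / 2))"
      by (intro mult_right_mono) auto
    also have "\<dots> = exp (ln (real c) + real l * ln (real n) - real t * \<epsilon>\<^sup>2 / 2)"
      by (simp add: exp_add[symmetric])
    also have "\<dots> \<le> exp (- ln (real n / \<delta>))"
    proof (unfold exp_le_cancel_iff)
      have "real l * ln (real n) \<le> real l * ?L" using lnn ln by (intro mult_left_mono) auto
      then have "ln (real c) + real l * ln (real n) \<le> real (c + l) * ?L" using lnc by (simp add: algebra_simps)
      moreover have "real (c + l + 1) * ?L = real (c + l) * ?L + ?L" by (simp add: algebra_simps)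
      ultimately show "ln (real c) + real l * ln (real n) - real t * \<epsilon>\<^sup>2 / 2 \<le> - ln (real n / \<delta>)"
        using A ln by linarith
    qed
    also have "\<dots> = \<delta> / real n" using d n2 by (simp add: ln_div exp_diff)
    also have "\<dots> \<le> \<delta>" using d n2 by (simp add: field_simps)
    finally show ?thesis .
  qed
qed

section \<open>Moving the input out of the low cells\<close>

fun saves :: "nat \<Rightarrow> nat \<Rightarrow> 'v instr list" where
  "saves j 0 = []"
| "saves j (Suc m) = Add 0 0 1 # Store 0 j # saves (Suc j) m"

context machine
begin

lemma ensures_double:
  "ensures (Blk (replicate w (Add 0 0 0))) M V w
    (\<lambda>M' V'. M' 0 = 2 ^ w * M 0 \<and> (\<forall>a. a \<noteq> 0 \<longrightarrow> M' a = M a))"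
proof (induction w arbitrary: M)
  case (Suc w)
  have "ensures (Blk (replicate w (Add 0 0 0))) (M(0 := M 0 + M 0)) V w
    (\<lambda>M' V'. M' 0 = 2 ^ Suc w * M 0 \<and> (\<forall>a. a \<noteq> 0 \<longrightarrow> M' a = M a))"
    by (rule ensures_mono[OF Suc.IH order_refl]) (auto simp: algebra_simps)
  then show ?case by simp
qed simp

text \<open>Cell 0 serves as a moving write pointer and cell 1 holds the constant 1; no other cell
  can be spared while the input is still in place.\<close>

lemma ensures_saves:
  assumes "M 1 = 1" "2 \<le> j" "j + m \<le> M 0 + 1"
  shows "ensures (Blk (saves j m)) M V (2 * m)
    (\<lambda>M' V'. V' = V \<and> M' 0 = M 0 + m \<and> (\<forall>i<m. M' (M 0 + 1 + i) = M (j + i)) \<and>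
       (\<forall>a. a \<noteq> 0 \<and> (a \<le> M 0 \<or> M 0 + m < a) \<longrightarrow> M' a = M a))"
  using assms
proof (induction m arbitrary: j M)
  case (Suc m)
  let ?M = "M(0 := Suc (M 0), Suc (M 0) := M j)"
  have "ensures (Blk (saves (Suc j) m)) ?M V (2 * m)
    (\<lambda>M' V'. V' = V \<and> M' 0 = M 0 + Suc m \<and> (\<forall>i<Suc m. M' (M 0 + 1 + i) = M (j + i)) \<and>
       (\<forall>a. a \<noteq> 0 \<and> (a \<le> M 0 \<or> M 0 + Suc m < a) \<longrightarrow> M' a = M a))"
  proof (rule ensures_mono[OF Suc.IH order_refl])
    fix M' V' assume *: "V' = V \<and> M' 0 = ?M 0 + m \<and> (\<forall>i<m. M' (?M 0 + 1 + i) = ?M (Suc j + i)) \<and>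
       (\<forall>a. a \<noteq> 0 \<and> (a \<le> ?M 0 \<or> ?M 0 + m < a) \<longrightarrow> M' a = ?M a)"
    have "M' (M 0 + 1 + i) = M (j + i)" if "i < Suc m" for i
    proof (cases i)
      case 0
      then show ?thesis using * Suc.prems by auto
    next
      case (Suc i')
      then have "M' (?M 0 + 1 + i') = ?M (Suc j + i')" using * that by blast
      then show ?thesis using Suc Suc.prems that by auto
    qed
    then show "V' = V \<and> M' 0 = M 0 + Suc m \<and> (\<forall>i<Suc m. M' (M 0 + 1 + i) = M (j + i)) \<and>
       (\<forall>a. a \<noteq> 0 \<and> (a \<le> M 0 \<or> M 0 + Suc m < a) \<longrightarrow> M' a = M a)"
      using * by auto
  qed (use Suc.prems in auto)
  then show ?case using Suc.prems by simp
qed simp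

text \<open>Division by repeated subtraction. It recovers the sample size from the pointer into
  which it was turned by doubling.\<close>

lemma ensures_divide:
  assumes "distinct [a, x, c, fl]" "0 < w" "M c = w * Suc m"
  shows "ensures (Until fl (Blk [SetC x w, Sub c c x, SetC x 1, Add a a x, SetC fl 1, Sub fl fl c])) M V
    (7 * Suc m) (\<lambda>M' V'. M' a = M a + Suc m \<and> (\<forall>j. j \<notin> {a, x, c, fl} \<longrightarrow> M' j = M j))"
  using assms(3)
proof (induction m arbitrary: M)
  case 0
  have "ensures (Until fl (Blk [SetC x w, Sub c c x, SetC x 1, Add a a x, SetC fl 1, Sub fl fl c])) M V
    (Suc (6 + 0)) (\<lambda>M' V'. M' a = M a + Suc 0 \<and> (\<forall>j. j \<notin> {a, x, c, fl} \<longrightarrow> M' j = M j))"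
    by (rule ensures_Until) (use assms(1,2) 0 in auto)
  then show ?case by simp
next
  case (Suc m)
  let ?c = "Until fl (Blk [SetC x w, Sub c c x, SetC x 1, Add a a x, SetC fl 1, Sub fl fl c])"
  let ?Q = "\<lambda>M' V'. M' a = M a + Suc (Suc m) \<and> (\<forall>j. j \<notin> {a, x, c, fl} \<longrightarrow> M' j = M j)"
  have "ensures ?c M V (Suc (6 + 7 * Suc m)) ?Q"
  proof (rule ensures_Until)
    let ?M = "M(x := 1, c := w * Suc m, a := Suc (M a), fl := 0)"
    have IH: "ensures ?c ?M V (7 * Suc m) (\<lambda>M' V'. M' a = ?M a + Suc m \<and> (\<forall>j. j \<notin> {a, x, c, fl} \<longrightarrow> M' j = ?M j))"
      by (rule Suc.IH) (use assms(1) in auto)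
    have Q: "ensures ?c ?M V (7 * Suc m) ?Q" by (rule ensures_mono[OF IH]) (use assms(1) in auto)
    have run: "ensures (Blk [SetC x w, Sub c c x, SetC x 1, Add a a x, SetC fl 1, Sub fl fl c]) M V 6
      (\<lambda>M' V'. M' = ?M \<and> V' = V)"
      using assms(1,2) Suc.prems by (auto simp: fun_eq_iff)
    show "ensures (Blk [SetC x w, Sub c c x, SetC x 1, Add a a x, SetC fl 1, Sub fl fl c]) M V 6
      (\<lambda>M' V'. if M' fl = 0 then ensures ?c M' V' (7 * Suc m) ?Q else ?Q M' V')"
      by (rule ensures_mono[OF run order_refl]) (use Q in simp)
  qed
  then show ?case by simp
qed

end

context layout
begin

text \<open>Chosen such that \<open>2 ^ w0 * t\<close>, for \<open>t\<close> examples with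
  \<open>0 < t\<close>, exceeds both the length of the sample and \<open>K\<close>. It depends on
  the formulas but not on the structure, so \<open>2 ^ w0\<close> is a constant in all running
  times.\<close>

definition "w0 = K + k + 2"

text \<open>
  At first there is no free register, as the input starts at address 0. Doubling the number of
  examples in place gives a pointer behind the input; saving the low cells there frees them.
\<close>

definition relocate :: "'v com" where
  "relocate =
     When 0 (Blk (replicate w0 (Add 0 0 0)) ;; Blk [Store 0 1, SetC 1 1] ;; Blk (saves 2 (K - 1)) ;;
       Blk [SetC rX (K - 1), Sub rIN 0 rX, SetC rX 1, Add rNE 0 rX, SetC rEP (Suc K),
            SetC rCNT 0, Add rCNT rCNT rIN] ;;
       For rCNT rFLAG (Blk [Load rX rEP, Store rNE rX, SetC rX 1, Add rEP rEP rX, Add rNE rNE rX]) ;;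
       Blk [SetC rT 0, SetC rCNT 0, Add rCNT rCNT rIN] ;;
       Until rFLAG (Blk [SetC rX (2 ^ w0), Sub rCNT rCNT rX, SetC rX 1, Add rT rT rX,
                         SetC rFLAG 1, Sub rFLAG rFLAG rCNT])) ;;
     Blk [SetC rX 1, Sub rX rX rNE] ;; When rX (Blk [SetC rIN K, SetC rNE K])"

text \<open>Both learners minimise the number of errors. The exact one replaces its answer by 0,
  that is rejection, if the minimum is not 0. As \<open>rBI\<close> holds the successor of an index,
  it is already in output format.\<close>

definition learn :: "bool \<Rightarrow> 'v com" where
  "learn exact = relocate ;; candidates ;; search ;; Blk (copies 1 [rBV..<rBV + l]) ;;
     Blk [SetC 0 0, Add 0 0 rBI] ;; (if exact then When rBEST (Blk [SetC 0 0]) else Blk [])"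

text \<open>Each formula is compiled into its own piece of code, so an index known only at run time
  has to be compared with all of them. The cell \<open>rT\<close> holds the result.\<close>

fun dispatch :: "nat \<Rightarrow> 'v fml list \<Rightarrow> 'v com" where
  "dispatch i [] = Blk []"
| "dispatch i (\<phi> # \<phi>s) =
     Blk [SetC rX i, Sub rY 0 rX, Sub rX rX 0, Add rX rX rY, SetC rY 1, Sub rX rY rX] ;;
     When rX (eval_hyp \<phi> ;; Blk [SetC rT 0, Add rT rT (fe + 4)]) ;; dispatch (Suc i) \<phi>s"

definition evaluate :: "'v com" where
  "evaluate = Blk [SetC rNE K] ;; dispatch 0 fs ;;
     Blk [SetC rX 1, Sub rX rX rT, SetC rY 1, Sub 0 rY rX]"

definition relocate_steps :: "nat \<Rightarrow> nat" where
  "relocate_steps t = w0 + 2 * K + 20 + 10 * (2 ^ w0 * t) + 7 * t"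

definition cand_bound :: "nat \<Rightarrow> nat \<Rightarrow> nat" where
  "cand_bound d t = (1 + t * k) * (d + 1) ^ (l * (2 * r + 2))"

definition cand_steps :: "nat \<Rightarrow> nat \<Rightarrow> nat" where
  "cand_steps d t = 10 + (t * (5 * k + 7) + 1) + l * (2 * r + 2) * (17 * cand_bound d t + 6)"

definition learn_steps :: "nat \<Rightarrow> nat \<Rightarrow> nat" where
  "learn_steps d t = relocate_steps t + cand_steps d t + search_steps d (cand_bound d t) t + 2 * l + 4"

definition evaluate_steps :: "nat \<Rightarrow> nat" where
  "evaluate_steps d = length fs * (9 + (\<Sum>\<phi>\<leftarrow>fs. at_steps d r \<phi>)) + 5"

end

section \<open>Correctness of the learner and the evaluator\<close>

context learner
begin

definition entries :: "nat set" where
  "entries = (\<Union>(as, b)\<in>set T. set as)"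

lemma entries_univ: "entries \<subseteq> univ A"
  using sample by (auto simp: entries_def samples_def tuples_def)

lemma entries_tuples: "(as, b) \<in> set T \<Longrightarrow> as \<in> tuples entries k"
  using sample by (auto simp: entries_def samples_def tuples_def)

definition e0 :: nat where "e0 = inv_into (univ A) code 0"

lemma e0: "e0 \<in> univ A" "code e0 = 0"
proof -
  have "finite (univ A)" "univ A \<noteq> {}" using struct by (auto simp: is_structure_def)
  then have "0 \<in> code ` univ A" by (simp add: code_image card_gt_0_iff)
  then show "e0 \<in> univ A" "code e0 = 0" by (auto simp: e0_def inv_into_into f_inv_into_f)
qed

lemma candidates_correct:
  assumes M: "M rT = length T" "M rIN = P" "M rNE = nb" "hlist M P inp" "P + length inp \<le> nb" "K \<le> P"
  shows "ensures candidates M V (cand_steps d (length T))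
    (\<lambda>M' V'. \<exists>ns. ctx P nb ns M' \<and> length ns \<le> cand_bound d (length T) \<and>
       set ns = code ` nbhd_set A (l * (2 * r + 2)) (insert e0 entries))"
proof -
  let ?t = "length T"
  let ?R = "l * (2 * r + 2)"
  define xs where "xs i = 0 # concat (map (\<lambda>(as, b). map code as) (take i T))" for i
  have KE: "fe + 15 \<le> K" by (simp add: K_def)
  have reg: "rT < fe" "rIN < fe" "rNB < fe" "rNE < fe" "rCNT < fe" "rFLAG < fe" "rEP < fe" "rX < fe"
    "distinct [rT, rIN, rNB, rNE, rCNT, rFLAG, rEP, rX]" by (simp_all add: reg_defs)
  have nb: "K \<le> nb" using M by simp
  have xsl: "length (xs i) = Suc (i * k)" if "i \<le> ?t" for i
  proof -
    have "sum_list (map (\<lambda>x. length (case x of (as, b) \<Rightarrow> map code as)) (take i T)) = sum_list (map (\<lambda>_. k) (take i T))"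
    proof (rule arg_cong[where f = sum_list], rule map_cong[OF refl])
      fix x assume "x \<in> set (take i T)"
      then have "x \<in> set T" by (rule in_set_takeD)
      then show "length (case x of (as, b) \<Rightarrow> map code as) = k"
        using sample by (auto simp: samples_def tuples_def)
    qed
    then show ?thesis using that by (simp add: xs_def length_concat comp_def sum_list_triv)
  qed
  define M1 where "M1 = M(rNB := 0, rNB := nb, rX := 0, nb := 0, rX := 1, rNE := Suc nb,
    rEP := 0, rEP := P, rCNT := 0, rCNT := ?t)"
  have M1r: "M1 rT = ?t" "M1 rIN = P" "M1 rNB = nb" "M1 nb = 0" "M1 rNE = Suc nb" "M1 rEP = P" "M1 rCNT = ?t"
    using M reg nb KE by (auto simp: M1_def)
  have M1h: "M1 j = M j" if "K \<le> j" "j < nb" for j using that reg KE by (auto simp: M1_def)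
  have init: "ensures (Blk [SetC rNB 0, Add rNB rNB rNE, SetC rX 0, Store rNE rX, SetC rX 1, Add rNE rNE rX,
          SetC rEP 0, Add rEP rEP rIN, SetC rCNT 0, Add rCNT rCNT rT]) M V 10 (\<lambda>M' V'. M' = M1 \<and> V' = V)"
  proof -
    have "nb \<notin> {rT, rIN, rNB, rNE, rCNT, rFLAG, rEP, rX}" using reg nb KE by auto
    then show ?thesis using M(1-3) by (simp add: M1_def reg_defs)
  qed
  let ?Inv = "\<lambda>i M' V'. M' rEP = P + i * Suc k \<and> M' rNE = nb + Suc (i * k) \<and> hlist M' nb (xs i) \<and>
    (\<forall>j<nb. j \<notin> {rNE, rEP, rX, rCNT, rFLAG} \<longrightarrow> M' j = M1 j)"
  have loop: "ensures (For rCNT rFLAG (Blk (appends rNE rEP rX k) ;; Blk [SetC rX 1, Add rEP rEP rX])) M1 V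
    (?t * (5 * k + 2 + 5) + 1) (?Inv ?t)"
  proof (rule ensures_For)
    show "?Inv 0 M1 V" using M1r by (simp add: xs_def hlist_def)
    show "?Inv i M' V1" if I: "?Inv i M2 V1" and eq: "\<forall>j. j \<noteq> rCNT \<longrightarrow> j \<noteq> rFLAG \<longrightarrow> M' j = M2 j" for i M2 V1 M'
    proof -
      have "hlist M' nb (xs i)" by (rule hlist_cong[of M2]) (use I eq reg nb KE in auto)
      then show ?thesis using I eq reg by auto
    qed
    fix i M2 V2 assume i: "i < ?t" and I: "?Inv i M2 V2" and cnt: "M2 rCNT = ?t - i"
    obtain as b where asb: "T ! i = (as, b)" by fastforce
    have len: "length as = k" using sample_entry[OF i asb] by simp
    have hl: "hlist M2 P inp"
      by (rule hlist_cong[OF M(4)]) (use I M1h M(5,6) reg KE in auto)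
    have ex: "\<forall>j<k. M2 (P + i * Suc k + j) = code (as ! j)" by (rule inp_example(1)[OF hl i asb])
    have le: "P + i * Suc k + k \<le> nb"
    proof -
      have "Suc i * Suc k \<le> ?t * Suc k" using i by (intro mult_le_mono1) simp
      then show ?thesis using M(5) inp_length by simp
    qed
    show "ensures (Blk (appends rNE rEP rX k) ;; Blk [SetC rX 1, Add rEP rEP rX]) M2 V2 (5 * k + 2)
      (\<lambda>M' V'. M' rCNT = ?t - i \<and> ?Inv (Suc i) M' V')"
    proof (rule ensures_seq[OF ensures_mono[OF ensures_appends order_refl]])
      show "rNE < M2 rEP" "rEP < M2 rEP" "rX < M2 rEP" "distinct [rNE, rEP, rX]" "M2 rEP + k \<le> M2 rNE"
        using I reg KE M(6) le by auto
      fix M3 V3 assume 3: "V3 = V2 \<and> M3 rEP = M2 rEP + k \<and> M3 rNE = M2 rNE + k \<and>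
        (\<forall>j<k. M3 (M2 rNE + j) = M2 (M2 rEP + j)) \<and> (\<forall>j<M2 rNE. j \<notin> {rNE, rEP, rX} \<longrightarrow> M3 j = M2 j)"
      let ?M = "M3(rX := 1, rEP := Suc (M3 rEP))"
      have "hlist ?M nb (xs i)"
        by (rule hlist_cong[of M2]) (use I 3 xsl[of i] i reg nb KE in auto)
      moreover have "hlist ?M (nb + length (xs i)) (map code as)"
        unfolding hlist_def
      proof (intro allI impI)
        fix j assume "j < length (map code as)"
        then have j: "j < k" using len by simp
        have "M3 (M2 rNE + j) = M2 (M2 rEP + j)" using 3 j by blast
        then have "M3 (nb + length (xs i) + j) = code (as ! j)" using I ex j xsl[of i] i by simp
        then show "?M (nb + length (xs i) + j) = map code as ! j" using j len reg nb KE by auto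
      qed
      moreover have "xs (Suc i) = xs i @ map code as" using i asb by (simp add: xs_def take_Suc_conv_app_nth)
      ultimately have "hlist ?M nb (xs (Suc i))" by (simp add: hlist_append)
      moreover have "?M j = M1 j" if "j < nb" "j \<notin> {rNE, rEP, rX, rCNT, rFLAG}" for j
        using that 3 I by auto
      moreover have "?M rCNT = ?t - i"
      proof -
        have "M2 rNE = nb + Suc (i * k)" using I by blast
        then have "rCNT < M2 rNE" using reg(5) nb KE by linarith
        moreover have "rCNT \<notin> {rNE, rEP, rX}" using reg(9) by auto
        ultimately have "M3 rCNT = M2 rCNT" using 3 by blast
        then show ?thesis using cnt reg(9) by auto
      qed
      moreover have "?M rEP = P + Suc i * Suc k" "?M rNE = nb + Suc (Suc i * k)"
      proof -
        have "M3 rEP = M2 rEP + k" "M3 rNE = M2 rNE + k" "M2 rEP = P + i * Suc k" "M2 rNE = nb + Suc (i * k)"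
          using 3 I by blast+
        then show "?M rEP = P + Suc i * Suc k" "?M rNE = nb + Suc (Suc i * k)" using reg(9) by auto
      qed
      ultimately have inv: "?M rCNT = ?t - i \<and> ?Inv (Suc i) ?M V3" by blast
      have run: "ensures (Blk [SetC rX 1, Add rEP rEP rX]) M3 V3 2 (\<lambda>M' V'. M' = ?M \<and> V' = V3)"
        using reg by auto
      show "ensures (Blk [SetC rX 1, Add rEP rEP rX]) M3 V3 2
        (\<lambda>M' V'. M' rCNT = ?t - i \<and> ?Inv (Suc i) M' V')"
      proof (rule ensures_mono[OF run order_refl])
        fix M' V' assume a: "M' = ?M \<and> V' = V3"
        show "M' rCNT = ?t - i \<and> ?Inv (Suc i) M' V'"
          unfolding a[THEN conjunct1] a[THEN conjunct2] by (rule inv)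
      qed
    qed simp
  qed (use reg M1r in auto)
  \<comment> \<open>The leading 0 is the code of \<open>e0\<close>. It is grown along with the
    entries of the sample, which is why \<open>cand_bound\<close> has the summand 1.\<close>
  have set_xs: "set (xs ?t) = code ` insert e0 entries"
    by (auto simp: xs_def entries_def e0 image_UN)
  have X: "insert e0 entries \<subseteq> univ A" using e0 entries_univ by auto
  have valid: "set (xs ?t) \<subseteq> {..<card (univ A)}"
    using X code_image unfolding set_xs by blast
  have bnd: "length (xs ?t) * (d + 1) ^ ?R \<le> cand_bound d ?t" by (simp add: xsl cand_bound_def)
  have fin: "ensures (grows rNB rNE fe ?R) M2 V2 (?R * (17 * cand_bound d ?t + 6))
    (\<lambda>M' V'. \<exists>ns. ctx P nb ns M' \<and> length ns \<le> cand_bound d ?t \<and>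
       set ns = code ` nbhd_set A ?R (insert e0 entries))" if I: "?Inv ?t M2 V2" for M2 V2
  proof (rule ensures_mono[OF ensures_grows[where b = nb and xs = "xs ?t"] order_refl])
    have r2: "M2 rNB = nb" "M2 rT = ?t" "M2 rIN = P" using I M1r reg nb KE by auto
    show "rNB < fe" "rNE < fe" "rNB \<noteq> rNE" "fe + 8 \<le> nb" using reg nb KE by auto
    show "M2 rNB = nb" "hlist M2 nb (xs ?t)" using r2 I by auto
    show "M2 rNE = nb + length (xs ?t)" using I xsl[of ?t] by simp
    show "set (xs ?t) \<subseteq> {..<card (univ A)}" "length (xs ?t) * (d + 1) ^ ?R \<le> cand_bound d ?t"
      by (fact valid, fact bnd)
    fix M3 V3 assume 3: "V3 = V2 \<and> M3 rNE = nb + length ((with_nbrs ^^ ?R) (xs ?t)) \<and>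
      hlist M3 nb ((with_nbrs ^^ ?R) (xs ?t)) \<and> (\<forall>j<nb. j \<noteq> rNE \<and> j \<notin> {fe..<fe + 8} \<longrightarrow> M3 j = M2 j)"
    have "hlist M3 P inp"
      by (rule hlist_cong[OF M(4)]) (use 3 I M1h M(5,6) reg KE in auto)
    moreover have "M3 rT = ?t" "M3 rIN = P" "M3 rNB = nb" using 3 r2 reg nb KE by auto
    ultimately have "ctx P nb ((with_nbrs ^^ ?R) (xs ?t)) M3" using 3 M(5,6) by (simp add: ctx_def)
    then show "\<exists>ns. ctx P nb ns M3 \<and> length ns \<le> cand_bound d ?t \<and>
       set ns = code ` nbhd_set A ?R (insert e0 entries)"
      using set_with_nbrs[OF X set_xs] funpow_with_nbrs(2)[OF valid, of ?R] bnd
      by (intro exI[of _ "(with_nbrs ^^ ?R) (xs ?t)"]) auto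
  qed
  have rest: "ensures (For rCNT rFLAG (Blk (appends rNE rEP rX k) ;; Blk [SetC rX 1, Add rEP rEP rX]) ;; grows rNB rNE fe ?R) M1 V
    (?t * (5 * k + 2 + 5) + 1 + ?R * (17 * cand_bound d ?t + 6))
    (\<lambda>M' V'. \<exists>ns. ctx P nb ns M' \<and> length ns \<le> cand_bound d ?t \<and>
       set ns = code ` nbhd_set A ?R (insert e0 entries))"
    by (rule ensures_seq[OF ensures_mono[OF loop order_refl fin] order_refl])
  show ?thesis unfolding candidates_def
  proof (rule ensures_seq[OF ensures_mono[OF init order_refl]])
    show "10 + (?t * (5 * k + 2 + 5) + 1 + ?R * (17 * cand_bound d ?t + 6)) \<le> cand_steps d ?t"
      by (simp add: cand_steps_def)
    fix M' V' assume "M' = M1 \<and> V' = V"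
    then show "ensures (For rCNT rFLAG (Blk (appends rNE rEP rX k) ;; Blk [SetC rX 1, Add rEP rEP rX]) ;; grows rNB rNE fe ?R) M' V'
    (?t * (5 * k + 2 + 5) + 1 + ?R * (17 * cand_bound d ?t + 6))
    (\<lambda>M' V'. \<exists>ns. ctx P nb ns M' \<and> length ns \<le> cand_bound d ?t \<and>
       set ns = code ` nbhd_set A ?R (insert e0 entries))" using rest by simp
  qed
qed

end

context learner
begin

definition input :: "nat \<Rightarrow> nat" where
  "input = write_list 0 (encode_sample code T) (\<lambda>_. 0)"

lemma input: "input 0 = length T" "\<And>a. a < length inp \<Longrightarrow> input (Suc a) = inp ! a"
  "\<And>a. length inp \<le> a \<Longrightarrow> input (Suc a) = 0"
  by (auto simp: input_def write_list_def encode_sample_def inp_def)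

text \<open>For a non-empty sample the copy starts at \<open>2 ^ w0 * length T\<close>, behind the
  input. The cells up to \<open>K\<close> are saved there before any register is used; afterwards an
  ordinary loop can copy the rest.\<close>

lemma relocate_correct:
  "ensures relocate input V (relocate_steps (length T))
    (\<lambda>M' V'. \<exists>P. M' rT = length T \<and> M' rIN = P \<and> hlist M' P inp \<and> P + length inp \<le> M' rNE \<and> K \<le> P)"
proof -
  let ?t = "length T"
  let ?P = "2 ^ w0 * ?t"
  have KE: "fe + 15 \<le> K" by (simp add: K_def)
  have reg: "rT < fe" "rIN < fe" "rNE < fe" "rCNT < fe" "rFLAG < fe" "rEP < fe" "rX < fe"
    "distinct [0, 1, rT, rIN, rNE, rCNT, rFLAG, rEP, rX]" "2 \<le> rX" "\<forall>x\<in>{rT, rIN, rNE, rCNT, rFLAG, rEP, rX}. 2 \<le> x"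
    by (auto simp: reg_defs q_def)
  let ?Q = "\<lambda>M' V'. M' rT = ?t \<and> M' rIN = ?P \<and> hlist M' ?P inp \<and> M' rNE = 2 * ?P + K"
  let ?div = "Until rFLAG (Blk [SetC rX (2 ^ w0), Sub rCNT rCNT rX, SetC rX 1, Add rT rT rX,
                         SetC rFLAG 1, Sub rFLAG rFLAG rCNT])"
  let ?loop = "For rCNT rFLAG (Blk [Load rX rEP, Store rNE rX, SetC rX 1, Add rEP rEP rX, Add rNE rNE rX])"
  let ?body = "Blk (replicate w0 (Add 0 0 0)) ;; Blk [Store 0 1, SetC 1 1] ;; Blk (saves 2 (K - 1)) ;;
       Blk [SetC rX (K - 1), Sub rIN 0 rX, SetC rX 1, Add rNE 0 rX, SetC rEP (Suc K),
            SetC rCNT 0, Add rCNT rCNT rIN] ;; ?loop ;;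
       Blk [SetC rT 0, SetC rCNT 0, Add rCNT rCNT rIN] ;; ?div"
  let ?N = "w0 + (2 + (2 * (K - 1) + (7 + ((?P * 10 + 1) + (3 + 7 * ?t)))))"
  \<comment> \<open>Both inequalities come from \<open>w0 < 2 ^ w0\<close>; they say that the input
    and the registers end before the copy begins.\<close>
  have big: "length inp < ?P" "K < ?P" if "?t \<noteq> 0"
  proof -
    have w: "w0 < 2 ^ w0" by (rule less_exp)
    have "length inp \<le> ?t * w0" unfolding inp_length w0_def by (intro mult_le_mono2) simp
    also have "\<dots> < ?t * 2 ^ w0" using w that by simp
    finally show "length inp < ?P" by (simp add: mult.commute)
    have "K < 2 ^ w0" using w by (simp add: w0_def)
    also have "2 ^ w0 \<le> ?P" using that by (cases T) simp_all
    finally show "K < ?P" .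
  qed
  have main: "ensures ?body input V ?N ?Q" if t: "?t \<noteq> 0"
  proof (rule ensures_seq[OF ensures_mono[OF ensures_double order_refl] order_refl])
    fix M1 V1 assume "M1 0 = 2 ^ w0 * input 0 \<and> (\<forall>a. a \<noteq> 0 \<longrightarrow> M1 a = input a)"
    then have M1: "M1 0 = ?P" "\<And>a. M1 (Suc a) = input (Suc a)" by (auto simp: input(1))
    \<comment> \<open>The first word of the sample is stored at the new place, which frees cell 1
      for the constant 1.\<close>
    define M2 where "M2 = M1(?P := M1 1, 1 := 1)"
    have P1: "1 < ?P" using big(2)[OF t] KE by linarith
    have in1: "M1 a = input a" if "0 < a" for a using M1(2)[of "a - 1"] that by simp
    have M2: "M2 0 = ?P" "M2 1 = 1" "M2 ?P = input 1" "\<And>a. 2 \<le> a \<Longrightarrow> a \<noteq> ?P \<Longrightarrow> M2 a = input a"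
      using P1 M1(1) in1 unfolding M2_def by auto
    have "ensures (Blk (saves 2 (K - 1)) ;;
       Blk [SetC rX (K - 1), Sub rIN 0 rX, SetC rX 1, Add rNE 0 rX, SetC rEP (Suc K),
            SetC rCNT 0, Add rCNT rCNT rIN] ;; ?loop ;;
       Blk [SetC rT 0, SetC rCNT 0, Add rCNT rCNT rIN] ;; ?div) M2 V1
       (2 * (K - 1) + (7 + ((?P * 10 + 1) + (3 + 7 * ?t)))) ?Q"
    proof (rule ensures_seq[OF ensures_mono[OF ensures_saves order_refl] order_refl])
      show "M2 1 = 1" "2 \<le> (2::nat)" "2 + (K - 1) \<le> M2 0 + 1" using big(2)[OF t] M2(1,2) KE by auto
      fix M3 V3 assume 3: "V3 = V1 \<and> M3 0 = M2 0 + (K - 1) \<and> (\<forall>i<K - 1. M3 (M2 0 + 1 + i) = M2 (2 + i)) \<and>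
         (\<forall>a. a \<noteq> 0 \<and> (a \<le> M2 0 \<or> M2 0 + (K - 1) < a) \<longrightarrow> M3 a = M2 a)"
      note P0 = M2(1)
      have 30: "M3 0 = ?P + (K - 1)" using 3 P0 by simp
      have saved: "M3 (?P + a) = input (Suc a)" if "a < K" for a
      proof (cases a)
        case 0
        have "M3 ?P = M2 ?P" using 3 P0 P1 by (metis le_refl less_nat_zero_code)
        then show ?thesis using 0 M2(3) by simp
      next
        case (Suc a')
        then have "a' < K - 1" using that by simp
        then have "M3 (M2 0 + 1 + a') = M2 (2 + a')" using 3 by blast
        moreover have "M2 (2 + a') = input (Suc a)"
          using Suc that big(2)[OF t] M2(4)[of "2 + a'"] by simp
        ultimately show ?thesis unfolding P0 using Suc by simp
      qed
      have kept: "M3 a = input a" if "K < a" "a < ?P" for a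
      proof -
        have "a \<noteq> 0" "a \<le> M2 0" using that P0 by auto
        then have "M3 a = M2 a" using 3 by blast
        then show ?thesis using that KE M2(4)[of a] by simp
      qed
      define N4 where "N4 = M3(rX := K - 1, rIN := M3 0 - (K - 1), rX := 1, rNE := M3 0 + 1, rEP := Suc K,
        rCNT := 0, rCNT := M3 0 - (K - 1))"
      have N4: "N4 rEP = Suc K" "N4 rNE = ?P + K" "N4 rIN = ?P" "N4 rCNT = ?P"
        unfolding N4_def using reg(8) 30 KE by auto
      have "\<forall>x\<in>{rT, rIN, rNE, rCNT, rFLAG, rEP, rX}. x < ?P \<and> x < K" using reg KE big(2)[OF t] by auto
      note regP = this
      \<comment> \<open>The loop runs \<open>2 ^ w0 * length T\<close> times, at least once for
        every remaining word. Reading past the end of the sample does no harm, as the invariant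
        speaks only of the first \<open>length inp\<close> cells of the copy.\<close>
      let ?Inv = "\<lambda>i M' V'. M' rEP = Suc K + i \<and> M' rNE = ?P + K + i \<and> M' rIN = ?P \<and>
        (\<forall>a<K + i. a < length inp \<longrightarrow> M' (?P + a) = input (Suc a)) \<and> (\<forall>a. K < a \<and> a < ?P \<longrightarrow> M' a = input a)"
      have loop: "ensures ?loop N4 V3 (?P * (5 + 5) + 1) (?Inv ?P)"
      proof (rule ensures_For[where Inv = ?Inv])
        show "?Inv 0 N4 V3"
        proof -
          have "N4 j = M3 j" if "K \<le> j" for j using that regP unfolding N4_def by auto
          then show ?thesis using saved kept N4 big(2)[OF t] by simp
        qed
        show "?Inv i M' V4" if I: "?Inv i M4 V4" and eq: "\<forall>j. j \<noteq> rCNT \<longrightarrow> j \<noteq> rFLAG \<longrightarrow> M' j = M4 j" for i M4 V4 M'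
        proof -
          have "M' j = M4 j" if "K \<le> j" for j using that eq regP by auto
          then show ?thesis using I eq reg big(2)[OF t] by auto
        qed
        fix i M4 V4 assume i: "i < ?P" and I: "?Inv i M4 V4" and cnt: "M4 rCNT = ?P - i"
        let ?v = "M4 (Suc K + i)"
        let ?M5 = "M4(rX := ?v, ?P + K + i := ?v, rX := 1, rEP := Suc K + Suc i, rNE := ?P + K + Suc i)"
        have ne: "?P + K + i \<notin> {rT, rIN, rNE, rCNT, rFLAG, rEP, rX}" "Suc K + i \<noteq> rX" using regP by fastforce+
        have run: "ensures (Blk [Load rX rEP, Store rNE rX, SetC rX 1, Add rEP rEP rX, Add rNE rNE rX]) M4 V4 5
          (\<lambda>M' V'. M' = ?M5 \<and> V' = V4)"
          using I ne by (simp add: reg_defs)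
        have hi: "?M5 j = (if j = ?P + K + i then ?v else M4 j)" if "K \<le> j" for j using that regP by auto
        have "?M5 (?P + a) = input (Suc a)" if a: "a < K + Suc i" "a < length inp" for a
        proof (cases "a = K + i")
          case True
          then have "?v = input (Suc a)" using I a big(1)[OF t] by auto
          then show ?thesis using True hi[of "?P + a"] by (simp add: add_ac)
        next
          case False
          then show ?thesis using I a hi[of "?P + a"] big(2)[OF t] by auto
        qed
        moreover have "?M5 a = input a" if "K < a" "a < ?P" for a using I that hi[of a] by auto
        moreover have "?M5 rCNT = ?P - i" "?M5 rIN = ?P" "?M5 rEP = Suc K + Suc i" "?M5 rNE = ?P + K + Suc i"
          using I cnt reg ne by auto
        ultimately have inv: "?M5 rCNT = ?P - i \<and> ?Inv (Suc i) ?M5 V4" by blast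
        show "ensures (Blk [Load rX rEP, Store rNE rX, SetC rX 1, Add rEP rEP rX, Add rNE rNE rX]) M4 V4 5
          (\<lambda>M' V'. M' rCNT = ?P - i \<and> ?Inv (Suc i) M' V')"
        proof (rule ensures_mono[OF run order_refl])
          fix M' V' assume a: "M' = ?M5 \<and> V' = V4"
          show "M' rCNT = ?P - i \<and> ?Inv (Suc i) M' V'"
            unfolding a[THEN conjunct1] a[THEN conjunct2] by (rule inv)
        qed
      next
        show "rCNT \<noteq> rFLAG" "N4 rCNT = ?P" using reg(8) N4(4) by auto
      qed
      have fin: "ensures (Blk [SetC rT 0, SetC rCNT 0, Add rCNT rCNT rIN] ;; ?div) M5 V5 (3 + 7 * ?t) ?Q"
        if I: "?Inv ?P M5 V5" for M5 V5
      proof -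
        let ?M6 = "M5(rT := 0, rCNT := ?P)"
        obtain t' where t': "?t = Suc t'" using t by (cases ?t) auto
        have hl: "hlist M5 ?P inp" unfolding hlist_def using I input(2) big(1)[OF t] by auto
        have "ensures ?div ?M6 V5 (7 * Suc t') (\<lambda>M' V'. M' rT = ?M6 rT + Suc t' \<and> (\<forall>j. j \<notin> {rT, rX, rCNT, rFLAG} \<longrightarrow> M' j = ?M6 j))"
          by (rule ensures_divide) (use reg t' in auto)
        then have "ensures ?div ?M6 V5 (7 * ?t) ?Q"
        proof (rule ensures_mono)
          fix M' V' assume 7: "M' rT = ?M6 rT + Suc t' \<and> (\<forall>j. j \<notin> {rT, rX, rCNT, rFLAG} \<longrightarrow> M' j = ?M6 j)"
          have "hlist M' ?P inp"
          proof (rule hlist_cong[OF hl])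
            fix j assume "?P \<le> j"
            then have "j \<notin> {rT, rX, rCNT, rFLAG}" using regP by auto
            then show "M' j = M5 j" using 7 by auto
          qed
          then show "?Q M' V'" using 7 I reg t' by auto
        qed (simp add: t')
        then show ?thesis using I reg
          by (intro ensures_seq[where ?N1.0 = 3 and ?N2.0 = "7 * ?t"]) auto
      qed
      have "ensures (Blk [SetC rX (K - 1), Sub rIN 0 rX, SetC rX 1, Add rNE 0 rX, SetC rEP (Suc K),
            SetC rCNT 0, Add rCNT rCNT rIN]) M3 V3 7 (\<lambda>M' V'. M' = N4 \<and> V' = V3)"
        by (simp add: N4_def reg_defs q_def)
      note set_regs = this
      show "ensures (Blk [SetC rX (K - 1), Sub rIN 0 rX, SetC rX 1, Add rNE 0 rX, SetC rEP (Suc K),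
            SetC rCNT 0, Add rCNT rCNT rIN] ;; ?loop ;;
            Blk [SetC rT 0, SetC rCNT 0, Add rCNT rCNT rIN] ;; ?div) M3 V3 (7 + ((?P * 10 + 1) + (3 + 7 * ?t))) ?Q"
      proof (rule ensures_seq[OF ensures_mono[OF set_regs order_refl] order_refl])
        fix M' V' assume eq: "M' = N4 \<and> V' = V3"
        show "ensures (?loop ;; Blk [SetC rT 0, SetC rCNT 0, Add rCNT rCNT rIN] ;; ?div) M' V' ((?P * 10 + 1) + (3 + 7 * ?t)) ?Q"
          unfolding eq[THEN conjunct1] eq[THEN conjunct2]
        proof (rule ensures_seq[OF ensures_mono[OF loop] order_refl])
          show "?P * (5 + 5) + 1 \<le> ?P * 10 + 1" by simp
          show "ensures (Blk [SetC rT 0, SetC rCNT 0, Add rCNT rCNT rIN] ;; ?div) M5 V5 (3 + 7 * ?t) ?Q"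
            if "?Inv ?P M5 V5" for M5 V5 by (rule fin[OF that])
        qed
      qed
    qed
    moreover have "M1(?P := M1 (Suc 0), Suc 0 := Suc 0) = M2" by (simp add: M2_def)
    ultimately show "ensures (Blk [Store 0 1, SetC 1 1] ;; Blk (saves 2 (K - 1)) ;;
       Blk [SetC rX (K - 1), Sub rIN 0 rX, SetC rX 1, Add rNE 0 rX, SetC rEP (Suc K),
            SetC rCNT 0, Add rCNT rCNT rIN] ;; ?loop ;;
       Blk [SetC rT 0, SetC rCNT 0, Add rCNT rCNT rIN] ;; ?div) M1 V1
       (2 + (2 * (K - 1) + (7 + ((?P * 10 + 1) + (3 + 7 * ?t))))) ?Q"
      using M1(1) by (intro ensures_seq[where ?N1.0 = 2 and
        ?N2.0 = "2 * (K - 1) + (7 + ((?P * 10 + 1) + (3 + 7 * ?t)))"]) simp_all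
  qed
  let ?Q' = "\<lambda>M' V'. \<exists>P. M' rT = ?t \<and> M' rIN = P \<and> hlist M' P inp \<and> P + length inp \<le> M' rNE \<and> K \<le> P"
  have "ensures (When 0 ?body) input V (Suc ?N) (\<lambda>M' V'. if ?t = 0 then M' = input else ?Q M' V')"
  proof (rule ensures_When[OF _ _ order_refl])
    assume "input 0 \<noteq> 0"
    then have t: "?t \<noteq> 0" by (simp add: input(1))
    show "ensures ?body input V ?N (\<lambda>M' V'. if ?t = 0 then M' = input else ?Q M' V')"
      by (rule ensures_mono[OF main[OF t] order_refl]) (use t in simp)
  qed (simp add: input(1))
  note branch = this
  \<comment> \<open>An empty sample skips the relocation and leaves \<open>rNE\<close> at 0; only
    then are the pointers set to \<open>K\<close>. After a relocation \<open>rNE\<close> is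
    positive.\<close>
  have "ensures (Blk [SetC rX 1, Sub rX rX rNE] ;; When rX (Blk [SetC rIN K, SetC rNE K])) M1 V1 5 ?Q'"
    if *: "if ?t = 0 then M1 = input else ?Q M1 V1" for M1 V1
  proof (cases "?t = 0")
    case True
    then have inp: "inp = []" and z: "input j = 0" for j
      using inp_length input(1) input(3)[of "j - 1"] by (cases j; simp)+
    have hl: "hlist M' p inp" for M' p unfolding inp by (simp add: hlist_def)
    let ?M = "input(rX := Suc 0, rIN := K, rNE := K)"
    have M: "?M rT = ?t" "?M rIN = K" "?M rNE = K" using reg(8) z[of rT] True by auto
    have "length inp = 0" by (simp add: inp)
    then have q: "?Q' ?M V1" using M hl by (intro exI[of _ K]) (simp only: add_0_right order_refl simp_thms)
    have w: "ensures (When rX (Blk [SetC rIN K, SetC rNE K])) (input(rX := Suc 0)) V1 3 ?Q'"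
    proof (rule ensures_When[where N = 2])
      show "ensures (Blk [SetC rIN K, SetC rNE K]) (input(rX := Suc 0)) V1 2 ?Q'" using q by simp
    qed simp_all
    have M1: "M1 = input" using * True by simp
    have "input rNE = 0" by (rule z)
    show ?thesis unfolding M1
    proof (rule ensures_seq[where ?N1.0 = 2 and ?N2.0 = 3])
      have e: "eff (SetC rX 1) input V1 = (input(rX := 1), V1)"
        "eff (Sub rX rX rNE) (input(rX := 1)) V1 = (input(rX := Suc 0), V1)"
        using \<open>input rNE = 0\<close> reg(8) by auto
      show "ensures (Blk [SetC rX 1, Sub rX rX rNE]) input V1 2
        (\<lambda>M' V'. ensures (When rX (Blk [SetC rIN K, SetC rNE K])) M' V' 3 ?Q')"
        unfolding ensures_Cons e prod.case ensures_Nil using w by simp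
    qed simp
  next
    case False
    then have Q: "?Q M1 V1" using * by simp
    let ?M = "M1(rX := 0)"
    have hl: "hlist ?M ?P inp" by (rule hlist_cong[of M1]) (use Q reg KE big(2)[OF False] in auto)
    have r: "?M rT = ?t" "?M rIN = ?P" "?M rNE = 2 * ?P + K" using Q reg(8) by auto
    have Q': "?Q' ?M V1"
    proof (intro exI[of _ ?P] conjI)
      show "?P + length inp \<le> ?M rNE" unfolding r(3) using big(1)[OF False] by linarith
      show "K \<le> ?P" using big(2)[OF False] by (rule less_imp_le)
    qed (fact r hl)+
    have "ensures (When rX (Blk [SetC rIN K, SetC rNE K])) ?M V1 3 ?Q'"
      by (rule ensures_When[where N = 2]) (use Q' in simp_all)
    moreover have "Suc 0 - (2 * ?P + K) = 0" using KE by simp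
    ultimately show ?thesis using Q reg
      by (intro ensures_seq[where ?N1.0 = 2 and ?N2.0 = 3]) simp_all
  qed
  then show ?thesis unfolding relocate_def
    by (intro ensures_seq[OF ensures_mono[OF branch order_refl]]) (auto simp: relocate_steps_def)
qed

text \<open>\<open>near_parameters\<close> for the set of entries of the sample: equal truth values
  on all examples mean equal error counts.\<close>

lemma errs_near:
  assumes "\<phi> \<in> set fs" "vs \<in> tuples (univ A) l"
  shows "\<exists>\<phi>'\<in>set fs. \<exists>vs'\<in>tuples (nbhd_set A (l * (2 * r + 2)) (insert e0 entries)) l.
    errs \<phi> vs T = errs \<phi>' vs' T"
proof -
  let ?R = "l * (2 * r + 2)"
  obtain \<phi>' vs' where *: "\<phi>' \<in> set fs" "vs' \<in> tuples (insert e0 (nbhd_set A ?R entries)) l"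
    "\<forall>as\<in>tuples entries k. sat C A ((!) (as @ vs)) \<phi> \<longleftrightarrow> sat C A ((!) (as @ vs')) \<phi>'"
    using near_parameters[OF struct entries_univ e0(1) assms] by blast
  have "errs \<phi> vs T = errs \<phi>' vs' T"
    unfolding errs_def using *(3) entries_tuples
    by (intro arg_cong[where f = length] filter_cong) auto
  moreover have "insert e0 (nbhd_set A ?R entries) \<subseteq> nbhd_set A ?R (insert e0 entries)"
    using nbhd_set_self[of "insert e0 entries" A ?R] nbhd_set_mono[of ?R ?R entries "insert e0 entries" A] by auto
  ultimately show ?thesis using *(1,2) by (intro bexI[of _ \<phi>'] bexI[of _ vs']) (auto simp: tuples_def)
qed

lemma learn_correct:
  "ensures (learn exact) input V (learn_steps d (length T))
    (\<lambda>M' V'. \<exists>i<length fs. \<exists>vs\<in>tuples (univ A) l.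
       M' 0 = (if exact \<and> errs (fs ! i) vs T \<noteq> 0 then 0 else Suc i) \<and> map M' [1..<l + 1] = map code vs \<and>
       (\<forall>\<phi>\<in>set fs. \<forall>vs'\<in>tuples (univ A) l. errs (fs ! i) vs T \<le> errs \<phi> vs' T))"
    (is "ensures _ _ _ _ ?Q")
proof -
  let ?t = "length T"
  let ?B = "cand_bound d ?t"
  let ?N = "nbhd_set A (l * (2 * r + 2)) (insert e0 entries)"
  let ?out = "Blk (copies 1 [rBV..<rBV + l]) ;; Blk [SetC 0 0, Add 0 0 rBI] ;;
     (if exact then When rBEST (Blk [SetC 0 0]) else Blk [])"
  have Nsub: "?N \<subseteq> univ A" using e0(1) entries_univ by (intro nbhd_set_univ[OF struct]) auto
  have out: "ensures ?out M1 V1 (2 * l + 4) ?Q"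
    if b: "best {(i, vs). i < length fs \<and> vs \<in> tuples (univ A) l \<and> map code vs \<in> tuples (set ns) l} M1"
      and ns: "set ns = code ` ?N" for M1 V1 ns
  proof -
    let ?S = "{(i, vs). i < length fs \<and> vs \<in> tuples (univ A) l \<and> map code vs \<in> tuples (set ns) l}"
    have inS: "(i, vs) \<in> ?S" if "i < length fs" "vs \<in> tuples ?N l" for i vs
      using that Nsub unfolding ns by (auto simp: tuples_def)
    have "0 < length fs" using ne by simp
    moreover have "replicate l e0 \<in> tuples ?N l"
      using nbhd_set_self[of "insert e0 entries" A] by (auto simp: tuples_def)
    ultimately have "?S \<noteq> {}" using inS by blast
    then obtain i vs where iv: "i < length fs" "vs \<in> tuples (univ A) l" "M1 rBEST = errs (fs ! i) vs T"
      "M1 rBI = Suc i" "\<forall>j<l. M1 (rBV + j) = code (vs ! j)" "\<forall>(i, vs)\<in>?S. M1 rBEST \<le> errs (fs ! i) vs T"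
      using b unfolding best_def by blast
    \<comment> \<open>The search covers only parameters close to the sample, but every hypothesis
      has a competitor there with the same number of errors.\<close>
    have min: "errs (fs ! i) vs T \<le> errs \<phi> vs' T" if phi: "\<phi> \<in> set fs" "vs' \<in> tuples (univ A) l" for \<phi> vs'
    proof -
      obtain \<phi>2 vs2 where 2: "\<phi>2 \<in> set fs" "vs2 \<in> tuples ?N l" "errs \<phi> vs' T = errs \<phi>2 vs2 T"
        using errs_near[OF phi] by blast
      obtain j where "j < length fs" "\<phi>2 = fs ! j" using 2(1) by (metis in_set_conv_nth)
      then show ?thesis using iv(3,6) inS[of j vs2] 2 by auto
    qed
    show ?thesis
    proof (rule ensures_seq[OF ensures_mono[OF ensures_copies_disjoint order_refl], where ?N2.0 = 4])
      show "\<forall>a\<in>set [rBV..<rBV + l]. a < 1 \<or> 1 + length [rBV..<rBV + l] \<le> a" by (auto simp: reg_defs q_def)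
      fix M2 V2 assume 2: "V2 = V1 \<and> (\<forall>j<length [rBV..<rBV + l]. M2 (1 + j) = M1 ([rBV..<rBV + l] ! j)) \<and>
        (\<forall>j. j < 1 \<or> 1 + length [rBV..<rBV + l] \<le> j \<longrightarrow> M2 j = M1 j)"
      have "map M2 [1..<l + 1] = map code vs"
      proof (rule nth_equalityI)
        show "length (map M2 [1..<l + 1]) = length (map code vs)" using iv(2) by (simp add: tuples_def)
        fix j assume "j < length (map M2 [1..<l + 1])"
        then have j: "j < l" by (simp del: upt_Suc)
        have "[1..<l + 1] ! j = Suc j" using j by (subst nth_upt) auto
        moreover have "M2 (Suc j) = code (vs ! j)" using 2 j iv(5) by simp
        ultimately show "map M2 [1..<l + 1] ! j = map code vs ! j"
          using j iv(2) by (simp add: tuples_def del: upt_Suc)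
      qed
      moreover have "map (M2(0 := x)) [1..<l + 1] = map M2 [1..<l + 1]" for x
        by (rule map_cong[OF refl]) (simp del: upt_Suc)
      ultimately have m: "map (M2(0 := x)) [1..<l + 1] = map code vs" for x by (rule trans[rotated])
      have r: "M2 rBI = Suc i" "M2 rBEST = errs (fs ! i) vs T"
        using 2 iv(3,4) by (auto simp: reg_defs q_def)
      have q0: "?Q (M2(0 := if exact \<and> errs (fs ! i) vs T \<noteq> 0 then 0 else Suc i)) V2"
        using iv(1,2) min m by (intro exI[of _ i] conjI bexI[of _ vs]) auto
      show "ensures (Blk [SetC 0 0, Add 0 0 rBI] ;; (if exact then When rBEST (Blk [SetC 0 0]) else Blk [])) M2 V2 4 ?Q"
      proof (rule ensures_seq[where ?N1.0 = 2 and ?N2.0 = 2])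
        have z: "rBI \<noteq> 0" "rBEST \<noteq> 0" by (simp_all add: reg_defs q_def)
        have "ensures (if exact then When rBEST (Blk [SetC 0 0]) else Blk []) (M2(0 := Suc i)) V2 2 ?Q"
        proof (cases exact)
          case True
          have "ensures (When rBEST (Blk [SetC 0 0])) (M2(0 := Suc i)) V2 2 ?Q"
          proof (rule ensures_When[where N = 1])
            assume "(M2(0 := Suc i)) rBEST \<noteq> 0"
            then have "errs (fs ! i) vs T \<noteq> 0" using z r by simp
            then have "?Q (M2(0 := 0)) V2" using q0 True by simp
            then show "ensures (Blk [SetC 0 0]) (M2(0 := Suc i)) V2 1 ?Q" by simp
          next
            assume "(M2(0 := Suc i)) rBEST = 0"
            then have "errs (fs ! i) vs T = 0" using z r by simp
            then show "?Q (M2(0 := Suc i)) V2" using q0 by simp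
          qed simp
          then show ?thesis using True by simp
        next
          case False
          then show ?thesis using q0 by simp
        qed
        then show "ensures (Blk [SetC 0 0, Add 0 0 rBI]) M2 V2 2 (\<lambda>M' V'. ensures (if exact then When rBEST (Blk [SetC 0 0]) else Blk []) M' V' 2 ?Q)"
          using z r(1) by simp
      qed simp
    qed simp
  qed
  have search: "ensures (search ;; ?out) M1 V1 (search_steps d ?B ?t + (2 * l + 4)) ?Q"
    if c: "ctx P nb ns M1" and len: "length ns \<le> ?B" and ns: "set ns = code ` ?N" for P nb ns M1 V1
  proof (rule ensures_seq[OF ensures_mono[OF search_correct[OF c]] order_refl])
    show "set ns \<subseteq> code ` univ A" using ns Nsub by blast
    show "search_steps d (length ns) ?t \<le> search_steps d ?B ?t"
      unfolding search_steps_def using len by (intro add_left_mono tup_steps_mono) auto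
    show "ensures ?out M' V' (2 * l + 4) ?Q"
      if "best {(i, vs). i < length fs \<and> vs \<in> tuples (univ A) l \<and> map code vs \<in> tuples (set ns) l} M'" for M' V'
      by (rule out[OF that ns])
  qed
  have cand: "ensures (candidates ;; search ;; ?out) M1 V1 (cand_steps d ?t + (search_steps d ?B ?t + (2 * l + 4))) ?Q"
    if "M1 rT = ?t" "M1 rIN = P" "hlist M1 P inp" "P + length inp \<le> M1 rNE" "K \<le> P" for P M1 V1
  proof (rule ensures_seq[OF ensures_mono[OF candidates_correct[OF that(1,2) refl that(3-5)] order_refl] order_refl])
    fix M' V' assume "\<exists>ns. ctx P (M1 rNE) ns M' \<and> length ns \<le> ?B \<and> set ns = code ` ?N"
    then obtain ns where "ctx P (M1 rNE) ns M'" "length ns \<le> ?B" "set ns = code ` ?N" by blast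
    then show "ensures (search ;; ?out) M' V' (search_steps d ?B ?t + (2 * l + 4)) ?Q" by (rule search)
  qed
  show ?thesis unfolding learn_def
  proof (rule ensures_seq[OF ensures_mono[OF relocate_correct order_refl]])
    show "relocate_steps ?t + (cand_steps d ?t + (search_steps d ?B ?t + (2 * l + 4))) \<le> learn_steps d ?t"
      by (simp add: learn_steps_def)
    fix M' V' assume "\<exists>P. M' rT = ?t \<and> M' rIN = P \<and> hlist M' P inp \<and> P + length inp \<le> M' rNE \<and> K \<le> P"
    then obtain P where "M' rT = ?t" "M' rIN = P" "hlist M' P inp" "P + length inp \<le> M' rNE" "K \<le> P" by blast
    then show "ensures (candidates ;; search ;; ?out) M' V' (cand_steps d ?t + (search_steps d ?B ?t + (2 * l + 4))) ?Q"
      by (rule cand)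
  qed
qed

text \<open>The second alternative of the postcondition says that formulas behind the selected one
  leave \<open>rT\<close> alone, so the result survives the remaining comparisons.\<close>

lemma dispatch_correct:
  assumes i: "i < length fs" and as: "as \<in> tuples (univ A) k" and vs: "vs \<in> tuples (univ A) l"
    and "j + length \<phi>s = length fs" "\<phi>s = drop j fs"
    and "M 0 = i" "\<forall>p<l. M (Suc p) = code (vs ! p)" "\<forall>p<k. M (Suc (l + p)) = code (as ! p)" "M rNE = K"
  shows "ensures (dispatch j \<phi>s) M V (length \<phi>s * (9 + (\<Sum>\<phi>\<leftarrow>fs. at_steps d r \<phi>)))
    (\<lambda>M' V'. if j \<le> i then (M' rT \<noteq> 0 \<longleftrightarrow> sat C A ((!) (as @ vs)) (fs ! i)) else M' rT = M rT)"
  using assms(4-)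
proof (induction \<phi>s arbitrary: j M V)
  case Nil
  then show ?case using i by simp
next
  case (Cons \<phi> \<phi>s)
  let ?s = "9 + (\<Sum>\<phi>\<leftarrow>fs. at_steps d r \<phi>)"
  let ?Q = "\<lambda>M' V'. if j \<le> i then (M' rT \<noteq> 0 \<longleftrightarrow> sat C A ((!) (as @ vs)) (fs ! i)) else M' rT = M rT"
  have j: "j < length fs" using Cons.prems(1) by simp
  have "\<phi> # \<phi>s = fs ! j # drop (Suc j) fs" using Cons.prems(2) Cons_nth_drop_Suc[OF j] by metis
  then have phi: "\<phi> = fs ! j" "\<phi> \<in> set fs" and rest: "\<phi>s = drop (Suc j) fs" using j by auto
  let ?keep = "\<lambda>M1. \<forall>p. p < q \<or> p = rNE \<longrightarrow> M1 p = M p"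
  have next_step: "ensures (dispatch (Suc j) \<phi>s) M1 V1 (length \<phi>s * ?s) ?Q"
    if k: "?keep M1" and r: "if j = i then (M1 rT \<noteq> 0 \<longleftrightarrow> sat C A ((!) (as @ vs)) (fs ! i)) else M1 rT = M rT" for M1 V1
  proof (rule ensures_mono[OF Cons.IH order_refl])
    show "Suc j + length \<phi>s = length fs" "\<phi>s = drop (Suc j) fs" using Cons.prems(1) rest by auto
    show "M1 0 = i" "\<forall>p<l. M1 (Suc p) = code (vs ! p)" "\<forall>p<k. M1 (Suc (l + p)) = code (as ! p)" "M1 rNE = K"
      using k Cons.prems(3-6) by (auto simp: q_def)
    fix M' V' assume "if Suc j \<le> i then (M' rT \<noteq> 0 \<longleftrightarrow> sat C A ((!) (as @ vs)) (fs ! i)) else M' rT = M1 rT"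
    then show "?Q M' V'" using r by (auto split: if_splits)
  qed
  let ?M1 = "M(rX := of_bool (i = j), rY := Suc 0)"
  have eqv: "Suc 0 - (j - i + (i - j)) = of_bool (i = j)" by auto
  have test: "ensures (Blk [SetC rX j, Sub rY 0 rX, Sub rX rX 0, Add rX rX rY, SetC rY 1, Sub rX rY rX]) M V 6
    (\<lambda>M' V'. M' = ?M1)"
    using Cons.prems(3) eqv by (auto simp: reg_defs q_def fun_eq_iff)
  have le: "at_steps d r \<phi> \<le> (\<Sum>\<phi>\<leftarrow>fs. at_steps d r \<phi>)"
    using phi(2) by (intro member_le_sum_list) auto
  have main: "ensures (When rX (eval_hyp \<phi> ;; Blk [SetC rT 0, Add rT rT (fe + 4)])) ?M1 V1 (at_steps d r \<phi> + 3)
    (\<lambda>M' V'. ?keep M' \<and> (if j = i then (M' rT \<noteq> 0 \<longleftrightarrow> sat C A ((!) (as @ vs)) (fs ! i)) else M' rT = M rT))" for V1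
  proof (rule ensures_When[where N = "at_steps d r \<phi> + 2"])
    assume "?M1 rX \<noteq> 0"
    then have ij: "i = j" by (auto simp: reg_defs split: if_splits)
    show "ensures (eval_hyp \<phi> ;; Blk [SetC rT 0, Add rT rT (fe + 4)]) ?M1 V1 (at_steps d r \<phi> + 2)
      (\<lambda>M' V'. ?keep M' \<and> (if j = i then (M' rT \<noteq> 0 \<longleftrightarrow> sat C A ((!) (as @ vs)) (fs ! i)) else M' rT = M rT))"
    proof (rule ensures_seq[OF ensures_mono[OF eval_hyp_correct[OF phi(2) as vs] order_refl], where ?N2.0 = 2])
      show "\<forall>p<l. ?M1 (Suc p) = code (vs ! p)" "\<forall>p<k. ?M1 (Suc (l + p)) = code (as ! p)" "K \<le> ?M1 rNE"
        using Cons.prems(4-6) by (auto simp: reg_defs q_def)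
      fix M2 V2 assume 2: "(M2 (fe + 4) \<noteq> 0 \<longleftrightarrow> sat C A ((!) (as @ vs)) \<phi>) \<and>
        (\<forall>p. p < fe \<or> K \<le> p \<and> p < ?M1 rNE \<longrightarrow> M2 p = ?M1 p)"
      have low: "M2 p = M p" if "p < q \<or> p = rNE" for p
        using 2 that by (auto simp: reg_defs)
      show "ensures (Blk [SetC rT 0, Add rT rT (fe + 4)]) M2 V2 2
        (\<lambda>M' V'. ?keep M' \<and> (if j = i then (M' rT \<noteq> 0 \<longleftrightarrow> sat C A ((!) (as @ vs)) (fs ! i)) else M' rT = M rT))"
        using 2 low ij phi by (auto simp: reg_defs)
    qed simp
  next
    assume "?M1 rX = 0"
    then have "i \<noteq> j" by (auto simp: reg_defs)
    then show "?keep ?M1 \<and> (if j = i then (?M1 rT \<noteq> 0 \<longleftrightarrow> sat C A ((!) (as @ vs)) (fs ! i)) else ?M1 rT = M rT)"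
      by (auto simp: reg_defs)
  qed simp
  have rest_run: "ensures (When rX (eval_hyp \<phi> ;; Blk [SetC rT 0, Add rT rT (fe + 4)]) ;; dispatch (Suc j) \<phi>s) ?M1 V1
    (at_steps d r \<phi> + 3 + length \<phi>s * ?s) ?Q" for V1
    by (rule ensures_seq[OF ensures_mono[OF main order_refl next_step] order_refl]) blast+
  show ?case unfolding dispatch.simps
  proof (rule ensures_seq[OF ensures_mono[OF test order_refl],
      where ?N2.0 = "at_steps d r \<phi> + 3 + length \<phi>s * ?s"])
    fix M' V' assume "M' = ?M1"
    then show "ensures (When rX (eval_hyp \<phi> ;; Blk [SetC rT 0, Add rT rT (fe + 4)]) ;; dispatch (Suc j) \<phi>s) M' V'
      (at_steps d r \<phi> + 3 + length \<phi>s * ?s) ?Q" using rest_run by simp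
  qed (use le in simp)
qed

lemma evaluate_correct:
  assumes i: "i < length fs" and as: "as \<in> tuples (univ A) k" and vs: "vs \<in> tuples (univ A) l"
  shows "ensures evaluate (write_list 0 (i # map code vs @ map code as) (\<lambda>_. 0)) V (evaluate_steps d)
    (\<lambda>M' V'. M' 0 = of_bool (sat C A ((!) (as @ vs)) (fs ! i)))"
proof -
  let ?M0 = "write_list 0 (i # map code vs @ map code as) (\<lambda>_. 0)"
  let ?M = "?M0(rNE := K)"
  let ?Q = "\<lambda>M' V'. M' 0 = of_bool (sat C A ((!) (as @ vs)) (fs ! i))"
  have len: "length vs = l" "length as = k" using as vs by (auto simp: tuples_def)
  have z: "0 \<noteq> rNE" "\<And>p. p < l + k \<Longrightarrow> Suc p \<noteq> rNE" by (auto simp: reg_defs q_def)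
  have v: "\<forall>p<l. ?M (Suc p) = code (vs ! p)"
    using len z by (auto simp: write_list_def nth_append)
  have a: "\<forall>p<k. ?M (Suc (l + p)) = code (as ! p)"
    using len z by (auto simp: write_list_def nth_append)
  have fin: "ensures (Blk [SetC rX 1, Sub rX rX rT, SetC rY 1, Sub 0 rY rX]) M1 V1 4 ?Q"
    if "if 0 \<le> i then (M1 rT \<noteq> 0 \<longleftrightarrow> sat C A ((!) (as @ vs)) (fs ! i)) else M1 rT = ?M rT" for M1 V1
    using that by (cases "M1 rT") (auto simp: reg_defs q_def)
  have "ensures (dispatch 0 fs ;; Blk [SetC rX 1, Sub rX rX rT, SetC rY 1, Sub 0 rY rX]) ?M V
    (length fs * (9 + (\<Sum>\<phi>\<leftarrow>fs. at_steps d r \<phi>)) + 4) ?Q"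
    by (rule ensures_seq[OF ensures_mono[OF dispatch_correct[OF i as vs _ _ _ v a] order_refl fin] order_refl])
      (use z in \<open>auto simp: write_list_def\<close>)
  then show ?thesis unfolding evaluate_def
    by (intro ensures_seq[where ?N1.0 = 1 and ?N2.0 = "length fs * (9 + (\<Sum>\<phi>\<leftarrow>fs. at_steps d r \<phi>)) + 4"])
      (simp_all add: evaluate_steps_def)
qed

end

section \<open>Polynomial bounds\<close>

text \<open>One base \<open>x\<close> bounds both the degree and the sample size \<open>t\<close>.
  Because of \<open>2 \<le> x\<close>, constants and sums can be absorbed into the exponent, which
  makes the property closed under all operations occurring in step counts.\<close>

definition poly_bounded :: "(nat \<Rightarrow> nat \<Rightarrow> nat) \<Rightarrow> bool" where
  "poly_bounded h \<longleftrightarrow> (\<exists>c. \<forall>x\<ge>2. \<forall>t\<le>x. h x t \<le> x ^ c)"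

lemma poly_bounded_const [simp]: "poly_bounded (\<lambda>x t. a)"
proof -
  have "a \<le> x ^ a" if "2 \<le> x" for x
  proof -
    have "a < 2 ^ a" by (rule less_exp)
    also have "\<dots> \<le> x ^ a" using that by (rule power_mono) simp
    finally show ?thesis by simp
  qed
  then show ?thesis unfolding poly_bounded_def by blast
qed

lemma poly_bounded_fst [simp]: "poly_bounded (\<lambda>x t. x)" and poly_bounded_snd [simp]: "poly_bounded (\<lambda>x t. t)"
  unfolding poly_bounded_def by (rule exI[of _ 1], simp)+

lemma poly_bounded_mult [simp]:
  assumes "poly_bounded h" "poly_bounded g"
  shows "poly_bounded (\<lambda>x t. h x t * g x t)"
proof -
  obtain a b where "\<forall>x\<ge>2. \<forall>t\<le>x. h x t \<le> x ^ a" "\<forall>x\<ge>2. \<forall>t\<le>x. g x t \<le> x ^ b"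
    using assms unfolding poly_bounded_def by blast
  then show ?thesis unfolding poly_bounded_def
    by (intro exI[of _ "a + b"]) (auto simp: power_add intro!: mult_le_mono)
qed

lemma poly_bounded_add [simp]:
  assumes "poly_bounded h" "poly_bounded g"
  shows "poly_bounded (\<lambda>x t. h x t + g x t)"
proof -
  obtain a b where ab: "\<forall>x\<ge>2. \<forall>t\<le>x. h x t \<le> x ^ a" "\<forall>x\<ge>2. \<forall>t\<le>x. g x t \<le> x ^ b"
    using assms unfolding poly_bounded_def by blast
  have "h x t + g x t \<le> x ^ Suc (max a b)" if x: "2 \<le> x" and t: "t \<le> x" for x t
  proof -
    have "x ^ a \<le> x ^ max a b" "x ^ b \<le> x ^ max a b" using x by (auto intro!: power_increasing)
    moreover have "h x t \<le> x ^ a" "g x t \<le> x ^ b" using ab x t by blast+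
    ultimately have "h x t + g x t \<le> 2 * x ^ max a b" by linarith
    also have "\<dots> \<le> x * x ^ max a b" using x by (rule mult_le_mono1)
    finally show ?thesis by simp
  qed
  then show ?thesis unfolding poly_bounded_def by blast
qed

lemma poly_bounded_power [simp]: "poly_bounded h \<Longrightarrow> poly_bounded (\<lambda>x t. h x t ^ m)"
  by (induction m) simp_all

lemma poly_bounded_Suc [simp]: "poly_bounded h \<Longrightarrow> poly_bounded (\<lambda>x t. Suc (h x t))"
  using poly_bounded_add[of h "\<lambda>x t. 1"] by simp

lemma poly_bounded_sum_list [simp]:
  "(\<And>y. y \<in> set ys \<Longrightarrow> poly_bounded (\<lambda>x t. h y x t)) \<Longrightarrow> poly_bounded (\<lambda>x t. \<Sum>y\<leftarrow>ys. h y x t)"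
  by (induction ys) simp_all

lemma poly_bounded_tup_steps [simp]:
  "poly_bounded L \<Longrightarrow> poly_bounded N \<Longrightarrow> poly_bounded (\<lambda>x t. tup_steps (L x t) (N x t) m)"
  by (induction m) simp_all

lemma poly_bounded_eval_steps [simp]:
  "poly_bounded L \<Longrightarrow> poly_bounded (\<lambda>x t. eval_steps (L x t) \<phi>)"
proof (induction \<phi> rule: measure_induct_rule[where f = size])
  case (less \<phi>)
  then show ?case by (cases \<phi>) simp_all
qed

lemma poly_bounded_at_steps [simp]: "poly_bounded (\<lambda>x t. at_steps x r \<phi>)"
  by (simp add: at_steps_def Let_def)

section \<open>Running time and well-formedness of the programs\<close>

context layout
begin

lemma poly_bounded_learn: "poly_bounded learn_steps"
  by (simp add: learn_steps_def[abs_def] relocate_steps_def cand_steps_def cand_bound_def search_steps_def try_steps_def)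

lemma poly_bounded_evaluate: "poly_bounded (\<lambda>x t. evaluate_steps x)"
  by (simp add: evaluate_steps_def)

lemma wf_search_parts:
  assumes "valid_vocab C" "\<And>\<phi>. \<phi> \<in> set fs \<Longrightarrow> wa1 C \<sigma> \<phi>"
  shows "wf_com C \<sigma> (learn exact)" "wf_com C \<sigma> evaluate"
proof -
  have loads: "\<forall>i\<in>set (loads a b c m). wf_instr C \<sigma> i" for a b c m
    by (induction m arbitrary: a) auto
  have appends: "\<forall>i\<in>set (appends a b c m). wf_instr C \<sigma> i" for a b c m
    by (induction m) auto
  have saves: "\<forall>i\<in>set (saves a m). wf_instr C \<sigma> i" for a m
    by (induction m arbitrary: a) auto
  have hyp: "wf_com C \<sigma> (eval_hyp \<phi>)" if "\<phi> \<in> set fs" for \<phi>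
    using wf_eval_at[OF assms(1) assms(2)[OF that]] by (simp add: eval_hyp_def)
  have "set \<phi>s \<subseteq> set fs \<Longrightarrow> wf_com C \<sigma> (try_all i \<phi>s)" for i \<phi>s
    by (induction \<phi>s arbitrary: i) (auto simp: try_formula_def check_example_def hyp loads wf_copies)
  moreover have "set \<phi>s \<subseteq> set fs \<Longrightarrow> wf_com C \<sigma> (dispatch i \<phi>s)" for i \<phi>s
    by (induction \<phi>s arbitrary: i) (auto simp: hyp)
  ultimately show "wf_com C \<sigma> (learn exact)" "wf_com C \<sigma> evaluate"
    by (auto simp: learn_def relocate_def candidates_def search_def evaluate_def wf_copies appends saves)
qed

end

text \<open>Here \<open>y\<close> is the bit length of the universe and \<open>x\<close> bounds its degree.\<close>

definition log_time :: "'v vocab \<Rightarrow> signature \<Rightarrow> 'v com \<Rightarrow> (nat \<Rightarrow> nat \<Rightarrow> nat) \<Rightarrow> nat \<Rightarrow> bool" where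
  "log_time C \<sigma> c h e \<longleftrightarrow> (\<forall>orc n x t y xs Q. machine orc n x \<longrightarrow> 2 \<le> x \<longrightarrow> t \<le> x \<longrightarrow> n \<le> 2 ^ y \<longrightarrow>
     (\<forall>v\<in>set xs. v < 2 ^ (x + y)) \<longrightarrow>
     machine.ensures C \<sigma> orc n c (write_list 0 xs (\<lambda>_. 0)) (\<lambda>_. undefined) (h x t) Q \<longrightarrow>
     (\<exists>M V T. T \<le> (x + y) ^ e \<and> log_runs C \<sigma> orc (compile 0 c) xs M T \<and> Q M V))"

text \<open>The exponent depends on the program and its step bound only, hence is uniform in the
  structure. With \<open>z = x + y\<close> every factor of the cost bound is polynomial in
  \<open>z\<close>.\<close>

lemma ex_log_time:
  fixes c :: "'v com"
  assumes "poly_bounded h"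
  shows "\<exists>e. log_time C \<sigma> c h e"
proof -
  obtain c0 where c0: "\<forall>x\<ge>2. \<forall>t\<le>x. h x t \<le> x ^ c0" using assms unfolding poly_bounded_def by blast
  let ?I = "set (compile 0 c) \<union> instrs c"
  \<comment> \<open>A dummy machine. The predicate \<open>ibound\<close> depends only on vocabulary
    and signature, so the bound obtained here is valid for every oracle.\<close>
  interpret m0: machine C \<sigma> "\<lparr>ask_rel = undefined, ask_wgt = undefined, ask_nbr = \<lambda>_. []\<rparr>" 0 0
    by unfold_locales auto
  have "finite (instrs c)" by (induction c) auto
  then obtain b0 where b0: "\<forall>i\<in>?I. m0.ibound b0 b0 i" using m0.ex_ibound_set[of ?I] by auto
  have "poly_bounded (\<lambda>z t. z ^ c0 * ((2 * b0 + 2 * z + 8) * Suc (b0 + z + z ^ c0)))" by simp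
  then obtain e where e: "\<And>z. 2 \<le> z \<Longrightarrow> z ^ c0 * ((2 * b0 + 2 * z + 8) * Suc (b0 + z + z ^ c0)) \<le> z ^ e"
    unfolding poly_bounded_def by (meson le0)
  show ?thesis unfolding log_time_def
  proof (rule exI[of _ e], intro allI impI)
    fix orc :: "'v answers" and n x t y xs Q
    assume A: "machine orc n x" "2 \<le> x" "t \<le> x" "n \<le> 2 ^ y" "\<forall>v\<in>set xs. v < 2 ^ (x + y)"
      "machine.ensures C \<sigma> orc n c (write_list 0 xs (\<lambda>_. 0)) (\<lambda>_. undefined) (h x t) Q"
    interpret machine C \<sigma> orc n x by (rule A(1))
    obtain m M V where R: "run c (write_list 0 xs (\<lambda>_. 0)) (\<lambda>_. undefined) m M V" "m \<le> h x t" "Q M V"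
      using A(6) unfolding ensures_def by blast
    have mx: "m \<le> x ^ c0" using c0 A(2,3) R(2) by (meson le_trans)
    let ?b = "b0 + (x + y)"
    have le: "(2::nat) ^ (x + y) \<le> 2 ^ ?b" "(2::nat) ^ y \<le> 2 ^ ?b" "(2::nat) ^ x \<le> 2 ^ ?b" "(2::nat) ^ b0 \<le> 2 ^ ?b"
      by (intro power_increasing; simp)+
    have "b0 \<le> 2 ^ b0" "x < 2 ^ x" using less_exp[of b0] less_exp[of x] by auto
    then have b0': "b0 \<le> 2 ^ ?b" and x': "x < 2 ^ ?b" using le by linarith+
    have ib: "\<forall>i\<in>?I. ibound b0 (2 ^ ?b) i" using b0 b0' by (auto intro: ibound_mono)
    have xs: "\<forall>v\<in>set xs. v < 2 ^ ?b" using A(5) le(1) by (meson less_le_trans)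
    have n: "n \<le> 2 ^ ?b" using A(4) le(2) by linarith
    obtain T where T: "T \<le> m * ((2 * b0 + 2 * x + 8) * Suc (?b + m))" "log_runs C \<sigma> orc (compile 0 c) xs M T"
      using run_log_runs[OF R(1) xs ib n x'] by blast
    let ?z = "x + y"
    have mz: "m \<le> ?z ^ c0" using mx power_mono[of x ?z c0] by simp
    have "T \<le> ?z ^ c0 * ((2 * b0 + 2 * ?z + 8) * Suc (b0 + ?z + ?z ^ c0))"
      using T(1) mz by (elim order_trans) (intro mult_le_mono; simp)
    also have "\<dots> \<le> ?z ^ e" by (rule e) (simp add: trans_le_add1 A(2))
    finally show "\<exists>M V T. T \<le> (x + y) ^ e \<and> log_runs C \<sigma> orc (compile 0 c) xs M T \<and> Q M V"
      using T(2) R(3) by blast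
  qed
qed

section \<open>The learners on expanded structures\<close>

lemma card_gaifman_le:
  "is_structure C \<sigma> A \<Longrightarrow> a \<in> univ A \<Longrightarrow> card (gaifman A `` {a}) \<le> struct_degree A"
  unfolding struct_degree_def by (intro Max_ge) (auto simp: is_structure_def)

text \<open>New symbols have arity at most 1, and edges join distinct elements. So the degree of the
  expanded structure is that of the original one, which appears in the time bounds.\<close>

lemma gaifman_expansion:
  assumes "is_structure C \<sigma> A" "is_structure C \<sigma>s B" "is_expansion C \<sigma> A B"
    "\<forall>R\<in>dom \<sigma>s - dom \<sigma>. the (\<sigma>s R) \<le> 1"
  shows "gaifman B = gaifman A"
proof -
  have "(\<exists>t\<in>rel B R. a \<in> set t \<and> b \<in> set t) \<longleftrightarrow> (\<exists>t\<in>rel A R. a \<in> set t \<and> b \<in> set t)" if "a \<noteq> b" for a b R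
  proof (cases "R \<in> dom \<sigma>")
    case True
    then show ?thesis using assms(3) by (simp add: is_expansion_def)
  next
    case False
    have "\<not> (a \<in> set t \<and> b \<in> set t)" if t: "t \<in> rel B R" for t
    proof -
      obtain m where m: "\<sigma>s R = Some m" "t \<in> tuples (univ B) m" by (rule structure_rel[OF assms(2) t])
      then have "the (\<sigma>s R) \<le> 1" using False assms(4) by blast
      then have "length t \<le> 1" using m by (simp add: tuples_def)
      then show ?thesis using \<open>a \<noteq> b\<close> by (cases t) auto
    qed
    moreover have "t \<notin> rel A R" for t using structure_rel[OF assms(1)] False by (metis domI)
    ultimately show ?thesis by blast
  qed
  then show ?thesis by (simp add: gaifman_def cong: conj_cong)
qed

lemma floorlog_2_le:
  assumes "1 \<le> n"
  shows "n \<le> 2 ^ floorlog 2 n" "real (floorlog 2 n) \<le> log 2 n + 1"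
proof -
  show "n \<le> 2 ^ floorlog 2 n" using floorlog_bounds[of n 2] assms by simp
  have "0 \<le> log 2 (real n)" using assms by simp
  then show "real (floorlog 2 n) \<le> log 2 n + 1" using assms by (simp add: floorlog_def)
qed

text \<open>Bernoulli's inequality. It hides additive constants, such as those from rounding the
  logarithm, in the exponent.\<close>

lemma add_le_power:
  fixes x :: real
  assumes "2 \<le> x"
  shows "x + real a \<le> x ^ Suc a"
proof -
  have "1 + real a \<le> 2 ^ a" using Bernoulli_inequality[of 1 a] by simp
  also have "\<dots> \<le> x ^ a" using assms by (intro power_mono) auto
  finally have "x * (1 + real a) \<le> x * x ^ a" using assms by (intro mult_left_mono) auto
  moreover have "1 * real a \<le> x * real a" using assms by (intro mult_right_mono) auto
  ultimately show ?thesis by (simp add: algebra_simps)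
qed

lemma power_time:
  fixes x :: real
  assumes "T \<le> z ^ e" "real z \<le> x ^ a"
  shows "real T \<le> x ^ (a * e)"
proof -
  have "real T \<le> real (z ^ e)" using assms(1) by (simp only: of_nat_le_iff)
  also have "\<dots> = real z ^ e" by simp
  also have "\<dots> \<le> (x ^ a) ^ e" using assms(2) by (intro power_mono) auto
  finally show ?thesis by (simp add: power_mult)
qed

lemma mistakes_eq_0: "mistakes h T = 0 \<longleftrightarrow> consistent h T"
  by (auto simp: mistakes_def consistent_def filter_empty_conv)

lemma tuples_eq: "tuples X m = {xs. set xs \<subseteq> X \<and> length xs = m}"
  by (auto simp: tuples_def)

lemma log_timeD:
  assumes "log_time C \<sigma> c h e" "machine orc n x" "2 \<le> x" "t \<le> x" "n \<le> 2 ^ y" "\<forall>v\<in>set xs. v < 2 ^ (x + y)"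
    "machine.ensures C \<sigma> orc n c (write_list 0 xs (\<lambda>_. 0)) (\<lambda>_. undefined) (h x t) Q"
  shows "\<exists>M V T. T \<le> (x + y) ^ e \<and> log_runs C \<sigma> orc (compile 0 c) xs M T \<and> Q M V"
  using assms(1)[unfolded log_time_def, rule_format, OF assms(2-5) bspec[OF assms(6)] assms(7)] .

lemma returns_hypI:
  "log_runs C \<sigma> orc p (encode_sample code T) M c \<Longrightarrow> i < length fs \<Longrightarrow> M 0 = Suc i \<Longrightarrow>
   vs \<in> tuples (univ B) l \<Longrightarrow> map M [1..<l + 1] = map code vs \<Longrightarrow>
   returns_hyp C \<sigma> B code orc fs l p T (fs ! i) vs c"
  unfolding returns_hyp_def by blast

context learner
begin

lemma errs_mistakes: "errs \<phi> vs T = mistakes (hyp C A k \<phi> vs) T"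
  unfolding errs_def mistakes_def
  by (intro arg_cong[where f = length] filter_cong refl)
    (use sample in \<open>auto simp: hyp_def samples_def\<close>)

end

section \<open>The learners, uniformly for all structures and their expansions\<close>

locale expansion_learner = layout C r k l fs
  for C :: "'v vocab" and r k l and fs :: "'v fml list" +
  fixes \<sigma> \<sigma>s :: signature and star :: "'v wstruct \<Rightarrow> 'v wstruct"
  assumes formulas: "formula_class C \<sigma>s r k l (set fs)"
    and star: "is_structure C \<sigma> A \<Longrightarrow> is_structure C \<sigma>s (star A) \<and> is_expansion C \<sigma> A (star A)"
    and unary: "\<forall>R\<in>dom \<sigma>s - dom \<sigma>. the (\<sigma>s R) \<le> 1"
begin

lemma univ_star: "is_structure C \<sigma> A \<Longrightarrow> univ (star A) = univ A"
  using star by (simp add: is_expansion_def)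

lemma learner_star:
  assumes "is_structure C \<sigma> A" "local_access C \<sigma>s (star A) code orc" "T \<in> samples A k" "struct_degree A \<le> D"
  shows "learner C \<sigma>s orc (star A) code D r k l fs T"
proof (intro learner.intro learner_axioms.intro formulas structure_access.intro)
  show "valid_vocab C" using formulas by (simp add: formula_class_def)
  show "is_structure C \<sigma>s (star A)" using star[OF assms(1)] by simp
  show "local_access C \<sigma>s (star A) code orc" by (rule assms(2))
  fix a assume "a \<in> univ (star A)"
  then show "card (gaifman (star A) `` {a}) \<le> D"
    using card_gaifman_le[OF assms(1)] assms(4) gaifman_expansion[OF assms(1)] star[OF assms(1)] unary
    by (metis le_trans univ_star[OF assms(1)])
next
  show "T \<in> samples (star A) k" using assms(3) by (simp add: samples_def univ_star[OF assms(1)])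
qed

lemma code_less:
  assumes "is_structure C \<sigma> A" "local_access C \<sigma>s (star A) code orc" "a \<in> univ A"
  shows "code a < 2 ^ (D + floorlog 2 (card (univ A)))"
proof -
  have "bij_betw code (univ A) {..<card (univ A)}"
    using assms(2) unfolding local_access_def univ_star[OF assms(1)] by (rule conjunct1)
  then have "code a \<in> {..<card (univ A)}" using assms(3) by (rule bij_betw_apply)
  then have "code a < card (univ A)" by simp
  also have "\<dots> \<le> 2 ^ floorlog 2 (card (univ A))" using calculation by (intro floorlog_2_le) simp
  also have "\<dots> \<le> 2 ^ (D + floorlog 2 (card (univ A)))" by (intro power_increasing) auto
  finally show ?thesis .
qed

lemma card_univ: "is_structure C \<sigma> A \<Longrightarrow> 1 \<le> card (univ A)"
  by (simp add: is_structure_def Suc_le_eq card_gt_0_iff)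

text \<open>The common specification of both learners, with one exponent for all structures and
  samples. It speaks of \<open>mistakes\<close> and \<open>hyp\<close> and so no longer refers to
  the internals of the machine.\<close>

definition finds_best :: "bool \<Rightarrow> nat \<Rightarrow> bool" where
  "finds_best exact e \<longleftrightarrow> (\<forall>A code orc T. is_structure C \<sigma> A \<longrightarrow> local_access C \<sigma>s (star A) code orc \<longrightarrow>
     T \<in> samples A k \<longrightarrow> (\<exists>time M i vs.
       time \<le> (struct_degree A + length T + 2 + floorlog 2 (card (univ A))) ^ e \<and>
       log_runs C \<sigma>s orc (compile 0 (learn exact)) (encode_sample code T) M time \<and>
       i < length fs \<and> vs \<in> tuples (univ A) l \<and>
       M 0 = (if exact \<and> mistakes (hyp C (star A) k (fs ! i) vs) T \<noteq> 0 then 0 else Suc i) \<and>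
       map M [1..<l + 1] = map code vs \<and>
       (\<forall>\<phi>\<in>set fs. \<forall>vs'\<in>tuples (univ A) l.
          mistakes (hyp C (star A) k (fs ! i) vs) T \<le> mistakes (hyp C (star A) k \<phi> vs') T)))"

lemma ex_finds_best: "\<exists>e. finds_best exact e"
proof -
  obtain e where e: "log_time C \<sigma>s (learn exact) learn_steps e" using ex_log_time[OF poly_bounded_learn] by blast
  show ?thesis unfolding finds_best_def
  proof (rule exI[of _ e], intro allI impI)
    fix A code orc T
    assume A: "is_structure C \<sigma> A" "local_access C \<sigma>s (star A) code orc" "T \<in> samples A k"
    \<comment> \<open>One number that bounds the degree and the sample size and is at least 2, as
      \<open>log_time\<close> demands.\<close>
    let ?D = "struct_degree A + length T + 2" and ?y = "floorlog 2 (card (univ A))"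
    interpret L: learner C \<sigma>s orc "star A" code ?D r k l fs T by (rule learner_star[OF A]) simp
    note u = univ_star[OF A(1)]
    have n: "card (univ (star A)) \<le> 2 ^ ?y" unfolding u by (rule floorlog_2_le[OF card_univ[OF A(1)]])
    have small: "v < 2 ^ (?D + ?y)" if "v \<le> ?D" for v
      using that less_exp[of ?D] power_increasing[of ?D "?D + ?y" "2::nat"] by linarith
    have bool: "of_bool b < (2::nat) ^ (?D + ?y)" for b by (rule small) (cases b; simp)
    have codes: "code a < 2 ^ (?D + ?y)" if "(as, b) \<in> set T" "a \<in> set as" for a as b
    proof (rule code_less[OF A(1,2)])
      have "as \<in> tuples (univ A) k" using A(3) that(1) by (auto simp: samples_def)
      then show "a \<in> univ A" using that(2) by (auto simp: tuples_def)
    qed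
    have xs: "\<forall>v\<in>set (encode_sample code T). v < 2 ^ (?D + ?y)"
    proof
      fix v assume "v \<in> set (encode_sample code T)"
      then consider "v = length T" | as b where "(as, b) \<in> set T" "v \<in> code ` set as \<or> v = of_bool b"
        unfolding encode_sample_def by auto
      then show "v < 2 ^ (?D + ?y)"
      proof cases
        case 1
        then show ?thesis by (intro small) simp
      next
        case 2
        then show ?thesis using codes[OF 2(1)] bool by blast
      qed
    qed
    define Q where "Q = (\<lambda>(M :: nat \<Rightarrow> nat) (V :: nat \<Rightarrow> 'v). \<exists>i<length fs. \<exists>vs\<in>tuples (univ (star A)) l.
       M 0 = (if exact \<and> L.errs (fs ! i) vs T \<noteq> 0 then 0 else Suc i) \<and> map M [1..<l + 1] = map code vs \<and>
       (\<forall>\<phi>\<in>set fs. \<forall>vs'\<in>tuples (univ (star A)) l. L.errs (fs ! i) vs T \<le> L.errs \<phi> vs' T))"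
    have "L.ensures (learn exact) (write_list 0 (encode_sample code T) (\<lambda>_. 0)) (\<lambda>_. undefined)
      (learn_steps ?D (length T)) Q"
      unfolding Q_def L.input_def[symmetric] by (rule L.learn_correct)
    moreover have "2 \<le> ?D" "length T \<le> ?D" by simp_all
    ultimately obtain M V time where R: "time \<le> (?D + ?y) ^ e"
      "log_runs C \<sigma>s orc (compile 0 (learn exact)) (encode_sample code T) M time" "Q M V"
      using log_timeD[OF e L.machine_axioms _ _ n xs, of "length T" Q] by blast
    obtain i vs where "i < length fs" "vs \<in> tuples (univ A) l"
       "M 0 = (if exact \<and> mistakes (hyp C (star A) k (fs ! i) vs) T \<noteq> 0 then 0 else Suc i)"
       "map M [1..<l + 1] = map code vs"
       "\<forall>\<phi>\<in>set fs. \<forall>vs'\<in>tuples (univ A) l.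
          mistakes (hyp C (star A) k (fs ! i) vs) T \<le> mistakes (hyp C (star A) k \<phi> vs') T"
      using R(3) unfolding Q_def L.errs_mistakes u by (elim exE conjE bexE) (rule that)
    with R(1,2) show "\<exists>time M i vs.
       time \<le> (?D + ?y) ^ e \<and>
       log_runs C \<sigma>s orc (compile 0 (learn exact)) (encode_sample code T) M time \<and>
       i < length fs \<and> vs \<in> tuples (univ A) l \<and>
       M 0 = (if exact \<and> mistakes (hyp C (star A) k (fs ! i) vs) T \<noteq> 0 then 0 else Suc i) \<and>
       map M [1..<l + 1] = map code vs \<and>
       (\<forall>\<phi>\<in>set fs. \<forall>vs'\<in>tuples (univ A) l.
          mistakes (hyp C (star A) k (fs ! i) vs) T \<le> mistakes (hyp C (star A) k \<phi> vs') T)"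
      by (intro exI[of _ time] exI[of _ M] exI[of _ i] exI[of _ vs] conjI)
  qed
qed

lemma finds_bestE:
  assumes "finds_best exact e" "is_structure C \<sigma> A" "local_access C \<sigma>s (star A) code orc" "T \<in> samples A k"
  obtains time M i vs where "time \<le> (struct_degree A + length T + 2 + floorlog 2 (card (univ A))) ^ e"
    "log_runs C \<sigma>s orc (compile 0 (learn exact)) (encode_sample code T) M time"
    "i < length fs" "vs \<in> tuples (univ A) l"
    "M 0 = (if exact \<and> mistakes (hyp C (star A) k (fs ! i) vs) T \<noteq> 0 then 0 else Suc i)"
    "map M [1..<l + 1] = map code vs"
    "\<forall>\<phi>\<in>set fs. \<forall>vs'\<in>tuples (univ A) l.
       mistakes (hyp C (star A) k (fs ! i) vs) T \<le> mistakes (hyp C (star A) k \<phi> vs') T"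
  using assms(1)[unfolded finds_best_def, rule_format, OF assms(2-4)] by (elim exE conjE) (rule that)

text \<open>A consistent classifier from \<Phi> over \<open>A\<close> is also a hypothesis from the
  listed formulas over the expansion, so its existence forces the minimum to be 0. Rejection on a
  positive minimum is therefore justified.\<close>

lemma solves_exact:
  assumes transfer: "\<forall>\<phi>\<in>\<Phi>. \<exists>\<phi>'\<in>set fs. \<forall>A. is_structure C \<sigma> A \<longrightarrow>
     (\<forall>as\<in>tuples (univ A) k. \<forall>bs\<in>tuples (univ A) l.
        sat C A ((!) (as @ bs)) \<phi> \<longleftrightarrow> sat C (star A) ((!) (as @ bs)) \<phi>')"
  shows "solves_exact_learning C \<sigma> \<sigma>s star \<Phi> fs k l (compile 0 (learn True))"
proof -
  obtain e where e: "finds_best True e" using ex_finds_best by blast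
  show ?thesis unfolding solves_exact_learning_def
  proof (rule exI[of _ "2 * e"], intro allI impI ballI)
    fix A code orc T
    assume A: "is_structure C \<sigma> A" "local_access C \<sigma>s (star A) code orc" "T \<in> samples A k"
    let ?n = "card (univ A)"
    let ?X = "log 2 ?n + struct_degree A + length T + 2"
    let ?m = "\<lambda>\<phi> vs. mistakes (hyp C (star A) k \<phi> vs) T"
    obtain time M i vs where R: "time \<le> (struct_degree A + length T + 2 + floorlog 2 ?n) ^ e"
      "log_runs C \<sigma>s orc (compile 0 (learn True)) (encode_sample code T) M time"
      "i < length fs" "vs \<in> tuples (univ A) l" "M 0 = (if True \<and> ?m (fs ! i) vs \<noteq> 0 then 0 else Suc i)"
      "map M [1..<l + 1] = map code vs" "\<forall>\<phi>\<in>set fs. \<forall>vs'\<in>tuples (univ A) l. ?m (fs ! i) vs \<le> ?m \<phi> vs'"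
      by (rule finds_bestE[OF e A])
    note n = card_univ[OF A(1)]
    have "0 \<le> log 2 ?n" using n by simp
    then have X: "2 \<le> ?X" by linarith
    have "real (struct_degree A + length T + 2 + floorlog 2 ?n) \<le> ?X + real 1"
      using floorlog_2_le(2)[OF n] by simp
    also have "\<dots> \<le> ?X ^ 2" using add_le_power[OF X, of 1] by (simp add: numeral_2_eq_2)
    finally have time: "real time \<le> ?X ^ (2 * e)" by (rule power_time[OF R(1)])
    have "(\<exists>\<phi> vs. returns_hyp C \<sigma>s (star A) code orc fs l (compile 0 (learn True)) T \<phi> vs time \<and>
                consistent (hyp C (star A) k \<phi> vs) T) \<or>
            rejects C \<sigma>s code orc (compile 0 (learn True)) T time \<and>
              \<not> (\<exists>h\<in>concept_class C \<Phi> A k l. consistent h T)"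
    proof (cases "?m (fs ! i) vs = 0")
      case True
      then have "returns_hyp C \<sigma>s (star A) code orc fs l (compile 0 (learn True)) T (fs ! i) vs time"
        by (intro returns_hypI[OF R(2,3) _ _ R(6)]) (use R(4,5) univ_star[OF A(1)] in simp_all)
      then show ?thesis using True mistakes_eq_0 by blast
    next
      case False
      then have "rejects C \<sigma>s code orc (compile 0 (learn True)) T time"
        unfolding rejects_def using R(2,5) by auto
      moreover have "\<not> consistent h T" if h: "h \<in> concept_class C \<Phi> A k l" for h
      proof
        assume con: "consistent h T"
        obtain \<phi> ws where p: "\<phi> \<in> \<Phi>" "ws \<in> tuples (univ A) l" "h = hyp C A k \<phi> ws"
          using h unfolding concept_class_def by blast
        obtain \<phi>' where p': "\<phi>' \<in> set fs" "\<forall>as\<in>tuples (univ A) k. \<forall>bs\<in>tuples (univ A) l.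
           sat C A ((!) (as @ bs)) \<phi> \<longleftrightarrow> sat C (star A) ((!) (as @ bs)) \<phi>'"
          using transfer p(1) A(1) by blast
        have "hyp C (star A) k \<phi>' ws = h"
          unfolding p(3) hyp_def univ_star[OF A(1)] by (rule restrict_ext) (use p' p(2) in blast)
        then have "?m \<phi>' ws = 0" using con mistakes_eq_0 by metis
        then show False using R(7) p'(1) p(2) False by (metis le_zero_eq)
      qed
      ultimately show ?thesis by blast
    qed
    with time show "\<exists>time. real time \<le> ?X ^ (2 * e) \<and>
       ((\<exists>\<phi> vs. returns_hyp C \<sigma>s (star A) code orc fs l (compile 0 (learn True)) T \<phi> vs time \<and>
                consistent (hyp C (star A) k \<phi> vs) T) \<or>
            rejects C \<sigma>s code orc (compile 0 (learn True)) T time \<and>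
              \<not> (\<exists>h\<in>concept_class C \<Phi> A k l. consistent h T))" by blast
  qed
qed

text \<open>A structure with one element has a single tuple of length \<open>k\<close>, which leaves
  two functions; this supplies the special case of \<open>hypotheses_bound\<close>.\<close>

lemma concept_class_card:
  assumes A: "is_structure C \<sigma> A"
  defines "H \<equiv> concept_class C (set fs) (star A) k l"
  shows "finite H" "H \<noteq> {}" "card H \<le> length fs * card (univ A) ^ l" "card (univ A) = 1 \<Longrightarrow> card H \<le> 2"
proof -
  have fin: "finite (univ A)" and ne: "univ A \<noteq> {}" using A by (auto simp: is_structure_def)
  let ?P = "set fs \<times> tuples (univ A) l"
  have H: "H = (\<lambda>(\<phi>, vs). hyp C (star A) k \<phi> vs) ` ?P"
    unfolding H_def concept_class_def univ_star[OF A] by auto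
  have fint: "finite (tuples (univ A) l)" and ct: "card (tuples (univ A) l) = card (univ A) ^ l"
    unfolding tuples_eq by (rule finite_lists_length_eq[OF fin], rule card_lists_length_eq[OF fin])
  then have finP: "finite ?P" by simp
  then show "finite H" unfolding H by (rule finite_imageI)
  obtain a where a: "a \<in> univ A" using ne by blast
  then have "replicate l a \<in> tuples (univ A) l" by (auto simp: tuples_def)
  moreover have "set fs \<noteq> {}" using formulas by (simp add: formula_class_def)
  ultimately have "?P \<noteq> {}" by (metis Times_empty empty_iff)
  then show "H \<noteq> {}" unfolding H by simp
  have "card H \<le> card ?P" unfolding H by (rule card_image_le[OF finP])
  also have "\<dots> \<le> length fs * card (univ A) ^ l"
    unfolding card_cartesian_product ct by (rule mult_le_mono1[OF card_length])
  finally show "card H \<le> length fs * card (univ A) ^ l" .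
  assume "card (univ A) = 1"
  then have ua: "univ A = {a}" using a by (metis card_1_singletonE singletonD)
  let ?S = "tuples (univ A) k"
  have single: "as = replicate k a" if "as \<in> ?S" for as
    using that ua by (auto simp: tuples_def intro!: replicate_eqI)
  have "hyp C (star A) k \<phi> vs \<in> {restrict (\<lambda>_. True) ?S, restrict (\<lambda>_. False) ?S}" for \<phi> vs
  proof -
    have "hyp C (star A) k \<phi> vs = restrict (\<lambda>_. sat C (star A) ((!) (replicate k a @ vs)) \<phi>) ?S"
      unfolding hyp_def univ_star[OF A] by (rule restrict_ext) (use single in blast)
    then show ?thesis by (cases "sat C (star A) ((!) (replicate k a @ vs)) \<phi>") simp_all
  qed
  then have "H \<subseteq> {restrict (\<lambda>_. True) ?S, restrict (\<lambda>_. False) ?S}" unfolding H by (intro image_subsetI) (simp only: split_beta)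
  then have "card H \<le> card {restrict (\<lambda>_. True) ?S, restrict (\<lambda>_. False) ?S}" by (intro card_mono) auto
  also have "\<dots> \<le> 2" by (simp add: card_insert_if)
  finally show "card H \<le> 2" .
qed

text \<open>The sample size is at most \<open>s * (x ^ 3 + 1)\<close>: one factor \<open>x\<close>
  for the logarithm of \<open>n / \<delta>\<close> and two for \<open>1 / \<epsilon>\<close>. The
  other summands fit into one more \<open>x ^ 3\<close>, and the constant \<open>2 * s + 1\<close>
  goes into the exponent.\<close>

lemma sample_time:
  fixes \<epsilon> \<delta> :: real and n s D :: nat
  assumes "1 \<le> n" and e: "0 < \<epsilon>" "\<epsilon> < 1" and d: "0 < \<delta>" "\<delta> < 1"
  defines "x \<equiv> log 2 n + real D + 1 / \<epsilon> + log 2 (1 / \<delta>) + 2"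
  shows "real (D + sample_size s n \<epsilon> \<delta> + 2 + floorlog 2 n) \<le> x ^ (2 * s + 4)"
proof -
  let ?a = "log 2 (real n / \<delta>)" and ?t = "sample_size s n \<epsilon> \<delta>"
  have pos: "0 \<le> log 2 (real n)" "0 \<le> log 2 (1 / \<delta>)" "1 \<le> 1 / \<epsilon>" using assms(1) e d by simp_all
  have a: "?a = log 2 (real n) + log 2 (1 / \<delta>)" using assms(1) d by (simp add: log_divide)
  have x: "2 \<le> x" "?a \<le> x" "1 / \<epsilon> \<le> x" "0 \<le> ?a" "real D + log 2 n + 2 \<le> x"
    using pos unfolding x_def a by linarith+
  have "?a / \<epsilon>\<^sup>2 = ?a * (1 / \<epsilon>)\<^sup>2" by (simp add: power_divide)
  also have "\<dots> \<le> x * x\<^sup>2" using x pos(3) e by (intro mult_mono power_mono) auto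
  finally have q: "?a / \<epsilon>\<^sup>2 \<le> x ^ 3" by (simp add: power3_eq_cube power2_eq_square mult.assoc)
  have "0 \<le> ?a / \<epsilon>\<^sup>2" using x(4) by simp
  then have "real (nat \<lceil>?a / \<epsilon>\<^sup>2\<rceil>) \<le> x ^ 3 + 1" using q by linarith
  then have "real s * real (nat \<lceil>?a / \<epsilon>\<^sup>2\<rceil>) \<le> real s * (x ^ 3 + 1)" by (rule mult_left_mono) simp
  then have t: "real ?t \<le> real s * (x ^ 3 + 1)" unfolding sample_size_def of_nat_mult .
  have x3: "2 * x \<le> x ^ 3 - 1"
  proof -
    have "4 * x \<le> (x * x) * x" using mult_mono[of 2 x 2 x] x(1) by (intro mult_right_mono) auto
    then show ?thesis using x(1) unfolding power3_eq_cube by linarith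
  qed
  have "real s * (x ^ 3 + 1) \<le> real s * (2 * x ^ 3)" using x3 x(1) by (intro mult_left_mono) auto
  then have "real (D + ?t + 2 + floorlog 2 n) \<le> real s * (2 * x ^ 3) + x ^ 3"
    using t x x3 floorlog_2_le(2)[OF assms(1)] by simp
  also have "\<dots> = real (2 * s + 1) * x ^ 3" by (simp add: algebra_simps)
  also have "\<dots> \<le> x ^ (2 * s + 1) * x ^ 3"
  proof (rule mult_right_mono)
    have "real (2 * s + 1) \<le> 2 ^ (2 * s + 1)" using less_exp[of "2 * s + 1"]
      by (metis less_imp_le of_nat_le_iff of_nat_numeral of_nat_power)
    also have "\<dots> \<le> x ^ (2 * s + 1)" using x(1) by (intro power_mono) auto
    finally show "real (2 * s + 1) \<le> x ^ (2 * s + 1)" .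
  qed (use x(1) in auto)
  also have "\<dots> = x ^ (2 * s + 4)"
  proof -
    have "2 * s + 4 = 2 * s + 1 + 3" by simp
    then show ?thesis by (simp only: power_add)
  qed
  finally show ?thesis .
qed

lemma learns: "pac_learns C \<sigma> \<sigma>s star fs k l (compile 0 (learn False))"
proof -
  obtain e where e: "finds_best False e" using ex_finds_best by blast
  let ?p = "compile 0 (learn False)"
  \<comment> \<open>The factor demanded by \<open>hypotheses_bound\<close>, with the number of
    formulas as the constant.\<close>
  let ?s = "2 * (length fs + l + 1)"
  have best: "\<exists>\<phi> vs time. returns_hyp C \<sigma>s (star A) code orc fs l ?p T \<phi> vs time \<and>
      time \<le> (struct_degree A + length T + 2 + floorlog 2 (card (univ A))) ^ e \<and>
      hyp C (star A) k \<phi> vs \<in> concept_class C (set fs) (star A) k l \<and>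
      (\<forall>h\<in>concept_class C (set fs) (star A) k l. mistakes (hyp C (star A) k \<phi> vs) T \<le> mistakes h T)"
    if A: "is_structure C \<sigma> A" "local_access C \<sigma>s (star A) code orc" "T \<in> samples A k" for A code orc T
  proof -
    let ?m = "\<lambda>\<phi> vs. mistakes (hyp C (star A) k \<phi> vs) T"
    obtain time M i vs where R: "time \<le> (struct_degree A + length T + 2 + floorlog 2 (card (univ A))) ^ e"
      "log_runs C \<sigma>s orc ?p (encode_sample code T) M time"
      "i < length fs" "vs \<in> tuples (univ A) l" "M 0 = (if False \<and> ?m (fs ! i) vs \<noteq> 0 then 0 else Suc i)"
      "map M [1..<l + 1] = map code vs" "\<forall>\<phi>\<in>set fs. \<forall>vs'\<in>tuples (univ A) l. ?m (fs ! i) vs \<le> ?m \<phi> vs'"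
      by (rule finds_bestE[OF e A])
    have "returns_hyp C \<sigma>s (star A) code orc fs l ?p T (fs ! i) vs time"
      by (intro returns_hypI[OF R(2,3) _ _ R(6)]) (use R(4,5) univ_star[OF A(1)] in simp_all)
    moreover have "hyp C (star A) k (fs ! i) vs \<in> concept_class C (set fs) (star A) k l"
      unfolding concept_class_def univ_star[OF A(1)] using R(3,4) nth_mem by blast
    moreover have "\<forall>h\<in>concept_class C (set fs) (star A) k l. ?m (fs ! i) vs \<le> mistakes h T"
      unfolding concept_class_def univ_star[OF A(1)] using R(7) by blast
    ultimately show ?thesis using R(1) by blast
  qed
  show ?thesis unfolding pac_learns_def
  proof (rule exI[of _ ?s], rule exI[of _ "(2 * ?s + 4) * e"], intro allI impI conjI ballI)
    fix A code orc
    assume A: "is_structure C \<sigma> A" "local_access C \<sigma>s (star A) code orc"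
    let ?n = "card (univ A)" and ?H = "concept_class C (set fs) (star A) k l"
    note n = card_univ[OF A(1)] and H = concept_class_card[OF A(1)]
    have fs: "1 \<le> length fs" using formulas by (cases fs) (auto simp: formula_class_def)
    show "agnostic_pac (tuples (univ A) k) ?H (sample_size ?s ?n)
      (\<lambda>T h. \<exists>\<phi> vs time. returns_hyp C \<sigma>s (star A) code orc fs l ?p T \<phi> vs time \<and> h = hyp C (star A) k \<phi> vs)"
      unfolding agnostic_pac_def
    proof (intro ballI impI allI)
      fix \<epsilon> \<delta> :: real and D :: "(nat list \<times> bool) pmf"
      assume ed: "\<epsilon> \<in> {0<..<1}" "\<delta> \<in> {0<..<1}" and D: "set_pmf D \<subseteq> tuples (univ A) k \<times> UNIV"
      let ?t = "sample_size ?s ?n \<epsilon> \<delta>"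
      show "1 - \<delta> \<le> measure_pmf.prob (replicate_pmf ?t D) {T. \<exists>h. (\<exists>\<phi> vs time.
          returns_hyp C \<sigma>s (star A) code orc fs l ?p T \<phi> vs time \<and> h = hyp C (star A) k \<phi> vs) \<and>
          err D h \<le> (INF h'\<in>?H. err D h') + \<epsilon>}"
      proof (rule erm_agnostic[OF H(1,2)])
        show "0 < \<epsilon>" using ed by simp
        show "real (card ?H - 1) * exp (- (real ?t * \<epsilon>\<^sup>2 / 2)) \<le> \<delta>"
          by (rule hypotheses_bound[OF n _ _ _ H(3) H(4) fs refl]) (use ed in auto)
        fix T assume "T \<in> set_pmf (replicate_pmf ?t D)"
        then have "T \<in> samples A k" using D by (auto simp: set_replicate_pmf samples_def)
        from best[OF A this] show "\<exists>h\<in>?H. (\<exists>\<phi> vs time.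
          returns_hyp C \<sigma>s (star A) code orc fs l ?p T \<phi> vs time \<and> h = hyp C (star A) k \<phi> vs) \<and>
          (\<forall>h'\<in>?H. mistakes h T \<le> mistakes h' T)" by blast
      qed
    qed
    fix \<epsilon> \<delta> :: real and T
    assume ed: "\<epsilon> \<in> {0<..<1}" "\<delta> \<in> {0<..<1}" and T: "T \<in> samples A k" "length T = sample_size ?s ?n \<epsilon> \<delta>"
    let ?X = "log 2 ?n + struct_degree A + 1 / \<epsilon> + log 2 (1 / \<delta>) + 2"
    obtain \<phi> vs time where R: "returns_hyp C \<sigma>s (star A) code orc fs l ?p T \<phi> vs time"
      "time \<le> (struct_degree A + length T + 2 + floorlog 2 ?n) ^ e"
      using best[OF A T(1)] by blast
    have "real (struct_degree A + length T + 2 + floorlog 2 ?n) \<le> ?X ^ (2 * ?s + 4)"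
      unfolding T(2) by (rule sample_time[OF n]) (use ed in auto)
    then have "real time \<le> ?X ^ ((2 * ?s + 4) * e)" by (rule power_time[OF R(2)])
    with R(1) show "\<exists>\<phi> vs time. returns_hyp C \<sigma>s (star A) code orc fs l ?p T \<phi> vs time \<and>
      real time \<le> ?X ^ ((2 * ?s + 4) * e)" by blast
  qed
qed

text \<open>Nothing is assumed of the learner \<open>p\<close>: the evaluator works for every index
  of a listed formula and all parameters from the universe.\<close>

lemma evaluates: "evaluates_output C \<sigma> \<sigma>s star fs k l p (compile 0 evaluate)"
proof -
  obtain e where e: "log_time C \<sigma>s evaluate (\<lambda>x t. evaluate_steps x) e"
    using ex_log_time[OF poly_bounded_evaluate] by blast
  let ?m = "length fs"
  show ?thesis unfolding evaluates_output_def
  proof (rule exI[of _ "Suc (?m + 1) * e"], intro allI impI ballI)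
    fix A code orc T i vs time as
    assume A: "is_structure C \<sigma> A" "local_access C \<sigma>s (star A) code orc" and i: "i < ?m"
      and ret: "returns_hyp C \<sigma>s (star A) code orc fs l p T (fs ! i) vs time" and as: "as \<in> tuples (univ A) k"
    let ?n = "card (univ A)"
    \<comment> \<open>The number of formulas is added so that the index, which is part of the input,
      has few enough bits.\<close>
    let ?D = "struct_degree A + 2 + ?m" and ?y = "floorlog 2 ?n" and ?X = "log 2 ?n + struct_degree A + 2"
    let ?xs = "i # map code vs @ map code as"
    \<comment> \<open>Evaluation happens without a sample, so the locale is entered with the empty
      one.\<close>
    interpret L: learner C \<sigma>s orc "star A" code ?D r k l fs "[]"
      by (rule learner_star[OF A]) (auto simp: samples_def)
    note u = univ_star[OF A(1)] and n = card_univ[OF A(1)]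
    have vs: "vs \<in> tuples (univ (star A)) l" and as': "as \<in> tuples (univ (star A)) k"
      using ret as u by (auto simp: returns_hyp_def)
    have n2: "card (univ (star A)) \<le> 2 ^ ?y" unfolding u by (rule floorlog_2_le[OF n])
    have "?D < 2 ^ (?D + ?y)"
      using less_exp[of ?D] power_increasing[of ?D "?D + ?y" "2::nat"] by linarith
    then have "i < 2 ^ (?D + ?y)" using i by linarith
    moreover have "code a < 2 ^ (?D + ?y)" if "a \<in> set vs \<union> set as" for a
      by (rule code_less[OF A]) (use that vs as' u in \<open>auto simp: tuples_def\<close>)
    ultimately have xs: "\<forall>v\<in>set ?xs. v < 2 ^ (?D + ?y)" by auto
    define Q where "Q = (\<lambda>(M :: nat \<Rightarrow> nat) (V :: nat \<Rightarrow> 'v). M 0 = of_bool (sat C (star A) ((!) (as @ vs)) (fs ! i)))"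
    have "L.ensures evaluate (write_list 0 ?xs (\<lambda>_. 0)) (\<lambda>_. undefined) (evaluate_steps ?D) Q"
      unfolding Q_def by (rule L.evaluate_correct[OF i as' vs])
    moreover have "2 \<le> ?D" "0 \<le> ?D" by simp_all
    ultimately obtain M V time' where R: "time' \<le> (?D + ?y) ^ e"
      "log_runs C \<sigma>s orc (compile 0 evaluate) ?xs M time'" "Q M V"
      using log_timeD[OF e L.machine_axioms _ _ n2 xs, of 0 Q] by blast
    have "0 \<le> log 2 ?n" using n by simp
    then have X: "2 \<le> ?X" by linarith
    have "real (?D + ?y) \<le> ?X + real (?m + 1)" using floorlog_2_le(2)[OF n] by simp
    also have "\<dots> \<le> ?X ^ Suc (?m + 1)" by (rule add_le_power[OF X])
    finally have "real time' \<le> ?X ^ (Suc (?m + 1) * e)" by (rule power_time[OF R(1)])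
    moreover have "M 0 = of_bool (hyp C (star A) k (fs ! i) vs as)" using R(3) as' by (simp add: hyp_def Q_def)
    ultimately show "\<exists>M time'. log_runs C \<sigma>s orc (compile 0 evaluate) ?xs M time' \<and>
        real time' \<le> ?X ^ (Suc (?m + 1) * e) \<and> M 0 = of_bool (hyp C (star A) k (fs ! i) vs as)"
      using R(2) by blast
  qed
qed

end

theorem theorem6p1:
  fixes C :: "'v vocab"
    and \<sigma> \<sigma>s :: signature
    and k l q r :: nat
    and SS :: "'v set"
    and \<Phi>s :: "'v fml set"
    and fs :: "'v fml list"
    and star :: "'v wstruct \<Rightarrow> 'v wstruct"
  assumes "valid_vocab C"
    and "finite (dom \<sigma>)"
    and "finite SS" and "SS \<subseteq> (\<Union>i\<in>idx C. carrier (alg C i))"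
    and "finite (dom \<sigma>s)" and "\<sigma> \<subseteq>\<^sub>m \<sigma>s"
    and "\<forall>R\<in>dom \<sigma>s - dom \<sigma>. the (\<sigma>s R) \<le> 1"
    and "\<forall>A. is_structure C \<sigma> A \<longrightarrow>
           is_structure C \<sigma>s (star A) \<and> is_expansion C \<sigma> A (star A)"
    and "computable_expansion C \<sigma> \<sigma>s star"
    and "finite \<Phi>s" and "\<Phi>s \<noteq> {}"
    and "\<forall>\<phi>\<in>\<Phi>s. fow1 C \<sigma>s \<phi> \<and> free \<phi> \<subseteq> {..<k + l} \<and> r_local C \<sigma>s r \<phi>"
    and "\<forall>\<phi>\<in>Phi_class C \<sigma> q (k + l) SS. \<exists>\<phi>'\<in>\<Phi>s. \<forall>A. is_structure C \<sigma> A \<longrightarrow>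
           (\<forall>as\<in>tuples (univ A) k. \<forall>bs\<in>tuples (univ A) l.
              sat C A ((!) (as @ bs)) \<phi> \<longleftrightarrow> sat C (star A) ((!) (as @ bs)) \<phi>')"
    and "fv_closed C \<sigma>s \<Phi>s"
    and "boolean_closed C \<sigma>s \<Phi>s"
    and "distinct fs" and "set fs = \<Phi>s"
  shows "\<exists>pE pL pV.
           wf_prog C \<sigma>s pE \<and> wf_prog C \<sigma>s pL \<and> wf_prog C \<sigma>s pV \<and>
           solves_exact_learning C \<sigma> \<sigma>s star (Phi_class C \<sigma> q (k + l) SS) fs k l pE \<and>
           pac_learns C \<sigma> \<sigma>s star fs k l pL \<and>
           evaluates_output C \<sigma> \<sigma>s star fs k l pE pV \<and>
           evaluates_output C \<sigma> \<sigma>s star fs k l pL pV"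
proof -
  interpret E: expansion_learner C r k l fs \<sigma> \<sigma>s star
    using assms(1,5,7,8,11,12,14,15,17) by unfold_locales blast+
  have wf: "wf_com C \<sigma>s (E.learn exact)" "wf_com C \<sigma>s E.evaluate" for exact
    using E.wf_search_parts[OF assms(1), of \<sigma>s] assms(12,17) by (auto simp: fow1_def)
  have "solves_exact_learning C \<sigma> \<sigma>s star (Phi_class C \<sigma> q (k + l) SS) fs k l (compile 0 (E.learn True))"
    by (rule E.solves_exact) (use assms(13,17) in simp)
  then show ?thesis
    using wf_prog_compile[OF wf(1)[of True, unfolded wf_com_def]] wf_prog_compile[OF wf(1)[of False, unfolded wf_com_def]]
      wf_prog_compile[OF wf(2)[unfolded wf_com_def]] E.learns E.evaluates by blast
qed

end
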